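(* For every $c\in\mathbb C$, let $Vir_c$ be the universal Virasoro vertex operator algebra of central charge $c$. Then $\dim H^2_{1/2}(Vir_c,Vir_c)=1$.
   Context: All vector spaces are over $\mathbb C$. $Vir_c$ is the vertex algebra freely generated by the conformal element $\omega$ (of weight $2$) with $\omega_3\omega=\frac c2\mathbf 1$, $\omega_2\omega=0$, $\omega_1\omega=2\omega$, $\omega_0\omega=D\omega$, $\omega_n\omega=0$ for $n\geq 4$, i.e. the induced module $U(\mathrm{Vir})\otimes_{U(\mathrm{Vir}_{\ge-1}\oplus\mathbb C\mathbf c)}\mathbb C$ with $\mathbf c$ acting by $c$ (not its simple quotient). For a grading-restricted vertex algebra $(V,Y,\mathbf 1)$ ($V=\coprod_{n\in\mathbb Z}V_{(n)}$, $Y(u,x)v=\sum u_nvx^{-n-1}$, $Dv=v_{-2}\mathbf 1$, $V'=\coprod V_{(n)}^*$), cocycles are linear maps $Y_1:V\otimes V\to V((x))$, $Y_1(u,x)v=\sum_n u^{def}_nv\,x^{-n-1}$, such that (1) $\mathrm{wt}(u^{def}_nv)=\mathrm{wt}\,u+\mathrm{wt}\,v-n-1$; (2) $Y_1(\mathbf 1,x)v=0$; (3) $Y_1(u,x)\mathbf 1=0$; (4) $[D,Y_1(u,x)]=Y_1(Du,x)=\frac{d}{dx}Y_1(u,x)$; (5) for $v'\in V'$, $u_1,u_2,v\in V$, the series $\langle v',Y_1(u_1,z_1)Y(u_2,z_2)v\rangle+\langle v',Y(u_1,z_1)Y_1(u_2,z_2)v\rangle$ and $\langle v',Y_1(Y(u_1,z_1-z_2)u_2,z_2)v\rangle+\langle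 v',Y(Y_1(u_1,z_1-z_2)u_2,z_2)v\rangle$ (only the sums) converge absolutely in $|z_1|>|z_2|>0$, resp. $|z_2|>|z_1-z_2|>0$, to a common rational function with only possible poles at $z_1=0,z_2=0,z_1=z_2$; (6) $Y_1(u,x)v=e^{xD}Y_1(v,-x)u$. Equivalently, $Y+tY_1$ is a first-order deformation of $V$ over $\mathbb C[t]/(t^2)$ with vacuum $\mathbf 1$ and the same grading. Coboundaries are $Y_\phi(u,x)v=Y(\phi(u),x)v-\phi(Y(u,x)v)+Y(u,x)\phi(v)$ for $\phi:V\to V$ linear, grading-preserving, commuting with $D$, $\phi(\mathbf 1)=0$. $H^2_{1/2}(V,V)$ is the space of cocycles modulo the space of coboundaries; it classifies first-order deformations up to equivalence. *)

theory Defs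
  imports
    "HOL-Analysis.Infinite_Sum"
    "HOL-Library.Poly_Mapping"
    "HOL-Library.Function_Algebras"
    "HOL-Library.Set_Algebras"
    "HOL-Computational_Algebra.Polynomial"
begin

section \<open>Quotient spaces and their dimension\<close>

definition quotient_space :: "'a::ab_group_add set \<Rightarrow> 'a set \<Rightarrow> 'a set set" where
  "quotient_space Z B = (\<lambda>z. z +o B) ` Z"

text \<open>\<open>Z/B\<close> has dimension \<open>n\<close>: there are \<open>n\<close> elements of \<open>Z\<close> whose classes form a basis,
  i.e. every class is the class of a unique linear combination of them.  (Uniqueness makes the
  classes of distinct elements of \<open>S\<close> distinct, so that \<open>card S\<close> counts classes; coefficient
  functions are taken \<open>undefined\<close> outside \<open>S\<close> so that uniqueness only concerns \<open>S\<close>.)\<close>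

definition quotient_has_dim ::
    "(complex \<Rightarrow> 'a::ab_group_add \<Rightarrow> 'a) \<Rightarrow> 'a set \<Rightarrow> 'a set \<Rightarrow> nat \<Rightarrow> bool" where
  "quotient_has_dim sc Z B n \<longleftrightarrow>
     (\<exists>S. finite S \<and> card S = n \<and> S \<subseteq> Z \<and>
          (\<forall>\<xi> \<in> quotient_space Z B.
             \<exists>!a. a \<in> extensional S \<and> \<xi> = (\<Sum>s\<in>S. sc (a s) s) +o B))"


section \<open>Grading-restricted vertex algebras\<close>

locale graded_complex_space =
  vector_space scale
  for scale :: "complex \<Rightarrow> 'v::ab_group_add \<Rightarrow> 'v" (infixr "*s" 75) +
  fixes gr :: "int \<Rightarrow> 'v set"
  assumes subspace_gr: "subspace (gr n)"
    and direct_sum: "\<exists>!p. (\<forall>n. p n \<in> gr n) \<and> finite {n. p n \<noteq> 0} \<and> v = Sum_any p"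
begin

text \<open>\<open>V' = \<Coprod> V\<^sub>(\<^sub>n\<^sub>)\<^sup>*\<close>, realised as the linear functionals on \<open>V\<close> that vanish on all but finitely many
  homogeneous subspaces.\<close>

definition graded_dual :: "('v \<Rightarrow> complex) set" where
  "graded_dual = {f. Vector_Spaces.linear (*s) (*) f \<and> finite {n. \<exists>v \<in> gr n. f v \<noteq> 0}}"

text \<open>A linear map \<open>X : V \<otimes> V \<rightarrow> V((x))\<close> is given by its modes,
  \<open>X(u,x)v = \<Sum>n. X u n v x\<^sup>-\<^sup>n\<^sup>-\<^sup>1\<close>.\<close>

definition laurent_bilinear :: "('v \<Rightarrow> int \<Rightarrow> 'v \<Rightarrow> 'v) \<Rightarrow> bool" where
  "laurent_bilinear X \<longleftrightarrow>
     (\<forall>u n. Vector_Spaces.linear (*s) (*s) (\<lambda>v. X u n v)) \<and>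
     (\<forall>n v. Vector_Spaces.linear (*s) (*s) (\<lambda>u. X u n v)) \<and>
     (\<forall>u v. \<exists>N. \<forall>n \<ge> N. X u n v = 0)"

definition weight_compatible :: "('v \<Rightarrow> int \<Rightarrow> 'v \<Rightarrow> 'v) \<Rightarrow> bool" where
  "weight_compatible X \<longleftrightarrow>
     (\<forall>p q n. \<forall>u \<in> gr p. \<forall>v \<in> gr q. X u n v \<in> gr (p + q - n - 1))"

end

text \<open>The Jacobi identity is stated in component form (Borcherds identity); all sums in it are
  finite because of lower truncation.\<close>

locale grading_restricted_vertex_algebra =
  graded_complex_space scale gr
  for scale :: "complex \<Rightarrow> 'v::ab_group_add \<Rightarrow> 'v" (infixr "*s" 75)
    and gr :: "int \<Rightarrow> 'v set" +
  fixes Y :: "'v \<Rightarrow> int \<Rightarrow> 'v \<Rightarrow> 'v" and vac :: 'v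
  assumes finite_dimensional_gr: "\<exists>B. finite B \<and> gr n \<subseteq> span B"
    and lower_bounded_gr: "\<exists>N. \<forall>n < N. gr n = {0}"
    and laurent_bilinear_Y: "laurent_bilinear Y"
    and weight_compatible_Y: "weight_compatible Y"
    and vacuum_weight: "vac \<in> gr 0"
    and vacuum: "Y vac n v = (if n = -1 then v else 0)"
    and creation: "Y u (-1) vac = u" "n \<ge> 0 \<Longrightarrow> Y u n vac = 0"
    and borcherds:
      "Sum_any (\<lambda>i::nat. (of_int m gchoose i) *s Y (Y u (n + int i) v) (m + k - int i) w) =
       Sum_any (\<lambda>i::nat. ((-1) ^ i * (of_int n gchoose i)) *s
         (Y u (m + n - int i) (Y v (k + int i) w)
          - ((-1) powi n) *s Y v (n + k - int i) (Y u (m + int i) w)))"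
begin

definition D :: "'v \<Rightarrow> 'v" where
  "D v = Y v (-2) vac"


subsection \<open>Cocycles, coboundaries and \<open>H\<^sup>2\<^sub>1\<^sub>/\<^sub>2(V,V)\<close>\<close>

text \<open>The double series are indexed by the pairs \<open>(m, n)\<close> of modes.  The right-hand side
  \<open>P(z\<^sub>1,z\<^sub>2) / (z\<^sub>1\<^sup>a z\<^sub>2\<^sup>b (z\<^sub>1 - z\<^sub>2)\<^sup>k)\<close> with a polynomial \<open>P\<close> is the general form of a rational function
  whose only possible poles are at \<open>z\<^sub>1 = 0\<close>, \<open>z\<^sub>2 = 0\<close> and \<open>z\<^sub>1 = z\<^sub>2\<close>; \<open>P\<close> is a polynomial in
  \<open>z\<^sub>2\<close> whose coefficients are polynomials in \<open>z\<^sub>1\<close>.\<close>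

definition cocycle_duality :: "('v \<Rightarrow> int \<Rightarrow> 'v \<Rightarrow> 'v) \<Rightarrow> bool" where
  "cocycle_duality Y1 \<longleftrightarrow>
     (\<forall>f \<in> graded_dual. \<forall>u1 u2 v.
        \<exists>(P :: complex poly poly) (a :: nat) (b :: nat) (k :: nat). \<forall>z1 z2 :: complex.
          let R = poly (poly P [:z2:]) z1 / (z1 ^ a * z2 ^ b * (z1 - z2) ^ k);
              prod = (\<lambda>(m, n). (f (Y1 u1 m (Y u2 n v)) + f (Y u1 m (Y1 u2 n v)))
                        * z1 powi (- m - 1) * z2 powi (- n - 1));
              iter = (\<lambda>(m, n). (f (Y1 (Y u1 m u2) n v) + f (Y (Y1 u1 m u2) n v))
                        * (z1 - z2) powi (- m - 1) * z2 powi (- n - 1))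
          in (cmod z1 > cmod z2 \<and> cmod z2 > 0
                \<longrightarrow> prod abs_summable_on UNIV \<and> (prod has_sum R) UNIV) \<and>
             (cmod z2 > cmod (z1 - z2) \<and> cmod (z1 - z2) > 0
                \<longrightarrow> iter abs_summable_on UNIV \<and> (iter has_sum R) UNIV))"

text \<open>The last condition is the coefficient of \<open>x\<^sup>-\<^sup>n\<^sup>-\<^sup>1\<close> in \<open>Y\<^sub>1(u,x)v = e\<^sup>x\<^sup>D Y\<^sub>1(v,-x)u\<close>.\<close>

definition cocycles :: "('v \<Rightarrow> int \<Rightarrow> 'v \<Rightarrow> 'v) set" where
  "cocycles = {Y1.
     laurent_bilinear Y1 \<and>
     weight_compatible Y1 \<and>
     (\<forall>n v. Y1 vac n v = 0) \<and>
     (\<forall>u n. Y1 u n vac = 0) \<and>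
     (\<forall>u n v. D (Y1 u n v) - Y1 u n (D v) = Y1 (D u) n v) \<and>
     (\<forall>u n v. Y1 (D u) n v = (- of_int n) *s Y1 u (n - 1) v) \<and>
     cocycle_duality Y1 \<and>
     (\<forall>u n v. Y1 u n v =
        Sum_any (\<lambda>i::nat. ((-1) powi (- (n + int i) - 1) / fact i) *s
                           (D ^^ i) (Y1 v (n + int i) u)))}"

definition coboundary :: "('v \<Rightarrow> 'v) \<Rightarrow> 'v \<Rightarrow> int \<Rightarrow> 'v \<Rightarrow> 'v" where
  "coboundary \<phi> u n v = Y (\<phi> u) n v - \<phi> (Y u n v) + Y u n (\<phi> v)"

definition coboundaries :: "('v \<Rightarrow> int \<Rightarrow> 'v \<Rightarrow> 'v) set" where
  "coboundaries = {coboundary \<phi> | \<phi>.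
     Vector_Spaces.linear (*s) (*s) \<phi> \<and> (\<forall>n. \<phi> ` gr n \<subseteq> gr n) \<and>
     (\<forall>v. \<phi> (D v) = D (\<phi> v)) \<and> \<phi> vac = 0}"

definition dim_H2_half_eq :: "nat \<Rightarrow> bool" where
  "dim_H2_half_eq d \<longleftrightarrow>
     quotient_has_dim (\<lambda>a X u n v. a *s X u n v) cocycles coboundaries d"

end


section \<open>The universal Virasoro vertex operator algebra\<close>

text \<open>The basis \<open>L\<^sub>n\<close> (\<open>n \<in> \<int>\<close>), \<open>\<^bold>c\<close> of the Virasoro algebra.  Finitely supported functions on words
  in these letters form the free associative algebra on them.\<close>

datatype vir_basis = Vir_L int | Vir_c

abbreviation word :: "complex \<Rightarrow> vir_basis list \<Rightarrow> vir_basis list \<Rightarrow>\<^sub>0 complex" where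
  "word a w \<equiv> Poly_Mapping.single w a"

definition free_scale ::
    "complex \<Rightarrow> (vir_basis list \<Rightarrow>\<^sub>0 complex) \<Rightarrow> (vir_basis list \<Rightarrow>\<^sub>0 complex)" where
  "free_scale a p = Poly_Mapping.map ((*) a) p"

text \<open>The induced module \<open>U(Vir) \<otimes>\<^bsub>U(Vir\<^sub>\<ge>\<^sub>-\<^sub>1 \<oplus> \<complex>\<^bold>c)\<^esub> \<complex>\<close> is \<open>U(Vir)\<close> modulo the left ideal generated by
  \<open>L\<^sub>n\<close> (\<open>n \<ge> -1\<close>) and \<open>\<^bold>c - c\<close>, hence the free algebra modulo the span of the elements below: the
  first two families span the kernel of the projection from the free algebra to \<open>U(Vir)\<close>, the last
  two the additional left ideal.\<close>

definition induced_relations :: "complex \<Rightarrow> (vir_basis list \<Rightarrow>\<^sub>0 complex) set" where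
  "induced_relations c =
     {word 1 (u @ [Vir_L m, Vir_L n] @ w) - word 1 (u @ [Vir_L n, Vir_L m] @ w)
        - word (of_int (m - n)) (u @ [Vir_L (m + n)] @ w)
        - word (if m + n = 0 then of_int (m ^ 3 - m) / 12 else 0) (u @ [Vir_c] @ w) | u m n w. True}
   \<union> {word 1 (u @ [Vir_c, Vir_L n] @ w) - word 1 (u @ [Vir_L n, Vir_c] @ w) | u n w. True}
   \<union> {word 1 (u @ [Vir_L n]) | u n. n \<ge> -1}
   \<union> {word 1 (u @ [Vir_c]) - word c u | u. True}"

text \<open>\<open>Vir\<^sub>c\<close> up to isomorphism: a grading-restricted vertex algebra with a conformal element
  \<open>\<omega>\<close> satisfying the Virasoro relations, whose underlying module over the Virasoro algebra, with
  \<open>L\<^sub>n = \<omega>\<^sub>n\<^sub>+\<^sub>1\<close> and \<open>\<^bold>c = c\<close>, is the induced module with generator the vacuum.\<close>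

locale universal_virasoro =
  grading_restricted_vertex_algebra scale gr Y vac
  for scale :: "complex \<Rightarrow> 'v::ab_group_add \<Rightarrow> 'v" (infixr "*s" 75)
    and gr :: "int \<Rightarrow> 'v set"
    and Y :: "'v \<Rightarrow> int \<Rightarrow> 'v \<Rightarrow> 'v" and vac :: 'v +
  fixes \<omega> :: 'v and c :: complex
  assumes omega_weight: "\<omega> \<in> gr 2"
    and omega_grading: "v \<in> gr n \<Longrightarrow> Y \<omega> 1 v = of_int n *s v"
    and omega_derivation: "Y \<omega> 0 v = D v"
    and omega_modes:
      "Y \<omega> 3 \<omega> = (c / 2) *s vac" "Y \<omega> 2 \<omega> = 0" "Y \<omega> 1 \<omega> = 2 *s \<omega>" "Y \<omega> 0 \<omega> = D \<omega>"
      "n \<ge> 4 \<Longrightarrow> Y \<omega> n \<omega> = 0"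
    and induced_module:
      "let act = (\<lambda>b v. case b of Vir_L n \<Rightarrow> Y \<omega> (n + 1) v | Vir_c \<Rightarrow> c *s v);
           ev = (\<lambda>p :: vir_basis list \<Rightarrow>\<^sub>0 complex.
                   \<Sum>w \<in> Poly_Mapping.keys p. Poly_Mapping.lookup p w *s foldr act w vac)
       in surj ev \<and> {p. ev p = 0} = module.span free_scale (induced_relations c)"

end

(* As a module over the modes omega_k with k < 0, Vir_c is free of rank one on the vacuum, so linear
   maps out of it may be prescribed by their value on the vacuum and their behaviour under these modes.

   A nontrivial cocycle is the derivative of the vertex operators with respect to c: keeping the words
   in the creation modes fixed, one differentiates the structure constants.  Concretely, freeness makes
   V[t]/(t^2) a Virasoro module of central charge c + t and yields its vertex operators, the t-part of
   which is the cocycle.  Weak associativity follows by induction on words, and rationality from it.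

   Conversely, let Y1 be a cocycle, omega^1_1 omega = b omega and omega^1_3 omega = a 1.  Duality gives
   the commutator formula to first order.  Subtracting alpha = 2 a - b c times the first cocycle and
   rescaling omega turns Y1(omega, x) into a derivation of the Virasoro action, which by freeness is
   the commutator with some phi; adding the coboundary of phi gives a cocycle that vanishes on omega and
   on the vacuum, hence vanishes.  The products omega_1 omega and omega_3 omega show that a multiple
   of the first cocycle is a coboundary only if it is zero. *)

theory Submission
  imports Defs "HOL-Analysis.Generalised_Binomial_Theorem"
begin

no_notation vector_scalar_mult (infixl "*s" 70)

section \<open>Binomially weighted sums\<close>

text \<open>Freeness over the creation modes is a Poincare-Birkhoff-Witt statement, while
  \<open>induced_module\<close> presents the space only by generators and relations. It is obtained
  without ordered monomials: the enveloping algebra of the creation modes is made a Virasoro module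
  by prescribing how each mode passes a creation mode, and the relations of the induced module are
  checked there. The same construction with 1 in place of \<open>c\<close> yields the derivative of
  the modes.

  Weak associativity is preferred to locality because both of its sides pass a mode
  \<open>W l\<close> in the same way, so it propagates along words from the vacuum. Weights confine
  each matrix coefficient to finitely many diagonals, which reduces rationality to one variable.

  For an arbitrary cocycle, duality treats the two orders of a product separately. Skew symmetry
  identifies their rational functions, and comparing residues gives commutators. The constant
  \<open>2 a - b c\<close> is the change of central charge seen by
  \<open>(1 - t b/2) \<omega>\<close>, the multiple of \<open>\<omega>\<close> that is again
  normalised by \<open>\<omega>_1 \<omega> = 2 \<omega>\<close>.\<close>

definition truncated :: "(nat \<Rightarrow> 'a::zero) \<Rightarrow> bool" where
  "truncated g \<longleftrightarrow> (\<exists>N. \<forall>i\<ge>N. g i = 0)"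

lemma truncatedI: "(\<And>i. i \<ge> N \<Longrightarrow> g i = 0) \<Longrightarrow> truncated g"
  unfolding truncated_def by blast

lemma truncated_add:
  fixes f g :: "nat \<Rightarrow> 'a::monoid_add"
  assumes "truncated f" "truncated g" shows "truncated (\<lambda>i. f i + g i)"
proof -
  from assms obtain M N where "\<forall>i\<ge>M. f i = 0" "\<forall>i\<ge>N. g i = 0" unfolding truncated_def by blast
  then show ?thesis by (intro truncatedI[of "max M N"]) auto
qed

lemma truncated_diff:
  fixes f g :: "nat \<Rightarrow> 'a::group_add"
  assumes "truncated f" "truncated g" shows "truncated (\<lambda>i. f i - g i)"
proof -
  from assms obtain M N where "\<forall>i\<ge>M. f i = 0" "\<forall>i\<ge>N. g i = 0" unfolding truncated_def by blast
  then show ?thesis by (intro truncatedI[of "max M N"]) auto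
qed

lemma truncated_uminus:
  fixes f :: "nat \<Rightarrow> 'a::group_add"
  shows "truncated f \<Longrightarrow> truncated (\<lambda>i. - f i)"
  unfolding truncated_def by auto

lemma truncated_shift: "truncated g \<Longrightarrow> truncated (\<lambda>i. g (i + j))"
  unfolding truncated_def by (metis trans_le_add1)

lemma truncated_map: "truncated g \<Longrightarrow> (\<And>i. g i = 0 \<Longrightarrow> f i = 0) \<Longrightarrow> truncated f"
  unfolding truncated_def by blast

lemma truncated_int:
  fixes h :: "int \<Rightarrow> 'a::zero"
  assumes "\<exists>N. \<forall>n\<ge>N. h n = 0" shows "truncated (\<lambda>i. h (n + int i))"
proof -
  from assms obtain N where "\<forall>n\<ge>N. h n = 0" by blast
  then show ?thesis by (intro truncatedI[of "nat (N - n)"]) auto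
qed

lemma Sum_any_truncated:
  fixes g :: "nat \<Rightarrow> 'a::comm_monoid_add"
  assumes "\<And>i. i \<ge> N \<Longrightarrow> g i = 0"
  shows "Sum_any g = sum g {..<N}"
  by (rule Sum_any.expand_superset) (use assms in \<open>auto simp: not_less[symmetric]\<close>)

lemma vector_space_complex: "vector_space ((*) :: complex \<Rightarrow> complex \<Rightarrow> complex)"
  by unfold_locales (simp_all add: algebra_simps)

locale complex_space = vector_space scale
  for scale :: "complex \<Rightarrow> 'v::ab_group_add \<Rightarrow> 'v" (infixr "*s" 75)
begin

text \<open>With \<open>S\<close> the shift of sequences this is the value at 0 of
  \<open>(1 + S)^a\<close> applied to \<open>g\<close>; the laws below are identities between such
  powers. \<open>Sum_any\<close> returns 0 on infinite supports, which is why most of them ask for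
  truncated sequences.\<close>

definition binsum :: "complex \<Rightarrow> (nat \<Rightarrow> 'v) \<Rightarrow> 'v" where
  "binsum a g = Sum_any (\<lambda>i. (a gchoose i) *s g i)"

lemma binsum_eq:
  assumes "\<And>i. i \<ge> N \<Longrightarrow> g i = 0"
  shows "binsum a g = (\<Sum>i<N. (a gchoose i) *s g i)"
  unfolding binsum_def by (rule Sum_any_truncated) (simp add: assms)

lemma binsum_cong: "(\<And>i. g i = h i) \<Longrightarrow> binsum a g = binsum a h"
  by (simp add: binsum_def)

lemma binsum_0 [simp]: "binsum a (\<lambda>i. 0) = 0"
  by (simp add: binsum_def)

lemma binsum_at_0: "binsum 0 g = g 0"
proof -
  have "Sum_any (\<lambda>i. ((0::complex) gchoose i) *s g i) = (\<Sum>i<1. (0 gchoose i) *s g i)"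
  proof (rule Sum_any_truncated)
    fix i :: nat assume "i \<ge> 1"
    then have "(0::complex) gchoose i = 0" by (cases i) auto
    then show "((0::complex) gchoose i) *s g i = 0" by simp
  qed
  then show ?thesis by (simp add: binsum_def)
qed

lemma binsum_add:
  assumes "truncated g" "truncated h"
  shows "binsum a (\<lambda>i. g i + h i) = binsum a g + binsum a h"
proof -
  from assms obtain M N where "\<forall>i\<ge>M. g i = 0" "\<forall>i\<ge>N. h i = 0" unfolding truncated_def by blast
  then show ?thesis
    by (simp add: binsum_eq[of "max M N"] scale_right_distrib sum.distrib)
qed

lemma binsum_scale:
  assumes "truncated g" shows "binsum a (\<lambda>i. b *s g i) = b *s binsum a g"
proof -
  from assms obtain M where "\<forall>i\<ge>M. g i = 0" unfolding truncated_def by blast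
  then show ?thesis
    by (simp add: binsum_eq[of M] scale_sum_right mult.commute)
qed

lemma binsum_uminus:
  assumes "truncated g" shows "binsum a (\<lambda>i. - g i) = - binsum a g"
  using binsum_scale[OF assms, of a "-1"] by simp

lemma binsum_diff:
  assumes "truncated g" "truncated h"
  shows "binsum a (\<lambda>i. g i - h i) = binsum a g - binsum a h"
  using binsum_add[OF assms(1) truncated_uminus[OF assms(2)], of a] binsum_uminus[OF assms(2)] by simp

lemma binsum_swap:
  assumes "\<And>i j. i \<ge> N \<or> j \<ge> N \<Longrightarrow> h i j = 0"
  shows "binsum a (\<lambda>i. binsum b (\<lambda>j. h i j)) = binsum b (\<lambda>j. binsum a (\<lambda>i. h i j))"
proof -
  have 1: "binsum b (\<lambda>j. h i j) = (\<Sum>j<N. (b gchoose j) *s h i j)" for i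
    by (rule binsum_eq) (use assms in auto)
  have 2: "binsum a (\<lambda>i. h i j) = (\<Sum>i<N. (a gchoose i) *s h i j)" for j
    by (rule binsum_eq) (use assms in auto)
  have "binsum a (\<lambda>i. binsum b (\<lambda>j. h i j)) = (\<Sum>i<N. (a gchoose i) *s (\<Sum>j<N. (b gchoose j) *s h i j))"
    by (subst binsum_eq[of N]) (use assms in \<open>auto simp: 1\<close>)
  also have "\<dots> = (\<Sum>j<N. \<Sum>i<N. ((a gchoose i) * (b gchoose j)) *s h i j)"
    by (subst sum.swap) (simp add: scale_sum_right)
  also have "\<dots> = (\<Sum>j<N. (b gchoose j) *s (\<Sum>i<N. (a gchoose i) *s h i j))"
    by (simp add: scale_sum_right mult.commute)
  also have "\<dots> = binsum b (\<lambda>j. binsum a (\<lambda>i. h i j))"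
    by (subst binsum_eq[where N = N and a = b]) (use assms in \<open>auto simp: 2\<close>)
  finally show ?thesis .
qed

text \<open>\<open>(1 + S)^a (1 + S)^b = (1 + S)^(a + b)\<close>, by collecting the terms with equal
  \<open>i + j\<close>.\<close>

lemma binsum_vandermonde:
  assumes "truncated g"
  shows "binsum a (\<lambda>i. binsum b (\<lambda>j. g (i + j))) = binsum (a + b) g"
proof -
  from assms obtain N where N: "\<And>i. i \<ge> N \<Longrightarrow> g i = 0" unfolding truncated_def by blast
  have 1: "binsum b (\<lambda>j. g (i + j)) = (\<Sum>j<N. (b gchoose j) *s g (i + j))" for i
    by (rule binsum_eq) (use N in auto)
  have "binsum a (\<lambda>i. binsum b (\<lambda>j. g (i + j))) = (\<Sum>i<N. \<Sum>j<N. ((a gchoose i) * (b gchoose j)) *s g (i + j))"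
    by (subst binsum_eq[of N]) (use N in \<open>auto simp: 1 scale_sum_right\<close>)
  also have "\<dots> = (\<Sum>(i,j)\<in>{..<N}\<times>{..<N}. ((a gchoose i) * (b gchoose j)) *s g (i + j))"
    by (simp add: sum.cartesian_product)
  also have "\<dots> = (\<Sum>(i,j)\<in>{(i,j). i + j < N}. ((a gchoose i) * (b gchoose j)) *s g (i + j))"
    proof (rule sum.mono_neutral_right)
    show "\<forall>x\<in>{..<N} \<times> {..<N} - {(i, j). i + j < N}.
        (case x of (i, j) \<Rightarrow> ((a gchoose i) * (b gchoose j)) *s g (i + j)) = 0"
      by auto (metis N not_less)
  qed auto
  also have "\<dots> = (\<Sum>p<N. \<Sum>i\<le>p. ((a gchoose i) * (b gchoose (p - i))) *s g (i + (p - i)))"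
    by (rule sum.triangle_reindex)
  also have "\<dots> = (\<Sum>p<N. (\<Sum>i\<le>p. (a gchoose i) * (b gchoose (p - i))) *s g p)"
    by (simp add: scale_sum_left)
  also have "\<dots> = (\<Sum>p<N. ((a + b) gchoose p) *s g p)"
    by (simp add: gbinomial_Vandermonde atMost_atLeast0)
  also have "\<dots> = binsum (a + b) g"
    by (rule binsum_eq[symmetric]) (use N in auto)
  finally show ?thesis .
qed

text \<open>The weight \<open>i\<close> is the operator \<open>S d/dS\<close>, which turns
  \<open>(1 + S)^a\<close> into \<open>a S (1 + S)^(a - 1)\<close>.\<close>

lemma binsum_absorb:
  assumes "truncated g"
  shows "binsum a (\<lambda>i. of_nat i *s g i) = a *s binsum (a - 1) (\<lambda>i. g (Suc i))"
proof -
  from assms obtain N where N: "\<And>i. i \<ge> N \<Longrightarrow> g i = 0" unfolding truncated_def by blast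
  have "binsum a (\<lambda>i. of_nat i *s g i) = (\<Sum>i<Suc N. (a gchoose i) *s of_nat i *s g i)"
    by (rule binsum_eq) (use N in auto)
  also have "\<dots> = (\<Sum>i<N. (of_nat (Suc i) * (a gchoose Suc i)) *s g (Suc i))"
    by (subst sum.lessThan_Suc_shift) (simp add: mult.commute)
  also have "\<dots> = (\<Sum>i<N. (a * ((a - 1) gchoose i)) *s g (Suc i))"
    by (simp only: gbinomial_absorption)
  also have "\<dots> = a *s (\<Sum>i<N. ((a - 1) gchoose i) *s g (Suc i))"
    by (simp add: scale_sum_right)
  also have "(\<Sum>i<N. ((a - 1) gchoose i) *s g (Suc i)) = binsum (a - 1) (\<lambda>i. g (Suc i))"
    by (rule binsum_eq[symmetric]) (use N in auto)
  finally show ?thesis .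
qed

text \<open>Absorbing each weight separately leaves the same power
  \<open>(1 + S)^(a + b - 1)\<close> twice, with factors \<open>a\<close> and \<open>- b\<close>.
  The factor \<open>i - j\<close> is the structure constant of two nonnegative modes, as it occurs
  in \<open>lam_rel\<close>.\<close>

lemma binsum_vandermonde_diff:
  assumes "truncated g"
  shows "binsum a (\<lambda>i. binsum b (\<lambda>j. (of_nat i - of_nat j) *s g (i + j)))
       = (a - b) *s binsum (a + b - 1) (\<lambda>p. g (Suc p))"
proof -
  from assms obtain N where N: "\<And>i. i \<ge> N \<Longrightarrow> g i = 0" unfolding truncated_def by blast
  have tg: "truncated (\<lambda>j. g (i + j))" for i by (rule truncatedI[of N]) (simp add: N)
  have tg': "truncated (\<lambda>j. of_nat j *s g (i + j))" for i by (rule truncatedI[of N]) (simp add: N)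
  have ts: "truncated (\<lambda>j. g (Suc j))" by (rule truncatedI[of N]) (simp add: N)
  have t1: "truncated (\<lambda>i. binsum b (\<lambda>j. g (i + j)))" by (rule truncatedI[of N]) (simp add: N)
  have t2: "truncated (\<lambda>i. binsum (b - 1) (\<lambda>j. g (Suc (i + j))))" by (rule truncatedI[of N]) (simp add: N)
  have t4: "truncated (\<lambda>i. of_nat i *s binsum b (\<lambda>j. g (i + j)))" by (rule truncatedI[of N]) (simp add: N)
  have t5: "truncated (\<lambda>i. b *s binsum (b - 1) (\<lambda>j. g (Suc (i + j))))" by (rule truncatedI[of N]) (simp add: N)
  have t6: "truncated (\<lambda>j. of_nat i *s g (i + j))" for i by (rule truncatedI[of N]) (simp add: N)
  have "binsum a (\<lambda>i. binsum b (\<lambda>j. (of_nat i - of_nat j) *s g (i + j)))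
      = binsum a (\<lambda>i. of_nat i *s binsum b (\<lambda>j. g (i + j)) - b *s binsum (b - 1) (\<lambda>j. g (Suc (i + j))))"
    by (rule binsum_cong)
      (simp add: scale_left_diff_distrib binsum_diff[OF t6 tg'] binsum_scale[OF tg] binsum_absorb[OF tg])
  also have "\<dots> = binsum a (\<lambda>i. of_nat i *s binsum b (\<lambda>j. g (i + j)))
        - binsum a (\<lambda>i. b *s binsum (b - 1) (\<lambda>j. g (Suc (i + j))))"
    by (rule binsum_diff[OF t4 t5])
  also have "binsum a (\<lambda>i. of_nat i *s binsum b (\<lambda>j. g (i + j)))
      = a *s binsum (a - 1) (\<lambda>i. binsum b (\<lambda>j. g (Suc (i + j))))"
    by (subst binsum_absorb[OF t1]) simp
  also have "binsum (a - 1) (\<lambda>i. binsum b (\<lambda>j. g (Suc (i + j)))) = binsum (a - 1 + b) (\<lambda>p. g (Suc p))"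
    by (rule binsum_vandermonde[OF ts])
  also have "binsum a (\<lambda>i. b *s binsum (b - 1) (\<lambda>j. g (Suc (i + j))))
      = b *s binsum (a + (b - 1)) (\<lambda>p. g (Suc p))"
    by (subst binsum_scale[OF t2]) (simp only: binsum_vandermonde[OF ts])
  finally show ?thesis by (simp add: scale_left_diff_distrib algebra_simps)
qed

lemma binsum_pascal:
  assumes "truncated g"
  shows "binsum (a + 1) g = binsum a g + binsum a (\<lambda>i. g (Suc i))"
proof -
  from assms obtain N where N: "\<And>i. i \<ge> N \<Longrightarrow> g i = 0" unfolding truncated_def by blast
  have "binsum (a + 1) g = binsum a (\<lambda>i. binsum 1 (\<lambda>j. g (i + j)))"
    by (simp add: binsum_vandermonde[OF assms])
  also have "binsum 1 (\<lambda>j. g (i + j)) = g i + g (Suc i)" for i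
  proof -
    have *: "(1::complex) gchoose j = 0" if "j \<ge> 2" for j
      using that binomial_gbinomial[of 1 j, where 'a=complex] by (simp add: binomial_eq_0)
    have "binsum 1 (\<lambda>j. g (i + j)) = (\<Sum>j<2. (1 gchoose j) *s g (i + j))"
      unfolding binsum_def by (rule Sum_any_truncated) (simp add: *)
    then show ?thesis by (simp add: numeral_2_eq_2)
  qed
  then have "binsum a (\<lambda>i. binsum 1 (\<lambda>j. g (i + j))) = binsum a (\<lambda>i. g i + g (Suc i))" by simp
  also have "\<dots> = binsum a g + binsum a (\<lambda>i. g (Suc i))"
    by (rule binsum_add) (use assms truncated_shift[OF assms, of 1] in auto)
  finally show ?thesis .
qed

end

lemma (in complex_space) linear_binsum:
  assumes "Vector_Spaces.linear (*s) sc f" and tr: "truncated g"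
  shows "f (binsum a g) = complex_space.binsum sc a (\<lambda>i. f (g i))"
proof -
  interpret l: Vector_Spaces.linear "(*s)" sc f by fact
  interpret t: complex_space sc ..
  from tr obtain N where N: "\<And>i. i \<ge> N \<Longrightarrow> g i = 0" unfolding truncated_def by blast
  show ?thesis
    by (subst binsum_eq[of N], simp add: N, subst t.binsum_eq[of N])
       (simp_all add: N l.sum l.scale)
qed


section \<open>Free vector spaces\<close>

definition lin_ext :: "(complex \<Rightarrow> 'm::ab_group_add \<Rightarrow> 'm) \<Rightarrow> ('k \<Rightarrow> 'm) \<Rightarrow> ('k \<Rightarrow>\<^sub>0 complex) \<Rightarrow> 'm" where
  "lin_ext s g p = (\<Sum>w\<in>Poly_Mapping.keys p. s (Poly_Mapping.lookup p w) (g w))"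

text \<open>A version of \<open>free_scale\<close> for arbitrary keys: words occur both in the
  letters \<open>vir_basis\<close> and in natural numbers.\<close>

definition fscale :: "complex \<Rightarrow> ('k \<Rightarrow>\<^sub>0 complex) \<Rightarrow> ('k \<Rightarrow>\<^sub>0 complex)" where
  "fscale a p = Poly_Mapping.map ((*) a) p"

lemma lookup_fscale: "Poly_Mapping.lookup (fscale a p) k = a * Poly_Mapping.lookup p k"
  by (simp add: fscale_def map.rep_eq when_def)

lemma vector_space_fscale: "vector_space fscale"
  by unfold_locales (auto intro!: poly_mapping_eqI simp: lookup_fscale lookup_add algebra_simps)

interpretation free: complex_space fscale
  unfolding complex_space_def by (rule vector_space_fscale)

lemma fscale_single: "fscale a (Poly_Mapping.single w b) = Poly_Mapping.single w (a * b)"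
  by (rule poly_mapping_eqI) (simp add: lookup_fscale lookup_single when_def)

context complex_space
begin

lemma lin_ext_superset:
  assumes "finite A" "Poly_Mapping.keys p \<subseteq> A"
  shows "lin_ext (*s) g p = (\<Sum>w\<in>A. Poly_Mapping.lookup p w *s g w)"
  unfolding lin_ext_def
  by (rule sum.mono_neutral_left) (use assms in \<open>auto simp: in_keys_iff\<close>)

lemma linear_lin_ext: "Vector_Spaces.linear fscale (*s) (lin_ext (*s) g)"
proof -
  have "lin_ext (*s) g (p + q) = lin_ext (*s) g p + lin_ext (*s) g q
      \<and> lin_ext (*s) g (fscale a p) = a *s lin_ext (*s) g p" for p q a
  proof
    let ?A = "Poly_Mapping.keys p \<union> Poly_Mapping.keys q"
    have "Poly_Mapping.keys (p + q) \<subseteq> ?A" by (rule Poly_Mapping.keys_add)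
    then show "lin_ext (*s) g (p + q) = lin_ext (*s) g p + lin_ext (*s) g q"
      by (simp add: lin_ext_superset[of ?A] lookup_add scale_left_distrib sum.distrib)
    have "Poly_Mapping.keys (fscale a p) \<subseteq> Poly_Mapping.keys p"
      by (auto simp: in_keys_iff lookup_fscale)
    then show "lin_ext (*s) g (fscale a p) = a *s lin_ext (*s) g p"
      by (simp add: lin_ext_superset[of "Poly_Mapping.keys p"] lookup_fscale scale_sum_right)
  qed
  then show ?thesis
    unfolding Vector_Spaces.linear_iff using vector_space_fscale vector_space_axioms by blast
qed

lemma lin_ext_single: "lin_ext (*s) g (Poly_Mapping.single w a) = a *s g w"
  by (simp add: lin_ext_superset[of "{w}"])

end

lemma free_expansion:
  "p = (\<Sum>w\<in>Poly_Mapping.keys p. fscale (Poly_Mapping.lookup p w) (Poly_Mapping.single w 1))"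
  by (rule poly_mapping_eqI)
    (simp add: lookup_sum lookup_fscale lookup_single when_def in_keys_iff if_distrib[of "\<lambda>x. _ * x"] cong: if_cong)

lemma free_eqI:
  assumes "Vector_Spaces.linear fscale s f" "Vector_Spaces.linear fscale s g"
    and "\<And>w. f (Poly_Mapping.single w 1) = g (Poly_Mapping.single w 1)"
  shows "f p = g p"
proof -
  interpret f: Vector_Spaces.linear fscale s f by fact
  interpret g: Vector_Spaces.linear fscale s g by fact
  show ?thesis
    by (subst (1 2) free_expansion) (simp add: f.sum g.sum f.scale g.scale assms(3))
qed


section \<open>Modules over the Virasoro modes that create from the vacuum\<close>

text \<open>The letter \<open>j\<close> stands for the mode \<open>\<omega>\<^sub>-\<^sub>1\<^sub>-\<^sub>j = L\<^sub>-\<^sub>2\<^sub>-\<^sub>j\<close>.  These modes span a Lie algebra without central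
  term; the modules are submodules \<open>S\<close> of a vector space because the operators of interest are only
  linear on a subspace.\<close>

definition creation_module ::
    "(complex \<Rightarrow> 'm::ab_group_add \<Rightarrow> 'm) \<Rightarrow> 'm set \<Rightarrow> (nat \<Rightarrow> 'm \<Rightarrow> 'm) \<Rightarrow> bool" where
  "creation_module s S e \<longleftrightarrow>
     vector_space s \<and> module.subspace s S \<and> (\<forall>j. \<forall>x\<in>S. e j x \<in> S) \<and>
     (\<forall>j. \<forall>x\<in>S. \<forall>y\<in>S. e j (x + y) = e j x + e j y) \<and>
     (\<forall>j a. \<forall>x\<in>S. e j (s a x) = s a (e j x)) \<and>
     (\<forall>i j. \<forall>x\<in>S. e i (e j x) - e j (e i x) = s (of_int (int j - int i)) (e (i + j + 2) x))"

text \<open>In terms of \<open>L_(-2-i)\<close> and \<open>L_(-2-j)\<close> the bracket is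
  \<open>(j - i) L_(-4-i-j)\<close>, whose letter is \<open>i + j + 2\<close>; the prefix
  \<open>u\<close> and suffix \<open>w\<close> make the span a two-sided ideal.\<close>

definition creation_rels :: "(nat list \<Rightarrow>\<^sub>0 complex) set" where
  "creation_rels = {Poly_Mapping.single (u @ [i, j] @ w) 1 - Poly_Mapping.single (u @ [j, i] @ w) 1
     - Poly_Mapping.single (u @ [i + j + 2] @ w) (of_int (int j - int i)) | u i j w. True}"

text \<open>Extend a basis of \<open>span R\<close> to the whole space, send the basis vectors in
  the span to zero and keep the others. The image is a complement that represents the quotient, so
  no quotient type has to be formed.\<close>

lemma (in complex_space) exists_projection_along:
  "\<exists>\<pi>. Vector_Spaces.linear (*s) (*s) \<pi> \<and> (\<forall>x. \<pi> x - x \<in> span R) \<and> (\<forall>x\<in>span R. \<pi> x = 0)"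
proof -
  interpret p: vector_space_pair "(*s)" "(*s)" ..
  obtain B where B: "B \<subseteq> R" "independent B" "span B = span R"
    using maximal_independent_subset[of R] by (metis span_mono span_span subset_antisym)
  obtain C where C: "B \<subseteq> C" "independent C" "span C = UNIV"
    using maximal_independent_subset_extend[of B UNIV] B by (auto simp: top.extremum_unique)
  define \<pi> where "\<pi> = p.construct C (\<lambda>b. if b \<in> B then 0 else b)"
  have lin: "Vector_Spaces.linear (*s) (*s) \<pi>"
    unfolding \<pi>_def by (rule p.linear_construct) (rule C)
  interpret l: Vector_Spaces.linear "(*s)" "(*s)" \<pi> by fact
  have b: "\<pi> b = (if b \<in> B then 0 else b)" if "b \<in> C" for b
    unfolding \<pi>_def by (rule p.construct_basis) (use C that in auto)
  have "\<pi> x - x \<in> span R" for x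
  proof -
    have "x \<in> span C" using C by simp
    then show ?thesis
    proof (induction rule: span_induct_alt)
      case base show ?case by (simp add: l.zero span_zero)
    next
      case (step c x y)
      have "\<pi> (c *s x + y) - (c *s x + y) = c *s (\<pi> x - x) + (\<pi> y - y)"
        by (simp add: l.add l.scale scale_right_diff_distrib)
      moreover have "\<pi> x - x \<in> span R"
        using b[OF step(1)] B(1) by (auto simp: span_zero intro: span_neg span_base)
      ultimately show ?case using step by (metis span_add span_scale)
    qed
  qed
  moreover have "\<pi> x = 0" if "x \<in> span R" for x
  proof -
    have "x \<in> span B" using B that by simp
    then show ?thesis
      by (rule l.eq_0_on_span[rotated]) (use b C in auto)
  qed
  ultimately show ?thesis using lin by blast
qed

definition creation_proj :: "(nat list \<Rightarrow>\<^sub>0 complex) \<Rightarrow> (nat list \<Rightarrow>\<^sub>0 complex)" where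
  "creation_proj = (SOME \<pi>. Vector_Spaces.linear fscale fscale \<pi>
     \<and> (\<forall>x. \<pi> x - x \<in> free.span creation_rels) \<and> (\<forall>x\<in>free.span creation_rels. \<pi> x = 0))"

lemma creation_proj:
  shows linear_creation_proj: "Vector_Spaces.linear fscale fscale creation_proj"
    and creation_proj_diff: "creation_proj x - x \<in> free.span creation_rels"
    and creation_proj_rels: "x \<in> free.span creation_rels \<Longrightarrow> creation_proj x = 0"
  using someI_ex[OF free.exists_projection_along[of creation_rels], folded creation_proj_def] by auto

definition left_letter :: "nat \<Rightarrow> (nat list \<Rightarrow>\<^sub>0 complex) \<Rightarrow> (nat list \<Rightarrow>\<^sub>0 complex)" where
  "left_letter j = lin_ext fscale (\<lambda>w. Poly_Mapping.single (j # w) 1)"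

text \<open>The quotient of the free algebra by \<open>creation_rels\<close> is the universal enveloping algebra of the
  creation modes.  It is realised on the free algebra itself, by composing with a projection whose
  kernel is the span of the relations.\<close>

definition free_e :: "nat \<Rightarrow> (nat list \<Rightarrow>\<^sub>0 complex) \<Rightarrow> (nat list \<Rightarrow>\<^sub>0 complex)" where
  "free_e j x = creation_proj (left_letter j x)"

definition free_one :: "nat list \<Rightarrow>\<^sub>0 complex" where
  "free_one = creation_proj (Poly_Mapping.single [] 1)"

lemma linear_left_letter: "Vector_Spaces.linear fscale fscale (left_letter j)"
  unfolding left_letter_def by (rule free.linear_lin_ext)

lemma left_letter_single: "left_letter j (Poly_Mapping.single w a) = Poly_Mapping.single (j # w) a"
  by (simp add: left_letter_def free.lin_ext_single fscale_single)

lemma linear_free_e: "Vector_Spaces.linear fscale fscale (free_e j)"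
  unfolding free_e_def using Vector_Spaces.linear_compose[OF linear_left_letter linear_creation_proj]
  by (simp add: o_def)

text \<open>The span of the relations is a left ideal because they carry arbitrary prefixes.\<close>

lemma left_letter_rels: "x \<in> free.span creation_rels \<Longrightarrow> left_letter k x \<in> free.span creation_rels"
proof -
  interpret l: Vector_Spaces.linear fscale fscale "left_letter k" by (rule linear_left_letter)
  assume "x \<in> free.span creation_rels"
  then show ?thesis
  proof (induction rule: free.span_induct_alt)
    case base show ?case by (simp add: l.zero free.span_zero)
  next
    case (step c x y)
    from step(1) obtain u i j w where x: "x = Poly_Mapping.single (u @ [i, j] @ w) 1
        - Poly_Mapping.single (u @ [j, i] @ w) 1
        - Poly_Mapping.single (u @ [i + j + 2] @ w) (of_int (int j - int i))"
      unfolding creation_rels_def by blast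
    have "left_letter k x = Poly_Mapping.single ((k # u) @ [i, j] @ w) 1
        - Poly_Mapping.single ((k # u) @ [j, i] @ w) 1
        - Poly_Mapping.single ((k # u) @ [i + j + 2] @ w) (of_int (int j - int i))"
      by (simp add: x l.diff left_letter_single)
    then have "left_letter k x \<in> creation_rels"
      unfolding creation_rels_def by blast
    then show ?case using step by (simp add: l.add l.scale free.span_add free.span_scale free.span_base)
  qed
qed

lemma linear_add': "Vector_Spaces.linear s1 s2 f \<Longrightarrow> f (x + y) = f x + f y"
  and linear_scale': "Vector_Spaces.linear s1 s2 f \<Longrightarrow> f (s1 a x) = s2 a (f x)"
  by (auto simp: Vector_Spaces.linear_def module_hom_def module_hom_axioms_def)

lemma creation_module_free: "creation_module fscale UNIV free_e"
proof -
  interpret \<pi>: Vector_Spaces.linear fscale fscale creation_proj by (rule linear_creation_proj)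
  have e: "Vector_Spaces.linear fscale fscale (free_e j)" for j by (rule linear_free_e)
  have ll: "Vector_Spaces.linear fscale fscale (left_letter j)" for j by (rule linear_left_letter)
  \<comment> \<open>The inner projection may be dropped: it changes its argument by relations,
    prepending a letter keeps them in the span, and the outer projection kills them.\<close>
  have collapse: "free_e i (free_e j x) = creation_proj (left_letter i (left_letter j x))" for i j x
  proof -
    interpret l: Vector_Spaces.linear fscale fscale "left_letter i" by (rule ll)
    have "left_letter i (creation_proj (left_letter j x) - left_letter j x) \<in> free.span creation_rels"
      by (rule left_letter_rels) (rule creation_proj_diff)
    then have "creation_proj (left_letter i (creation_proj (left_letter j x) - left_letter j x)) = 0"
      by (rule creation_proj_rels)
    then show ?thesis by (simp add: free_e_def l.diff \<pi>.diff)
  qed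
  have rel: "free_e i (free_e j x) - free_e j (free_e i x)
      = fscale (of_int (int j - int i)) (free_e (i + j + 2) x)" for i j x
  proof (rule free_eqI[where s = fscale and f = "\<lambda>x. free_e i (free_e j x) - free_e j (free_e i x)"])
    interpret pp: vector_space_pair fscale fscale ..
    show "Vector_Spaces.linear fscale fscale (\<lambda>x. free_e i (free_e j x) - free_e j (free_e i x))"
      using pp.linear_compose_sub[OF Vector_Spaces.linear_compose[OF e[of j] e[of i]]
          Vector_Spaces.linear_compose[OF e[of i] e[of j]]] by (simp add: o_def)
    show "Vector_Spaces.linear fscale fscale (\<lambda>x. fscale (of_int (int j - int i)) (free_e (i + j + 2) x))"
      by (rule pp.linear_compose_scale_right) (rule e)
    fix w
    have "Poly_Mapping.single ([] @ [i, j] @ w) 1 - Poly_Mapping.single ([] @ [j, i] @ w) 1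
       - Poly_Mapping.single ([] @ [i + j + 2] @ w) (of_int (int j - int i)) \<in> free.span creation_rels"
      by (rule free.span_base) (unfold creation_rels_def, blast)
    then have "creation_proj (Poly_Mapping.single ([] @ [i, j] @ w) 1
       - Poly_Mapping.single ([] @ [j, i] @ w) 1
       - Poly_Mapping.single ([] @ [i + j + 2] @ w) (of_int (int j - int i))) = 0"
      by (rule creation_proj_rels)
    moreover have "creation_proj (Poly_Mapping.single ((i + j + 2) # w) (of_int (int j - int i)))
        = fscale (of_int (int j - int i)) (creation_proj (Poly_Mapping.single ((i + j + 2) # w) 1))"
      by (simp flip: \<pi>.scale add: fscale_single)
    ultimately show "free_e i (free_e j (Poly_Mapping.single w 1)) - free_e j (free_e i (Poly_Mapping.single w 1))
      = fscale (of_int (int j - int i)) (free_e (i + j + 2) (Poly_Mapping.single w 1))"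
      unfolding collapse by (simp add: left_letter_single \<pi>.diff free_e_def)
  qed
  show ?thesis
    unfolding creation_module_def
    using rel vector_space_fscale
    by (simp add: linear_add'[OF e] linear_scale'[OF e])
qed

text \<open>\<open>T\<close> lets the letters of a word act successively on \<open>m0\<close>; it
  respects the relations because they hold for \<open>lam\<close> on \<open>S\<close>.\<close>

lemma free_universal:
  fixes s :: "complex \<Rightarrow> 'm::ab_group_add \<Rightarrow> 'm"
  assumes mod: "creation_module s S lam" and m0: "m0 \<in> S"
  shows "\<exists>T. Vector_Spaces.linear fscale s T \<and> range T \<subseteq> S \<and> T free_one = m0
       \<and> (\<forall>j x. T (free_e j x) = lam j (T x))"
proof -
  from mod interpret M: complex_space s
    unfolding creation_module_def complex_space_def by simp
  interpret pp: vector_space_pair fscale s ..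
  have S: "M.subspace S" and closed: "\<And>j x. x \<in> S \<Longrightarrow> lam j x \<in> S"
    and add: "\<And>j x y. x \<in> S \<Longrightarrow> y \<in> S \<Longrightarrow> lam j (x + y) = lam j x + lam j y"
    and scale: "\<And>j a x. x \<in> S \<Longrightarrow> lam j (s a x) = s a (lam j x)"
    and rel: "\<And>i j x. x \<in> S \<Longrightarrow> lam i (lam j x) - lam j (lam i x) = s (of_int (int j - int i)) (lam (i + j + 2) x)"
    using mod unfolding creation_module_def by auto
  define g where "g w = foldr lam w m0" for w
  define T where "T = lin_ext s g"
  have lin: "Vector_Spaces.linear fscale s T" unfolding T_def by (rule M.linear_lin_ext)
  interpret T: Vector_Spaces.linear fscale s T by fact
  have g: "g w \<in> S" for w by (induction w) (auto simp: g_def m0 closed)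
  have TS: "T p \<in> S" for p
    unfolding T_def lin_ext_def by (intro M.subspace_sum M.subspace_scale S g)
  have T_single: "T (Poly_Mapping.single w a) = s a (g w)" for w a
    by (simp add: T_def M.lin_ext_single)
  have T_left: "T (left_letter j p) = lam j (T p)" for j p
  proof -
    have l0: "lam j 0 = 0" using scale[of 0 j 0] M.subspace_0[OF S] by simp
    \<comment> \<open>\<open>lam j\<close> is linear only on \<open>S\<close>, so every summand has
      to be kept inside \<open>S\<close>.\<close>
    have sum: "lam j (sum f A) = (\<Sum>a\<in>A. lam j (f a))" if "finite A" "\<And>a. a \<in> A \<Longrightarrow> f a \<in> S"
      for f :: "nat list \<Rightarrow> 'm" and A
      using that by (induction A rule: finite_induct) (auto simp: l0 add M.subspace_sum[OF S])
    interpret l: Vector_Spaces.linear fscale fscale "left_letter j" by (rule linear_left_letter)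
    have "lam j (T p) = (\<Sum>w\<in>Poly_Mapping.keys p. lam j (s (Poly_Mapping.lookup p w) (g w)))"
      unfolding T_def lin_ext_def by (rule sum) (auto intro: M.subspace_scale[OF S] g)
    also have "\<dots> = (\<Sum>w\<in>Poly_Mapping.keys p. s (Poly_Mapping.lookup p w) (g (j # w)))"
      by (simp add: scale g) (simp add: g_def)
    also have "\<dots> = T (left_letter j p)"
      by (subst (2) free_expansion)
        (simp add: l.sum l.scale T.sum T.scale left_letter_single T_single)
    finally show ?thesis by simp
  qed
  have T_words: "T (Poly_Mapping.single (u @ w) a) = foldr lam u (T (Poly_Mapping.single w a))" for u w a
    by (induction u) (auto simp: left_letter_single[symmetric] T_left)
  have foldr_diff: "foldr lam u (x - y) = foldr lam u x - foldr lam u y \<and> foldr lam u x \<in> S"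
    if "x \<in> S" "y \<in> S" for u x y
  proof (induction u)
    case (Cons i u)
    have *: "lam i (a - b) = lam i a - lam i b" if "a \<in> S" "b \<in> S" for a b
      using add[of a "s (-1) b" i] scale[of b i "-1"] that M.subspace_scale[OF S, of b "-1"] by simp
    have "foldr lam u y \<in> S" using that(2) by (induction u) (auto simp: closed)
    then show ?case using Cons by (simp add: * closed)
  qed (use that in auto)
  have foldr_0: "foldr lam u 0 = 0" for u
    using foldr_diff[of 0 0 u] M.subspace_0[OF S] by simp
  have kill: "T x = 0" if "x \<in> free.span creation_rels" for x
    using that
  proof (rule T.eq_0_on_span[rotated])
    fix x assume "x \<in> creation_rels"
    then obtain u i j w where x: "x = Poly_Mapping.single (u @ [i, j] @ w) 1
        - Poly_Mapping.single (u @ [j, i] @ w) 1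
        - Poly_Mapping.single (u @ [i + j + 2] @ w) (of_int (int j - int i))"
      unfolding creation_rels_def by blast
    let ?y = "g w"
    have t: "T (Poly_Mapping.single (v @ w) a) = s a (foldr lam v (g w))" for v a
      by (simp add: T_single) (simp add: g_def)
    have "T (Poly_Mapping.single ([i + j + 2] @ w) (of_int (int j - int i)))
        = T (Poly_Mapping.single ([i, j] @ w) 1) - T (Poly_Mapping.single ([j, i] @ w) 1)"
      unfolding t using rel[OF g, of i j w] by simp
    then have "T x = foldr lam u (T (Poly_Mapping.single ([i, j] @ w) 1))
        - foldr lam u (T (Poly_Mapping.single ([j, i] @ w) 1))
        - foldr lam u (T (Poly_Mapping.single ([i, j] @ w) 1) - T (Poly_Mapping.single ([j, i] @ w) 1))"
      unfolding x T.diff T_words[of u] by simp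
    then show "T x = 0" using foldr_diff TS by simp
  qed
  \<comment> \<open>Since \<open>T\<close> kills the relations, it does not see the projections
    built into \<open>free_e\<close> and \<open>free_one\<close>.\<close>
  have T_proj: "T (creation_proj x) = T x" for x
    using kill[OF creation_proj_diff[of x]] by (simp add: T.diff)
  have "T free_one = m0" by (simp add: free_one_def T_proj T_single g_def)
  moreover have "T (free_e j x) = lam j (T x)" for j x
    by (simp add: free_e_def T_proj T_left)
  ultimately show ?thesis using lin TS by blast
qed


section \<open>Extending an action of the creation modes to all Virasoro modes\<close>

text \<open>The central coefficient \<open>(n^3 - n)/12\<close> of the Virasoro algebra at
  \<open>n = m - 1\<close>, as \<open>\<omega>_m = L_(m-1)\<close>.\<close>

definition vir_cocycle :: "int \<Rightarrow> complex" where
  "vir_cocycle m = of_int (m * (m - 1) * (m - 2)) / 12"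

lemma vir_cocycle_0 [simp]: "0 \<le> m \<Longrightarrow> m \<le> 2 \<Longrightarrow> vir_cocycle m = 0"
proof -
  assume "0 \<le> m" "m \<le> 2"
  then have "m = 0 \<or> m = 1 \<or> m = 2" by linarith
  then show ?thesis by (auto simp: vir_cocycle_def)
qed

lemma vir_cocycle_flip: "m + n = 2 \<Longrightarrow> vir_cocycle n = - vir_cocycle m"
proof -
  assume "m + n = 2"
  then have n: "n = 2 - m" by simp
  show ?thesis unfolding n by (simp add: vir_cocycle_def field_simps)
qed

text \<open>The cocycle condition of the central extension for the modes with indices
  \<open>- 1 - i\<close>, \<open>- 1 - j\<close> and \<open>i + j + 5\<close>.\<close>

lemma vir_cocycle_jacobi:
  "of_int (2 * i + j + 6) * vir_cocycle (j + 3) - of_int (2 * j + i + 6) * vir_cocycle (i + 3)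
     = of_int (j - i) * vir_cocycle (i + j + 5)"
  by (simp add: vir_cocycle_def field_simps)

definition family_scale :: "(complex \<Rightarrow> 'm \<Rightarrow> 'm) \<Rightarrow> complex \<Rightarrow> 'm \<times> ('i \<Rightarrow> 'm) \<Rightarrow> 'm \<times> ('i \<Rightarrow> 'm)" where
  "family_scale s a p = (s a (fst p), \<lambda>m. s a (snd p m))"

text \<open>The parameter \<open>z\<close> is the central charge when the modes themselves are
  built, and 1 when their derivative with respect to the charge is built.\<close>

definition family_e ::
    "(complex \<Rightarrow> 'm::ab_group_add \<Rightarrow> 'm) \<Rightarrow> (nat \<Rightarrow> 'm \<Rightarrow> 'm) \<Rightarrow> complex \<Rightarrow> nat
      \<Rightarrow> 'm \<times> (int \<Rightarrow> 'm) \<Rightarrow> 'm \<times> (int \<Rightarrow> 'm)" where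
  "family_e s e z j p = (e j (fst p), \<lambda>m. e j (snd p m)
     + s (of_int (m + 1 + int j)) (snd p (m - 2 - int j))
     + s (if m = int j + 3 then vir_cocycle m * z else 0) (fst p))"

lemma (in complex_space) vector_space_family_scale: "vector_space (family_scale (*s))"
  by unfold_locales
    (auto simp: family_scale_def fun_eq_iff plus_fun_def scale_left_distrib scale_right_distrib)

text \<open>If \<open>x\<close> generates a module for all modes, then \<open>m \<mapsto> \<omega>\<^sub>m x\<close> transforms under creation modes by
  \<open>family_e\<close>; that this is consistent is the cocycle property of \<open>vir_cocycle\<close>.\<close>

lemma (in complex_space) creation_module_family:
  assumes "creation_module (*s) UNIV e"
  shows "creation_module (family_scale (*s)) UNIV (family_e (*s) e z)"
proof -
  interpret f: vector_space "family_scale (*s)" by (rule vector_space_family_scale)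
  have add: "e j (x + y) = e j x + e j y"
    and sc: "e j (a *s x) = a *s e j x"
    and rel: "e i (e j x) - e j (e i x) = of_int (int j - int i) *s e (i + j + 2) x" for i j x y a
    using assms unfolding creation_module_def by auto
  have rel': "e i (e j x) = e j (e i x) + of_int (int j - int i) *s e (i + j + 2) x" for i j x
    using rel[of i j x] by (simp add: algebra_simps)
  have "family_e (*s) e z i (family_e (*s) e z j p) - family_e (*s) e z j (family_e (*s) e z i p)
      = family_scale (*s) (of_int (int j - int i)) (family_e (*s) e z (i + j + 2) p)" for i j p
  proof (rule prod_eqI)
    show "snd (family_e (*s) e z i (family_e (*s) e z j p) - family_e (*s) e z j (family_e (*s) e z i p))
      = snd (family_scale (*s) (of_int (int j - int i)) (family_e (*s) e z (i + j + 2) p))"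
    proof (rule ext)
      fix m
      obtain x \<kappa> where p: "p = (x, \<kappa>)" by force
      define d where "d = (\<lambda>j. if m = int j + 3 then vir_cocycle m * z else 0)"
      define y where "y = \<kappa> (m - 4 - int i - int j)"
      have i1: "m - 2 - int i - 2 - int j = m - 4 - int i - int j"
        "m - 2 - int j - 2 - int i = m - 4 - int i - int j"
        "m - 2 - int (i + j + 2) = m - 4 - int i - int j" by simp_all
      define ci where "ci = (if m - 2 - int i = int j + 3 then vir_cocycle (m - 2 - int i) * z else 0)"
      define cj where "cj = (if m - 2 - int j = int i + 3 then vir_cocycle (m - 2 - int j) * z else 0)"
      define cc where "cc = (if m = int (i + j + 2) + 3 then vir_cocycle m * z else 0)"
      define A where "A = (of_int (m + 1 + int i) :: complex)"
      define B where "B = (of_int (m + 1 + int j) :: complex)"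
      define A' where "A' = (of_int (m - 2 - int j + 1 + int i) :: complex)"
      define B' where "B' = (of_int (m - 2 - int i + 1 + int j) :: complex)"
      define C where "C = (of_int (int j - int i) :: complex)"
      define C' where "C' = (of_int (m + 1 + int (i + j + 2)) :: complex)"
      have coeff1: "A * B' - B * A' = C * C'"
        unfolding A_def B_def A'_def B'_def C_def C'_def of_int_mult[symmetric] of_int_diff[symmetric]
          of_int_eq_iff by (simp add: algebra_simps)
      \<comment> \<open>All three central contributions are supported at
        \<open>m = i + j + 5\<close>.\<close>
      have coeff2: "A * ci - B * cj = C * cc"
      proof (cases "m = int (i + j + 2) + 3")
        case True
        then have "A * ci - B * cj = (of_int (2 * int i + int j + 6) * vir_cocycle (int j + 3)
            - of_int (2 * int j + int i + 6) * vir_cocycle (int i + 3)) * z"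
          by (simp add: A_def B_def ci_def cj_def algebra_simps)
        then show ?thesis using True unfolding vir_cocycle_jacobi
          by (simp add: C_def cc_def algebra_simps)
      qed (auto simp: ci_def cj_def cc_def)
      have "snd (family_e (*s) e z i (family_e (*s) e z j p)) m
          = e i (e j (\<kappa> m) + B *s \<kappa> (m - 2 - int j) + d j *s x)
            + A *s (e j (\<kappa> (m - 2 - int i)) + B' *s y + ci *s x) + d i *s e j x"
        by (simp only: family_e_def p fst_conv snd_conv A_def B_def B'_def d_def ci_def y_def i1)
      moreover have "snd (family_e (*s) e z j (family_e (*s) e z i p)) m
          = e j (e i (\<kappa> m) + A *s \<kappa> (m - 2 - int i) + d i *s x)
            + B *s (e i (\<kappa> (m - 2 - int j)) + A' *s y + cj *s x) + d j *s e i x"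
        by (simp only: family_e_def p fst_conv snd_conv A_def B_def A'_def d_def cj_def y_def i1)
      ultimately have "snd (family_e (*s) e z i (family_e (*s) e z j p)) m
            - snd (family_e (*s) e z j (family_e (*s) e z i p)) m
          = C *s e (i + j + 2) (\<kappa> m) + (A * B' - B * A') *s y + (A * ci - B * cj) *s x"
        by (simp add: rel'[of i j] C_def scale_left_diff_distrib scale_right_distrib add sc)
      also have "\<dots> = C *s (e (i + j + 2) (\<kappa> m) + C' *s y + cc *s x)"
        unfolding coeff1 coeff2 by (simp add: scale_right_distrib)
      also have "\<dots> = snd (family_scale (*s) (of_int (int j - int i)) (family_e (*s) e z (i + j + 2) p)) m"
        unfolding family_scale_def family_e_def snd_conv p fst_conv C_def C'_def cc_def y_def i1 ..
      finally show "snd (family_e (*s) e z i (family_e (*s) e z j p)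
            - family_e (*s) e z j (family_e (*s) e z i p)) m
          = snd (family_scale (*s) (of_int (int j - int i)) (family_e (*s) e z (i + j + 2) p)) m"
        by (simp add: fun_diff_def)
    qed
  qed (simp add: family_e_def family_scale_def rel)
  moreover have "family_e (*s) e z j (p + q) = family_e (*s) e z j p + family_e (*s) e z j q" for j p q
    by (rule prod_eqI) (auto simp: family_e_def fun_eq_iff plus_fun_def add scale_right_distrib algebra_simps)
  moreover have "family_e (*s) e z j (family_scale (*s) a p) = family_scale (*s) a (family_e (*s) e z j p)" for j a p
    by (rule prod_eqI) (auto simp: family_e_def family_scale_def fun_eq_iff sc scale_right_distrib mult.commute)
  ultimately show ?thesis
    unfolding creation_module_def using f.vector_space_axioms by simp
qed

inductive_set creation_words :: "(nat \<Rightarrow> 'm \<Rightarrow> 'm) \<Rightarrow> 'm set \<Rightarrow> 'm set" for e G where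
  base: "g \<in> G \<Longrightarrow> g \<in> creation_words e G"
| step: "x \<in> creation_words e G \<Longrightarrow> e j x \<in> creation_words e G"

text \<open>Only the values on generators and the rule for passing a creation mode are assumed. The
  locale is used on the free module, on the vertex algebra and on its extension by \<open>t\<close>,
  with central operator \<open>c\<close>, \<open>c\<close> and \<open>c + t\<close>; the last is no
  scalar, hence the operator \<open>Z\<close>.\<close>

locale virasoro_extension = complex_space scale
  for scale :: "complex \<Rightarrow> 'm::ab_group_add \<Rightarrow> 'm" (infixr "*s" 75) +
  fixes e :: "nat \<Rightarrow> 'm \<Rightarrow> 'm" and L :: "int \<Rightarrow> 'm \<Rightarrow> 'm" and Z :: "'m \<Rightarrow> 'm" and G H :: "'m set"
  assumes mod: "creation_module (*s) UNIV e"
    and lin_L: "Vector_Spaces.linear (*s) (*s) (L m)"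
    and lin_Z: "Vector_Spaces.linear (*s) (*s) Z"
    and H_def: "H = span (creation_words e G)"
    and L_gen: "g \<in> G \<Longrightarrow> L m g = (if m < 0 then e (nat (- 1 - m)) g else 0)"
    and Z_gen: "g \<in> G \<Longrightarrow> Z g \<in> H"
    and L_e: "x \<in> H \<Longrightarrow> L m (e j x) = e j (L m x) + of_int (m + 1 + int j) *s L (m - 2 - int j) x
               + (if m = int j + 3 then vir_cocycle m else 0) *s Z x"
    and Z_e: "Z (e j x) = e j (Z x)"
    and Z_L: "Z (L m x) = L m (Z x)"
begin

sublocale L: Vector_Spaces.linear "(*s)" "(*s)" "L m" for m by (rule lin_L)
sublocale Z: Vector_Spaces.linear "(*s)" "(*s)" Z by (rule lin_Z)

lemma e_add: "e j (x + y) = e j x + e j y"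
  and e_scale: "e j (a *s x) = a *s e j x"
  and e_rel: "e i (e j x) - e j (e i x) = of_int (int j - int i) *s e (i + j + 2) x"
  using mod unfolding creation_module_def by auto

lemma e_0: "e j 0 = 0"
  using e_scale[of j 0 0] by simp

lemma subspace_H: "subspace H"
  by (simp add: H_def)

lemma H_induct [consumes 1, case_names gen 0 add step]:
  assumes "x \<in> H"
    and gen: "\<And>g. g \<in> G \<Longrightarrow> P g" and zero: "P 0"
    and add: "\<And>a x y. P x \<Longrightarrow> P y \<Longrightarrow> P (a *s x + y)"
    and step: "\<And>j x. x \<in> H \<Longrightarrow> P x \<Longrightarrow> P (e j x)"
  shows "P x"
  using assms(1)[unfolded H_def]
proof (induction rule: span_induct_alt)
  case (step c x y)
  from step(1) have "P x"
  proof induction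
    case (step x j)
    then show ?case using assms(5) by (simp add: H_def span_base)
  qed (rule gen)
  then show ?case using step by (rule_tac add)
qed (rule zero)

lemma H_gen: "g \<in> G \<Longrightarrow> g \<in> H"
  by (simp add: H_def creation_words.base span_base)

lemma H_e: "x \<in> H \<Longrightarrow> e j x \<in> H"
  unfolding H_def
proof (induction rule: span_induct_alt)
  case base then show ?case by (simp add: e_0 span_zero)
next
  case (step c x y)
  then show ?case by (simp add: e_add e_scale span_add span_scale span_base creation_words.step)
qed

text \<open>Along words: passing \<open>e i\<close> produces the term by which
  \<open>e i (e j x)\<close> and \<open>e j (e i x)\<close> differ.\<close>

lemma L_neg: "x \<in> H \<Longrightarrow> L (- 1 - int j) x = e j x"
proof (induction arbitrary: j rule: H_induct)
  case (step i x)
  have "L (- 1 - int j - 2 - int i) x = L (- 1 - int (i + j + 2)) x"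
    by (rule arg_cong[of _ _ "\<lambda>m. L m x"]) simp
  then have *: "L (- 1 - int j - 2 - int i) x = e (i + j + 2) x" by (simp only: step.IH)
  have "L (- 1 - int j) (e i x) = e i (e j x) + of_int (int i - int j) *s e (i + j + 2) x"
    unfolding L_e[OF step(1)] * step.IH by simp
  also have "\<dots> = e j (e i x)"
    using e_rel[of i j x] by (simp add: algebra_simps)
  finally show ?case .
qed (auto simp: L_gen e_0 e_add e_scale L.zero L.add L.scale)

lemma H_Z: "x \<in> H \<Longrightarrow> Z x \<in> H"
proof (induction rule: H_induct)
  case 0 show ?case using subspace_H by (simp add: Z.zero subspace_0)
next
  case (add a x y)
  then show ?case by (simp add: Z.add Z.scale subspace_add[OF subspace_H] subspace_scale[OF subspace_H])
qed (auto simp: Z_gen Z_e H_e)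

lemma H_L: "x \<in> H \<Longrightarrow> L m x \<in> H"
proof (induction arbitrary: m rule: H_induct)
  case 0 show ?case using subspace_H by (simp add: L.zero subspace_0)
next
  case (add a x y)
  then show ?case by (simp add: L.add L.scale subspace_add[OF subspace_H] subspace_scale[OF subspace_H])
next
  case (gen g)
  then show ?case using subspace_0[OF subspace_H] by (simp add: L_gen H_gen H_e)
next
  case (step j x)
  then show ?case
    unfolding L_e[OF step(1)]
    by (intro subspace_add[OF subspace_H] subspace_scale[OF subspace_H] H_e H_Z step)
qed

text \<open>\<open>L (- 1 - int j)\<close> is \<open>e j\<close> on \<open>H\<close>, so this is
  \<open>L_e\<close> read backwards.\<close>

lemma virasoro_neg:
  assumes "x \<in> H"
  shows "L (- 1 - int j) (L n x) - L n (L (- 1 - int j) x)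
    = of_int (- 1 - int j - n) *s L (- 1 - int j + n - 1) x
      + (if - 1 - int j + n = 2 then vir_cocycle (- 1 - int j) else 0) *s Z x"
proof -
  have "vir_cocycle (- 1 - int j) = - vir_cocycle (int j + 3)"
    by (rule vir_cocycle_flip) simp
  moreover have "(- 1 - int j + n = 2) = (n = int j + 3)" by auto
  moreover have "L (- 1 - int j + n - 1) x = L (n - 2 - int j) x" by (rule arg_cong[of _ _ "\<lambda>m. L m x"]) simp
  moreover have "of_int (- 1 - int j - n) = - (of_int (n + 1 + int j) :: complex)" by simp
  ultimately show ?thesis using assms
    unfolding L_neg[OF assms] L_neg[OF H_L[OF assms]] L_e[OF assms]
    by (simp del: of_int_add of_int_diff)
qed

text \<open>Along words: both modes pass \<open>e j\<close> by \<open>L_e\<close>, and the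
  coefficients match by the Jacobi identity of the Virasoro bracket. On a generator either one index
  is negative or both modes annihilate it.\<close>

theorem virasoro:
  assumes "x \<in> H"
  shows "L m (L n x) - L n (L m x) = of_int (m - n) *s L (m + n - 1) x
    + (if m + n = 2 then vir_cocycle m else 0) *s Z x"
  using assms
proof (induction arbitrary: m n rule: H_induct)
  case (add a x y)
  have "L m (L n (a *s x + y)) - L n (L m (a *s x + y))
      = a *s (L m (L n x) - L n (L m x)) + (L m (L n y) - L n (L m y))"
    by (simp add: L.add L.scale scale_right_diff_distrib)
  then show ?case unfolding add by (simp add: L.add L.scale Z.add Z.scale scale_right_distrib mult.commute)
next
  case (gen g)
  show ?case
  proof (cases "m \<ge> 0 \<and> n \<ge> 0")
    case True
    then have "(if m + n = 2 then vir_cocycle m else 0) = 0" by simp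
    \<comment> \<open>For \<open>m = n = 0\<close> the index \<open>m + n - 1\<close> is negative,
      but then the factor \<open>m - n\<close> vanishes.\<close>
    moreover have "of_int (m - n) *s L (m + n - 1) g = 0"
      using True L_gen[OF gen] by (cases "m = 0 \<and> n = 0") auto
    ultimately show ?thesis using True L_gen[OF gen] by (simp add: L.zero)
  next
    case False
    then consider "m < 0" | "n < 0" by linarith
    then show ?thesis
    proof cases
      case 1
      then show ?thesis using virasoro_neg[OF H_gen[OF gen], of "nat (- 1 - m)" n] by simp
    next
      case 2
      have "L n (L m g) - L m (L n g) = of_int (n - m) *s L (m + n - 1) g
          + (if m + n = 2 then vir_cocycle n else 0) *s Z g"
        using 2 virasoro_neg[OF H_gen[OF gen], of "nat (- 1 - n)" m] by (simp add: add.commute)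
      moreover have "(if m + n = 2 then vir_cocycle n else 0) = - (if m + n = 2 then vir_cocycle m else 0)"
        using vir_cocycle_flip[of m n] by auto
      moreover have "of_int (n - m) = - (of_int (m - n) :: complex)" by simp
      ultimately have "L n (L m g) - L m (L n g) = - (of_int (m - n) *s L (m + n - 1) g
          + (if m + n = 2 then vir_cocycle m else 0) *s Z g)"
        by (simp only: scale_minus_left minus_add_distrib)
      then show ?thesis by (metis minus_diff_eq neg_equal_iff_equal)
    qed
  qed
next
  case (step j x)
  define J where "J = int j"
  define d where "d = (\<lambda>m. if m = J + 3 then vir_cocycle m else 0)"
  define C where "C = (\<lambda>m n. if m + n = 2 then vir_cocycle m else 0)"
  have IH: "L m (L n x) = L n (L m x) + of_int (m - n) *s L (m + n - 1) x + C m n *s Z x" for m n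
    using step(2)[of m n] by (simp add: C_def algebra_simps)
  have L_e': "L m (e j x) = e j (L m x) + of_int (m + 1 + J) *s L (m - 2 - J) x + d m *s Z x" if "x \<in> H" for m x
    using L_e[OF that, of m j] unfolding d_def J_def by simp
  have LL: "L m (L n (e j x)) = e j (L m (L n x)) + of_int (m + 1 + J) *s L (m - 2 - J) (L n x) + d m *s Z (L n x)
      + of_int (n + 1 + J) *s L m (L (n - 2 - J) x) + d n *s L m (Z x)" for m n
    using step(1) by (simp add: L_e' H_L L.add L.scale)
  have e1: "m - 2 - J + n - 1 = m + n - 3 - J" "m + (n - 2 - J) - 1 = m + n - 3 - J"
      "m + n - 1 - 2 - J = m + n - 3 - J" by simp_all
  have coeff1: "of_int (m + 1 + J) * of_int (m - 2 - J - n) + of_int (n + 1 + J) * of_int (m - (n - 2 - J))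
      = (of_int (m - n) * of_int (m + n - 1 + 1 + J) :: complex)"
    unfolding of_int_mult[symmetric] of_int_add[symmetric] of_int_eq_iff by (simp add: algebra_simps)
  \<comment> \<open>The central contributions all sit at \<open>m + n = J + 4\<close>, where this is
    the cocycle condition again.\<close>
  have coeff2: "of_int (m + 1 + J) * C (m - 2 - J) n + of_int (n + 1 + J) * C m (n - 2 - J)
      = of_int (m - n) * d (m + n - 1)"
  proof (cases "m + n = J + 4")
    case True
    then have n: "n = J + 4 - m" by simp
    show ?thesis unfolding n
      by (simp add: C_def d_def vir_cocycle_def field_simps)
  qed (auto simp: C_def d_def)
  have "L m (L n (e j x)) - L n (L m (e j x))
      = e j (L m (L n x) - L n (L m x))
        + (of_int (m + 1 + J) * of_int (m - 2 - J - n) + of_int (n + 1 + J) * of_int (m - (n - 2 - J))) *s L (m + n - 3 - J) x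
        + (of_int (m + 1 + J) * C (m - 2 - J) n + of_int (n + 1 + J) * C m (n - 2 - J)) *s Z x"
    unfolding LL IH[of "m - 2 - J" n] IH[of m "n - 2 - J"] e1
    using e_add[of j "L m (L n x) - L n (L m x)" "L n (L m x)"]
    by (simp add: scale_right_distrib scale_left_distrib Z_L algebra_simps del: of_int_add of_int_diff)
  also have "\<dots> = of_int (m - n) *s (e j (L (m + n - 1) x) + of_int (m + n - 1 + 1 + J) *s L (m + n - 1 - 2 - J) x
       + d (m + n - 1) *s Z x) + C m n *s e j (Z x)"
    unfolding coeff1 coeff2 using IH[of m n]
    by (simp add: e_add e_scale scale_right_distrib e1 del: of_int_add of_int_diff)
  finally show ?case
    using step(1) by (simp add: L_e' Z_e C_def del: of_int_add of_int_diff)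
qed (auto simp: L.zero Z.zero)

end


text \<open>A vector \<open>x\<close> is sent to \<open>x\<close> together with the family of its
  prospective images \<open>L m x\<close>; the universal property builds this map from its value on
  the generator. The consistency proved in \<open>creation_module_family\<close> takes the place of
  a basis theorem.\<close>

lemma exists_free_virasoro:
  "\<exists>L. virasoro_extension fscale free_e L (fscale c) {free_one} (free.span (creation_words free_e {free_one}))"
proof -
  define H where "H = free.span (creation_words free_e {free_one})"
  define m0 where "m0 = (free_one, \<lambda>m. if m < 0 then free_e (nat (- 1 - m)) free_one else 0)"
  interpret fam: vector_space "family_scale fscale" by (rule free.vector_space_family_scale)
  obtain T where T: "Vector_Spaces.linear fscale (family_scale fscale) T"
    and T1: "T free_one = m0" and Te: "\<And>j x. T (free_e j x) = family_e fscale free_e c j (T x)"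
    using free_universal[OF free.creation_module_family[OF creation_module_free, of c], of m0] by blast
  interpret T: Vector_Spaces.linear fscale "family_scale fscale" T by (rule T)
  \<comment> \<open>True on words because \<open>family_e\<close> acts on first components by
    \<open>free_e\<close>; this is why \<open>L_e\<close> is required on \<open>H\<close>
    only.\<close>
  have fstT: "fst (T x) = x" if "x \<in> H" for x
    using that unfolding H_def
  proof (induction rule: free.span_induct_alt)
    case base show ?case by (simp add: T.zero)
  next
    case (step a x y)
    from step(1) have "fst (T x) = x"
      by induction (auto simp: T1 m0_def Te family_e_def)
    then show ?case using step by (simp add: T.add T.scale family_scale_def)
  qed
  define L where "L m x = snd (T x) m" for m x
  have "virasoro_extension fscale free_e L (fscale c) {free_one} H"
  proof (intro virasoro_extension.intro virasoro_extension_axioms.intro)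
    show "complex_space fscale" by (rule free.complex_space_axioms)
    show "creation_module fscale UNIV free_e" by (rule creation_module_free)
    show "Vector_Spaces.linear fscale fscale (L m)" for m
      unfolding Vector_Spaces.linear_iff L_def
      by (simp add: vector_space_fscale T.add T.scale family_scale_def)
    show "Vector_Spaces.linear fscale fscale (fscale c)"
      by (rule free.linear_scale_self)
    show "H = free.span (creation_words free_e {free_one})" by (rule H_def)
    show "L m g = (if m < 0 then free_e (nat (- 1 - m)) g else 0)" if "g \<in> {free_one}" for g m
      using that by (simp add: L_def T1 m0_def)
    show "fscale c g \<in> H" if "g \<in> {free_one}" for g
      unfolding H_def by (intro free.span_scale free.span_base creation_words.base that)
    show "L m (free_e j x) = free_e j (L m x) + fscale (of_int (m + 1 + int j)) (L (m - 2 - int j) x)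
        + fscale (if m = int j + 3 then vir_cocycle m else 0) (fscale c x)" if "x \<in> H" for m j x
      using fstT[OF that] by (simp add: L_def Te family_e_def)
    interpret e: Vector_Spaces.linear fscale fscale "free_e j" for j by (rule linear_free_e)
    show "fscale c (free_e j x) = free_e j (fscale c x)" for j x
      by (simp add: e.scale)
    show "fscale c (L m x) = L m (fscale c x)" for m x
      by (simp add: L_def T.scale family_scale_def)
  qed
  then show ?thesis unfolding H_def by blast
qed


section \<open>Modes of a vertex algebra\<close>

context grading_restricted_vertex_algebra
begin

sublocale complex_space scale ..

lemma linear_Y_right: "Vector_Spaces.linear (*s) (*s) (\<lambda>v. Y u n v)"
  and linear_Y_left: "Vector_Spaces.linear (*s) (*s) (\<lambda>u. Y u n v)"
  using laurent_bilinear_Y unfolding laurent_bilinear_def by auto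

sublocale Yr: Vector_Spaces.linear "(*s)" "(*s)" "\<lambda>v. Y u n v" for u n by (rule linear_Y_right)
sublocale Yl: Vector_Spaces.linear "(*s)" "(*s)" "\<lambda>u. Y u n v" for n v by (rule linear_Y_left)

lemma Y_bounded: "\<exists>N. \<forall>n\<ge>N. Y u n v = 0"
  using laurent_bilinear_Y unfolding laurent_bilinear_def by auto

lemma truncated_Y: "truncated (\<lambda>i. Y u (n + int i) v)"
  by (rule truncated_int) (rule Y_bounded)

lemma Sum_any_single:
  assumes "\<And>i. i \<noteq> k \<Longrightarrow> f i = 0"
  shows "Sum_any f = (f k :: 'b::comm_monoid_add)"
  using assms Sum_any.expand_superset[of "{k}" f] by auto

text \<open>The Borcherds identity with the middle exponent 0, where only \<open>i = 0\<close>
  survives on the right.\<close>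

lemma commutator:
  "Y u m (Y v k w) - Y v k (Y u m w) = binsum (of_int m) (\<lambda>i. Y (Y u (int i) v) (m + k - int i) w)"
proof -
  have "Sum_any (\<lambda>i::nat. ((-1) ^ i * (of_int 0 gchoose i)) *s
         (Y u (m + 0 - int i) (Y v (k + int i) w)
          - ((-1) powi 0) *s Y v (0 + k - int i) (Y u (m + int i) w)))
      = Y u m (Y v k w) - Y v k (Y u m w)"
    by (subst Sum_any_single[of 0]) (auto simp: gr0_conv_Suc)
  then show ?thesis
    using borcherds[of m u 0 v k w] by (simp add: binsum_def)
qed

text \<open>The Borcherds identity with exponents 0 and -2 and the vacuum as second vector; the
  modes of the vacuum leave at most one term, at \<open>i = - 1 - n\<close> or at
  \<open>i = n - 1\<close>.\<close>

lemma Y_D: "Y (D u) n w = (- of_int n) *s Y u (n - 1) w"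
proof -
  \<comment> \<open>These are the coefficients of \<open>(1 - x)^(-2)\<close>.\<close>
  have g: "(-1) ^ i * ((- 2 :: complex) gchoose i) = of_nat (i + 1)" for i
    using gbinomial_minus[of "2::complex" i] binomial_gbinomial[of "i + 1" i, where 'a = complex]
    by (simp add: power_mult_distrib[symmetric] add.commute)
  have "Sum_any (\<lambda>i::nat. (of_int 0 gchoose i) *s Y (Y u (- 2 + int i) vac) (0 + n - int i) w)
      = Y (D u) n w"
    by (subst Sum_any_single[of 0]) (auto simp: gr0_conv_Suc D_def)
  moreover have "Sum_any (\<lambda>i::nat. ((-1) ^ i * (of_int (- 2) gchoose i)) *s
         (Y u (0 + (- 2) - int i) (Y vac (n + int i) w)
          - ((-1) powi (- 2)) *s Y vac (- 2 + n - int i) (Y u (0 + int i) w)))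
      = (- of_int n) *s Y u (n - 1) w"
  proof (cases "n < 0")
    case True
    have "Sum_any (\<lambda>i::nat. ((-1) ^ i * (of_int (- 2) gchoose i)) *s
         (Y u (0 + (- 2) - int i) (Y vac (n + int i) w)
          - ((-1) powi (- 2)) *s Y vac (- 2 + n - int i) (Y u (0 + int i) w)))
       = of_nat (nat (- 1 - n) + 1) *s Y u (n - 1) w"
      by (subst Sum_any_single[of "nat (- 1 - n)"])
        (use True in \<open>auto simp: vacuum Yr.zero g nat_eq_iff\<close>)
    then show ?thesis using True by simp
  next
    case False
    show ?thesis
    proof (cases "n = 0")
      case True
      then show ?thesis by (simp add: vacuum Yr.zero)
    next
      case nz: False
      have "Sum_any (\<lambda>i::nat. ((-1) ^ i * (of_int (- 2) gchoose i)) *s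
         (Y u (0 + (- 2) - int i) (Y vac (n + int i) w)
          - ((-1) powi (- 2)) *s Y vac (- 2 + n - int i) (Y u (0 + int i) w)))
       = - (of_nat (nat (n - 1) + 1) *s Y u (n - 1) w)"
        by (subst Sum_any_single[of "nat (n - 1)"])
          (use False nz in \<open>auto simp: vacuum Yr.zero g nat_eq_iff power_int_def\<close>)
      then show ?thesis using False nz by simp
    qed
  qed
  ultimately show ?thesis using borcherds[of 0 u "- 2" vac n w] by simp
qed

end


section \<open>The universal Virasoro vertex algebra as a module\<close>

lemma free_scale_eq: "free_scale = fscale"
  by (intro ext) (simp add: free_scale_def fscale_def)

context universal_virasoro
begin

abbreviation W :: "int \<Rightarrow> 'v \<Rightarrow> 'v" where "W k \<equiv> Y \<omega> k"

text \<open>Of the products \<open>\<omega>_i \<omega>\<close> only \<open>i = 0, 1, 3\<close>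
  contribute. The last one enters with \<open>binom(m,3) c/2\<close>, and \<open>binom(m,3)\<close>
  is twice \<open>vir_cocycle m\<close>.\<close>

lemma W_virasoro: "W m (W k v) - W k (W m v)
    = of_int (m - k) *s W (m + k - 1) v + (if m + k = 2 then vir_cocycle m else 0) *s (c *s v)"
proof -
  have w: "Y (W (int i) \<omega>) (m + k - int i) v = 0" if "i \<ge> 4" for i
    using that omega_modes(5)[of "int i"] by (simp add: Yl.zero)
  have "binsum (of_int m) (\<lambda>i. Y (W (int i) \<omega>) (m + k - int i) v)
     = Y (D \<omega>) (m + k) v + of_int m *s Y (2 *s \<omega>) (m + k - 1) v
       + (of_int m gchoose 3) *s Y ((c / 2) *s vac) (m + k - 3) v"
    by (subst binsum_eq[of "Suc (Suc (Suc (Suc 0)))"])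
      (auto simp: w omega_modes Yl.zero Yl.scale numeral_3_eq_3)
  also have "(of_int m gchoose 3 :: complex) = 2 * vir_cocycle m"
    by (simp add: vir_cocycle_def eval_nat_numeral(3) numeral_2_eq_2 gbinomial_Suc field_simps)
  also have "(2 * vir_cocycle m) *s Y ((c / 2) *s vac) (m + k - 3) v
      = (if m + k = 2 then vir_cocycle m else 0) *s (c *s v)"
    by (simp add: Yl.scale vacuum)
  finally show ?thesis
    unfolding commutator
    by (simp only: Y_D Yl.scale scale_scale scale_left_distrib[symmetric]) (simp add: algebra_simps)
qed

definition words :: "'v set" where
  "words = creation_words (\<lambda>j. W (- 1 - int j)) {vac}"

lemma creation_module_V: "creation_module (*s) UNIV (\<lambda>j. W (- 1 - int j))"
  unfolding creation_module_def
proof (intro conjI allI ballI)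
  fix i j v
  have "- 1 - int i + (- 1 - int j) - 1 = - 1 - int (i + j + 2)" by simp
  then show "W (- 1 - int i) (W (- 1 - int j) v) - W (- 1 - int j) (W (- 1 - int i) v)
      = of_int (int j - int i) *s W (- 1 - int (i + j + 2)) v"
    using W_virasoro[of "- 1 - int i" "- 1 - int j" v] by simp
qed (auto simp: Yr.add Yr.scale vector_space_axioms)

lemma W_vac: "k \<ge> 0 \<Longrightarrow> W k vac = 0"
  by (rule creation(2))

sublocale V: virasoro_extension scale "\<lambda>j. W (- 1 - int j)" W "\<lambda>v. c *s v" "{vac}" "span words"
proof (intro virasoro_extension.intro virasoro_extension_axioms.intro)
  show "complex_space (*s)" by (rule complex_space_axioms)
  show "creation_module (*s) UNIV (\<lambda>j. W (- 1 - int j))" by (rule creation_module_V)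
  show "Vector_Spaces.linear (*s) (*s) (W m)" for m by (rule linear_Y_right)
  show "Vector_Spaces.linear (*s) (*s) (\<lambda>v. c *s v)" by (rule linear_scale_self)
  show "W m g = (if m < 0 then W (- 1 - int (nat (- 1 - m))) g else 0)" if "g \<in> {vac}" for g m
    using that W_vac by auto
  show "c *s g \<in> span words" if "g \<in> {vac}" for g
    unfolding words_def by (intro span_scale span_base creation_words.base that)
  show "W m (W (- 1 - int j) x) = W (- 1 - int j) (W m x)
      + of_int (m + 1 + int j) *s W (m - 2 - int j) x
      + (if m = int j + 3 then vir_cocycle m else 0) *s (c *s x)" for m j x
  proof -
    have e: "m - (- 1 - int j) = m + 1 + int j" "m + (- 1 - int j) - 1 = m - 2 - int j"
      "(m + (- 1 - int j) = 2) = (m = int j + 3)" by auto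
    show ?thesis using W_virasoro[of m "- 1 - int j" x, unfolded e]
      by (simp only: diff_eq_eq ac_simps)
  qed
qed (auto simp: words_def Yr.scale)

definition act :: "vir_basis \<Rightarrow> 'v \<Rightarrow> 'v" where
  "act b v = (case b of Vir_L n \<Rightarrow> Y \<omega> (n + 1) v | Vir_c \<Rightarrow> c *s v)"

lemma surj_ev: "surj (lin_ext (*s) (\<lambda>w. foldr act w vac))"
  and ker_ev: "{p. lin_ext (*s) (\<lambda>w. foldr act w vac) p = 0} = free.span (induced_relations c)"
proof -
  have *: "lin_ext (*s) (\<lambda>w. foldr act w vac)
      = (\<lambda>p. \<Sum>w\<in>Poly_Mapping.keys p. Poly_Mapping.lookup p w *s foldr act w vac)"
    by (rule ext) (simp add: lin_ext_def)
  show "surj (lin_ext (*s) (\<lambda>w. foldr act w vac))"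
    and "{p. lin_ext (*s) (\<lambda>w. foldr act w vac) p = 0} = free.span (induced_relations c)"
    using induced_module
    unfolding Let_def act_def[abs_def, symmetric] * free_scale_eq by auto
qed

text \<open>The span of the creation words is stable under all modes by \<open>V.H_L\<close>, so it
  contains every word in the Virasoro letters applied to the vacuum, and these span.\<close>

lemma span_words: "span words = UNIV"
proof -
  have vac: "vac \<in> span words" by (rule V.H_gen) simp
  have "foldr act w vac \<in> span words" for w
  proof (induction w)
    case (Cons b w)
    then show ?case by (cases b) (auto simp: act_def V.H_L span_scale)
  qed (simp add: vac)
  then have "lin_ext (*s) (\<lambda>w. foldr act w vac) p \<in> span words" for p
    unfolding lin_ext_def by (intro span_sum span_scale)
  then show ?thesis using surj_ev by (metis UNIV_eq_I surjD)
qed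

lemma word_induct [case_names vac 0 add step]:
  assumes "P vac" "P 0" "\<And>a x y. P x \<Longrightarrow> P y \<Longrightarrow> P (a *s x + y)"
    and "\<And>j x. P x \<Longrightarrow> P (W (- 1 - int j) x)"
  shows "P v"
proof -
  have "v \<in> span words" by (simp add: span_words)
  then show ?thesis by (induction rule: V.H_induct) (auto intro: assms)
qed

text \<open>As a module over the creation modes, \<open>Vir\<^sub>c\<close> is free of rank one.  The proof lets all Virasoro
  modes act on the free module, which by the definition of the induced module maps \<open>Vir\<^sub>c\<close> to it.\<close>

theorem universal_property:
  fixes s :: "complex \<Rightarrow> 'm::ab_group_add \<Rightarrow> 'm"
  assumes mod: "creation_module s S lam" and m0: "m0 \<in> S"
  shows "\<exists>T. Vector_Spaces.linear (*s) s T \<and> range T \<subseteq> S \<and> T vac = m0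
    \<and> (\<forall>j v. T (W (- 1 - int j) v) = lam j (T v))"
proof -
  define H where "H = free.span (creation_words free_e {free_one})"
  obtain L where "virasoro_extension fscale free_e L (fscale c) {free_one} H"
    using exists_free_virasoro[of c] unfolding H_def by blast
  then interpret F: virasoro_extension fscale free_e L "fscale c" "{free_one}" H .
  obtain T where T: "Vector_Spaces.linear fscale s T" "range T \<subseteq> S" "T free_one = m0"
      "\<And>j x. T (free_e j x) = lam j (T x)"
    using free_universal[OF mod m0] by blast
  define actF where "actF b x = (case b of Vir_L n \<Rightarrow> L (n + 1) x | Vir_c \<Rightarrow> fscale c x)" for b x
  \<comment> \<open>\<open>G\<close> evaluates words in the Virasoro letters on the free module;
    \<open>L (n + 1)\<close> plays the role of \<open>Vir_L n\<close>.\<close>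
  define G where "G = lin_ext fscale (\<lambda>w. foldr actF w free_one)"
  let ?ev = "lin_ext (*s) (\<lambda>w. foldr act w vac)"
  interpret G: Vector_Spaces.linear fscale fscale G unfolding G_def by (rule free.linear_lin_ext)
  interpret ev: Vector_Spaces.linear fscale "(*s)" ?ev by (rule linear_lin_ext)
  have G_single: "G (Poly_Mapping.single w a) = fscale a (foldr actF w free_one)" for w a
    by (simp add: G_def free.lin_ext_single)
  have lin_act: "Vector_Spaces.linear fscale fscale (actF b)" for b
    unfolding actF_def by (cases b) (simp_all add: F.lin_L free.linear_scale_self)
  have lin_u: "Vector_Spaces.linear fscale fscale (foldr actF u)" for u
  proof (induction u)
    case Nil
    then show ?case by (simp add: free.linear_id id_def[symmetric])
  next
    case (Cons b u)
    then show ?case using Vector_Spaces.linear_compose[OF Cons lin_act] by (simp add: o_def)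
  qed
  have one: "free_one \<in> H" by (rule F.H_gen) simp
  have inH: "foldr actF w free_one \<in> H" for w
  proof (induction w)
    case (Cons b w)
    then show ?case by (cases b) (auto simp: actF_def F.H_L free.subspace_scale[OF F.subspace_H])
  qed (simp add: one)
  \<comment> \<open>The free module satisfies the defining relations of the induced module. Since
    these span the kernel of \<open>?ev\<close>, \<open>G\<close> factors through
    \<open>?ev\<close>.\<close>
  have kill: "G p = 0" if p: "p \<in> induced_relations c" for p
  proof -
    interpret u: Vector_Spaces.linear fscale fscale "foldr actF u" for u by (rule lin_u)
    consider (LL) u m n w where "p = word 1 (u @ [Vir_L m, Vir_L n] @ w) - word 1 (u @ [Vir_L n, Vir_L m] @ w)
        - word (of_int (m - n)) (u @ [Vir_L (m + n)] @ w)
        - word (if m + n = 0 then of_int (m ^ 3 - m) / 12 else 0) (u @ [Vir_c] @ w)"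
      | (cL) u n w where "p = word 1 (u @ [Vir_c, Vir_L n] @ w) - word 1 (u @ [Vir_L n, Vir_c] @ w)"
      | (L) u n where "p = word 1 (u @ [Vir_L n])" "n \<ge> - 1"
      | (c) u where "p = word 1 (u @ [Vir_c]) - word c u"
      using p unfolding induced_relations_def by blast
    then show ?thesis
    proof cases
      case LL
      define x where "x = foldr actF w free_one"
      have x: "x \<in> H" unfolding x_def by (rule inH)
      define z where "z = (if m + n = 0 then of_int (m ^ 3 - m) / 12 else 0 :: complex)"
      have "(m + 1) * m * (m - 1) = m ^ 3 - m" by (simp add: algebra_simps power3_eq_cube)
      then have z: "(if m + 1 + (n + 1) = 2 then vir_cocycle (m + 1) else 0) = z"
        by (auto simp: z_def vir_cocycle_def)
      have "L (m + 1) (L (n + 1) x) - L (n + 1) (L (m + 1) x)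
          = fscale (of_int (m - n)) (L (m + n + 1) x) + fscale z (fscale c x)"
        using F.virasoro[OF x, of "m + 1" "n + 1"] unfolding z by (simp add: algebra_simps)
      then have "actF (Vir_L m) (actF (Vir_L n) x) - actF (Vir_L n) (actF (Vir_L m) x)
          - fscale (of_int (m - n)) (actF (Vir_L (m + n)) x) - fscale z (actF Vir_c x) = 0"
        by (simp add: actF_def algebra_simps)
      then have "foldr actF u (actF (Vir_L m) (actF (Vir_L n) x) - actF (Vir_L n) (actF (Vir_L m) x)
          - fscale (of_int (m - n)) (actF (Vir_L (m + n)) x) - fscale z (actF Vir_c x)) = 0"
        by (simp add: u.zero)
      then show ?thesis
        unfolding LL z_def[symmetric] by (simp add: G.diff G_single u.diff u.scale x_def)
    next
      case cL
      then show ?thesis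
        by (simp add: G.diff G_single actF_def F.L.scale)
    next
      case L
      have "L (n + 1) free_one = 0" using F.L_gen[of free_one "n + 1"] L by simp
      then show ?thesis by (simp add: L G_single actF_def u.zero)
    next
      case c
      then show ?thesis by (simp add: G.diff G_single actF_def u.scale)
    qed
  qed
  have ker: "G p = 0" if "?ev p = 0" for p
  proof -
    have "p \<in> free.span (induced_relations c)" using that ker_ev by blast
    then show ?thesis by (rule G.eq_0_on_span[rotated]) (rule kill)
  qed
  have G_eq: "G p = G q" if "?ev p = ?ev q" for p q
    using ker[of "p - q"] that by (simp add: ev.diff G.diff)
  define pre where "pre = inv ?ev"
  have pre: "?ev (pre v) = v" for v unfolding pre_def by (rule surj_f_inv_f[OF surj_ev])
  \<comment> \<open>The induced map from \<open>V\<close> to the free module; by \<open>G_eq\<close>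
    the choice of preimage does not matter.\<close>
  define \<tau> where "\<tau> v = G (pre v)" for v
  have \<tau>: "\<tau> (?ev p) = G p" for p unfolding \<tau>_def by (rule G_eq) (rule pre)
  have lin_\<tau>: "Vector_Spaces.linear (*s) fscale \<tau>"
  proof -
    have "\<tau> (x + y) = \<tau> x + \<tau> y" for x y
      using \<tau>[of "pre x + pre y"] by (simp add: ev.add pre G.add) (simp add: \<tau>_def)
    moreover have "\<tau> (a *s x) = fscale a (\<tau> x)" for a x
      using \<tau>[of "fscale a (pre x)"] by (simp add: ev.scale pre G.scale) (simp add: \<tau>_def)
    ultimately show ?thesis
      unfolding Vector_Spaces.linear_iff using vector_space_axioms vector_space_fscale by blast
  qed
  interpret \<tau>: Vector_Spaces.linear "(*s)" fscale \<tau> by (rule lin_\<tau>)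
  have \<tau>_word: "\<tau> (foldr act w vac) = foldr actF w free_one" for w
    using \<tau>[of "Poly_Mapping.single w 1"] by (simp add: lin_ext_single G_single)
  \<comment> \<open>On \<open>H\<close> the mode \<open>L (- 1 - int j)\<close> is
    \<open>free_e j\<close>, so \<open>\<tau>\<close> intertwines the creation modes.\<close>
  have \<tau>_W: "\<tau> (W (- 1 - int j) v) = free_e j (\<tau> v)" for j v
  proof -
    have "W (- 1 - int j) (?ev p) = (\<Sum>w\<in>Poly_Mapping.keys p. Poly_Mapping.lookup p w *s foldr act (Vir_L (- 2 - int j) # w) vac)" for p
      by (simp add: lin_ext_def Yr.sum Yr.scale act_def)
    moreover have "free_e j (G p) = (\<Sum>w\<in>Poly_Mapping.keys p. fscale (Poly_Mapping.lookup p w) (foldr actF (Vir_L (- 2 - int j) # w) free_one))" for p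
    proof -
      interpret e: Vector_Spaces.linear fscale fscale "free_e i" for i by (rule linear_free_e)
      show ?thesis using F.L_neg[OF inH, of j]
        by (simp add: G_def lin_ext_def e.sum e.scale actF_def)
    qed
    ultimately have "\<tau> (W (- 1 - int j) (?ev (pre v))) = free_e j (G (pre v))"
      by (simp only: \<tau>.sum \<tau>.scale \<tau>_word)
    then show ?thesis by (simp add: pre) (simp add: \<tau>_def)
  qed
  have "T (\<tau> vac) = m0" using \<tau>_word[of "[]"] T by simp
  moreover have "Vector_Spaces.linear (*s) s (T \<circ> \<tau>)"
    by (rule Vector_Spaces.linear_compose[OF lin_\<tau> T(1)])
  ultimately show ?thesis
    using T \<tau>_W by (intro exI[of _ "T \<circ> \<tau>"]) auto
qed

end


section \<open>Further identities for binomial sums\<close>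

context complex_space
begin

lemma binsum_coabsorb:
  assumes "truncated g"
  shows "binsum a (\<lambda>i. (a - of_nat i) *s g i) = a *s binsum (a - 1) g"
proof -
  from assms obtain N where N: "\<And>i. i \<ge> N \<Longrightarrow> g i = 0" unfolding truncated_def by blast
  have "binsum a (\<lambda>i. (a - of_nat i) *s g i) = (\<Sum>i<N. ((a - of_nat i) * (a gchoose i)) *s g i)"
    by (subst binsum_eq[of N]) (auto simp: N mult.commute)
  also have "\<dots> = a *s (\<Sum>i<N. ((a - 1) gchoose i) *s g i)"
    by (simp add: gbinomial_absorb_comp scale_sum_right)
  also have "\<dots> = a *s binsum (a - 1) g"
    by (subst binsum_eq[of N]) (auto simp: N)
  finally show ?thesis .
qed

text \<open>From \<open>binom(a,r) binom(r,s) = binom(a,s) binom(a-s,r-s)\<close> with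
  \<open>t = r - s\<close>. It resolves a mode that acts on a product inside a commutator
  sum.\<close>

lemma binsum_trinomial:
  assumes N: "\<And>r s. r \<ge> N \<Longrightarrow> h r s = 0"
  shows "binsum a (\<lambda>r. binsum (of_nat r) (\<lambda>s. h r s))
       = binsum a (\<lambda>s. binsum (a - of_nat s) (\<lambda>t. h (s + t) s))"
proof -
  have 1: "binsum (of_nat r) (\<lambda>s. h r s) = (\<Sum>s\<le>r. (of_nat r gchoose s) *s h r s)" for r
  proof -
    have "((of_nat r :: complex) gchoose s) *s h r s = 0" if "s \<ge> Suc r" for s
      using that by (simp add: binomial_gbinomial[symmetric])
    then show ?thesis unfolding binsum_def lessThan_Suc_atMost[symmetric]
      by (rule Sum_any_truncated)
  qed
  have 2: "binsum (a - of_nat s) (\<lambda>t. h (s + t) s) = (\<Sum>t<N - s. (a - of_nat s gchoose t) *s h (s + t) s)" for s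
    by (rule binsum_eq) (use N in auto)
  have "binsum a (\<lambda>r. binsum (of_nat r) (\<lambda>s. h r s))
      = (\<Sum>r<N. \<Sum>s\<le>r. ((a gchoose r) * (of_nat r gchoose s)) *s h r s)"
    by (subst binsum_eq[of N]) (auto simp: 1 N scale_sum_right)
  also have "\<dots> = (\<Sum>r<N. \<Sum>s\<le>r. ((a gchoose s) * (a - of_nat s gchoose (r - s))) *s h (s + (r - s)) s)"
    by (intro sum.cong refl) (simp add: gbinomial_trinomial_revision)
  also have "\<dots> = (\<Sum>(s,t)\<in>{(s,t). s + t < N}. ((a gchoose s) * (a - of_nat s gchoose t)) *s h (s + t) s)"
    by (rule sum.triangle_reindex[symmetric])
  also have "{(s,t). s + t < N} = (SIGMA s:{..<N}. {..<N - s})" by auto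
  also have "(\<Sum>(s,t)\<in>(SIGMA s:{..<N}. {..<N - s}). ((a gchoose s) * (a - of_nat s gchoose t)) *s h (s + t) s)
      = (\<Sum>s<N. (a gchoose s) *s (\<Sum>t<N - s. (a - of_nat s gchoose t) *s h (s + t) s))"
    by (subst sum.Sigma[symmetric]) (auto simp: scale_sum_right)
  also have "\<dots> = binsum a (\<lambda>s. binsum (a - of_nat s) (\<lambda>t. h (s + t) s))"
    by (subst binsum_eq[of N]) (auto simp: 2)
  finally show ?thesis .
qed

lemma binsum_of_nat_eq:
  "binsum (of_nat m) g = (\<Sum>i\<le>m. (of_nat m gchoose i) *s g i)"
proof -
  have "((of_nat m :: complex) gchoose s) *s g s = 0" if "s \<ge> Suc m" for s
    using that by (simp add: binomial_gbinomial[symmetric])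
  then show ?thesis unfolding binsum_def lessThan_Suc_atMost[symmetric]
    by (rule Sum_any_truncated)
qed

end

text \<open>Only finitely many \<open>i\<close> contribute, so the maximum of their bounds serves
  for all.\<close>

lemma uniform_bound:
  fixes f :: "nat \<Rightarrow> int \<Rightarrow> 'a::zero"
  assumes "\<And>i. \<exists>N. \<forall>q\<ge>N. f i q = 0" and "\<And>i q. i \<ge> S \<Longrightarrow> f i q = 0"
  shows "\<exists>N. \<forall>i q. q \<ge> N \<longrightarrow> f i q = 0"
proof -
  from assms(1) obtain N where N: "\<And>i q. q \<ge> N i \<Longrightarrow> f i q = 0" by metis
  have "f i q = 0" if "q \<ge> Max (insert 0 (N ` {..<S}))" for i q
  proof (cases "i < S")
    case True
    then have "N i \<le> Max (insert 0 (N ` {..<S}))" by (intro Max_ge) auto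
    then have "N i \<le> q" using that by linarith
    then show ?thesis by (rule N)
  qed (use assms(2) in auto)
  then show ?thesis by blast
qed


section \<open>Vertex algebras generated by a Virasoro field\<close>

text \<open>The central element acts by an operator because the second use of the locale is over the
  dual numbers, where the charge is \<open>c + t\<close>.\<close>

locale virasoro_module = complex_space scale
  for scale :: "complex \<Rightarrow> 'e::ab_group_add \<Rightarrow> 'e" (infixr "*s" 75) +
  fixes W :: "int \<Rightarrow> 'e \<Rightarrow> 'e" and C :: "'e \<Rightarrow> 'e" and vac :: 'e
  assumes lin_W: "Vector_Spaces.linear (*s) (*s) (W k)"
    and lin_C: "Vector_Spaces.linear (*s) (*s) C"
    and W_bounded: "\<exists>N. \<forall>k\<ge>N. W k u = 0"
    and W_rel: "W m (W k u) - W k (W m u) = of_int (m - k) *s W (m + k - 1) u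
                 + (if m + k = 2 then vir_cocycle m else 0) *s C u"
    and W_C: "W k (C u) = C (W k u)"
    and W_vac: "k \<ge> 0 \<Longrightarrow> W k vac = 0"
begin

sublocale W: Vector_Spaces.linear "(*s)" "(*s)" "W k" for k by (rule lin_W)
sublocale C: Vector_Spaces.linear "(*s)" "(*s)" C by (rule lin_C)

lemma W_bounded_nat: obtains I where "\<And>i. i \<ge> I \<Longrightarrow> W (int i) u = 0"
proof -
  obtain N where "\<forall>k\<ge>N. W k u = 0" using W_bounded by blast
  then have "W (int i) u = 0" if "i \<ge> nat N" for i using that by auto
  then show ?thesis by (rule that)
qed

lemma W_swap: "W m (W k u) = W k (W m u) + of_int (m - k) *s W (m + k - 1) u
    + (if m + k = 2 then vir_cocycle m else 0) *s C u"
  using W_rel[of m k u] by (simp add: algebra_simps)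

lemma W_nonneg_rel: "W (int i) (W (int j) u) - W (int j) (W (int i) u)
    = (of_nat i - of_nat j) *s W (int i + int j - 1) u"
  using W_rel[of "int i" "int j" u] by simp

definition mode_lin :: "('e \<Rightarrow> int \<Rightarrow> 'e) \<Rightarrow> bool" where
  "mode_lin F \<longleftrightarrow> (\<forall>n. Vector_Spaces.linear (*s) (*s) (\<lambda>u. F u n))"

text \<open>The action of the modes on families \<open>F u n = u\<^sub>n v\<close> that is forced by the commutator formula.\<close>

definition lam :: "int \<Rightarrow> ('e \<Rightarrow> int \<Rightarrow> 'e) \<Rightarrow> 'e \<Rightarrow> int \<Rightarrow> 'e" where
  "lam k F u n = W k (F u n) - binsum (of_int k) (\<lambda>i. F (W (int i) u) (k + n - int i))"

lemma mode_lin_add: "mode_lin F \<Longrightarrow> F (x + y) n = F x n + F y n"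
  and mode_lin_scale: "mode_lin F \<Longrightarrow> F (a *s x) n = a *s F x n"
  and mode_lin_zero: "mode_lin F \<Longrightarrow> F 0 n = 0"
  and mode_lin_diff: "mode_lin F \<Longrightarrow> F (x - y) n = F x n - F y n"
proof -
  assume "mode_lin F"
  then have l: "Vector_Spaces.linear (*s) (*s) (\<lambda>u. F u n)" by (simp add: mode_lin_def)
  then interpret l: Vector_Spaces.linear "(*s)" "(*s)" "\<lambda>u. F u n" .
  show "F (x + y) n = F x n + F y n" "F (a *s x) n = a *s F x n" "F 0 n = 0" "F (x - y) n = F x n - F y n"
    by (rule l.add, rule l.scale, rule l.zero, rule l.diff)
qed

lemma truncated_mode: "mode_lin F \<Longrightarrow> truncated (\<lambda>i. F (W (int i) u) (f i))"
proof -
  assume F: "mode_lin F"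
  obtain I where "\<And>i. i \<ge> I \<Longrightarrow> W (int i) u = 0" using W_bounded_nat[of u] by blast
  then show ?thesis by (intro truncatedI[of I]) (simp add: mode_lin_zero[OF F])
qed

lemma mode_lin_lam:
  assumes "mode_lin F" shows "mode_lin (lam k F)"
  unfolding mode_lin_def Vector_Spaces.linear_iff lam_def
  using vector_space_axioms
  by (auto simp: W.add W.scale mode_lin_add[OF assms] mode_lin_scale[OF assms]
      binsum_add[OF truncated_mode[OF assms] truncated_mode[OF assms]] binsum_scale[OF truncated_mode[OF assms]] scale_right_diff_distrib algebra_simps)

lemma lam_add:
  assumes "mode_lin F" "mode_lin G"
  shows "lam k (\<lambda>u n. F u n + G u n) u n = lam k F u n + lam k G u n"
  unfolding lam_def by (simp add: W.add binsum_add[OF truncated_mode[OF assms(1)] truncated_mode[OF assms(2)]])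

lemma lam_scale:
  assumes "mode_lin F"
  shows "lam k (\<lambda>u n. a *s F u n) u n = a *s lam k F u n"
  unfolding lam_def by (simp add: W.scale binsum_scale[OF truncated_mode[OF assms]] scale_right_diff_distrib)

text \<open>Terms with one mode outside and one inside \<open>F\<close> are symmetric in
  \<open>k\<close> and \<open>l\<close> and cancel. Two outer modes give the bracket with its
  central term; two inner modes give \<open>binsum_vandermonde_diff\<close>, without a central term
  because \<open>vir_cocycle\<close> vanishes at 0, 1 and 2.\<close>

lemma lam_rel:
  assumes F: "mode_lin F"
  shows "lam k (lam l F) u n - lam l (lam k F) u n = of_int (k - l) *s lam (k + l - 1) F u n
      + (if k + l = 2 then vir_cocycle k else 0) *s C (F u n)"
proof -
  have lamlam: "lam k (lam l F) u n = W k (W l (F u n))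
      - binsum (of_int l) (\<lambda>j. W k (F (W (int j) u) (l + n - int j)))
      - binsum (of_int k) (\<lambda>i. W l (F (W (int i) u) (k + n - int i)))
      + binsum (of_int k) (\<lambda>i. binsum (of_int l) (\<lambda>j. F (W (int j) (W (int i) u)) (k + l + n - int i - int j)))"
    for k l
  proof -
    have idx: "l + (k + n - int i) - int j = k + l + n - int i - int j" for i j by simp
    have 1: "W k (binsum (of_int l) (\<lambda>j. F (W (int j) u) (l + n - int j)))
        = binsum (of_int l) (\<lambda>j. W k (F (W (int j) u) (l + n - int j)))"
      by (rule linear_binsum[OF lin_W]) (rule truncated_mode[OF F])
    have t1: "truncated (\<lambda>i. W l (F (W (int i) u) (k + n - int i)))"
      by (rule truncated_map[OF truncated_mode[OF F, of u "\<lambda>i. k + n - int i"]]) (simp add: W.zero)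
    obtain I where I: "\<And>i. i \<ge> I \<Longrightarrow> W (int i) u = 0" using W_bounded_nat[of u] by blast
    have t2: "truncated (\<lambda>i. binsum (of_int l) (\<lambda>j. F (W (int j) (W (int i) u)) (l + (k + n - int i) - int j)))"
      by (rule truncatedI[of I]) (simp add: I W.zero mode_lin_zero[OF F])
    have "lam k (lam l F) u n = W k (W l (F u n) - binsum (of_int l) (\<lambda>j. F (W (int j) u) (l + n - int j)))
        - binsum (of_int k) (\<lambda>i. W l (F (W (int i) u) (k + n - int i))
            - binsum (of_int l) (\<lambda>j. F (W (int j) (W (int i) u)) (l + (k + n - int i) - int j)))"
      by (simp only: lam_def)
    also have "\<dots> = W k (W l (F u n)) - binsum (of_int l) (\<lambda>j. W k (F (W (int j) u) (l + n - int j)))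
        - (binsum (of_int k) (\<lambda>i. W l (F (W (int i) u) (k + n - int i)))
        - binsum (of_int k) (\<lambda>i. binsum (of_int l) (\<lambda>j. F (W (int j) (W (int i) u)) (l + (k + n - int i) - int j))))"
      by (simp only: W.diff 1 binsum_diff[OF t1 t2])
    finally show ?thesis unfolding idx by (simp add: algebra_simps)
  qed
  obtain I where I: "\<And>i. i \<ge> I \<Longrightarrow> W (int i) u = 0" using W_bounded_nat[of u] by blast
  have "\<exists>N. \<forall>i q. q \<ge> N \<longrightarrow> W q (W (int i) u) = 0"
    by (rule uniform_bound[where S = I]) (use W_bounded I in \<open>auto simp: W.zero\<close>)
  then obtain J where J: "\<And>i q. q \<ge> J \<Longrightarrow> W q (W (int i) u) = 0" by blast
  define N where "N = max I (nat J)"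
  have N: "W (int j) (W (int i) u) = 0" if "i \<ge> N \<or> j \<ge> N" for i j
    using that I[of i] J[of "int j" i] by (auto simp: N_def W.zero)
  define dbl where "dbl a b = binsum (of_int k) (\<lambda>i. binsum (of_int l)
      (\<lambda>j. F (W (int (a i j)) (W (int (b i j)) u)) (k + l + n - int i - int j)))" for a b
  have sw: "binsum (of_int l) (\<lambda>i. binsum (of_int k) (\<lambda>j. F (W (int j) (W (int i) u)) (l + k + n - int i - int j)))
      = dbl (\<lambda>i j. i) (\<lambda>i j. j)"
  proof -
    have "binsum (of_int l) (\<lambda>i. binsum (of_int k) (\<lambda>j. F (W (int j) (W (int i) u)) (l + k + n - int i - int j)))
      = binsum (of_int k) (\<lambda>j. binsum (of_int l) (\<lambda>i. F (W (int j) (W (int i) u)) (l + k + n - int i - int j)))"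
      by (rule binsum_swap[of N]) (auto simp: N mode_lin_zero[OF F])
    moreover have "l + k + n - int i - int j = k + l + n - int j - int i" for i j by simp
    ultimately show ?thesis unfolding dbl_def by (simp only:)
  qed
  \<comment> \<open>Indexed by \<open>p = i + j\<close>, for the mode \<open>i + j - 1\<close>. The
    entry at \<open>p = 0\<close> belongs to the mode -1, but its weight \<open>i - j\<close> is
    zero.\<close>
  define g where "g p = F (W (int p - 1) u) (k + l + n - int p)" for p
  have tg: "truncated g"
  proof (rule truncatedI[of "Suc I"])
    fix i assume "i \<ge> Suc I"
    then show "g i = 0" using I[of "i - 1"] by (simp add: g_def mode_lin_zero[OF F] of_nat_diff)
  qed
  have t1: "truncated (\<lambda>j. F (W (int j) (W (int i) u)) (k + l + n - int i - int j))" for i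
    by (rule truncatedI[of N]) (simp add: N mode_lin_zero[OF F])
  have t2: "truncated (\<lambda>j. F (W (int i) (W (int j) u)) (k + l + n - int i - int j))" for i
    by (rule truncatedI[of N]) (simp add: N mode_lin_zero[OF F])
  have t3: "truncated (\<lambda>i. binsum (of_int l) (\<lambda>j. F (W (int j) (W (int i) u)) (k + l + n - int i - int j)))"
    by (rule truncatedI[of N]) (simp add: N mode_lin_zero[OF F])
  have t4: "truncated (\<lambda>i. binsum (of_int l) (\<lambda>j. F (W (int i) (W (int j) u)) (k + l + n - int i - int j)))"
    by (rule truncatedI[of N]) (simp add: N mode_lin_zero[OF F])
  have "dbl (\<lambda>i j. i) (\<lambda>i j. j) - dbl (\<lambda>i j. j) (\<lambda>i j. i)
      = binsum (of_int k) (\<lambda>i. binsum (of_int l) (\<lambda>j. F (W (int i) (W (int j) u) - W (int j) (W (int i) u))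
         (k + l + n - int i - int j)))"
    unfolding dbl_def by (simp add: binsum_diff[symmetric] t1 t2 t3 t4 mode_lin_diff[OF F])
  also have "\<dots> = binsum (of_int k) (\<lambda>i. binsum (of_int l) (\<lambda>j. (of_nat i - of_nat j) *s g (i + j)))"
    unfolding W_nonneg_rel mode_lin_scale[OF F] g_def by (simp add: algebra_simps)
  also have "\<dots> = of_int (k - l) *s binsum (of_int (k + l - 1)) (\<lambda>p. g (Suc p))"
    by (subst binsum_vandermonde_diff[OF tg]) simp
  also have "(\<lambda>p. g (Suc p)) = (\<lambda>p. F (W (int p) u) (k + l - 1 + n - int p))"
    by (simp add: g_def fun_eq_iff algebra_simps)
  finally have D: "dbl (\<lambda>i j. i) (\<lambda>i j. j) - dbl (\<lambda>i j. j) (\<lambda>i j. i)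
      = of_int (k - l) *s binsum (of_int (k + l - 1)) (\<lambda>p. F (W (int p) u) (k + l - 1 + n - int p))" .
  have "lam k (lam l F) u n - lam l (lam k F) u n = (W k (W l (F u n)) - W l (W k (F u n)))
      - (dbl (\<lambda>i j. i) (\<lambda>i j. j) - dbl (\<lambda>i j. j) (\<lambda>i j. i))"
    unfolding lamlam sw unfolding dbl_def by (simp add: algebra_simps)
  then show ?thesis
    unfolding D W_rel lam_def by (simp add: scale_right_diff_distrib)
qed

end


section \<open>Divided powers of the translation operator\<close>

context virasoro_module
begin

text \<open>\<open>D^j / j!\<close>, the coefficients of \<open>exp(x D)\<close> with
  \<open>D = W 0\<close>. The value 0 at negative \<open>j\<close> lets index shifts run past the
  end without case distinctions.\<close>

definition dpow :: "int \<Rightarrow> 'e \<Rightarrow> 'e" where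
  "dpow j u = (if j < 0 then 0 else (1 / fact (nat j)) *s (W 0 ^^ nat j) u)"

lemma dpow_neg [simp]: "j < 0 \<Longrightarrow> dpow j u = 0"
  and dpow_0 [simp]: "dpow 0 u = u"
  by (auto simp: dpow_def)

lemma dpow_D: "of_int (j + 1) *s dpow (j + 1) u = dpow j (W 0 u)"
proof (cases "j \<ge> 0")
  case True
  then obtain m where j: "j = int m" using nonneg_int_cases by blast
  have "nat (int m + 1) = Suc m" by simp
  moreover have "of_int (int m + 1) * (1 / fact (Suc m)) = (1 / fact m :: complex)"
  proof -
    have "of_int (int m + 1) = (of_nat (Suc m) :: complex)" by simp
    then show ?thesis by (simp only: fact_Suc of_nat_mult) (simp del: of_nat_Suc)
  qed
  ultimately show ?thesis
    by (simp only: j dpow_def scale_scale funpow_Suc_right o_def) simp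
next
  case False
  then have "j = -1 \<or> j + 1 < 0" by linarith
  then show ?thesis by auto
qed

lemma linear_dpow: "Vector_Spaces.linear (*s) (*s) (dpow j)"
proof -
  have "(W 0 ^^ m) (x + y) = (W 0 ^^ m) x + (W 0 ^^ m) y \<and> (W 0 ^^ m) (a *s x) = a *s (W 0 ^^ m) x" for m x y a
    by (induction m) (auto simp: W.add W.scale)
  then show ?thesis
    unfolding Vector_Spaces.linear_iff using vector_space_axioms
    by (auto simp: dpow_def scale_right_distrib mult.commute)
qed

sublocale dpow: Vector_Spaces.linear "(*s)" "(*s)" "dpow j" for j by (rule linear_dpow)

lemma dpow_D': "of_int (j + 1) *s dpow (j + 1) u = W 0 (dpow j u)"
proof -
  have "dpow j (W 0 u) = W 0 (dpow j u)"
    by (simp add: dpow_def W.zero W.scale funpow_swap1)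
  then show ?thesis using dpow_D by simp
qed

lemma dpow_induct_scale:
  assumes "of_int (int j + 1) *s x = of_int (int j + 1) *s y" shows "x = y"
proof -
  have "(of_int (int j + 1) :: complex) \<noteq> 0" unfolding of_int_eq_0_iff by simp
  then show ?thesis using assms scale_cancel_left by blast
qed

text \<open>If \<open>A\<^sub>m D = D A\<^sub>m + m A\<^sub>m\<^sub>-\<^sub>1\<close>, then \<open>A(x) e\<^sup>y\<^sup>D = e\<^sup>y\<^sup>D A(x - y)\<close>.\<close>

lemma mode_dpow_nat:
  assumes lin: "\<And>m. Vector_Spaces.linear (*s) (*s) (A m)"
    and AD: "\<And>m w. A m (W 0 w) = W 0 (A m w) + of_int m *s A (m - 1) w"
  shows "A m (dpow (int i) w) = binsum (of_int m) (\<lambda>r. dpow (int i - int r) (A (m - int r) w))"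
proof (induction i arbitrary: m w)
    case 0
    have "binsum (of_int m) (\<lambda>r. dpow (0 - int r) (A (m - int r) w)) = (\<Sum>r<1. (of_int m gchoose r) *s dpow (0 - int r) (A (m - int r) w))"
      by (rule binsum_eq) simp
    then show ?case by simp
  next
    case (Suc j)
    interpret A: Vector_Spaces.linear "(*s)" "(*s)" "A q" for q by (rule lin)
    let ?B = "\<lambda>r. dpow (int j + 1 - int r) (A (m - int r) w)"
    have tB: "truncated ?B" by (rule truncatedI[of "nat (int j + 2)"]) simp
    have t1: "truncated (\<lambda>r. dpow (int j - int r) (W 0 (A (m - int r) w)))"
      by (rule truncatedI[of "nat (int j + 2)"]) simp
    have t2: "truncated (\<lambda>r. of_int (m - int r) *s dpow (int j - int r) (A (m - 1 - int r) w))"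
      by (rule truncatedI[of "nat (int j + 2)"]) simp
    have t3: "truncated (\<lambda>r. (of_int (int j + 1) - of_nat r) *s ?B r)" by (rule truncatedI[of "nat (int j + 2)"]) simp
    have t4: "truncated (\<lambda>r. of_nat r *s ?B r)" by (rule truncatedI[of "nat (int j + 2)"]) simp
    have t5: "truncated (\<lambda>r. dpow (int j - int r) (A (m - 1 - int r) w))"
      by (rule truncatedI[of "nat (int j + 2)"]) simp
    \<comment> \<open>Both sides are compared after multiplication by \<open>j + 1\<close>, which
      trades \<open>dpow (j + 1)\<close> for \<open>dpow j\<close> after \<open>D\<close>; the two
      sums that arise carry the weights \<open>j + 1 - r\<close> and \<open>r\<close>.\<close>
    have "of_int (int j + 1) *s A m (dpow (int j + 1) w) = A m (dpow (int j) (W 0 w))"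
      by (simp only: dpow_D[symmetric] A.scale)
    also have "\<dots> = binsum (of_int m) (\<lambda>r. dpow (int j - int r) (A (m - int r) (W 0 w)))"
      by (rule Suc.IH)
    also have "\<dots> = binsum (of_int m) (\<lambda>r. dpow (int j - int r) (W 0 (A (m - int r) w))
         + (of_int m - of_nat r) *s dpow (int j - int r) (A (m - 1 - int r) w))"
      by (rule binsum_cong)
        (simp only: AD dpow.add dpow.scale of_int_diff of_int_of_nat_eq, simp add: algebra_simps)
    also have "\<dots> = binsum (of_int m) (\<lambda>r. dpow (int j - int r) (W 0 (A (m - int r) w)))
         + of_int m *s binsum (of_int m - 1) (\<lambda>r. dpow (int j - int r) (A (m - 1 - int r) w))"
      using binsum_add[OF t1, of "\<lambda>r. (of_int m - of_nat r) *s dpow (int j - int r) (A (m - 1 - int r) w)"] t2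
      by (simp add: binsum_coabsorb[OF t5])
    also have "(\<lambda>r. dpow (int j - int r) (W 0 (A (m - int r) w))) = (\<lambda>r. (of_int (int j + 1) - of_nat r) *s ?B r)"
      by (rule ext) (simp only: dpow_D[symmetric], simp add: algebra_simps)
    also have "(\<lambda>r. dpow (int j - int r) (A (m - 1 - int r) w)) = (\<lambda>r. ?B (Suc r))"
      by (rule ext) (simp add: algebra_simps)
    also have "of_int m *s binsum (of_int m - 1) (\<lambda>r. ?B (Suc r)) = binsum (of_int m) (\<lambda>r. of_nat r *s ?B r)"
      by (rule binsum_absorb[OF tB, symmetric])
    also have "binsum (of_int m) (\<lambda>r. (of_int (int j + 1) - of_nat r) *s ?B r) + binsum (of_int m) (\<lambda>r. of_nat r *s ?B r)
        = binsum (of_int m) (\<lambda>r. of_int (int j + 1) *s ?B r)"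
      by (subst binsum_add[OF t3 t4, symmetric]) (simp add: scale_left_distrib[symmetric])
    also have "\<dots> = of_int (int j + 1) *s binsum (of_int m) ?B"
      by (rule binsum_scale[OF tB])
    finally have "of_int (int j + 1) *s A m (dpow (int j + 1) w) = of_int (int j + 1) *s binsum (of_int m) ?B" .
    from dpow_induct_scale[OF this] show ?case by (simp add: add.commute)
  qed

lemma mode_dpow:
  assumes lin: "\<And>m. Vector_Spaces.linear (*s) (*s) (A m)"
    and AD: "\<And>m w. A m (W 0 w) = W 0 (A m w) + of_int m *s A (m - 1) w"
  shows "A m (dpow j w) = binsum (of_int m) (\<lambda>r. dpow (j - int r) (A (m - int r) w))"
proof (cases "j < 0")
  case True
  interpret A: Vector_Spaces.linear "(*s)" "(*s)" "A q" for q by (rule lin)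
  show ?thesis using True by (simp add: A.zero)
next
  case False
  then obtain i where "j = int i" using nonneg_int_cases[of j] by auto
  then show ?thesis using mode_dpow_nat[of A m i w, OF assms] by simp
qed

lemma W_D: "W m (W 0 w) = W 0 (W m w) + of_int m *s W (m - 1) w"
  using W_swap[of m 0 w] by simp

lemma W_dpow: "W m (dpow j w) = binsum (of_int m) (\<lambda>r. dpow (j - int r) (W (m - int r) w))"
  by (rule mode_dpow[OF lin_W W_D])

lemma dpow_vac: "dpow j vac = (if j = 0 then vac else 0)"
proof -
  have "(W 0 ^^ Suc n) vac = 0" for n
    by (simp only: funpow_Suc_right o_def) (simp add: W_vac, induction n, auto simp: W.zero)
  then show ?thesis by (cases "nat j") (auto simp: dpow_def)
qed

text \<open>\<open>W_dpow\<close> in reversed order, \<open>r = k - i\<close>, so that only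
  nonnegative modes of \<open>u\<close> appear. In this form it is the commutator formula on the
  vacuum, which \<open>W k\<close> kills.\<close>

lemma W_dpow_vac:
  assumes "k \<ge> 0"
  shows "W k (dpow j u) = binsum (of_int k) (\<lambda>i. dpow (j - k + int i) (W (int i) u))"
proof -
  define K where "K = nat k"
  have k: "of_int k = (of_nat K :: complex)" "k = int K" using assms by (auto simp: K_def)
  have "W k (dpow j u) = (\<Sum>i\<le>K. (of_nat K gchoose i) *s dpow (j - int i) (W (k - int i) u))"
    unfolding W_dpow k(1) binsum_of_nat_eq ..
  also have "\<dots> = (\<Sum>i\<le>K. (of_nat K gchoose (K - i)) *s dpow (j - int (K - i)) (W (k - int (K - i)) u))"
    by (rule sum.reindex_bij_witness[of _ "\<lambda>i. K - i" "\<lambda>i. K - i"]) auto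
  also have "\<dots> = (\<Sum>i\<le>K. (of_nat K gchoose i) *s dpow (j - k + int i) (W (int i) u))"
  proof (intro sum.cong refl)
    fix i assume "i \<in> {..K}"
    then have "i \<le> K" by simp
    then have "(of_nat K gchoose (K - i) :: complex) = (of_nat K gchoose i)" "j - int (K - i) = j - k + int i"
        "k - int (K - i) = int i"
      by (auto simp: binomial_gbinomial[symmetric] binomial_symmetric[symmetric] k of_nat_diff)
    then show "(of_nat K gchoose (K - i)) *s dpow (j - int (K - i)) (W (k - int (K - i)) u)
      = (of_nat K gchoose i) *s dpow (j - k + int i) (W (int i) u)" by (simp only:)
  qed
  also have "\<dots> = binsum (of_int k) (\<lambda>i. dpow (j - k + int i) (W (int i) u))"
    unfolding k(1) binsum_of_nat_eq ..
  finally show ?thesis .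
qed

lemma dpow_conformal: "dpow (int j) (W (- 1) vac) = W (- 1 - int j) vac"
proof (induction j)
  case (Suc j)
  have "W 0 (W (- 1 - int j) vac) = of_int (int j + 1) *s W (- 1 - int (Suc j)) vac"
    using W_rel[of 0 "- 1 - int j" vac] by (simp add: W_vac W.zero algebra_simps)
  then have "of_int (int j + 1) *s dpow (int j + 1) (W (- 1) vac) = of_int (int j + 1) *s W (- 1 - int (Suc j)) vac"
    unfolding dpow_D' Suc .
  from dpow_induct_scale[OF this] show ?case by (simp add: add.commute)
qed simp

end


text \<open>The fields are fixed only on the vacuum and along creation modes; truncation, the
  commutator with all modes, associativity and skew symmetry are derived. One development thus
  serves the vertex algebra and its deformation.\<close>

locale virasoro_fields = virasoro_module scale W C vac
  for scale :: "complex \<Rightarrow> 'e::ab_group_add \<Rightarrow> 'e" (infixr "*s" 75)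
    and W :: "int \<Rightarrow> 'e \<Rightarrow> 'e" and C :: "'e \<Rightarrow> 'e" and vac :: 'e +
  fixes Y :: "'e \<Rightarrow> int \<Rightarrow> 'e \<Rightarrow> 'e"
  assumes lin_Yr: "Vector_Spaces.linear (*s) (*s) (\<lambda>v. Y u n v)"
    and lin_Yl: "Vector_Spaces.linear (*s) (*s) (\<lambda>u. Y u n v)"
    and Y_C_right: "Y u n (C v) = C (Y u n v)"
    and Y_C_left: "Y (C u) n v = C (Y u n v)"
    and Y_vac_right: "Y u n vac = dpow (- n - 1) u"
    and Y_W: "Y u n (W (- 1 - int j) v) = lam (- 1 - int j) (\<lambda>u n. Y u n v) u n"
    and generated: "\<And>P v. P vac \<Longrightarrow> P 0 \<Longrightarrow> (\<And>a x y. P x \<Longrightarrow> P y \<Longrightarrow> P (a *s x + y))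
       \<Longrightarrow> (\<And>j x. P x \<Longrightarrow> P (W (- 1 - int j) x)) \<Longrightarrow> (\<And>x. P x \<Longrightarrow> P (C x)) \<Longrightarrow> P v"
begin

sublocale Yr: Vector_Spaces.linear "(*s)" "(*s)" "\<lambda>v. Y u n v" for u n by (rule lin_Yr)
sublocale Yl: Vector_Spaces.linear "(*s)" "(*s)" "\<lambda>u. Y u n v" for n v by (rule lin_Yl)

lemma generate [case_names vac 0 add step C]:
  "P vac \<Longrightarrow> P 0 \<Longrightarrow> (\<And>a x y. P x \<Longrightarrow> P y \<Longrightarrow> P (a *s x + y))
       \<Longrightarrow> (\<And>j x. P x \<Longrightarrow> P (W (- 1 - int j) x)) \<Longrightarrow> (\<And>x. P x \<Longrightarrow> P (C x)) \<Longrightarrow> P v"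
  by (rule generated)

lemma mode_lin_Y: "mode_lin (\<lambda>u n. Y u n v)"
  by (simp add: mode_lin_def lin_Yl)

lemma truncated_YW: "truncated (\<lambda>i. Y (W (int i) u) (f i) v)"
  by (rule truncated_mode[OF mode_lin_Y])

lemma Y_W_neg: "l < 0 \<Longrightarrow> Y u n (W l v) = lam l (\<lambda>u n. Y u n v) u n"
  using Y_W[of u n "nat (- 1 - l)" v] by simp

lemma C_lam: assumes "mode_lin F" shows "lam k (\<lambda>u n. C (F u n)) u n = C (lam k F u n)"
  unfolding lam_def by (simp add: W_C C.diff linear_binsum[OF lin_C truncated_mode[OF assms]])

text \<open>For \<open>k \<ge> 0\<close> by induction on words: when \<open>W k\<close> passes a
  creation mode, the family side changes in the same way by \<open>lam_rel\<close>.\<close>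

lemma Y_W_lam: "Y u n (W k v) = lam k (\<lambda>u n. Y u n v) u n"
proof (cases "k < 0")
  case False
  have "\<forall>k\<ge>0. \<forall>u n. Y u n (W k v) = lam k (\<lambda>u n. Y u n v) u n"
  proof (induction v rule: generate)
    case vac
    show ?case
    proof (intro allI impI)
      fix k u n assume k: "k \<ge> (0::int)"
      have "W k (dpow (- n - 1) u) = binsum (of_int k) (\<lambda>i. Y (W (int i) u) (k + n - int i) vac)"
        unfolding W_dpow_vac[OF k] by (rule binsum_cong) (simp add: Y_vac_right algebra_simps)
      then show "Y u n (W k vac) = lam k (\<lambda>u n. Y u n vac) u n"
        using k by (simp add: W_vac Yr.zero lam_def Y_vac_right[of u n])
    qed
  next
    case 0
    then show ?case by (simp add: W.zero Yr.zero lam_def)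
  next
    case (add a x y)
    have "lam k (\<lambda>u n. a *s Y u n x + Y u n y) u n = a *s lam k (\<lambda>u n. Y u n x) u n + lam k (\<lambda>u n. Y u n y) u n" for k u n
    proof -
      have "mode_lin (\<lambda>u n. a *s Y u n x)"
        using mode_lin_Y[of "a *s x"] by (simp add: Yr.scale)
      then show ?thesis by (simp add: lam_add[OF _ mode_lin_Y] lam_scale[OF mode_lin_Y])
    qed
    then show ?case using add by (simp add: W.add W.scale Yr.add Yr.scale)
  next
    case (C x)
    then show ?case by (simp add: W_C Y_C_right C_lam[OF mode_lin_Y])
  next
    case (step j x)
    define l where "l = - 1 - int j"
    have l: "l < 0" by (simp add: l_def)
    have F: "(\<lambda>u n. Y u n (W l x)) = lam l (\<lambda>u n. Y u n x)" by (intro ext) (rule Y_W_neg[OF l])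
    show ?case unfolding l_def[symmetric]
    proof (intro allI impI)
      fix k u n assume k: "k \<ge> (0::int)"
      have Fk: "(\<lambda>u n. Y u n (W k x)) = lam k (\<lambda>u n. Y u n x)" using step k by blast
      \<comment> \<open>The index \<open>k + l - 1\<close> may have either sign; both cases are
        available here.\<close>
      have Fkl: "Y u n (W (k + l - 1) x) = lam (k + l - 1) (\<lambda>u n. Y u n x) u n"
        using step Y_W_neg[of "k + l - 1"] by (cases "k + l - 1 < 0") auto
      have "Y u n (W k (W l x)) = Y u n (W l (W k x)) + of_int (k - l) *s Y u n (W (k + l - 1) x)
          + (if k + l = 2 then vir_cocycle k else 0) *s C (Y u n x)"
        unfolding W_swap[of k l x] Yr.add Yr.scale Y_C_right ..
      also have "\<dots> = lam k (lam l (\<lambda>u n. Y u n x)) u n"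
        unfolding Y_W_neg[OF l] Fk Fkl using lam_rel[OF mode_lin_Y, of k l x u n] by (simp add: algebra_simps)
      finally show "Y u n (W k (W l x)) = lam k (\<lambda>u n. Y u n (W l x)) u n" unfolding F .
    qed
  qed
  then show ?thesis using False by simp
qed (rule Y_W_neg)

lemma commutator: "W k (Y u n v) - Y u n (W k v) = binsum (of_int k) (\<lambda>i. Y (W (int i) u) (k + n - int i) v)"
  unfolding Y_W_lam lam_def by simp

lemma Y_W_eq: "Y u n (W k v) = W k (Y u n v) - binsum (of_int k) (\<lambda>i. Y (W (int i) u) (k + n - int i) v)"
  unfolding Y_W_lam lam_def ..

lemma W_Y_eq: "W k (Y u n v) = Y u n (W k v) + binsum (of_int k) (\<lambda>i. Y (W (int i) u) (k + n - int i) v)"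
  unfolding Y_W_lam lam_def by simp

lemma Y_bounded: "\<exists>N. \<forall>n\<ge>N. Y u n v = 0"
proof (induction v arbitrary: u rule: generate)
  case vac
  then show ?case by (intro exI[of _ 0]) (simp add: Y_vac_right)
next
  case 0
  then show ?case by (simp add: Yr.zero)
next
  case (add a x y)
  then obtain M N where "\<forall>n\<ge>M. Y u n x = 0" "\<forall>n\<ge>N. Y u n y = 0" by metis
  then show ?case by (intro exI[of _ "max M N"]) (simp add: Yr.add Yr.scale)
next
  case (C x)
  then show ?case by (metis Y_C_right C.zero)
next
  case (step j x)
  obtain I where I: "\<And>i. i \<ge> I \<Longrightarrow> W (int i) u = 0" using W_bounded_nat[of u] by blast
  obtain M where M: "\<forall>n\<ge>M. Y u n x = 0" using step by blast
  have "\<exists>N. \<forall>i q. q \<ge> N \<longrightarrow> Y (W (int i) u) q x = 0"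
    by (rule uniform_bound[where S = I]) (use step I in \<open>auto simp: Yl.zero\<close>)
  then obtain N where N: "\<And>i q. q \<ge> N \<Longrightarrow> Y (W (int i) u) q x = 0" by blast
  \<comment> \<open>For the relevant \<open>i < I\<close> the mode \<open>- 1 - j + n - i\<close> is
    then at least \<open>N\<close>.\<close>
  have "Y u n (W (- 1 - int j) x) = 0" if "n \<ge> max M (N + int I + int j + 1)" for n
  proof -
    have "binsum (of_int (- 1 - int j)) (\<lambda>i. Y (W (int i) u) (- 1 - int j + n - int i) x) = 0"
    proof -
      have "Y (W (int i) u) (- 1 - int j + n - int i) x = 0" for i
        using that I[of i] N[of "- 1 - int j + n - int i" i] by (cases "i \<ge> I") (auto simp: Yl.zero)
      then show ?thesis by simp
    qed
    then show ?thesis unfolding Y_W_eq using M that by (simp add: W.zero)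
  qed
  then show ?case by blast
qed

lemma truncated_Y: "truncated (\<lambda>i. Y u (n + int i) v)"
  by (rule truncated_int) (rule Y_bounded)

lemma Y_vac_left: "Y vac n v = (if n = - 1 then v else 0)"
proof (induction v arbitrary: n rule: generate)
  case vac
  then show ?case by (auto simp: Y_vac_right dpow_vac)
qed (auto simp: Y_W_eq W_vac Yl.zero Yr.zero Yr.add Yr.scale W.zero C.zero Y_C_right)

text \<open>Moving \<open>W i\<close> past \<open>D\<close> produces \<open>i W (i - 1)\<close>; by
  \<open>binsum_coabsorb\<close> and \<open>binsum_absorb\<close> the sums with weights
  \<open>l - i\<close> and \<open>i\<close> are equal and cancel.\<close>

lemma Y_D: "Y (W 0 u) n v = (- of_int n) *s Y u (n - 1) v"
proof (induction v arbitrary: u n rule: generate)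
  case vac
  have "dpow (- n - 1) (W 0 u) = (- of_int n) *s dpow (- n) u"
    using dpow_D[of "- n - 1" u] by simp
  then show ?case by (simp add: Y_vac_right)
next
  case (step j x)
  define l where "l = - 1 - int j"
  let ?g = "\<lambda>i. Y (W (int i) u) (l + n - 1 - int i) x"
  let ?h = "\<lambda>i. Y (W (int i - 1) u) (l + n - int i) x"
  have tg: "truncated ?g" by (rule truncated_YW)
  obtain I where I: "\<And>i. i \<ge> I \<Longrightarrow> W (int i) u = 0" using W_bounded_nat[of u] by blast
  have th: "truncated ?h"
    by (rule truncatedI[of "Suc I"]) (metis I Suc_le_D Suc_le_mono Yl.zero add_diff_cancel_left' of_nat_Suc)
  have hg: "?h (Suc i) = ?g i" for i by (simp add: algebra_simps)
  have ti: "truncated (\<lambda>i. of_nat i *s ?h i)"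
    using th by (rule truncated_map) simp
  have tl: "truncated (\<lambda>i. (of_int l - of_nat i) *s ?g i)" "truncated (\<lambda>i. of_int n *s ?g i)"
    using tg by (rule truncated_map, simp)+
  have 1: "Y (W (int i) (W 0 u)) (l + n - int i) x
      = - ((of_int l - of_nat i) *s ?g i + of_int n *s ?g i) + of_nat i *s ?h i" for i
  proof -
    have "Y (W (int i) (W 0 u)) (l + n - int i) x = Y (W 0 (W (int i) u)) (l + n - int i) x
        + of_nat i *s Y (W (int i - 1) u) (l + n - int i) x"
      by (simp add: W_D Yl.add Yl.scale)
    also have "Y (W 0 (W (int i) u)) (l + n - int i) x = - (of_int (l + n - int i) *s ?g i)"
      unfolding step by (simp add: algebra_simps)
    also have "of_int (l + n - int i) *s ?g i = (of_int l - of_nat i) *s ?g i + of_int n *s ?g i"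
      by (simp only: scale_left_distrib[symmetric]) (simp add: algebra_simps)
    finally show ?thesis .
  qed
  have "binsum (of_int l) (\<lambda>i. Y (W (int i) (W 0 u)) (l + n - int i) x)
      = - (binsum (of_int l) (\<lambda>i. (of_int l - of_nat i) *s ?g i) + binsum (of_int l) (\<lambda>i. of_int n *s ?g i))
        + binsum (of_int l) (\<lambda>i. of_nat i *s ?h i)"
    unfolding 1 by (simp only: binsum_add[OF tl, symmetric] binsum_uminus[OF truncated_add[OF tl], symmetric]
      binsum_add[OF truncated_uminus[OF truncated_add[OF tl]] ti, symmetric])
  also have "\<dots> = - (of_int n *s binsum (of_int l) ?g)"
    unfolding binsum_coabsorb[OF tg] binsum_absorb[OF th] binsum_scale[OF tg] hg by simp
  finally show ?case
    unfolding l_def[symmetric] Y_W_eq step W.scale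
    by (simp add: scale_right_diff_distrib algebra_simps)
next
  case (C x)
  then show ?case by (simp only: Y_C_right C.scale)
next
  case (add a x y)
  then show ?case by (simp only: Yr.add Yr.scale scale_right_distrib scale_left_commute)
qed (simp add: Yr.zero)

lemma D_Y: "Y u n (W 0 v) = W 0 (Y u n v) + of_int n *s Y u (n - 1) v"
  using W_Y_eq[of 0 u n v] by (simp add: binsum_at_0 Y_D)

lemma Y_dpow: "Y u m (dpow j w) = binsum (of_int m) (\<lambda>r. dpow (j - int r) (Y u (m - int r) w))"
  by (rule mode_dpow[OF lin_Yr D_Y])

text \<open>Both sides agree on the vacuum and have the same commutators with the creation modes, as
  the products \<open>W i \<omega>\<close> show.\<close>

lemma Y_conformal: "Y (W (- 1) vac) n v = W n v"
proof (induction v arbitrary: n rule: generate)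
  case vac
  show ?case
  proof (cases "n < 0")
    case True
    then show ?thesis using dpow_conformal[of "nat (- n - 1)"] by (simp add: Y_vac_right)
  qed (simp add: Y_vac_right W_vac)
next
  case (step j x)
  define k where "k = - 1 - int j"
  define \<omega> where "\<omega> = W (- 1) vac"
  have w1: "W 1 \<omega> = 2 *s \<omega>" and w2: "W 2 \<omega> = 0" and w3: "W 3 \<omega> = (1 / 2) *s C vac"
    using W_rel[of 1 "- 1" vac] W_rel[of 2 "- 1" vac] W_rel[of 3 "- 1" vac]
    by (simp_all add: \<omega>_def W_vac W.zero vir_cocycle_def)
  have w4: "W (int i) \<omega> = 0" if "i \<ge> 4" for i
    using that W_rel[of "int i" "- 1" vac] by (simp add: \<omega>_def W_vac W.zero)
  have "binsum (of_int k) (\<lambda>i. Y (W (int i) \<omega>) (k + n - int i) x)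
      = Y (W 0 \<omega>) (k + n) x + of_int k *s Y (2 *s \<omega>) (k + n - 1) x
       + (of_int k gchoose 3) *s Y ((1 / 2) *s C vac) (k + n - 3) x"
    by (subst binsum_eq[of "Suc (Suc (Suc (Suc 0)))"])
      (auto simp: w1 w2 w3 w4 Yl.zero Yl.scale numeral_3_eq_3)
  also have "(of_int k gchoose 3 :: complex) = 2 * vir_cocycle k"
    by (simp add: vir_cocycle_def eval_nat_numeral(3) numeral_2_eq_2 gbinomial_Suc field_simps)
  also have "(2 * vir_cocycle k) *s Y ((1 / 2) *s C vac) (k + n - 3) x
      = (if k + n = 2 then vir_cocycle k else 0) *s C x"
    by (simp add: Yl.scale Y_C_left Y_vac_left C.zero)
  also have "Y (W 0 \<omega>) (k + n) x + of_int k *s Y (2 *s \<omega>) (k + n - 1) x = of_int (k - n) *s W (k + n - 1) x"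
    using step[folded \<omega>_def]
    by (simp only: Y_D Yl.scale scale_scale scale_left_distrib[symmetric]) (simp add: algebra_simps)
  finally show ?case
    unfolding k_def[symmetric] \<omega>_def[symmetric] Y_W_eq using W_swap[of k n x] step[folded \<omega>_def]
    by simp
qed (auto simp: Yr.zero W.zero Yr.add W.add Yr.scale W.scale Y_C_right W_C)

end


lemma sgn_powi:
  "(- 1 :: complex) powi (a + b) = (- 1) powi a * (- 1) powi b"
  "(- 1 :: complex) powi (- a) = (- 1) powi a"
  "(- 1 :: complex) powi (int i) = (- 1) ^ i"
  "(- 1 :: complex) powi a * (- 1) powi a = 1"
  "(- 1 :: complex) powi a * ((- 1) powi a * z) = z"
proof -
  show "(- 1 :: complex) powi (a + b) = (- 1) powi a * (- 1) powi b" by (simp add: power_int_add)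
  show "(- 1 :: complex) powi (- a) = (- 1) powi a"
    by (simp add: power_int_minus power_int_inverse[symmetric])
  show *: "(- 1 :: complex) powi a * (- 1) powi a = 1"
    by (simp add: power_int_mult_distrib[symmetric])
  show "(- 1 :: complex) powi a * ((- 1) powi a * z) = z"
    by (simp only: mult.assoc[symmetric] *) simp
qed (simp add: power_int_of_nat)

text \<open>Negating the upper index makes it independent of \<open>i\<close>, up to signs, and
  leaves the ordinary Vandermonde convolution.\<close>

lemma gbinomial_alternating_vandermonde:
  fixes a b :: complex
  shows "(\<Sum>i\<le>p. (- 1) ^ i * (a gchoose i) * (a + b - of_nat i gchoose (p - i))) = (b gchoose p)"
proof -
  have eq: "(- 1) ^ i * (a gchoose i) * (a + b - of_nat i gchoose (p - i))
      = (- 1) ^ p * ((a gchoose i) * (of_nat p - a - b - 1 gchoose (p - i)))" if "i \<le> p" for i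
  proof -
    have "(a + b - of_nat i gchoose (p - i)) = (- 1) ^ (p - i) * (of_nat p - a - b - 1 gchoose (p - i))"
      using that by (subst gbinomial_negated_upper) (simp add: of_nat_diff algebra_simps)
    moreover have "(- 1) ^ i * (- 1) ^ (p - i) = ((- 1) ^ p :: complex)"
      using that by (simp add: power_add[symmetric])
    ultimately show ?thesis by (simp add: mult_ac)
  qed
  have "(\<Sum>i\<le>p. (- 1) ^ i * (a gchoose i) * (a + b - of_nat i gchoose (p - i)))
      = (- 1) ^ p * (\<Sum>i\<le>p. (a gchoose i) * (of_nat p - a - b - 1 gchoose (p - i)))"
    unfolding sum_distrib_left by (intro sum.cong refl eq) simp
  also have "\<dots> = (- 1) ^ p * (of_nat p - b - 1 gchoose p)"
    by (simp add: gbinomial_Vandermonde atMost_atLeast0 algebra_simps)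
  also have "\<dots> = (b gchoose p)"
    by (subst (2) gbinomial_negated_upper) (simp add: algebra_simps)
  finally show ?thesis .
qed

context complex_space
begin

text \<open>The power \<open>(1 - S)^a\<close> of the shift, as \<open>binsum\<close> is
  \<open>(1 + S)^a\<close>.\<close>

definition altsum :: "complex \<Rightarrow> (nat \<Rightarrow> 'v) \<Rightarrow> 'v" where
  "altsum a g = binsum a (\<lambda>i. (- 1) ^ i *s g i)"

lemma altsum_0 [simp]: "altsum a (\<lambda>i. 0) = 0"
  by (simp add: altsum_def)

lemma altsum_at_0: "altsum 0 g = g 0"
  by (simp add: altsum_def binsum_at_0)

lemma truncated_alt: "truncated g \<Longrightarrow> truncated (\<lambda>i. (- 1) ^ i *s g i)"
  by (rule truncated_map) auto

lemma altsum_add: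
  "truncated g \<Longrightarrow> truncated h \<Longrightarrow> altsum a (\<lambda>i. g i + h i) = altsum a g + altsum a h"
  unfolding altsum_def by (simp add: scale_right_distrib binsum_add truncated_alt)

lemma altsum_diff:
  "truncated g \<Longrightarrow> truncated h \<Longrightarrow> altsum a (\<lambda>i. g i - h i) = altsum a g - altsum a h"
  unfolding altsum_def by (simp add: scale_right_diff_distrib binsum_diff truncated_alt)

lemma altsum_scale: "truncated g \<Longrightarrow> altsum a (\<lambda>i. b *s g i) = b *s altsum a g"
proof -
  assume g: "truncated g"
  have "(\<lambda>i. (- 1) ^ i *s b *s g i) = (\<lambda>i. b *s (- 1) ^ i *s g i)" by (simp add: mult.commute)
  then show ?thesis unfolding altsum_def by (simp only: binsum_scale[OF truncated_alt[OF g]])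
qed

lemma linear_altsum:
  assumes "Vector_Spaces.linear (*s) (*s) f" "truncated g"
  shows "f (altsum a g) = altsum a (\<lambda>i. f (g i))"
proof -
  interpret l: Vector_Spaces.linear "(*s)" "(*s)" f by fact
  show ?thesis unfolding altsum_def
    by (simp add: linear_binsum[OF assms(1) truncated_alt[OF assms(2)]] l.scale)
qed

lemma altsum_pascal:
  assumes "truncated g"
  shows "altsum (a + 1) g = altsum a g - altsum a (\<lambda>i. g (Suc i))"
  unfolding altsum_def binsum_pascal[OF truncated_alt[OF assms]]
  using binsum_uminus[OF truncated_alt[OF truncated_shift[OF assms, of 1]], of a] by simp

lemma binsum_altsum_swap:
  assumes "\<And>i j. i \<ge> N \<or> j \<ge> N \<Longrightarrow> h i j = 0"
  shows "binsum a (\<lambda>i. altsum b (\<lambda>j. h i j)) = altsum b (\<lambda>j. binsum a (\<lambda>i. h i j))"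
proof -
  have t: "truncated (\<lambda>i. h i j)" for j by (rule truncatedI[of N]) (simp add: assms)
  show ?thesis unfolding altsum_def
    by (subst binsum_swap[of N]) (auto simp: assms binsum_scale[OF t])
qed

end

section \<open>Weak associativity\<close>

context virasoro_fields
begin

text \<open>This and the next two are the sums of the Borcherds identity, iterate = product -
  opposite. The numbers \<open>m\<close>, \<open>n\<close>, \<open>k\<close> are the exponents of
  \<open>x1\<close>, \<open>x0 = x1 - x2\<close> and \<open>x2\<close>.\<close>

definition iterate_term :: "int \<Rightarrow> int \<Rightarrow> int \<Rightarrow> 'e \<Rightarrow> 'e \<Rightarrow> 'e \<Rightarrow> 'e" where
  "iterate_term m n k u1 u2 v = binsum (of_int m) (\<lambda>i. Y (Y u1 (n + int i) u2) (m + k - int i) v)"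

definition product_term :: "int \<Rightarrow> int \<Rightarrow> int \<Rightarrow> 'e \<Rightarrow> 'e \<Rightarrow> 'e \<Rightarrow> 'e" where
  "product_term m n k u1 u2 v = altsum (of_int n) (\<lambda>i. Y u1 (m + n - int i) (Y u2 (k + int i) v))"

definition opposite_term :: "int \<Rightarrow> int \<Rightarrow> int \<Rightarrow> 'e \<Rightarrow> 'e \<Rightarrow> 'e \<Rightarrow> 'e" where
  "opposite_term m n k u1 u2 v
     = (- 1) powi n *s altsum (of_int n) (\<lambda>i. Y u2 (n + k - int i) (Y u1 (m + int i) v))"

lemma tr_iterate: "truncated (\<lambda>i. Y (Y u1 (n + int i) u2) (f i) v)"
  by (rule truncated_map[OF truncated_Y[of u1 n u2]]) (simp add: Yl.zero)

lemma tr_product: "truncated (\<lambda>i. Y u1 (f i) (Y u2 (k + int i) v))"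
  by (rule truncated_map[OF truncated_Y[of u2 k v]]) (simp add: Yr.zero)

lemma W_nat_bounded_uniform:
  shows "\<exists>N. \<forall>i q. q \<ge> N \<longrightarrow> Y (W (int i) u) q v = 0"
    and "\<exists>N. \<forall>i q. q \<ge> N \<longrightarrow> Y u q (W (int i) v) = 0"
proof -
  obtain I where I: "\<And>i. i \<ge> I \<Longrightarrow> W (int i) u = 0" using W_bounded_nat[of u] by blast
  show "\<exists>N. \<forall>i q. q \<ge> N \<longrightarrow> Y (W (int i) u) q v = 0"
    by (rule uniform_bound[where S = I]) (use Y_bounded I in \<open>auto simp: Yl.zero\<close>)
  obtain J where J: "\<And>i. i \<ge> J \<Longrightarrow> W (int i) v = 0" using W_bounded_nat[of v] by blast
  show "\<exists>N. \<forall>i q. q \<ge> N \<longrightarrow> Y u q (W (int i) v) = 0"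
    by (rule uniform_bound[where S = J]) (use Y_bounded J in \<open>auto simp: Yr.zero\<close>)
qed

text \<open>Passing \<open>W l\<close> multiplies by \<open>x1^(l - s)\<close> while
  \<open>W s\<close> acts on \<open>u1\<close>, and by \<open>x2^(l - r)\<close> while
  \<open>W r\<close> acts on \<open>u2\<close>. In the iterate \<open>x1\<close> stands for
  \<open>x2 + x0\<close>, so the first factor has to be recovered from its expansion and merged with
  \<open>x1^m\<close>.\<close>

lemma iterate_term_W:
  "iterate_term m n k u1 u2 (W l v) = W l (iterate_term m n k u1 u2 v)
     - binsum (of_int l) (\<lambda>s. iterate_term (m + l - int s) n k (W (int s) u1) u2 v)
     - binsum (of_int l) (\<lambda>r. iterate_term m n (k + l - int r) u1 (W (int r) u2) v)"
proof -
  obtain I1 where I1: "\<And>i. i \<ge> I1 \<Longrightarrow> W (int i) u1 = 0" using W_bounded_nat[of u1] by blast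
  obtain I2 where I2: "\<And>i. i \<ge> I2 \<Longrightarrow> W (int i) u2 = 0" using W_bounded_nat[of u2] by blast
  obtain N1 where N1: "\<And>i q. q \<ge> N1 \<Longrightarrow> Y (W (int i) u1) q u2 = 0"
    using W_nat_bounded_uniform(1)[of u1 u2] by blast
  obtain N2 where N2: "\<And>i q. q \<ge> N2 \<Longrightarrow> Y u1 q (W (int i) u2) = 0"
    using W_nat_bounded_uniform(2)[of u1 u2] by blast
  obtain N0 where N0: "\<And>q. q \<ge> N0 \<Longrightarrow> Y u1 q u2 = 0" using Y_bounded[of u1 u2] by blast
  \<comment> \<open>Past \<open>N\<close> the double families below vanish, so the finite sums may
    be interchanged.\<close>
  define N where "N = nat (max (max N1 N2) N0) + nat \<bar>n\<bar> + I1 + I2 + I1"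
  have z0: "Y u1 (n + int i) u2 = 0" if "i \<ge> N" for i
    using that by (intro N0) (auto simp: N_def)
  have z2: "Y u1 (n + int i) (W (int r) u2) = 0" if "i \<ge> N \<or> r \<ge> N" for i r
  proof (cases "r \<ge> I2")
    case False
    then show ?thesis using that by (intro N2) (auto simp: N_def)
  qed (simp add: I2 Yr.zero)
  have z1: "Y (W (int s) u1) (n + int i + int r - int s) u2 = 0" if "i \<ge> N \<or> r \<ge> N" for i r s
  proof (cases "s \<ge> I1")
    case False
    then show ?thesis using that by (intro N1) (auto simp: N_def)
  qed (simp add: I1 Yl.zero)
  have z1': "Y (W (int s) u1) (n + int i) u2 = 0" if "i \<ge> N \<or> s \<ge> N" for i s
  proof (cases "s \<ge> I1")
    case False
    then show ?thesis using that by (intro N1) (auto simp: N_def)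
  qed (simp add: I1 Yl.zero)
  let ?A = "\<lambda>i r. Y (Y u1 (n + int i) (W (int r) u2)) (l + m + k - int i - int r) v"
  let ?B = "\<lambda>i r s. Y (Y (W (int s) u1) (n + int i + int r - int s) u2) (l + m + k - int i - int r) v"
  have inner: "binsum (of_int l) (\<lambda>r. Y (W (int r) (Y u1 (n + int i) u2)) (l + (m + k - int i) - int r) v)
      = binsum (of_int l) (?A i) + binsum (of_int l) (\<lambda>r. binsum (of_nat r) (?B i r))" for i
  proof -
    have "Y (W (int r) (Y u1 (n + int i) u2)) (l + (m + k - int i) - int r) v
        = ?A i r + binsum (of_nat r) (?B i r)" for r
    proof -
      define q where "q = l + (m + k - int i) - int r"
      have "Y (W (int r) (Y u1 (n + int i) u2)) q v = Y (Y u1 (n + int i) (W (int r) u2)) q v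
          + Y (binsum (of_int (int r)) (\<lambda>s. Y (W (int s) u1) (int r + (n + int i) - int s) u2)) q v"
        by (simp only: W_Y_eq Yl.add)
      also have "Y (binsum (of_int (int r)) (\<lambda>s. Y (W (int s) u1) (int r + (n + int i) - int s) u2)) q v
        = binsum (of_int (int r)) (\<lambda>s. Y (Y (W (int s) u1) (int r + (n + int i) - int s) u2) q v)"
        by (rule linear_binsum[OF lin_Yl]) (rule truncated_YW)
      finally show ?thesis unfolding q_def by (simp add: algebra_simps)
    qed
    moreover have "truncated (?A i)" by (rule truncatedI[of N]) (simp add: z2 Yl.zero)
    moreover have "truncated (\<lambda>r. binsum (of_nat r) (?B i r))" by (rule truncatedI[of N]) (simp add: z1 Yl.zero)
    ultimately show ?thesis by (simp add: binsum_add)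
  qed
  \<comment> \<open>With \<open>r = s + t\<close> the factors \<open>x2^(l - r) x0^(r - s)\<close>,
    summed over \<open>t\<close>, form the expansion of \<open>(x2 + x0)^(l - s)\<close>.\<close>
  have tri: "binsum (of_int l) (\<lambda>r. binsum (of_nat r) (?B i r))
      = binsum (of_int l) (\<lambda>s. binsum (of_int (l - int s)) (\<lambda>t.
          Y (Y (W (int s) u1) (n + int (i + t)) u2) (l - int s + m + k - int (i + t)) v))" for i
  proof -
    have "binsum (of_int l) (\<lambda>r. binsum (of_nat r) (?B i r))
      = binsum (of_int l) (\<lambda>s. binsum (of_int l - of_nat s) (\<lambda>t. ?B i (s + t) s))"
      by (rule binsum_trinomial[of N]) (simp add: z1 Yl.zero)
    then show ?thesis by (simp add: algebra_simps)
  qed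
  have tA: "truncated (\<lambda>i. binsum (of_int l) (?A i))" by (rule truncatedI[of N]) (simp add: z2 Yl.zero)
  have tB: "truncated (\<lambda>i. binsum (of_int l) (\<lambda>r. binsum (of_nat r) (?B i r)))"
    by (rule truncatedI[of N]) (simp add: z1 Yl.zero)
  have t0: "truncated (\<lambda>i. W l (Y (Y u1 (n + int i) u2) (m + k - int i) v))"
    by (rule truncatedI[of N]) (simp add: z0 Yl.zero W.zero)
  have "iterate_term m n k u1 u2 (W l v)
      = binsum (of_int m) (\<lambda>i. W l (Y (Y u1 (n + int i) u2) (m + k - int i) v)
          - (binsum (of_int l) (?A i) + binsum (of_int l) (\<lambda>r. binsum (of_nat r) (?B i r))))"
    unfolding iterate_term_def Y_W_eq inner ..
  also have "\<dots> = binsum (of_int m) (\<lambda>i. W l (Y (Y u1 (n + int i) u2) (m + k - int i) v))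
       - binsum (of_int m) (\<lambda>i. binsum (of_int l) (?A i))
       - binsum (of_int m) (\<lambda>i. binsum (of_int l) (\<lambda>r. binsum (of_nat r) (?B i r)))"
    by (simp add: binsum_diff[OF t0 truncated_add[OF tA tB]] binsum_add[OF tA tB])
  also have "binsum (of_int m) (\<lambda>i. W l (Y (Y u1 (n + int i) u2) (m + k - int i) v)) = W l (iterate_term m n k u1 u2 v)"
    unfolding iterate_term_def by (rule linear_binsum[OF lin_W, symmetric]) (rule tr_iterate)
  also have "binsum (of_int m) (\<lambda>i. binsum (of_int l) (?A i))
      = binsum (of_int l) (\<lambda>r. iterate_term m n (k + l - int r) u1 (W (int r) u2) v)"
    unfolding iterate_term_def by (subst binsum_swap[of N]) (auto simp: z2 Yl.zero algebra_simps)
  also have "binsum (of_int m) (\<lambda>i. binsum (of_int l) (\<lambda>r. binsum (of_nat r) (?B i r)))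
      = binsum (of_int l) (\<lambda>s. binsum (of_int m) (\<lambda>i. binsum (of_int (l - int s)) (\<lambda>t.
          Y (Y (W (int s) u1) (n + int (i + t)) u2) (l - int s + m + k - int (i + t)) v)))"
    unfolding tri
  proof (rule binsum_swap[of N])
    fix i s assume "i \<ge> N \<or> s \<ge> N"
    then have "Y (W (int s) u1) (n + int (i + t)) u2 = 0" for t by (intro z1') auto
    then show "binsum (of_int (l - int s)) (\<lambda>t.
          Y (Y (W (int s) u1) (n + int (i + t)) u2) (l - int s + m + k - int (i + t)) v) = 0"
      by (simp add: Yl.zero)
  qed
  also have "\<dots> = binsum (of_int l) (\<lambda>s. iterate_term (m + l - int s) n k (W (int s) u1) u2 v)"
  proof (rule binsum_cong)
    fix s
    have e: "l - int s + m + k = m + l - int s + k" by simp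
    \<comment> \<open>The powers \<open>m\<close> and \<open>l - s\<close> of the same
      \<open>x2 + x0\<close> combine.\<close>
    have "binsum (of_int m) (\<lambda>i. binsum (of_int (l - int s)) (\<lambda>t.
          Y (Y (W (int s) u1) (n + int (i + t)) u2) (l - int s + m + k - int (i + t)) v))
       = binsum (of_int m + of_int (l - int s)) (\<lambda>p. Y (Y (W (int s) u1) (n + int p) u2) (l - int s + m + k - int p) v)"
      by (rule binsum_vandermonde) (rule tr_iterate)
    also have "of_int m + of_int (l - int s) = (of_int (m + l - int s) :: complex)" by simp
    finally show "binsum (of_int m) (\<lambda>i. binsum (of_int (l - int s)) (\<lambda>t.
          Y (Y (W (int s) u1) (n + int (i + t)) u2) (l - int s + m + k - int (i + t)) v))
       = iterate_term (m + l - int s) n k (W (int s) u1) u2 v"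
      unfolding iterate_term_def e .
  qed
  finally show ?thesis by (simp add: algebra_simps)
qed

text \<open>\<open>W l\<close> passes \<open>u1\<close> and \<open>u2\<close> in turn, with the
  shifts visible at once. The induction for weak associativity rests on the agreement in shape with
  \<open>iterate_term_W\<close>.\<close>

lemma product_term_W:
  "product_term m n k u1 u2 (W l v) = W l (product_term m n k u1 u2 v)
     - binsum (of_int l) (\<lambda>s. product_term (m + l - int s) n k (W (int s) u1) u2 v)
     - binsum (of_int l) (\<lambda>r. product_term m n (k + l - int r) u1 (W (int r) u2) v)"
proof -
  obtain I1 where I1: "\<And>i. i \<ge> I1 \<Longrightarrow> W (int i) u1 = 0" using W_bounded_nat[of u1] by blast
  obtain I2 where I2: "\<And>i. i \<ge> I2 \<Longrightarrow> W (int i) u2 = 0" using W_bounded_nat[of u2] by blast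
  obtain N2 where N2: "\<And>i q. q \<ge> N2 \<Longrightarrow> Y (W (int i) u2) q v = 0"
    using W_nat_bounded_uniform(1)[of u2 v] by blast
  obtain N0 where N0: "\<And>q. q \<ge> N0 \<Longrightarrow> Y u2 q v = 0" using Y_bounded[of u2 v] by blast
  define N where "N = nat (max N2 N0) + nat \<bar>l + k\<bar> + nat \<bar>k\<bar> + I1 + I2"
  have z0: "Y u2 (k + int i) v = 0" if "i \<ge> N" for i
    using that by (intro N0) (auto simp: N_def)
  have z2: "Y (W (int r) u2) (l + k + int i - int r) v = 0" if "i \<ge> N \<or> r \<ge> N" for i r
  proof (cases "r \<ge> I2")
    case False
    then show ?thesis using that by (intro N2) (auto simp: N_def)
  qed (simp add: I2 Yl.zero)
  let ?A = "\<lambda>i r. Y u1 (m + n - int i) (Y (W (int r) u2) (l + k + int i - int r) v)"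
  let ?B = "\<lambda>i s. Y (W (int s) u1) (l + m + n - int i - int s) (Y u2 (k + int i) v)"
  have zA: "?A i r = 0" if "i \<ge> N \<or> r \<ge> N" for i r by (simp add: z2[OF that] Yr.zero)
  have zB: "?B i s = 0" if "i \<ge> N \<or> s \<ge> N" for i s
    using that z0[of i] I1[of s] by (auto simp: N_def Yl.zero Yr.zero)
  have inner: "Y u1 (m + n - int i) (Y u2 (k + int i) (W l v))
      = W l (Y u1 (m + n - int i) (Y u2 (k + int i) v)) - binsum (of_int l) (?B i) - binsum (of_int l) (?A i)" for i
  proof -
    have "Y u1 (m + n - int i) (binsum (of_int l) (\<lambda>r. Y (W (int r) u2) (l + (k + int i) - int r) v))
        = binsum (of_int l) (?A i)"
      by (subst linear_binsum[OF lin_Yr]) (rule truncated_YW, simp add: algebra_simps)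
    then show ?thesis by (simp add: Y_W_eq Yr.diff algebra_simps)
  qed
  have tA: "truncated (\<lambda>i. binsum (of_int l) (?A i))" by (rule truncatedI[of N]) (simp add: zA)
  have tB: "truncated (\<lambda>i. binsum (of_int l) (?B i))" by (rule truncatedI[of N]) (simp add: zB)
  have t0: "truncated (\<lambda>i. W l (Y u1 (m + n - int i) (Y u2 (k + int i) v)))"
    by (rule truncatedI[of N]) (simp add: z0 Yr.zero W.zero)
  have "product_term m n k u1 u2 (W l v)
      = altsum (of_int n) (\<lambda>i. W l (Y u1 (m + n - int i) (Y u2 (k + int i) v)))
        - altsum (of_int n) (\<lambda>i. binsum (of_int l) (?B i)) - altsum (of_int n) (\<lambda>i. binsum (of_int l) (?A i))"
    unfolding product_term_def inner by (simp only: altsum_diff[OF truncated_diff[OF t0 tB] tA] altsum_diff[OF t0 tB])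
  also have "altsum (of_int n) (\<lambda>i. W l (Y u1 (m + n - int i) (Y u2 (k + int i) v))) = W l (product_term m n k u1 u2 v)"
    unfolding product_term_def by (rule linear_altsum[OF lin_W, symmetric]) (rule tr_product)
  also have "altsum (of_int n) (\<lambda>i. binsum (of_int l) (?A i)) = binsum (of_int l) (\<lambda>r. altsum (of_int n) (\<lambda>i. ?A i r))"
    by (rule binsum_altsum_swap[of N, symmetric]) (use zA in auto)
  also have "\<dots> = binsum (of_int l) (\<lambda>r. product_term m n (k + l - int r) u1 (W (int r) u2) v)"
    unfolding product_term_def by (simp add: algebra_simps)
  also have "altsum (of_int n) (\<lambda>i. binsum (of_int l) (?B i)) = binsum (of_int l) (\<lambda>s. altsum (of_int n) (\<lambda>i. ?B i s))"
    by (rule binsum_altsum_swap[of N, symmetric]) (use zB in auto)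
  also have "\<dots> = binsum (of_int l) (\<lambda>s. product_term (m + l - int s) n k (W (int s) u1) u2 v)"
    unfolding product_term_def by (simp add: algebra_simps)
  finally show ?thesis .
qed

text \<open>Modes of \<open>u2\<close> on the vacuum are divided powers of \<open>D\<close> applied
  to \<open>u2\<close>. After \<open>u1\<close> has passed these by \<open>Y_dpow\<close>, the
  coefficients collapse by \<open>gbinomial_alternating_vandermonde\<close>, and reversing the sum
  gives the iterate.\<close>

lemma weak_associativity_vac:
  "iterate_term (int m) n k u1 u2 vac = product_term (int m) n k u1 u2 vac"
proof -
  let ?K = "- k - 1"
  let ?g = "\<lambda>p. dpow (?K - int p) (Y u1 (int m + n - int p) u2)"
  define N where "N = nat (?K + 1)"
  have z: "dpow (?K - int p) x = 0" if "p \<ge> N" for p x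
    using that by (intro dpow_neg) (auto simp: N_def)
  have inner: "Y u1 (int m + n - int i) (Y u2 (k + int i) vac)
      = (\<Sum>r<N - i. (of_int (int m + n - int i) gchoose r) *s ?g (i + r))" for i
  proof -
    have "- (k + int i) - 1 - int r = ?K - int (i + r)" "int m + n - int i - int r = int m + n - int (i + r)" for r
      by simp_all
    then have "Y u1 (int m + n - int i) (Y u2 (k + int i) vac) = binsum (of_int (int m + n - int i)) (\<lambda>r. ?g (i + r))"
      unfolding Y_vac_right Y_dpow by (simp only:)
    also have "\<dots> = (\<Sum>r<N - i. (of_int (int m + n - int i) gchoose r) *s ?g (i + r))"
      by (rule binsum_eq) (rule z, simp)
    finally show ?thesis .
  qed
  have "product_term (int m) n k u1 u2 vac
      = (\<Sum>i<N. (of_int n gchoose i) *s (- 1) ^ i *s Y u1 (int m + n - int i) (Y u2 (k + int i) vac))"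
    unfolding product_term_def altsum_def by (rule binsum_eq) (auto simp: inner)
  also have "\<dots> = (\<Sum>i<N. \<Sum>r<N - i. ((- 1) ^ i * (of_int n gchoose i) * (of_int (int m + n - int i) gchoose r)) *s ?g (i + r))"
    unfolding inner by (simp only: scale_sum_right scale_scale mult_ac)
  also have "\<dots> = (\<Sum>(i,r)\<in>(SIGMA i:{..<N}. {..<N - i}). ((- 1) ^ i * (of_int n gchoose i) * (of_int (int m + n - int i) gchoose r)) *s ?g (i + r))"
    by (rule sum.Sigma) auto
  also have "(SIGMA i:{..<N}. {..<N - i}) = {(i, r). i + r < N}" by auto
  also have "(\<Sum>(i,r)\<in>{(i, r). i + r < N}. ((- 1) ^ i * (of_int n gchoose i) * (of_int (int m + n - int i) gchoose r)) *s ?g (i + r))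
     = (\<Sum>p<N. \<Sum>i\<le>p. ((- 1) ^ i * (of_int n gchoose i) * (of_int (int m + n - int i) gchoose (p - i))) *s ?g (i + (p - i)))"
    by (rule sum.triangle_reindex)
  also have "\<dots> = (\<Sum>p<N. (of_nat m gchoose p) *s ?g p)"
  proof (intro sum.cong refl)
    fix p
    have "(\<Sum>i\<le>p. ((- 1) ^ i * (of_int n gchoose i) * (of_int (int m + n - int i) gchoose (p - i))) *s ?g (i + (p - i)))
      = (\<Sum>i\<le>p. (- 1) ^ i * (of_int n gchoose i) * (of_int n + of_nat m - of_nat i gchoose (p - i))) *s ?g p"
      by (simp add: scale_sum_left add.commute)
    then show "(\<Sum>i\<le>p. ((- 1) ^ i * (of_int n gchoose i) * (of_int (int m + n - int i) gchoose (p - i))) *s ?g (i + (p - i)))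
      = (of_nat m gchoose p) *s ?g p"
      by (simp only: gbinomial_alternating_vandermonde)
  qed
  also have "\<dots> = binsum (of_nat m) ?g"
    by (rule binsum_eq[symmetric]) (simp add: z)
  also have "\<dots> = (\<Sum>p\<le>m. (of_nat m gchoose p) *s ?g p)"
    by (rule binsum_of_nat_eq)
  also have "\<dots> = (\<Sum>i\<le>m. (of_nat m gchoose (m - i)) *s ?g (m - i))"
    by (rule sum.reindex_bij_witness[of _ "\<lambda>i. m - i" "\<lambda>i. m - i"]) auto
  also have "\<dots> = (\<Sum>i\<le>m. (of_nat m gchoose i) *s Y (Y u1 (n + int i) u2) (int m + k - int i) vac)"
  proof (intro sum.cong refl)
    fix i assume "i \<in> {..m}"
    then have "i \<le> m" by simp
    then have "(of_nat m gchoose (m - i) :: complex) = (of_nat m gchoose i)"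
      "?K - int (m - i) = - (int m + k - int i) - 1" "int m + n - int (m - i) = n + int i"
      by (auto simp: binomial_gbinomial[symmetric] binomial_symmetric[symmetric] of_nat_diff)
    then show "(of_nat m gchoose (m - i)) *s ?g (m - i)
        = (of_nat m gchoose i) *s Y (Y u1 (n + int i) u2) (int m + k - int i) vac"
      by (simp only: Y_vac_right)
  qed
  also have "\<dots> = iterate_term (int m) n k u1 u2 vac"
    unfolding iterate_term_def by (simp add: binsum_of_nat_eq)
  finally show ?thesis ..
qed

text \<open>Both sides obey the same recursion in \<open>W l\<close>. The bound on the exponent has
  to cover all \<open>W s u1\<close> and \<open>W r u2\<close> that occur, of which finitely many
  are nonzero.\<close>

theorem weak_associativity:
  "\<exists>a. \<forall>m\<ge>int a. \<forall>n k. iterate_term m n k u1 u2 v = product_term m n k u1 u2 v"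
proof (induction v arbitrary: u1 u2 rule: generate)
  case vac
  show ?case
    by (intro exI[of _ 0]) (metis weak_associativity_vac nonneg_int_cases of_nat_0)
next
  case 0
  show ?case by (simp add: iterate_term_def product_term_def Yr.zero)
next
  case (add a x y)
  obtain M N where "\<forall>m\<ge>int M. \<forall>n k. iterate_term m n k u1 u2 x = product_term m n k u1 u2 x"
    "\<forall>m\<ge>int N. \<forall>n k. iterate_term m n k u1 u2 y = product_term m n k u1 u2 y"
    using add[of u1 u2] by blast
  moreover have "iterate_term m n k u1 u2 (a *s x + y) = a *s iterate_term m n k u1 u2 x + iterate_term m n k u1 u2 y" for m n k
    unfolding iterate_term_def Yr.add Yr.scale
    by (subst binsum_add) (auto intro: truncated_map[OF tr_iterate] tr_iterate simp: binsum_scale[OF tr_iterate])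
  moreover have "product_term m n k u1 u2 (a *s x + y) = a *s product_term m n k u1 u2 x + product_term m n k u1 u2 y" for m n k
    unfolding product_term_def Yr.add Yr.scale
    by (subst altsum_add) (auto intro: truncated_map[OF tr_product] tr_product simp: altsum_scale[OF tr_product])
  ultimately show ?case by (intro exI[of _ "max M N"]) simp
next
  case (C x)
  have "iterate_term m n k u1 u2 (C x) = C (iterate_term m n k u1 u2 x)" for m n k
    unfolding iterate_term_def Y_C_right by (rule linear_binsum[OF lin_C, symmetric]) (rule tr_iterate)
  moreover have "product_term m n k u1 u2 (C x) = C (product_term m n k u1 u2 x)" for m n k
    unfolding product_term_def Y_C_right by (rule linear_altsum[OF lin_C, symmetric]) (rule tr_product)
  ultimately show ?case using C[of u1 u2] by metis
next
  case (step j x)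
  define l where "l = - 1 - int j"
  obtain I1 where I1: "\<And>i. i \<ge> I1 \<Longrightarrow> W (int i) u1 = 0" using W_bounded_nat[of u1] by blast
  obtain I2 where I2: "\<And>i. i \<ge> I2 \<Longrightarrow> W (int i) u2 = 0" using W_bounded_nat[of u2] by blast
  from step obtain A where A: "\<And>u1 u2 m n k. m \<ge> int (A u1 u2) \<Longrightarrow> iterate_term m n k u1 u2 x = product_term m n k u1 u2 x"
    by metis
  define M1 where "M1 = Max (insert 0 ((\<lambda>s. A (W (int s) u1) u2) ` {..<I1}))"
  define M2 where "M2 = Max (insert 0 ((\<lambda>r. A u1 (W (int r) u2)) ` {..<I2}))"
  \<comment> \<open>The recursion lowers \<open>m\<close> by \<open>s + 1 + j\<close> with
    \<open>s < I1\<close>; the other summands dominate the bounds for the vectors involved.\<close>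
  define a where "a = A u1 u2 + M1 + Suc j + I1 + M2"
  have "iterate_term m n k u1 u2 (W l x) = product_term m n k u1 u2 (W l x)" if m: "m \<ge> int a" for m n k
  proof -
    have 0: "iterate_term m n k u1 u2 x = product_term m n k u1 u2 x"
      by (rule A) (use m in \<open>simp add: a_def\<close>)
    have 1: "iterate_term (m + l - int s) n k (W (int s) u1) u2 x = product_term (m + l - int s) n k (W (int s) u1) u2 x" for s
    proof (cases "s < I1")
      case True
      then have "A (W (int s) u1) u2 \<le> M1" unfolding M1_def by (intro Max_ge) auto
      then have "int (A (W (int s) u1) u2) \<le> m + l - int s"
        using m True unfolding a_def l_def by linarith
      then show ?thesis by (rule A)
    qed (simp add: I1 iterate_term_def product_term_def Yl.zero)
    have 2: "iterate_term m n (k + l - int r) u1 (W (int r) u2) x = product_term m n (k + l - int r) u1 (W (int r) u2) x" for r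
    proof (cases "r < I2")
      case True
      then have "A u1 (W (int r) u2) \<le> M2" unfolding M2_def by (intro Max_ge) auto
      then have "int (A u1 (W (int r) u2)) \<le> m"
        using m unfolding a_def by linarith
      then show ?thesis by (rule A)
    qed (simp add: I2 iterate_term_def product_term_def Yl.zero Yr.zero)
    show ?thesis unfolding iterate_term_W product_term_W 0 1 2 ..
  qed
  then show ?case unfolding l_def by blast
qed

end


section \<open>Skew symmetry\<close>

context virasoro_module
begin

text \<open>The coefficient of \<open>x\<^sup>-\<^sup>n\<^sup>-\<^sup>1\<close> in \<open>e\<^sup>x\<^sup>D g(-x)\<close>.\<close>

definition esum :: "int \<Rightarrow> (int \<Rightarrow> 'e) \<Rightarrow> 'e" where
  "esum n g = Sum_any (\<lambda>j. (- 1) powi (- (n + int j) - 1) *s dpow (int j) (g (n + int j)))"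

lemma esum_eq:
  assumes "\<And>q. q \<ge> n + int M \<Longrightarrow> g q = 0"
  shows "esum n g = (\<Sum>j<M. (- 1) powi (- (n + int j) - 1) *s dpow (int j) (g (n + int j)))"
  unfolding esum_def by (rule Sum_any_truncated) (use assms in \<open>simp add: dpow.zero\<close>)

lemma esum_add_scale:
  assumes "\<exists>N. \<forall>q\<ge>N. f q = 0" "\<exists>N. \<forall>q\<ge>N. g q = 0"
  shows "esum n (\<lambda>q. a *s f q + g q) = a *s esum n f + esum n g"
proof -
  from assms obtain A B where A: "\<And>q. q \<ge> A \<Longrightarrow> f q = 0" and B: "\<And>q. q \<ge> B \<Longrightarrow> g q = 0" by blast
  define M where "M = nat (max A B - n)"
  have "f q = 0" "g q = 0" if "q \<ge> n + int M" for q
  proof -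
    have "A \<le> q" "B \<le> q" using that by (simp_all add: M_def split: if_splits)
    then show "f q = 0" "g q = 0" by (auto intro: A B)
  qed
  then show ?thesis
    by (simp add: esum_eq[of n M] dpow.add dpow.scale scale_right_distrib sum.distrib scale_sum_right mult.commute)
qed

lemma esum_shift: "esum n (\<lambda>q. g (q + d)) = (- 1) powi d *s esum (n + d) g"
  if g: "\<exists>N. \<forall>q\<ge>N. g q = 0"
proof -
  from g obtain A where A: "\<And>q. q \<ge> A \<Longrightarrow> g q = 0" by blast
  define M where "M = nat (A - n - d)"
  have z: "g q = 0" if "q \<ge> n + d + int M" for q
  proof (rule A)
    show "A \<le> q" using that by (simp add: M_def split: if_splits)
  qed
  have h: "(- 1 :: complex) powi d * (- 1) powi (- (n + int j + d) - 1) = (- 1) powi (- (n + int j) - 1)" for j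
    unfolding sgn_powi(1)[symmetric] by (rule arg_cong[of _ _ "\<lambda>e. (- 1) powi e"]) simp
  have sgn: "(- 1) powi d *s (- 1) powi (- (n + int j + d) - 1) *s x = (- 1) powi (- (n + int j) - 1) *s x" for j x
    by (simp only: scale_scale h)
  have "esum n (\<lambda>q. g (q + d)) = (\<Sum>j<M. (- 1) powi (- (n + int j) - 1) *s dpow (int j) (g (n + int j + d)))"
    by (rule esum_eq) (rule z, simp)
  moreover have "esum (n + d) g = (\<Sum>j<M. (- 1) powi (- (n + d + int j) - 1) *s dpow (int j) (g (n + d + int j)))"
    by (rule esum_eq) (rule z, simp)
  moreover have "n + d + int j = n + int j + d" for j by simp
  ultimately show ?thesis by (simp only: scale_sum_right sgn)
qed

lemma esum_binsum:
  assumes "\<And>i q. q \<ge> n \<Longrightarrow> i \<ge> N \<or> q \<ge> n + int N \<Longrightarrow> h i q = 0"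
  shows "esum n (\<lambda>q. binsum a (\<lambda>i. h i q)) = binsum a (\<lambda>i. esum n (h i))"
proof -
  have 1: "binsum a (\<lambda>i. h i q) = (\<Sum>i<N. (a gchoose i) *s h i q)" if "q \<ge> n" for q
    by (rule binsum_eq) (use assms that in auto)
  have 2: "esum n (h i) = (\<Sum>j<N. (- 1) powi (- (n + int j) - 1) *s dpow (int j) (h i (n + int j)))" for i
    by (rule esum_eq) (use assms in auto)
  have "esum n (\<lambda>q. binsum a (\<lambda>i. h i q))
      = (\<Sum>j<N. (- 1) powi (- (n + int j) - 1) *s dpow (int j) (\<Sum>i<N. (a gchoose i) *s h i (n + int j)))"
    by (subst esum_eq[of n N]) (use assms in \<open>auto simp: 1\<close>)
  also have "\<dots> = (\<Sum>i<N. (a gchoose i) *s esum n (h i))"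
    by (simp only: dpow.sum dpow.scale scale_sum_right 2) (subst sum.swap, simp add: mult.commute)
  also have "\<dots> = binsum a (\<lambda>i. esum n (h i))"
    by (rule binsum_eq[symmetric]) (use assms in \<open>simp add: 2 dpow.zero\<close>)
  finally show ?thesis .
qed

lemma esum_altsum:
  assumes "\<And>i q. q \<ge> n \<Longrightarrow> i \<ge> N \<or> q \<ge> n + int N \<Longrightarrow> h i q = 0"
  shows "esum n (\<lambda>q. altsum a (\<lambda>i. h i q)) = altsum a (\<lambda>i. esum n (h i))"
proof -
  have "esum n (\<lambda>q. (- 1) ^ i *s h i q) = (- 1) ^ i *s esum n (h i)" for i
  proof -
    have z: "h i q = 0" if "q \<ge> n + int N" for q using assms that by auto
    then show ?thesis
      by (simp add: esum_eq[of n N] dpow.scale scale_sum_right mult.commute)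
  qed
  then show ?thesis
    unfolding altsum_def by (subst esum_binsum[of n N]) (use assms in auto)
qed

text \<open>The rule \<open>W(x) e^(yD) = e^(yD) W(x - y)\<close>, summed against the coefficients
  of \<open>g(-y)\<close>; replacing \<open>y\<close> by \<open>-y\<close> there is the source of
  the alternating signs.\<close>

lemma W_esum:
  assumes "\<exists>N. \<forall>q\<ge>N. g q = 0"
  shows "W l (esum n g) = altsum (of_int l) (\<lambda>r. esum n (\<lambda>q. W (l - int r) (g (q + int r))))"
proof -
  from assms obtain A where A: "\<And>q. q \<ge> A \<Longrightarrow> g q = 0" by blast
  define M where "M = nat (A - n)"
  have z: "g q = 0" if "q \<ge> n + int M" for q
  proof (rule A)
    show "A \<le> q" using that by (simp add: M_def split: if_splits)
  qed
  define s where "s j = ((- 1) powi (- (n + int j) - 1) :: complex)" for j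
  \<comment> \<open>Shifting the summation index by \<open>r\<close> costs the sign that turns the
    binomial sum into \<open>altsum\<close>.\<close>
  have s: "s (r + j) = (- 1) ^ r * s j" for r j
  proof -
    have "- (n + int (r + j)) - 1 = - int r + (- (n + int j) - 1)" by simp
    then show ?thesis unfolding s_def by (simp only: sgn_powi(1)) (simp only: sgn_powi(2,3))
  qed
  let ?f = "\<lambda>r j. ((of_int l gchoose r) * s (r + j)) *s dpow (int j) (W (l - int r) (g (n + int (r + j))))"
  have inner: "W l (dpow (int j) x) = (\<Sum>r\<le>j. (of_int l gchoose r) *s dpow (int (j - r)) (W (l - int r) x))" for j x
    unfolding W_dpow
    by (subst binsum_eq[of "Suc j"]) (auto simp: lessThan_Suc_atMost of_nat_diff intro!: sum.cong)
  have "W l (esum n g) = (\<Sum>j<M. s j *s W l (dpow (int j) (g (n + int j))))"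
    by (subst esum_eq[of n M]) (auto simp: z W.sum W.scale s_def)
  also have "\<dots> = (\<Sum>j<M. \<Sum>r\<le>j. ?f r (j - r))"
    unfolding inner by (simp add: scale_sum_right mult.commute)
  also have "\<dots> = (\<Sum>(r,j)\<in>{(r,j). r + j < M}. ?f r j)"
    by (rule sum.triangle_reindex[symmetric])
  also have "{(r,j). r + j < M} = (SIGMA r:{..<M}. {..<M - r})" by auto
  also have "(\<Sum>(r,j)\<in>(SIGMA r:{..<M}. {..<M - r}). ?f r j) = (\<Sum>r<M. \<Sum>j<M - r. ?f r j)"
    by (subst sum.Sigma[symmetric]) auto
  also have "\<dots> = (\<Sum>r<M. (of_int l gchoose r) *s (- 1) ^ r *s esum n (\<lambda>q. W (l - int r) (g (q + int r))))"
  proof (intro sum.cong refl)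
    fix r assume "r \<in> {..<M}"
    then have "r < M" by simp
    then have "esum n (\<lambda>q. W (l - int r) (g (q + int r)))
        = (\<Sum>j<M - r. s j *s dpow (int j) (W (l - int r) (g (n + int j + int r))))"
      unfolding s_def by (intro esum_eq) (simp add: z of_nat_diff W.zero)
    then show "(\<Sum>j<M - r. ?f r j) = (of_int l gchoose r) *s (- 1) ^ r *s esum n (\<lambda>q. W (l - int r) (g (q + int r)))"
      by (simp only: s scale_sum_right scale_scale) (simp add: mult_ac add_ac)
  qed
  also have "\<dots> = altsum (of_int l) (\<lambda>r. esum n (\<lambda>q. W (l - int r) (g (q + int r))))"
    unfolding altsum_def
  proof (rule binsum_eq[symmetric])
    fix r assume "r \<ge> M"
    then have "esum n (\<lambda>q. W (l - int r) (g (q + int r))) = 0"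
      by (subst esum_eq[of n 0]) (auto simp: z W.zero)
    then show "(- 1) ^ r *s esum n (\<lambda>q. W (l - int r) (g (q + int r))) = 0" by simp
  qed
  finally show ?thesis .
qed

end

context virasoro_fields
begin

definition jacobi_defect :: "int \<Rightarrow> int \<Rightarrow> int \<Rightarrow> 'e \<Rightarrow> 'e \<Rightarrow> 'e \<Rightarrow> 'e" where
  "jacobi_defect m n k u1 u2 v = iterate_term m n k u1 u2 v - product_term m n k u1 u2 v + opposite_term m n k u1 u2 v"

text \<open>Coefficient form of multiplication by \<open>x1 = x2 + x0\<close>, which holds for each
  of the three sums.\<close>

lemma jacobi_defect_pascal:
  "jacobi_defect (m + 1) n k u1 u2 v = jacobi_defect m n (k + 1) u1 u2 v + jacobi_defect m (n + 1) k u1 u2 v"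
proof -
  have "iterate_term (m + 1) n k u1 u2 v = iterate_term m n (k + 1) u1 u2 v + iterate_term m (n + 1) k u1 u2 v"
  proof -
    have "iterate_term (m + 1) n k u1 u2 v = binsum (of_int m + 1) (\<lambda>i. Y (Y u1 (n + int i) u2) (m + (k + 1) - int i) v)"
      unfolding iterate_term_def by (simp add: algebra_simps)
    also have "\<dots> = binsum (of_int m) (\<lambda>i. Y (Y u1 (n + int i) u2) (m + (k + 1) - int i) v)
        + binsum (of_int m) (\<lambda>i. Y (Y u1 (n + int (Suc i)) u2) (m + (k + 1) - int (Suc i)) v)"
      by (rule binsum_pascal) (rule tr_iterate)
    finally show ?thesis unfolding iterate_term_def by (simp add: algebra_simps)
  qed
  moreover have "product_term m (n + 1) k u1 u2 v = product_term (m + 1) n k u1 u2 v - product_term m n (k + 1) u1 u2 v"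
  proof -
    have "product_term m (n + 1) k u1 u2 v = altsum (of_int n + 1) (\<lambda>i. Y u1 (m + (n + 1) - int i) (Y u2 (k + int i) v))"
      unfolding product_term_def by simp
    also have "\<dots> = altsum (of_int n) (\<lambda>i. Y u1 (m + (n + 1) - int i) (Y u2 (k + int i) v))
        - altsum (of_int n) (\<lambda>i. Y u1 (m + (n + 1) - int (Suc i)) (Y u2 (k + int (Suc i)) v))"
      by (rule altsum_pascal) (rule tr_product)
    finally show ?thesis unfolding product_term_def by (simp add: algebra_simps)
  qed
  moreover have "opposite_term m (n + 1) k u1 u2 v = opposite_term (m + 1) n k u1 u2 v - opposite_term m n (k + 1) u1 u2 v"
  proof -
    have h1: "altsum (of_int (n + 1)) (\<lambda>i. Y u2 (n + 1 + k - int i) (Y u1 (m + int i) v))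
        = altsum (of_int n) (\<lambda>i. Y u2 (n + 1 + k - int i) (Y u1 (m + int i) v))
        - altsum (of_int n) (\<lambda>i. Y u2 (n + 1 + k - int (Suc i)) (Y u1 (m + int (Suc i)) v))"
      by (simp only: of_int_add of_int_1) (rule altsum_pascal, rule tr_product)
    have h2: "(- 1 :: complex) powi (n + 1) = - ((- 1) powi n)" by (simp add: sgn_powi(1))
    show ?thesis unfolding opposite_term_def h1 h2 by (simp add: scale_right_diff_distrib algebra_simps)
  qed
  ultimately show ?thesis unfolding jacobi_defect_def by simp
qed

text \<open>Weak associativity and the commutator formula imply the Borcherds identity.\<close>

lemma jacobi_defect_conformal: "jacobi_defect m (- int d) k (W (- 1) vac) u v = 0"
proof (induction d arbitrary: m k)
  case 0
  \<comment> \<open>At exponent 0 of \<open>x0\<close> the identity is the commutator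
    formula.\<close>
  then show ?case
    unfolding jacobi_defect_def iterate_term_def product_term_def opposite_term_def
    using commutator[of m u k v, symmetric] by (simp add: altsum_at_0 Y_conformal)
next
  case (Suc d)
  define J where "J m k = jacobi_defect m (- int (Suc d)) k (W (- 1) vac) u v" for m k
  obtain a where a: "\<And>m n k. m \<ge> int a \<Longrightarrow> iterate_term m n k (W (- 1) vac) u v = product_term m n k (W (- 1) vac) u v"
    using weak_associativity[of "W (- 1) vac" u v] by blast
  obtain b where b: "\<And>m. m \<ge> b \<Longrightarrow> Y (W (- 1) vac) m v = 0" using Y_bounded by blast
  \<comment> \<open>For large \<open>m\<close> iterate and product agree, and the opposite term
    vanishes by truncation.\<close>
  have large: "J m k = 0" if "m \<ge> max (int a) b" for m k
    using that unfolding J_def jacobi_defect_def opposite_term_def by (simp add: a b Yr.zero)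
  \<comment> \<open>The defects at \<open>(m + 1, k - 1)\<close> and \<open>(m, k)\<close> differ by
    one at exponent \<open>- d\<close>, which is zero by induction; so \<open>m\<close> can be
    raised until \<open>large\<close> applies.\<close>
  have shift: "J m k = J (m + 1) (k - 1)" for m k
    using jacobi_defect_pascal[of m "- int (Suc d)" "k - 1" "W (- 1) vac" u v] Suc[of m "k - 1"]
    unfolding J_def by simp
  have "J m k = J (m + int r) (k - int r)" for r
  proof (induction r)
    case (Suc r)
    then show ?case using shift[of "m + int r" "k - int r"] by (simp add: algebra_simps)
  qed simp
  from this[of "nat (max (int a) b - m)"] have "J m k = J (m + int (nat (max (int a) b - m))) (k - int (nat (max (int a) b - m)))" .
  also have "\<dots> = 0" by (rule large) linarith
  finally have "J m k = 0" .
  then show ?case unfolding J_def .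
qed

text \<open>The Borcherds identity at exponent 0 of \<open>x1\<close>; it writes the modes of
  \<open>W n u\<close> through products, as the induction for skew symmetry requires.\<close>

lemma iterate_conformal:
  assumes "n \<le> 0"
  shows "Y (W n u) k v = altsum (of_int n) (\<lambda>i. W (n - int i) (Y u (k + int i) v))
     - (- 1) powi n *s altsum (of_int n) (\<lambda>i. Y u (n + k - int i) (W (int i) v))"
proof -
  have "jacobi_defect 0 n k (W (- 1) vac) u v = 0"
    using jacobi_defect_conformal[of 0 "nat (- n)" k u v] assms by simp
  then show ?thesis
    unfolding jacobi_defect_def iterate_term_def product_term_def opposite_term_def
    by (simp add: binsum_at_0 Y_conformal algebra_simps)
qed

text \<open>The iterate formula for \<open>W l x\<close> gives two sums. In the first
  \<open>e^(xD)\<close> passes \<open>W l\<close> by \<open>W_esum\<close>; in the second the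
  nonnegative modes hit \<open>u\<close>, and the induction hypothesis holds for
  \<open>W i u\<close>. The result is the commutator formula for
  \<open>Y u n (W l x)\<close>.\<close>

theorem skew_symmetry: "Y u n v = esum n (\<lambda>q. Y v q u)"
proof (induction v arbitrary: u n rule: generate)
  case vac
  have "esum n (\<lambda>q. Y vac q u) = Sum_any (\<lambda>j. if j = nat (- n - 1) \<and> n < 0 then dpow (- n - 1) u else 0)"
    unfolding esum_def by (rule Sum_any.cong) (auto simp: Y_vac_left dpow.zero)
  also have "\<dots> = Y u n vac"
    by (cases "n < 0") (auto simp: Y_vac_right)
  finally show ?case ..
next
  case 0
  then show ?case by (simp add: Yr.zero Yl.zero esum_def dpow.zero)
next
  case (add a x y)
  then show ?case by (simp add: Yr.add Yr.scale Yl.add Yl.scale esum_add_scale Y_bounded)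
next
  case (C x)
  have "esum n (\<lambda>q. C (Y x q u)) = C (esum n (\<lambda>q. Y x q u))"
  proof -
    obtain N where N: "\<And>q. q \<ge> N \<Longrightarrow> Y x q u = 0" using Y_bounded by blast
    have CW: "C ((W 0 ^^ j) x) = (W 0 ^^ j) (C x)" for j x
      by (induction j) (auto simp: W_C[symmetric])
    have Cd: "dpow j (C x) = C (dpow j x)" for j x
      unfolding dpow_def by (simp add: C.scale CW C.zero)
    have z: "Y x q u = 0" "C (Y x q u) = 0" if "q \<ge> n + int (nat (N - n))" for q
      proof -
      have "N \<le> q" using that by (simp split: if_splits)
      then show "Y x q u = 0" "C (Y x q u) = 0" by (simp_all add: N C.zero)
    qed
    show ?thesis
      by (subst esum_eq[of n "nat (N - n)"], rule z, simp, subst esum_eq[of n "nat (N - n)"], rule z, simp)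
        (simp add: C.sum C.scale Cd)
  qed
  then show ?case by (simp add: Y_C_right Y_C_left C)
next
  case (step j x)
  define l where "l = - 1 - int j"
  have l: "l \<le> 0" by (simp add: l_def)
  obtain N where N: "\<And>q. q \<ge> N \<Longrightarrow> Y x q u = 0" using Y_bounded by blast
  obtain I where I: "\<And>i. i \<ge> I \<Longrightarrow> W (int i) u = 0" using W_bounded_nat[of u] by blast
  obtain M where M: "\<And>i q. q \<ge> M \<Longrightarrow> Y x q (W (int i) u) = 0"
    using W_nat_bounded_uniform(2)[of x u] by blast
  define K where "K = I + nat \<bar>M\<bar> + nat \<bar>l\<bar> + nat \<bar>n\<bar> + nat \<bar>N\<bar>"
  let ?P = "\<lambda>i q. W (l - int i) (Y x (q + int i) u)"
  let ?O = "\<lambda>i q. Y x (l + q - int i) (W (int i) u)"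
  have P0: "?P i q = 0" if "q \<ge> n" "i \<ge> K \<or> q \<ge> n + int K" for i q
  proof -
    have "q + int i \<ge> N" using that by (auto simp: K_def)
    then show ?thesis by (simp add: N W.zero)
  qed
  have O0: "?O i q = 0" if "q \<ge> n" "i \<ge> K \<or> q \<ge> n + int K" for i q
  proof (cases "i \<ge> I")
    case False
    then have "l + q - int i \<ge> M" using that by (auto simp: K_def)
    then show ?thesis by (rule M)
  qed (simp add: I Yr.zero)
  have eO: "esum n (?O i) = (- 1) powi (l - int i) *s Y (W (int i) u) (l + n - int i) x" for i
  proof -
    have "?O i = (\<lambda>q. Y x (q + (l - int i)) (W (int i) u))" by (rule ext) (simp add: algebra_simps)
    then have "esum n (?O i) = (- 1) powi (l - int i) *s esum (n + (l - int i)) (\<lambda>q. Y x q (W (int i) u))"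
      by (simp only: esum_shift[OF Y_bounded])
    then show ?thesis unfolding step[of "W (int i) u"] by (simp add: algebra_simps)
  qed
  have bP: "\<exists>N. \<forall>q\<ge>N. altsum (of_int l) (\<lambda>i. ?P i q) = 0"
    by (intro exI[of _ "n + int K"]) (use P0 in \<open>auto simp: K_def\<close>)
  have bO: "\<exists>N. \<forall>q\<ge>N. altsum (of_int l) (\<lambda>i. ?O i q) = 0"
    by (intro exI[of _ "n + int K"]) (use O0 in \<open>auto simp: K_def\<close>)
  have "esum n (\<lambda>q. Y (W l x) q u)
      = esum n (\<lambda>q. - ((- 1) powi l) *s altsum (of_int l) (\<lambda>i. ?O i q) + altsum (of_int l) (\<lambda>i. ?P i q))"
    by (simp add: iterate_conformal[OF l])
  also have "\<dots> = - ((- 1) powi l) *s esum n (\<lambda>q. altsum (of_int l) (\<lambda>i. ?O i q))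
      + esum n (\<lambda>q. altsum (of_int l) (\<lambda>i. ?P i q))"
    by (rule esum_add_scale[OF bO bP])
  also have "esum n (\<lambda>q. altsum (of_int l) (\<lambda>i. ?P i q)) = altsum (of_int l) (\<lambda>i. esum n (?P i))"
    by (rule esum_altsum[of n K]) (rule P0)
  also have "\<dots> = W l (esum n (\<lambda>q. Y x q u))"
    by (rule W_esum[symmetric]) (rule Y_bounded)
  also have "esum n (\<lambda>q. Y x q u) = Y u n x" by (rule step[symmetric])
  also have "esum n (\<lambda>q. altsum (of_int l) (\<lambda>i. ?O i q)) = altsum (of_int l) (\<lambda>i. esum n (?O i))"
    by (rule esum_altsum[of n K]) (rule O0)
  also have "altsum (of_int l) (\<lambda>i. esum n (?O i))
      = altsum (of_int l) (\<lambda>i. (- 1) powi (l - int i) *s Y (W (int i) u) (l + n - int i) x)"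
    by (simp only: eO)
  also have "- ((- 1) powi l) *s altsum (of_int l) (\<lambda>i. (- 1) powi (l - int i) *s Y (W (int i) u) (l + n - int i) x)
      = - binsum (of_int l) (\<lambda>i. Y (W (int i) u) (l + n - int i) x)"
  proof -
    have "(- 1 :: complex) ^ i * (- 1) powi (l - int i) = (- 1) powi l" for i
      by (simp only: sgn_powi(3)[symmetric] sgn_powi(1)[symmetric]) simp
    then show ?thesis unfolding altsum_def
      by (simp add: binsum_scale[OF truncated_YW] sgn_powi(4))
  qed
  finally show ?case unfolding l_def[symmetric] Y_W_eq by simp
qed

end


lemma (in virasoro_module) C_dpow: "dpow j (C x) = C (dpow j x)"
proof -
  have "(W 0 ^^ j) (C x) = C ((W 0 ^^ j) x)" for j
    by (induction j) (auto simp: W_C)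
  then show ?thesis unfolding dpow_def by (simp add: C.scale C.zero)
qed

lemma (in virasoro_module) lam_C_left:
  assumes "mode_lin F" "\<And>u n. F (C u) n = C (F u n)"
  shows "lam k F (C u) n = C (lam k F u n)"
  unfolding lam_def by (simp add: W_C assms C.diff linear_binsum[OF lin_C truncated_mode[OF assms(1)]])


section \<open>The universal Virasoro vertex algebra as an instance of these axioms\<close>

context universal_virasoro
begin

sublocale V: virasoro_module scale W "\<lambda>v. c *s v" vac
proof (intro virasoro_module.intro virasoro_module_axioms.intro)
  show "complex_space scale" by (rule complex_space_axioms)
qed (auto simp: W_virasoro W_vac Yr.scale linear_Y_right Y_bounded)

text \<open>\<open>Y_D\<close> gives a recursion in the mode, which the divided powers of
  \<open>D\<close> solve.\<close>

lemma Y_vac_right: "Y u n vac = V.dpow (- n - 1) u"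
proof (cases "n < 0")
  case True
  have "Y u (- 1 - int j) vac = V.dpow (int j) u" for j u
  proof (induction j arbitrary: u)
    case 0
    then show ?case by (simp add: creation(1))
  next
    case (Suc j)
    have "of_int (int j + 1) *s Y u (- 1 - int (Suc j)) vac = Y (W 0 u) (- 1 - int j) vac"
      by (simp add: omega_derivation Y_D algebra_simps)
    also have "\<dots> = of_int (int j + 1) *s V.dpow (int j + 1) u"
      by (simp only: Suc V.dpow_D)
    finally show ?case using V.dpow_induct_scale[of j] by (simp add: add.commute)
  qed
  from this[of u "nat (- n - 1)"] show ?thesis using True by simp
qed (simp add: creation(2))

sublocale V: virasoro_fields scale W "\<lambda>v. c *s v" vac Y
proof (intro virasoro_fields.intro virasoro_fields_axioms.intro)
  show "virasoro_module scale W (\<lambda>v. c *s v) vac" by (rule V.virasoro_module_axioms)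
  show "Y u n vac = V.dpow (- n - 1) u" for u n by (rule Y_vac_right)
  show "Y u n (W (- 1 - int j) v) = V.lam (- 1 - int j) (\<lambda>u n. Y u n v) u n" for u n j v
    unfolding V.lam_def commutator[symmetric] by simp
  show "P v" if "P vac" "P 0" "\<And>a x y. P x \<Longrightarrow> P y \<Longrightarrow> P (a *s x + y)"
      "\<And>j x. P x \<Longrightarrow> P (W (- 1 - int j) x)" for P v
    using that by (rule word_induct)
qed (auto simp: linear_Y_right linear_Y_left Yr.scale Yl.scale)

end


section \<open>Varying the central charge to first order\<close>

context universal_virasoro
begin

text \<open>The family of the vacuum is zero because \<open>\<omega>_m 1\<close>, as a word, does
  not involve the charge. The parameter 1 is the derivative of the charge with respect to
  itself.\<close>

definition charge_family :: "'v \<Rightarrow> 'v \<times> (int \<Rightarrow> 'v)" where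
  "charge_family = (SOME T. Vector_Spaces.linear (*s) (family_scale (*s)) T \<and> T vac = (vac, \<lambda>_. 0)
     \<and> (\<forall>j v. T (W (- 1 - int j) v) = family_e (*s) (\<lambda>j. W (- 1 - int j)) 1 j (T v)))"

lemma charge_family:
  "Vector_Spaces.linear (*s) (family_scale (*s)) charge_family"
  "charge_family vac = (vac, \<lambda>_. 0)"
  "charge_family (W (- 1 - int j) v) = family_e (*s) (\<lambda>j. W (- 1 - int j)) 1 j (charge_family v)"
proof -
  have "\<exists>T. Vector_Spaces.linear (*s) (family_scale (*s)) T \<and> T vac = (vac, \<lambda>_. 0)
     \<and> (\<forall>j v. T (W (- 1 - int j) v) = family_e (*s) (\<lambda>j. W (- 1 - int j)) 1 j (T v))"
    using universal_property[OF creation_module_family[OF creation_module_V, of 1], of "(vac, \<lambda>_. 0)"] by blast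
  from someI_ex[OF this, folded charge_family_def] show
    "Vector_Spaces.linear (*s) (family_scale (*s)) charge_family"
    "charge_family vac = (vac, \<lambda>_. 0)"
    "charge_family (W (- 1 - int j) v) = family_e (*s) (\<lambda>j. W (- 1 - int j)) 1 j (charge_family v)"
    by auto
qed

text \<open>The derivative of the mode \<open>\<omega>\<^sub>m\<close> with respect to the central charge, where words in creation
  modes are kept fixed.\<close>

definition K :: "int \<Rightarrow> 'v \<Rightarrow> 'v" where
  "K m v = snd (charge_family v) m"

lemma linear_K: "Vector_Spaces.linear (*s) (*s) (K m)"
proof -
  interpret T: Vector_Spaces.linear "(*s)" "family_scale (*s)" charge_family by (rule charge_family)
  show ?thesis
    unfolding Vector_Spaces.linear_iff K_def using vector_space_axioms
    by (simp add: T.add T.scale family_scale_def)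
qed

sublocale K: Vector_Spaces.linear "(*s)" "(*s)" "K m" for m by (rule linear_K)

lemma fst_charge_family: "fst (charge_family v) = v"
proof -
  interpret T: Vector_Spaces.linear "(*s)" "family_scale (*s)" charge_family by (rule charge_family)
  show ?thesis
  proof (induction v rule: word_induct)
    case 0 show ?case by (simp add: T.zero)
  qed (auto simp: charge_family T.add T.scale family_scale_def family_e_def)
qed

lemma K_vac: "K m vac = 0"
  by (simp add: K_def charge_family)

lemma K_W: "K m (W (- 1 - int j) v) = W (- 1 - int j) (K m v) + of_int (m + 1 + int j) *s K (m - 2 - int j) v
     + (if m = int j + 3 then vir_cocycle m else 0) *s v"
  by (simp add: K_def charge_family family_e_def fst_charge_family)

text \<open>The inhomogeneous term of \<open>K_W\<close> occurs for \<open>m \<ge> 3\<close> only,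
  and the recursion never raises \<open>m\<close>. So the creation modes and \<open>D\<close> are
  not deformed.\<close>

lemma K_0: "m \<le> 2 \<Longrightarrow> K m v = 0"
  by (induction v arbitrary: m rule: word_induct) (auto simp: K_vac K.zero K.add K.scale K_W Yr.zero)

lemma K_bounded: "\<exists>N. \<forall>m\<ge>N. K m v = 0"
proof (induction v rule: word_induct)
  case (add a x y)
  then obtain M N where "\<forall>n\<ge>M. K n x = 0" "\<forall>n\<ge>N. K n y = 0" by metis
  then show ?case by (intro exI[of _ "max M N"]) (simp add: K.add K.scale)
next
  case (step j x)
  then obtain M where "\<forall>n\<ge>M. K n x = 0" by blast
  then show ?case by (intro exI[of _ "\<bar>M\<bar> + int j + 4"]) (simp add: K_W Yr.zero)
qed (auto simp: K_vac K.zero)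

definition scale2 :: "complex \<Rightarrow> 'v \<times> 'v \<Rightarrow> 'v \<times> 'v" where
  "scale2 a p = (a *s fst p, a *s snd p)"

text \<open>The deformation over \<open>\<complex>[t]/(t\<^sup>2)\<close> lives on \<open>V[t]/(t\<^sup>2)\<close>; the pair \<open>(x, y)\<close> stands for \<open>x + t y\<close>.
  The central charge is \<open>c + t\<close>.\<close>

definition W2 :: "int \<Rightarrow> 'v \<times> 'v \<Rightarrow> 'v \<times> 'v" where
  "W2 k p = (W k (fst p), W k (snd p) + K k (fst p))"

definition C2 :: "'v \<times> 'v \<Rightarrow> 'v \<times> 'v" where
  "C2 p = (c *s fst p, c *s snd p + fst p)"

definition t2 :: "'v \<times> 'v \<Rightarrow> 'v \<times> 'v" where
  "t2 p = (0, fst p)"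

lemma fst_scale2: "fst (scale2 a p) = a *s fst p"
  and snd_scale2: "snd (scale2 a p) = a *s snd p"
  by (simp_all add: scale2_def)

lemma vector_space_scale2: "vector_space scale2"
  by unfold_locales (auto simp: scale2_def scale_left_distrib scale_right_distrib prod_eq_iff)

sublocale S2: complex_space scale2
  unfolding complex_space_def by (rule vector_space_scale2)

lemma linear_W2: "Vector_Spaces.linear scale2 scale2 (W2 k)"
  and linear_C2: "Vector_Spaces.linear scale2 scale2 C2"
  and linear_t2: "Vector_Spaces.linear scale2 scale2 t2"
  unfolding Vector_Spaces.linear_iff
  by (auto simp: vector_space_scale2 W2_def C2_def t2_def scale2_def Yr.add Yr.scale K.add K.scale
      scale_right_distrib mult.commute)

lemma linear_fst: "Vector_Spaces.linear scale2 (*s) fst"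
  and linear_snd: "Vector_Spaces.linear scale2 (*s) snd"
  unfolding Vector_Spaces.linear_iff
  by (auto simp: vector_space_scale2 vector_space_axioms scale2_def)

lemma creation_module_E: "creation_module scale2 UNIV (\<lambda>j p. (W (- 1 - int j) (fst p), W (- 1 - int j) (snd p)))"
  using creation_module_V vector_space_scale2
  unfolding creation_module_def by (auto simp: scale2_def prod_eq_iff)

text \<open>Scalars are complex, so the vacuum and \<open>t\<close> times the vacuum serve as two
  generators. The gain is \<open>X.virasoro\<close>: the modes \<open>W2\<close> satisfy the
  Virasoro relations with central operator \<open>c + t\<close>.\<close>

sublocale X: virasoro_extension scale2 "\<lambda>j p. (W (- 1 - int j) (fst p), W (- 1 - int j) (snd p))" W2 C2
    "{(vac, 0), (0, vac)}"
    "S2.span (creation_words (\<lambda>j p. (W (- 1 - int j) (fst p), W (- 1 - int j) (snd p))) {(vac, 0), (0, vac)})"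
proof (intro virasoro_extension.intro virasoro_extension_axioms.intro)
  show "complex_space scale2" by (rule S2.complex_space_axioms)
  show "creation_module scale2 UNIV (\<lambda>j p. (W (- 1 - int j) (fst p), W (- 1 - int j) (snd p)))"
    by (rule creation_module_E)
  show "Vector_Spaces.linear scale2 scale2 (W2 m)" for m by (rule linear_W2)
  show "Vector_Spaces.linear scale2 scale2 C2" by (rule linear_C2)
  show "W2 m g = (if m < 0 then (W (- 1 - int (nat (- 1 - m))) (fst g), W (- 1 - int (nat (- 1 - m))) (snd g)) else 0)"
    if "g \<in> {(vac, 0), (0, vac)}" for g m
    using that W_vac by (auto simp: W2_def K_vac K.zero Yr.zero zero_prod_def)
  let ?H = "S2.span (creation_words (\<lambda>j p. (W (- 1 - int j) (fst p), W (- 1 - int j) (snd p))) {(vac, 0), (0, vac)})"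
  have G: "(vac, 0) \<in> ?H" "(0, vac) \<in> ?H" by (auto intro!: S2.span_base creation_words.base)
  have "C2 (vac, 0) = scale2 c (vac, 0) + (0, vac)" "C2 (0, vac) = scale2 c (0, vac)"
    by (auto simp: C2_def scale2_def)
  then show "C2 g \<in> ?H" if "g \<in> {(vac, 0), (0, vac)}" for g
    using that G S2.span_add S2.span_scale by (elim insertE) (simp_all del: fst_add snd_add)
  show "W2 m (W (- 1 - int j) (fst x), W (- 1 - int j) (snd x))
      = (W (- 1 - int j) (fst (W2 m x)), W (- 1 - int j) (snd (W2 m x)))
        + scale2 (of_int (m + 1 + int j)) (W2 (m - 2 - int j) x)
        + scale2 (if m = int j + 3 then vir_cocycle m else 0) (C2 x)" for m j x
  proof -
    have V: "W m (W (- 1 - int j) y) = W (- 1 - int j) (W m y) + of_int (m + 1 + int j) *s W (m - 2 - int j) y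
        + (if m = int j + 3 then vir_cocycle m else 0) *s (c *s y)" for y
      by (rule V.L_e) (simp add: span_words)
    show ?thesis
      by (simp only: W2_def V K_W C2_def scale2_def fst_conv snd_conv Yr.add prod.inject plus_prod_def
          scale_right_distrib) (simp add: add_ac)
  qed
  show "C2 (W (- 1 - int j) (fst x), W (- 1 - int j) (snd x)) = (W (- 1 - int j) (fst (C2 x)), W (- 1 - int j) (snd (C2 x)))" for j x
    by (simp add: C2_def Yr.add Yr.scale)
  show "C2 (W2 m x) = W2 m (C2 x)" for m x
    by (simp add: C2_def W2_def Yr.add Yr.scale K.add K.scale scale_right_distrib)
qed simp

lemma span_E: "p \<in> S2.span (creation_words (\<lambda>j p. (W (- 1 - int j) (fst p), W (- 1 - int j) (snd p))) {(vac, 0), (0, vac)})"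
proof -
  let ?H = "S2.span (creation_words (\<lambda>j p. (W (- 1 - int j) (fst p), W (- 1 - int j) (snd p))) {(vac, 0), (0, vac)})"
  have "(x, 0) \<in> ?H \<and> (0, x) \<in> ?H" for x
  proof (induction x rule: word_induct)
    case vac show ?case by (simp add: X.H_gen)
  next
    case 0 show ?case using S2.span_zero by (simp add: zero_prod_def)
  next
    case (add a x y)
    have "(a *s x + y, 0) = scale2 a (x, 0) + (y, 0)" "(0, a *s x + y) = scale2 a (0, x) + (0, y)"
      by (auto simp: scale2_def)
    then show ?case using add by (simp only: S2.span_add S2.span_scale conj_ac)
  next
    case (step j x)
    then show ?case using X.H_e[of "(x, 0)" j] X.H_e[of "(0, x)" j] by (simp add: Yr.zero)
  qed
  then have "(fst p, 0) + (0, snd p) \<in> ?H" by (blast intro: S2.span_add)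
  then show ?thesis by simp
qed

sublocale E: virasoro_module scale2 W2 C2 "(vac, 0)"
proof (intro virasoro_module.intro virasoro_module_axioms.intro)
  show "complex_space scale2" by (rule S2.complex_space_axioms)
  show "Vector_Spaces.linear scale2 scale2 (W2 m)" for m by (rule linear_W2)
  show "Vector_Spaces.linear scale2 scale2 C2" by (rule linear_C2)
  show "W2 m (W2 k u) - W2 k (W2 m u) = scale2 (of_int (m - k)) (W2 (m + k - 1) u)
      + scale2 (if m + k = 2 then vir_cocycle m else 0) (C2 u)" for m k u
    by (rule X.virasoro) (rule span_E)
  show "\<exists>N. \<forall>k\<ge>N. W2 k u = 0" for u
  proof -
    obtain N1 N2 N3 where "\<forall>k\<ge>N1. W k (fst u) = 0" "\<forall>k\<ge>N2. W k (snd u) = 0" "\<forall>k\<ge>N3. K k (fst u) = 0"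
      using Y_bounded K_bounded by metis
    then show ?thesis by (intro exI[of _ "max N1 (max N2 N3)"]) (simp add: W2_def zero_prod_def)
  qed
  show "W2 k (C2 u) = C2 (W2 k u)" for k u by (rule X.Z_L[symmetric])
  show "W2 k (vac, 0) = 0" if "k \<ge> 0" for k
    using that by (simp add: W2_def W_vac K_vac Yr.zero zero_prod_def)
qed

text \<open>Commuting with \<open>C2 = c + t\<close> encodes linearity over the dual numbers in the
  field argument \<open>u\<close>.\<close>

definition families :: "('v \<times> 'v \<Rightarrow> int \<Rightarrow> 'v \<times> 'v) set" where
  "families = {F. E.mode_lin F \<and> (\<forall>u n. F (C2 u) n = C2 (F u n))}"

definition families_scale :: "complex \<Rightarrow> ('v \<times> 'v \<Rightarrow> int \<Rightarrow> 'v \<times> 'v) \<Rightarrow> 'v \<times> 'v \<Rightarrow> int \<Rightarrow> 'v \<times> 'v" where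
  "families_scale a F u n = scale2 a (F u n)"

lemma vector_space_families_scale: "vector_space families_scale"
  by unfold_locales
    (auto simp: families_scale_def[abs_def] fun_eq_iff plus_fun_def S2.scale_left_distrib S2.scale_right_distrib)

text \<open>By \<open>E.lam_rel\<close>, whose central term is absent since two creation indices
  never add up to 2.\<close>

lemma creation_module_families:
  "creation_module families_scale families (\<lambda>j. E.lam (- 1 - int j))"
proof -
  interpret F: vector_space families_scale by (rule vector_space_families_scale)
  have lin0: "E.mode_lin (\<lambda>u n. 0)"
    unfolding E.mode_lin_def Vector_Spaces.linear_iff using vector_space_scale2 by (simp)
  have add: "E.mode_lin (\<lambda>u n. F u n + G u n)" if "E.mode_lin F" "E.mode_lin G" for F G
    using that unfolding E.mode_lin_def Vector_Spaces.linear_iff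
    by (simp add: S2.scale_right_distrib add_ac)
  have scale: "E.mode_lin (\<lambda>u n. scale2 a (F u n))" if "E.mode_lin F" for F a
    using that unfolding E.mode_lin_def Vector_Spaces.linear_iff
    by (simp add: S2.scale_right_distrib mult.commute)
  show ?thesis unfolding creation_module_def
  proof (intro conjI allI ballI)
    show "vector_space families_scale" by (rule vector_space_families_scale)
    show "F.subspace families"
    proof -
      have eqs: "0 = (\<lambda>u n. 0 :: 'v \<times> 'v)" "F + G = (\<lambda>u n. F u n + G u n)"
        "families_scale a F = (\<lambda>u n. scale2 a (F u n))" for F G a
        by (auto simp: fun_eq_iff families_scale_def)
      show ?thesis
        unfolding F.subspace_def families_def mem_Collect_eq
      proof (intro conjI allI impI ballI)
        show "E.mode_lin 0" unfolding eqs(1) by (rule lin0)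
      qed (auto simp: eqs(2,3) add scale X.Z.zero X.Z.add X.Z.scale simp del: split_paired_All)
    qed
    fix F G i j a assume F: "F \<in> families"
    then have mF: "E.mode_lin F" and cF: "\<And>u n. F (C2 u) n = C2 (F u n)" by (auto simp: families_def)
    show "E.lam (- 1 - int j) F \<in> families"
      using E.mode_lin_lam[OF mF] E.lam_C_left[OF mF cF] by (simp add: families_def)
    show "E.lam (- 1 - int j) (families_scale a F) = families_scale a (E.lam (- 1 - int j) F)"
      unfolding families_scale_def[abs_def] by (intro ext) (rule E.lam_scale[OF mF])
    show "E.lam (- 1 - int i) (E.lam (- 1 - int j) F) - E.lam (- 1 - int j) (E.lam (- 1 - int i) F)
      = families_scale (of_int (int j - int i)) (E.lam (- 1 - int (i + j + 2)) F)"
    proof (intro ext)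
      fix u n
      have "- 1 - int i + (- 1 - int j) - 1 = - 1 - int (i + j + 2)" by simp
      then show "(E.lam (- 1 - int i) (E.lam (- 1 - int j) F) - E.lam (- 1 - int j) (E.lam (- 1 - int i) F)) u n
        = families_scale (of_int (int j - int i)) (E.lam (- 1 - int (i + j + 2)) F) u n"
        using E.lam_rel[OF mF, of "- 1 - int i" "- 1 - int j" u n]
        by (simp add: families_scale_def)
    qed
  next
    fix F G j assume "F \<in> families" "G \<in> families"
    then show "E.lam (- 1 - int j) (F + G) = E.lam (- 1 - int j) F + E.lam (- 1 - int j) G"
      unfolding families_def plus_fun_def by (intro ext) (auto intro: E.lam_add)
  qed
qed

text \<open>Sends \<open>v\<close> to the deformed products \<open>u_n v\<close>. It can be
  prescribed on words of the undeformed algebra because \<open>W2\<close> and \<open>W\<close> have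
  the same creation modes.\<close>

definition deformed_family :: "'v \<Rightarrow> 'v \<times> 'v \<Rightarrow> int \<Rightarrow> 'v \<times> 'v" where
  "deformed_family = (SOME T. Vector_Spaces.linear (*s) families_scale T \<and> range T \<subseteq> families
     \<and> T vac = (\<lambda>u n. E.dpow (- n - 1) u) \<and> (\<forall>j v. T (W (- 1 - int j) v) = E.lam (- 1 - int j) (T v)))"

lemma deformed_family:
  "Vector_Spaces.linear (*s) families_scale deformed_family"
  "deformed_family v \<in> families"
  "deformed_family vac = (\<lambda>u n. E.dpow (- n - 1) u)"
  "deformed_family (W (- 1 - int j) v) = E.lam (- 1 - int j) (deformed_family v)"
proof -
  have "(\<lambda>u n. E.dpow (- n - 1) u) \<in> families"
    unfolding families_def E.mode_lin_def by (simp add: E.linear_dpow E.C_dpow)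
  then have "\<exists>T. Vector_Spaces.linear (*s) families_scale T \<and> range T \<subseteq> families
     \<and> T vac = (\<lambda>u n. E.dpow (- n - 1) u) \<and> (\<forall>j v. T (W (- 1 - int j) v) = E.lam (- 1 - int j) (T v))"
    by (rule universal_property[OF creation_module_families])
  from someI_ex[OF this, folded deformed_family_def] show
    "Vector_Spaces.linear (*s) families_scale deformed_family"
    "deformed_family v \<in> families"
    "deformed_family vac = (\<lambda>u n. E.dpow (- n - 1) u)"
    "deformed_family (W (- 1 - int j) v) = E.lam (- 1 - int j) (deformed_family v)"
    by auto
qed

lemma mode_lin_deformed: "E.mode_lin (deformed_family v)"
  and C2_deformed: "deformed_family v (C2 u) n = C2 (deformed_family v u n)"
  using deformed_family(2)[of v] unfolding families_def by blast+

text \<open>The extension of \<open>deformed_family\<close> to right arguments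
  \<open>x + t y\<close> that is linear over the dual numbers.\<close>

definition Y2 :: "'v \<times> 'v \<Rightarrow> int \<Rightarrow> 'v \<times> 'v \<Rightarrow> 'v \<times> 'v" where
  "Y2 u n p = deformed_family (fst p) u n + t2 (deformed_family (snd p) u n)"

lemma deformed_family_add: "deformed_family (x + y) u n = deformed_family x u n + deformed_family y u n"
  and deformed_family_scale: "deformed_family (a *s x) u n = scale2 a (deformed_family x u n)"
  and deformed_family_0: "deformed_family 0 u n = 0"
proof -
  interpret T: Vector_Spaces.linear "(*s)" families_scale deformed_family by (rule deformed_family)
  show "deformed_family (x + y) u n = deformed_family x u n + deformed_family y u n"
    "deformed_family (a *s x) u n = scale2 a (deformed_family x u n)" "deformed_family 0 u n = 0"
    by (simp_all add: T.add T.scale T.zero families_scale_def)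
qed

lemma C2_eq: "C2 p = scale2 c p + t2 p"
  by (simp add: C2_def t2_def scale2_def)

lemma t2_t2: "t2 (t2 p) = 0"
  by (simp add: t2_def zero_prod_def)

sublocale t2: Vector_Spaces.linear scale2 scale2 t2 by (rule linear_t2)

lemma t2_deformed: "deformed_family v (t2 u) n = t2 (deformed_family v u n)"
proof -
  have "t2 u = C2 u - scale2 c u" for u by (simp add: C2_eq)
  then show ?thesis
    by (simp only: E.mode_lin_diff[OF mode_lin_deformed] E.mode_lin_scale[OF mode_lin_deformed] C2_deformed)
qed

lemma W2_t2: "W2 k (t2 p) = t2 (W2 k p)"
  by (simp add: W2_def t2_def Yr.zero K.zero)

lemma lam_t2:
  assumes "E.mode_lin F"
  shows "E.lam k (\<lambda>u n. t2 (F u n)) u n = t2 (E.lam k F u n)"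
  unfolding E.lam_def
  by (simp add: W2_t2 t2.diff S2.linear_binsum[OF linear_t2 E.truncated_mode[OF assms]])

sublocale E: virasoro_fields scale2 W2 C2 "(vac, 0)" Y2
proof (intro virasoro_fields.intro virasoro_fields_axioms.intro)
  show "virasoro_module scale2 W2 C2 (vac, 0)" by (rule E.virasoro_module_axioms)
  show "Vector_Spaces.linear scale2 scale2 (\<lambda>v. Y2 u n v)" for u n
    unfolding Vector_Spaces.linear_iff Y2_def
    by (simp add: vector_space_scale2 deformed_family_add deformed_family_scale t2.add t2.scale
        S2.scale_right_distrib fst_scale2 snd_scale2)
  have l: "Vector_Spaces.linear scale2 scale2 (\<lambda>u. deformed_family v u n)" for v n
    using mode_lin_deformed unfolding E.mode_lin_def by blast
  show lin_left: "Vector_Spaces.linear scale2 scale2 (\<lambda>u. Y2 u n v)" for n v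
    using l unfolding Vector_Spaces.linear_iff Y2_def
    by (simp add: t2.add t2.scale S2.scale_right_distrib)
  show "Y2 u n (C2 v) = C2 (Y2 u n v)" for u n v
  proof -
    have "fst (C2 v) = c *s fst v" "snd (C2 v) = c *s snd v + fst v" by (simp_all add: C2_def)
    then show ?thesis
      unfolding Y2_def by (simp add: deformed_family_add deformed_family_scale C2_eq
          t2.add t2.scale t2_t2 S2.scale_right_distrib)
  qed
  show "Y2 (C2 u) n v = C2 (Y2 u n v)" for u n v
    unfolding Y2_def C2_deformed X.Z.add by (simp add: C2_eq t2.add t2.scale)
  show "Y2 u n (vac, 0) = E.dpow (- n - 1) u" for u n
    by (simp add: Y2_def deformed_family deformed_family_0 t2.zero)
  show "Y2 u n (W2 (- 1 - int j) v) = E.lam (- 1 - int j) (\<lambda>u n. Y2 u n v) u n" for u n j v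
  proof -
    have "E.mode_lin (\<lambda>u n. t2 (deformed_family (snd v) u n))"
      unfolding E.mode_lin_def using Vector_Spaces.linear_compose[OF l linear_t2] by (simp add: o_def)
    then show ?thesis
      unfolding Y2_def by (simp add: E.lam_add[OF mode_lin_deformed] lam_t2[OF mode_lin_deformed]
          W2_def K_0 deformed_family(4))
  qed
  fix P :: "'v \<times> 'v \<Rightarrow> bool" and v
  assume P: "P (vac, 0)" "P 0" "\<And>a x y. P x \<Longrightarrow> P y \<Longrightarrow> P (scale2 a x + y)"
    "\<And>j x. P x \<Longrightarrow> P (W2 (- 1 - int j) x)" "\<And>x. P x \<Longrightarrow> P (C2 x)"
  \<comment> \<open>The second generator is recovered as \<open>t = C2 - c\<close> applied to the
    first.\<close>
  have "P (scale2 (- c) (vac, 0) + C2 (vac, 0))" by (intro P)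
  then have P0: "P (0, vac)" by (simp add: C2_def scale2_def)
  have e: "(W (- 1 - int j) (fst x), W (- 1 - int j) (snd x)) = W2 (- 1 - int j) x" for j x
    by (simp add: W2_def K_0)
  show "P v"
    using span_E[of v]
  proof (induction rule: X.H_induct)
    case (step j x)
    then show ?case unfolding e by (intro P)
  qed (use P P0 in auto)
qed

end


context universal_virasoro
begin

text \<open>Freeness gives a map to the trivial one-dimensional module that sends the vacuum to
  1.\<close>

lemma vac_nonzero: "vac \<noteq> 0"
proof -
  have "creation_module ((*) :: complex \<Rightarrow> complex \<Rightarrow> complex) UNIV (\<lambda>j x. 0)"
    unfolding creation_module_def using vector_space_complex
    by (simp add: module.subspace_UNIV module_iff_vector_space)
  then obtain T where "Vector_Spaces.linear (*s) ((*) :: complex \<Rightarrow> complex \<Rightarrow> complex) T" "T vac = 1"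
    using universal_property[of _ UNIV _ 1] by blast
  then interpret T: Vector_Spaces.linear "(*s)" "(*) :: complex \<Rightarrow> complex \<Rightarrow> complex" T by simp
  show ?thesis using T.zero \<open>T vac = 1\<close> by auto
qed

subsection \<open>Homogeneous components\<close>

lemma gr_0: "0 \<in> gr n"
  and gr_add: "x \<in> gr n \<Longrightarrow> y \<in> gr n \<Longrightarrow> x + y \<in> gr n"
  and gr_scale: "x \<in> gr n \<Longrightarrow> a *s x \<in> gr n"
  and gr_diff: "x \<in> gr n \<Longrightarrow> y \<in> gr n \<Longrightarrow> x - y \<in> gr n"
  using subspace_gr[of n] by (auto simp: subspace_0 subspace_add subspace_scale subspace_diff)

lemma gr_binsum:
  assumes "\<And>i. g i \<in> gr n" shows "binsum a g \<in> gr n"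
  unfolding binsum_def Sum_any.expand_set using assms
  by (auto intro!: subspace_sum subspace_gr gr_scale)

lemma Y_gr: "u \<in> gr p \<Longrightarrow> v \<in> gr q \<Longrightarrow> Y u n v \<in> gr (p + q - n - 1)"
  using weight_compatible_Y unfolding weight_compatible_def by blast

lemma W_gr: "v \<in> gr q \<Longrightarrow> W k v \<in> gr (q + 1 - k)"
  using Y_gr[OF omega_weight, of v q k] by (simp add: algebra_simps)

inductive_set homogeneous_words :: "(int \<times> 'v) set" where
  base: "(0, vac) \<in> homogeneous_words"
| step: "(q, x) \<in> homogeneous_words \<Longrightarrow> (q + 2 + int j, W (- 1 - int j) x) \<in> homogeneous_words"

lemma homogeneous_words_gr: "(q, x) \<in> homogeneous_words \<Longrightarrow> x \<in> gr q"
proof (induction rule: homogeneous_words.induct)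
  case (step q x j)
  then show ?case using W_gr[of x q "- 1 - int j"] by (simp add: algebra_simps)
qed (rule vacuum_weight)

definition graded_span :: "int \<Rightarrow> 'v set" where
  "graded_span q = span {x. (q, x) \<in> homogeneous_words}"

lemma graded_span_subset: "graded_span q \<subseteq> gr q"
  unfolding graded_span_def by (rule span_minimal) (auto simp: homogeneous_words_gr subspace_gr)

lemma graded_decomposition:
  "\<exists>p. (\<forall>n. p n \<in> graded_span n) \<and> finite {n. p n \<noteq> 0} \<and> v = Sum_any p"
proof -
  define D where "D = {v. \<exists>p. (\<forall>n. p n \<in> graded_span n) \<and> finite {n. p n \<noteq> 0} \<and> v = Sum_any p}"
  have sub: "subspace D"
    unfolding subspace_def
  proof (intro conjI ballI allI)
    show "0 \<in> D" unfolding D_def graded_span_def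
      by (auto intro!: exI[of _ "\<lambda>_. 0"] span_zero)
    fix x y a assume "x \<in> D"
    then obtain p where p: "\<And>n. p n \<in> graded_span n" "finite {n. p n \<noteq> 0}" "x = Sum_any p"
      unfolding D_def by blast
    have "finite {n. a *s p n \<noteq> 0}" by (rule finite_subset[OF _ p(2)]) auto
    moreover have "a *s x = Sum_any (\<lambda>n. a *s p n)"
      unfolding p(3) by (subst (1 2) Sum_any.expand_superset[OF p(2)]) (auto simp: scale_sum_right)
    ultimately show "a *s x \<in> D" unfolding D_def using p(1)
      by (auto intro!: exI[of _ "\<lambda>n. a *s p n"] simp: graded_span_def span_scale)
    assume "y \<in> D"
    then obtain r where r: "\<And>n. r n \<in> graded_span n" "finite {n. r n \<noteq> 0}" "y = Sum_any r"
      unfolding D_def by blast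
    have "finite {n. p n + r n \<noteq> 0}"
      by (rule finite_subset[OF _ finite_UnI[OF p(2) r(2)]]) auto
    moreover have "x + y = Sum_any (\<lambda>n. p n + r n)"
      unfolding p(3) r(3) by (rule Sum_any.distrib[symmetric]) (rule p r)+
    ultimately show "x + y \<in> D" unfolding D_def using p(1) r(1)
      by (auto intro!: exI[of _ "\<lambda>n. p n + r n"] simp: graded_span_def span_add)
  qed
  have words_D: "x \<in> D" if "(q, x) \<in> homogeneous_words" for q x
  proof -
    have "x = Sum_any (\<lambda>n. if n = q then x else 0)" by simp
    moreover have "finite {n. (if n = q then x else 0) \<noteq> 0}" by (rule finite_subset[of _ "{q}"]) auto
    ultimately show ?thesis unfolding D_def using that
      by (auto intro!: exI[of _ "\<lambda>n. if n = q then x else 0"] simp: graded_span_def span_zero span_base)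
  qed
  have "v \<in> span words" by (simp add: span_words)
  moreover have "\<exists>q. (q, x) \<in> homogeneous_words" if "x \<in> words" for x
    using that unfolding words_def by induction (auto intro: homogeneous_words.intros)
  ultimately have "v \<in> D"
    using span_minimal[OF _ sub, of words] words_D by blast
  then show ?thesis unfolding D_def by blast
qed

text \<open>A homogeneous vector decomposes into spans of words of fixed weights; by uniqueness in
  \<open>direct_sum\<close> this is its trivial decomposition.\<close>

lemma graded_span_eq: "graded_span q = gr q"
proof
  show "gr q \<subseteq> graded_span q"
  proof
    fix v assume v: "v \<in> gr q"
    obtain p where p: "\<forall>n. p n \<in> graded_span n" "finite {n. p n \<noteq> 0}" "v = Sum_any p"
      using graded_decomposition by blast
    then have g: "\<forall>n. p n \<in> gr n" using graded_span_subset by blast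
    let ?r = "\<lambda>n. if n = q then v else 0"
    have r: "\<forall>n. ?r n \<in> gr n" "finite {n. ?r n \<noteq> 0}" "v = Sum_any ?r"
      using v by (auto simp: gr_0 intro: finite_subset[of _ "{q}"])
    from direct_sum[of v] obtain p0 where
      p0: "\<And>p. (\<forall>n. p n \<in> gr n) \<Longrightarrow> finite {n. p n \<noteq> 0} \<Longrightarrow> v = Sum_any p \<Longrightarrow> p = p0"
      by (elim ex1E) blast
    have "p = ?r"
      by (rule trans[OF p0[OF g p(2,3)] p0[OF r, symmetric]])
    then have "p q = v" by simp
    then show "v \<in> graded_span q" using p(1) by metis
  qed
qed (rule graded_span_subset)

lemma graded_induct [consumes 1, case_names vac 0 add step]:
  assumes "v \<in> gr q"
    and vac: "P 0 vac" and zero: "\<And>q. P q 0"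
    and add: "\<And>q a x y. P q x \<Longrightarrow> P q y \<Longrightarrow> P q (a *s x + y)"
    and step: "\<And>q j x. x \<in> gr q \<Longrightarrow> P q x \<Longrightarrow> P (q + 2 + int j) (W (- 1 - int j) x)"
  shows "P q v"
proof -
  have w: "P q x" if "(q, x) \<in> homogeneous_words" for q x
    using that by induction (auto intro: vac step homogeneous_words_gr)
  have "v \<in> span {x. (q, x) \<in> homogeneous_words}"
    using assms(1) unfolding graded_span_eq[symmetric] graded_span_def .
  then show ?thesis
    by (induction rule: span_induct_alt) (auto intro: zero add w)
qed

text \<open>A creation mode raises the weight by at least 2, and words start at the vacuum of weight
  0.\<close>

lemma low_weights:
  assumes "v \<in> gr q"
  shows "q < 0 \<Longrightarrow> v = 0" "q = 0 \<Longrightarrow> \<exists>a. v = a *s vac" "q = 1 \<Longrightarrow> v = 0" "q = 2 \<Longrightarrow> \<exists>a. v = a *s \<omega>"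
proof -
  have "(q < 0 \<longrightarrow> v = 0) \<and> (q = 0 \<longrightarrow> (\<exists>a. v = a *s vac)) \<and> (q = 1 \<longrightarrow> v = 0) \<and> (q = 2 \<longrightarrow> (\<exists>a. v = a *s \<omega>))"
    using assms
  proof (induction rule: graded_induct)
    case vac show ?case by (auto intro: exI[of _ 1])
  next
    case (0 q) show ?case by (auto intro: exI[of _ 0])
  next
    case (add q a x y)
    have comb: "\<exists>b. a *s (b1 *s z) + b2 *s z = b *s z" for b1 b2 z
      by (intro exI[of _ "a * b1 + b2"]) (simp add: scale_left_distrib)
    show ?case
    proof (intro conjI impI)
      assume "q = 0"
      then obtain b1 b2 where "x = b1 *s vac" "y = b2 *s vac" using add by blast
      then show "\<exists>b. a *s x + y = b *s vac" using comb by simp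
    next
      assume "q = 2"
      then obtain b1 b2 where "x = b1 *s \<omega>" "y = b2 *s \<omega>" using add by blast
      then show "\<exists>b. a *s x + y = b *s \<omega>" using comb by simp
    qed (use add in auto)
  next
    case (step q j x)
    show ?case
    proof (cases "q = 0 \<and> j = 0")
      case True
      then obtain a where "x = a *s vac" using step by blast
      then show ?thesis using True by (auto simp: Yr.scale creation(1))
    next
      case False
      have "x = 0 \<or> q + 2 + int j > 2" using step False by (cases "q < 0") auto
      then show ?thesis by (auto simp: Yr.zero intro: exI[of _ 0])
    qed
  qed
  then show "q < 0 \<Longrightarrow> v = 0" "q = 0 \<Longrightarrow> \<exists>a. v = a *s vac" "q = 1 \<Longrightarrow> v = 0" "q = 2 \<Longrightarrow> \<exists>a. v = a *s \<omega>"
    by auto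
qed

lemma K_gr: "v \<in> gr q \<Longrightarrow> K m v \<in> gr (q + 1 - m)"
proof (induction arbitrary: m rule: graded_induct)
  case (step q j x)
  have a1: "W (- 1 - int j) (K m x) \<in> gr (q + 2 + int j + 1 - m)"
    using W_gr[OF step(2)[of m], of "- 1 - int j"] by (simp add: algebra_simps)
  have a2: "K (m - 2 - int j) x \<in> gr (q + 2 + int j + 1 - m)"
    using step(2)[of "m - 2 - int j"] by (simp add: algebra_simps)
  have a3: "(if m = int j + 3 then vir_cocycle m else 0) *s x \<in> gr (q + 2 + int j + 1 - m)"
    using step(1) by (auto intro: gr_0 gr_scale)
  show ?case unfolding K_W by (rule gr_add[OF gr_add[OF a1 gr_scale[OF a2]] a3])
qed (auto simp: K_vac K.zero K.add K.scale gr_0 gr_add gr_scale)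


subsection \<open>The cocycle of the central charge\<close>

definition charge_cocycle :: "'v \<Rightarrow> int \<Rightarrow> 'v \<Rightarrow> 'v" where
  "charge_cocycle u n v = snd (Y2 (u, 0) n (v, 0))"

lemma fst_dpow: "fst (E.dpow j p) = V.dpow j (fst p)"
  and snd_dpow: "snd (E.dpow j p) = V.dpow j (snd p)"
proof -
  have "(W2 0 ^^ j) p = ((W 0 ^^ j) (fst p), (W 0 ^^ j) (snd p))" for j
    by (induction j) (auto simp: W2_def K_0)
  then show "fst (E.dpow j p) = V.dpow j (fst p)" "snd (E.dpow j p) = V.dpow j (snd p)"
    by (simp_all add: E.dpow_def V.dpow_def scale2_def)
qed

text \<open>Both sides obey the same recursion along words, since \<open>W2\<close> is
  \<open>W\<close> modulo \<open>t\<close>.\<close>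

lemma fst_deformed: "fst (deformed_family v u n) = Y (fst u) n v"
proof (induction v arbitrary: u n rule: word_induct)
  case vac
  then show ?case by (simp add: deformed_family fst_dpow Y_vac_right)
next
  case (step j x)
  have "fst (S2.binsum a (\<lambda>i. deformed_family x (W2 (int i) u) (k + n - int i)))
      = binsum a (\<lambda>i. Y (W (int i) (fst u)) (k + n - int i) x)" for k a
    by (subst S2.linear_binsum[OF linear_fst E.truncated_mode[OF mode_lin_deformed]]) (simp add: step W2_def)
  then show ?case
    unfolding deformed_family(4) E.lam_def by (simp add: step W2_def V.Y_W_eq)
qed (auto simp: deformed_family_0 deformed_family_add deformed_family_scale Yr.zero Yr.add Yr.scale fst_scale2)

text \<open>The product of \<open>u + t u'\<close> and \<open>v + t v'\<close> modulo
  \<open>t^2\<close>, expanded by bilinearity over the dual numbers.\<close>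

lemma Y2_eq: "Y2 (u, u') n (v, v') = (Y u n v, charge_cocycle u n v + Y u' n v + Y u n v')"
proof -
  have f: "fst (Y2 (u, u') n (v, v')) = Y u n v" for u u' v v'
    by (simp add: Y2_def fst_deformed t2_def)
  have "Y2 (u, u') n (v, v') = Y2 (u, 0) n (v, 0) + Y2 (t2 (u', 0)) n (v, 0) + t2 (deformed_family v' (u, u') n)"
  proof -
    have "Y2 (u, u') n (v, v') = Y2 (u, u') n (v, 0) + t2 (deformed_family v' (u, u') n)"
      by (simp add: Y2_def deformed_family_0 t2.zero)
    moreover have h: "(u, u') = (u, 0) + t2 (u', 0)" by (simp add: t2_def)
    have "Y2 (u, u') n (v, 0) = Y2 (u, 0) n (v, 0) + Y2 (t2 (u', 0)) n (v, 0)"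
      by (subst h) (rule E.Yl.add)
    ultimately show ?thesis by simp
  qed
  moreover have "Y2 (t2 (u', 0)) n (v, 0) = t2 (Y2 (u', 0) n (v, 0))"
    by (simp add: Y2_def t2_deformed deformed_family_0 t2.zero)
  ultimately have "snd (Y2 (u, u') n (v, v')) = charge_cocycle u n v + Y u' n v + Y u n v'"
    by (simp add: charge_cocycle_def t2_def f fst_deformed)
  then show ?thesis using f by (metis prod.collapse)
qed

lemma charge_cocycle_conformal: "charge_cocycle \<omega> n v = K n v"
proof -
  have "W2 (- 1) (vac, 0) = (\<omega>, 0)" by (simp add: W2_def K_vac creation(1) Yr.zero)
  then have "Y2 (\<omega>, 0) n (v, 0) = W2 n (v, 0)" using E.Y_conformal[of n "(v, 0)"] by simp
  then show ?thesis by (simp add: charge_cocycle_def W2_def Yr.zero)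
qed

text \<open>The derivatives of \<open>\<omega>_3 \<omega> = (c/2) 1\<close> and
  \<open>\<omega>_1 \<omega> = 2 \<omega>\<close> with respect to \<open>c\<close>.\<close>

lemma K_3_conformal: "K 3 \<omega> = (1 / 2) *s vac"
  and K_1_conformal: "K 1 \<omega> = 0"
  using K_W[of 3 0 vac] by (simp_all add: creation(1) K_vac K_0 Yr.zero vir_cocycle_def)

lemma linear_charge_cocycle:
  "Vector_Spaces.linear (*s) (*s) (\<lambda>v. charge_cocycle u n v)"
  "Vector_Spaces.linear (*s) (*s) (\<lambda>u. charge_cocycle u n v)"
proof -
  have p: "(x + y, 0) = (x, 0) + (y, 0 :: 'v)" "(a *s x, 0) = scale2 a (x, 0)" for x y a
    by (simp_all add: scale2_def)
  show "Vector_Spaces.linear (*s) (*s) (\<lambda>v. charge_cocycle u n v)"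
    "Vector_Spaces.linear (*s) (*s) (\<lambda>u. charge_cocycle u n v)"
    unfolding Vector_Spaces.linear_iff charge_cocycle_def p E.Yr.add E.Yr.scale E.Yl.add E.Yl.scale
    by (simp_all add: vector_space_axioms snd_scale2)
qed

sublocale Xr: Vector_Spaces.linear "(*s)" "(*s)" "\<lambda>v. charge_cocycle u n v" for u n
  by (rule linear_charge_cocycle)
sublocale Xl: Vector_Spaces.linear "(*s)" "(*s)" "\<lambda>u. charge_cocycle u n v" for n v
  by (rule linear_charge_cocycle)

lemma charge_cocycle_bounded: "\<exists>N. \<forall>n\<ge>N. charge_cocycle u n v = 0"
proof -
  obtain N where "\<forall>n\<ge>N. Y2 (u, 0) n (v, 0) = 0" using E.Y_bounded by blast
  then show ?thesis by (intro exI[of _ N]) (simp add: charge_cocycle_def)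
qed

lemma charge_cocycle_vac: "charge_cocycle vac n v = 0"
  by (simp add: charge_cocycle_def E.Y_vac_left)

lemma charge_cocycle_vac_right: "charge_cocycle u n vac = 0"
  by (simp add: charge_cocycle_def E.Y_vac_right snd_dpow V.dpow.zero)

lemma W2_0: "W2 0 (x, 0) = (D x, 0)"
  by (simp add: W2_def K_0 omega_derivation Yr.zero D_def)

lemma charge_cocycle_D: "charge_cocycle (D u) n v = (- of_int n) *s charge_cocycle u (n - 1) v"
proof -
  have "snd (Y2 (W2 0 (u, 0)) n (v, 0)) = snd (scale2 (- of_int n) (Y2 (u, 0) (n - 1) (v, 0)))"
    by (simp only: E.Y_D)
  then show ?thesis by (simp only: charge_cocycle_def W2_0 snd_scale2)
qed

text \<open>The \<open>t\<close>-part of the commutator formula for \<open>Y2\<close>.\<close>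

lemma charge_cocycle_commutator:
  "W k (charge_cocycle u n v) + K k (Y u n v) - (charge_cocycle u n (W k v) + Y u n (K k v))
    = binsum (of_int k) (\<lambda>i. charge_cocycle (W (int i) u) (k + n - int i) v + Y (K (int i) u) (k + n - int i) v)"
proof -
  have "snd (S2.binsum (of_int k) (\<lambda>i. Y2 (W2 (int i) (u, 0)) (k + n - int i) (v, 0)))
    = binsum (of_int k) (\<lambda>i. charge_cocycle (W (int i) u) (k + n - int i) v + Y (K (int i) u) (k + n - int i) v)"
    by (subst S2.linear_binsum[OF linear_snd E.truncated_YW]) (simp add: W2_def Y2_eq Yr.zero)
  then show ?thesis
    using arg_cong[OF E.commutator[of k "(u, 0)" n "(v, 0)"], of snd]
    by (simp add: W2_def Y2_eq Yr.zero Yl.zero)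
qed

lemma charge_cocycle_gr:
  assumes "u \<in> gr p" "v \<in> gr q"
  shows "charge_cocycle u n v \<in> gr (p + q - n - 1)"
  using assms(2,1)
proof (induction arbitrary: u p n rule: graded_induct)
  case (step q j x)
  define l where "l = - 1 - int j"
  have "charge_cocycle u n (W l x) = W l (charge_cocycle u n x)
      - binsum (of_int l) (\<lambda>i. charge_cocycle (W (int i) u) (l + n - int i) x + Y (K (int i) u) (l + n - int i) x)"
    using charge_cocycle_commutator[of l u n x] by (simp add: K_0 l_def Yr.zero algebra_simps)
  moreover have "charge_cocycle (W (int i) u) (l + n - int i) x \<in> gr (p + (q + 2 + int j) - n - 1)" for i
    using step(2)[OF W_gr[OF step(3), of "int i"], of "l + n - int i"] by (simp add: l_def algebra_simps)
  moreover have "Y (K (int i) u) (l + n - int i) x \<in> gr (p + (q + 2 + int j) - n - 1)" for i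
    using Y_gr[OF K_gr[OF step(3), of "int i"] step(1), of "l + n - int i"] by (simp add: l_def algebra_simps)
  moreover have "W l (charge_cocycle u n x) \<in> gr (p + (q + 2 + int j) - n - 1)"
    using W_gr[OF step(2)[OF step(3), of n], of l] by (simp add: l_def algebra_simps)
  ultimately show ?case unfolding l_def[symmetric] by (simp add: gr_diff gr_binsum gr_add)
qed (auto simp: charge_cocycle_vac_right Xr.zero Xr.add Xr.scale gr_0 gr_add gr_scale)

lemma esum_D_form:
  "V.esum n g = Sum_any (\<lambda>i::nat. ((-1) powi (- (n + int i) - 1) / fact i) *s (D ^^ i) (g (n + int i)))"
proof -
  have "(W 0 ^^ i) x = (D ^^ i) x" for i x
    by (induction i) (auto simp: omega_derivation)
  then show ?thesis unfolding V.esum_def by (simp add: V.dpow_def)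
qed

text \<open>The \<open>t\<close>-part of skew symmetry for \<open>Y2\<close>; \<open>D\<close>
  itself is not deformed.\<close>

lemma charge_cocycle_skew:
  "charge_cocycle u n v = Sum_any (\<lambda>i::nat. ((-1) powi (- (n + int i) - 1) / fact i) *s
                           (D ^^ i) (charge_cocycle v (n + int i) u))"
proof -
  obtain N where N: "\<And>q. q \<ge> N \<Longrightarrow> Y2 (v, 0) q (u, 0) = 0" using E.Y_bounded by blast
  have z: "Y2 (v, 0) q (u, 0) = 0" "charge_cocycle v q u = 0" if "q \<ge> n + int (nat (N - n))" for q
  proof -
    have "N \<le> q" using that by (simp split: if_splits)
    then show "Y2 (v, 0) q (u, 0) = 0" "charge_cocycle v q u = 0" by (simp_all add: N charge_cocycle_def)
  qed
  interpret s: Vector_Spaces.linear scale2 "(*s)" snd by (rule linear_snd)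
  have "charge_cocycle u n v = snd (E.esum n (\<lambda>q. Y2 (v, 0) q (u, 0)))"
    unfolding charge_cocycle_def using E.skew_symmetry by metis
  also have "\<dots> = V.esum n (\<lambda>q. charge_cocycle v q u)"
    by (subst E.esum_eq[of n "nat (N - n)"], rule z, simp, subst V.esum_eq[of n "nat (N - n)"], rule z, simp)
      (simp add: s.sum s.scale snd_dpow charge_cocycle_def)
  finally show ?thesis unfolding esum_D_form .
qed

end


section \<open>Laurent expansions of rational functions\<close>

definition abs_has_sum :: "('i \<Rightarrow> complex) \<Rightarrow> complex \<Rightarrow> bool" where
  "abs_has_sum f S \<longleftrightarrow> f abs_summable_on UNIV \<and> (f has_sum S) UNIV"

lemma abs_has_sum_reindex:
  assumes h: "inj h" and 0: "\<And>x. x \<notin> range h \<Longrightarrow> g x = 0"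
  shows "abs_has_sum g S \<longleftrightarrow> abs_has_sum (\<lambda>x. g (h x)) S"
proof -
  have "(g has_sum S) UNIV \<longleftrightarrow> (g has_sum S) (range h)"
    by (rule has_sum_cong_neutral) (use 0 in auto)
  moreover have "(g has_sum S) (range h) \<longleftrightarrow> ((\<lambda>x. g (h x)) has_sum S) UNIV"
    using has_sum_reindex[OF h, of g S] by (simp add: o_def)
  moreover have "g abs_summable_on UNIV \<longleftrightarrow> g abs_summable_on (range h)"
    by (rule summable_on_cong_neutral) (use 0 in auto)
  moreover have "g abs_summable_on (range h) \<longleftrightarrow> (\<lambda>x. g (h x)) abs_summable_on UNIV"
    using summable_on_reindex[OF h, of "\<lambda>x. norm (g x)"] by (simp add: o_def)
  ultimately show ?thesis by (simp add: abs_has_sum_def)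
qed

lemma abs_has_sum_0: "abs_has_sum (\<lambda>_. 0) 0"
  by (simp add: abs_has_sum_def)

lemma abs_has_sum_add:
  assumes "abs_has_sum f S" "abs_has_sum g T" shows "abs_has_sum (\<lambda>x. f x + g x) (S + T)"
proof -
  have "(\<lambda>x. norm (f x) + norm (g x)) summable_on UNIV"
    using assms by (intro summable_on_add) (auto simp: abs_has_sum_def)
  then have "(\<lambda>x. f x + g x) abs_summable_on UNIV"
    by (rule summable_on_comparison_test) (auto intro: norm_triangle_ineq)
  then show ?thesis using assms by (auto simp: abs_has_sum_def intro: has_sum_add)
qed

lemma abs_has_sum_cmult:
  assumes "abs_has_sum f S" shows "abs_has_sum (\<lambda>x. c * f x) (c * S)"
  using assms by (auto simp: abs_has_sum_def norm_mult intro!: has_sum_cmult_right summable_on_cmult_right)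

lemma abs_has_sum_sum:
  assumes "finite I" "\<And>i. i \<in> I \<Longrightarrow> abs_has_sum (f i) (S i)"
  shows "abs_has_sum (\<lambda>x. \<Sum>i\<in>I. f i x) (\<Sum>i\<in>I. S i)"
  using assms by (induction I rule: finite_induct) (auto simp: abs_has_sum_0 intro: abs_has_sum_add)

text \<open>Absolute convergence follows from convergence at a radius strictly between
  \<open>norm z\<close> and 1.\<close>

lemma abs_has_sum_binomial:
  fixes z :: complex
  assumes "norm z < 1"
  shows "abs_has_sum (\<lambda>l::nat. (of_int r gchoose l) * z ^ l) ((1 + z) powi r)"
proof -
  have "1 + z \<noteq> 0" using assms by (metis add_eq_0_iff norm_minus_cancel norm_one less_irrefl)
  then have "(\<lambda>l. (of_int r gchoose l) * z ^ l) sums ((1 + z) powi r)"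
    using gen_binomial_complex[OF assms, of "of_int r"] by (simp add: complex_powr_of_int)
  moreover have "summable (\<lambda>l. norm ((of_int r gchoose l) * z ^ l))"
  proof -
    obtain q where q: "norm z < q" "q < 1" using assms dense by blast
    have "0 < q" using q norm_ge_zero[of z] by linarith
    then have "norm (of_real q :: complex) = q" by simp
    then have "summable (\<lambda>l. (of_int r gchoose l) * (of_real q :: complex) ^ l)" "norm z < norm (of_real q :: complex)"
      using q by (auto intro: sums_summable[OF gen_binomial_complex])
    then show ?thesis by (rule powser_insidea)
  qed
  ultimately show ?thesis
    unfolding abs_has_sum_def
    using norm_summable_imp_has_sum norm_summable_imp_summable_on[of "\<lambda>l. norm ((of_int r gchoose l) * z ^ l)"]
    by auto
qed

text \<open>The value 0 at negative lower index makes the coefficient formulas below valid for every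
  integer mode.\<close>

definition ibin :: "int \<Rightarrow> int \<Rightarrow> complex" where
  "ibin q l = (if l < 0 then 0 else of_int q gchoose nat l)"

text \<open>The coefficients of \<open>z\<^sup>-\<^sup>m\<^sup>-\<^sup>1\<close>, \<open>(z - 1)\<^sup>-\<^sup>m\<^sup>-\<^sup>1\<close> and \<open>z\<^sup>-\<^sup>m\<^sup>-\<^sup>1\<close> in the expansions of \<open>z\<^sup>q (z - 1)\<^sup>r\<close> at
  \<open>\<infinity>\<close>, \<open>1\<close> and \<open>0\<close>, respectively.\<close>

definition exp_inf :: "int \<Rightarrow> int \<Rightarrow> int \<Rightarrow> complex" where
  "exp_inf q r m = (- 1) powi (q + r + m + 1) * ibin r (q + r + m + 1)"

definition exp_one :: "int \<Rightarrow> int \<Rightarrow> int \<Rightarrow> complex" where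
  "exp_one q r m = ibin q (- r - m - 1)"

definition exp_zero :: "int \<Rightarrow> int \<Rightarrow> int \<Rightarrow> complex" where
  "exp_zero q r m = (- 1) powi (r - q - m - 1) * ibin r (- q - m - 1)"

text \<open>The binomial series of \<open>z^(q+r) (1 - 1/z)^r\<close>.\<close>

lemma exp_inf_sum:
  assumes "norm z > 1"
  shows "abs_has_sum (\<lambda>m. exp_inf q r m * z powi (- m - 1)) (z powi q * (z - 1) powi r)"
proof -
  have z: "z \<noteq> 0" using assms by auto
  have "abs_has_sum (\<lambda>l. z powi (q + r) * ((of_int r gchoose l) * (- 1 / z) ^ l)) (z powi (q + r) * (1 + - 1 / z) powi r)"
  proof (intro abs_has_sum_cmult abs_has_sum_binomial)
    have "0 < norm z" using z by simp
    then show "norm (- 1 / z) < 1" using assms by (simp add: norm_divide divide_less_eq_1)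
  qed
  also have "z powi (q + r) * (1 + - 1 / z) powi r = z powi q * (z - 1) powi r"
  proof -
    have "(z * (1 + - 1 / z)) powi r = z powi r * (1 + - 1 / z) powi r" by (rule power_int_mult_distrib)
    moreover have "z * (1 + - 1 / z) = z - 1" using z by (simp add: field_simps)
    ultimately show ?thesis using z by (simp add: power_int_add)
  qed
  also have "(\<lambda>l. z powi (q + r) * ((of_int r gchoose l) * (- 1 / z) ^ l))
      = (\<lambda>l. exp_inf q r (int l - q - r - 1) * z powi (- (int l - q - r - 1) - 1))"
  proof (rule ext)
    fix l
    have "z powi (- (int l - q - r - 1) - 1) = z powi (q + r) * (1 / z) ^ l"
      using power_int_diff[of z "q + r" "int l"] z by (simp add: algebra_simps power_one_over)
    moreover have "(- 1 / z) ^ l = (- 1) ^ l * (1 / z) ^ l"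
      by (simp add: power_mult_distrib[symmetric])
    ultimately show "z powi (q + r) * ((of_int r gchoose l) * (- 1 / z) ^ l)
        = exp_inf q r (int l - q - r - 1) * z powi (- (int l - q - r - 1) - 1)"
      by (simp add: exp_inf_def ibin_def)
  qed
  finally have *: "abs_has_sum (\<lambda>l. exp_inf q r (int l - q - r - 1) * z powi (- (int l - q - r - 1) - 1)) (z powi q * (z - 1) powi r)" .
  have "exp_inf q r m = 0" if "m \<notin> range (\<lambda>l::nat. int l - q - r - 1)" for m
  proof -
    have "q + r + m + 1 < 0"
    proof (rule ccontr)
      assume "\<not> q + r + m + 1 < 0"
      then have "m = int (nat (q + r + m + 1)) - q - r - 1" by simp
      with that show False by blast
    qed
    then show ?thesis by (simp add: exp_inf_def ibin_def)
  qed
  then show ?thesis using *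
    by (subst abs_has_sum_reindex[of "\<lambda>l::nat. int l - q - r - 1"]) (auto simp: inj_on_def mult.commute)
qed

lemma exp_one_sum:
  assumes "0 < norm w" "norm w < 1"
  shows "abs_has_sum (\<lambda>m. exp_one q r m * w powi (- m - 1)) ((1 + w) powi q * w powi r)"
proof -
  have w: "w \<noteq> 0" using assms by auto
  have "abs_has_sum (\<lambda>l. w powi r * ((of_int q gchoose l) * w ^ l)) (w powi r * (1 + w) powi q)"
    by (intro abs_has_sum_cmult abs_has_sum_binomial assms)
  also have "(\<lambda>l. w powi r * ((of_int q gchoose l) * w ^ l))
      = (\<lambda>l. exp_one q r (- r - 1 - int l) * w powi (- (- r - 1 - int l) - 1))"
    using w by (simp add: exp_one_def ibin_def power_int_add fun_eq_iff)
  finally have *: "abs_has_sum (\<lambda>l. exp_one q r (- r - 1 - int l) * w powi (- (- r - 1 - int l) - 1)) (w powi r * (1 + w) powi q)" .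
  have "exp_one q r m = 0" if "m \<notin> range (\<lambda>l::nat. - r - 1 - int l)" for m
  proof -
    have "- r - m - 1 < 0"
    proof (rule ccontr)
      assume "\<not> - r - m - 1 < 0"
      then have "m = - r - 1 - int (nat (- r - m - 1))" by simp
      with that show False by blast
    qed
    then show ?thesis by (simp add: exp_one_def ibin_def)
  qed
  then show ?thesis using *
    by (subst abs_has_sum_reindex[of "\<lambda>l::nat. - r - 1 - int l"]) (auto simp: inj_on_def mult.commute)
qed

text \<open>The binomial series of \<open>(-1)^r z^q (1 - z)^r\<close>.\<close>

lemma exp_zero_sum:
  assumes "0 < norm z" "norm z < 1"
  shows "abs_has_sum (\<lambda>m. exp_zero q r m * z powi (- m - 1)) (z powi q * (z - 1) powi r)"
proof -
  have z: "z \<noteq> 0" using assms by auto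
  have "abs_has_sum (\<lambda>l. ((- 1) powi r * z powi q) * ((of_int r gchoose l) * (- z) ^ l)) (((- 1) powi r * z powi q) * (1 + - z) powi r)"
    by (intro abs_has_sum_cmult abs_has_sum_binomial) (use assms in simp)
  also have "((- 1) powi r * z powi q) * (1 + - z) powi r = z powi q * (z - 1) powi r"
    using power_int_mult_distrib[of "-1" "1 + - z" r] by simp
  also have "(\<lambda>l. ((- 1) powi r * z powi q) * ((of_int r gchoose l) * (- z) ^ l))
      = (\<lambda>l. exp_zero q r (- q - 1 - int l) * z powi (- (- q - 1 - int l) - 1))"
  proof (rule ext)
    fix l
    have "r - q - (- q - 1 - int l) - 1 = r + int l" by simp
    moreover have "(- z) ^ l = (- 1) ^ l * z ^ l" by (metis power_minus)
    ultimately show "((- 1) powi r * z powi q) * ((of_int r gchoose l) * (- z) ^ l)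
        = exp_zero q r (- q - 1 - int l) * z powi (- (- q - 1 - int l) - 1)"
      using z by (simp add: exp_zero_def ibin_def power_int_add)
  qed
  finally have *: "abs_has_sum (\<lambda>l. exp_zero q r (- q - 1 - int l) * z powi (- (- q - 1 - int l) - 1)) (z powi q * (z - 1) powi r)" .
  have "exp_zero q r m = 0" if "m \<notin> range (\<lambda>l::nat. - q - 1 - int l)" for m
  proof -
    have "- q - m - 1 < 0"
    proof (rule ccontr)
      assume "\<not> - q - m - 1 < 0"
      then have "m = - q - 1 - int (nat (- q - m - 1))" by simp
      with that show False by blast
    qed
    then show ?thesis by (simp add: exp_zero_def ibin_def)
  qed
  then show ?thesis using *
    by (subst abs_has_sum_reindex[of "\<lambda>l::nat. - q - 1 - int l"]) (auto simp: inj_on_def mult.commute)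
qed

section \<open>Uniqueness of Laurent coefficients\<close>

lemma power_series_zero:
  fixes c :: "nat \<Rightarrow> complex"
  assumes "\<And>x. 0 < norm x \<Longrightarrow> norm x < 1 \<Longrightarrow> ((\<lambda>n. c n * x ^ n) has_sum 0) UNIV"
  shows "c n = 0"
proof (induction n rule: less_induct)
  case (less n)
  have "(\<lambda>k. c (k + n) * x ^ k) sums 0" if x: "x \<noteq> 0" "norm x < 1" for x
  proof -
    have "(\<lambda>n. c n * x ^ n) sums 0"
      using assms[of x] x by (simp add: has_sum_imp_sums)
    then have "(\<lambda>k. c (k + n) * x ^ (k + n)) sums (0 - (\<Sum>i<n. c i * x ^ i))"
      by (rule sums_split_initial_segment)
    also have "(\<Sum>i<n. c i * x ^ i) = 0" using less by simp
    finally have "(\<lambda>k. (1 / x ^ n) * (c (k + n) * x ^ (k + n))) sums ((1 / x ^ n) * (0 - 0))"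
      by (rule sums_mult)
    then show ?thesis using x by (simp add: power_add)
  qed
  \<comment> \<open>The hypothesis says nothing at \<open>x = 0\<close>, so the coefficient is read
    off as a limit.\<close>
  then have "((\<lambda>x. 0) \<longlongrightarrow> c (0 + n)) (at (0::complex))"
    by (intro powser_limit_0_strong[OF zero_less_one]) simp
  then show ?case using LIM_const_eq by fastforce
qed

lemma laurent_zero:
  fixes b :: "int \<Rightarrow> complex"
  assumes b: "\<And>m. m < M \<Longrightarrow> b m = 0"
    and sum: "\<And>x. 0 < norm x \<Longrightarrow> norm x < 1 \<Longrightarrow> ((\<lambda>m. b m * x powi m) has_sum 0) UNIV"
  shows "b m = 0"
proof -
  have "b (M + int n) = 0" for n
  proof (rule power_series_zero[of "\<lambda>n. b (M + int n)"])
    fix x :: complex assume x: "0 < norm x" "norm x < 1"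
    then have x0: "x \<noteq> 0" by auto
    let ?h = "\<lambda>n::nat. M + int n"
    have "((\<lambda>m. b m * x powi m) has_sum 0) UNIV \<longleftrightarrow> ((\<lambda>m. b m * x powi m) has_sum 0) (range ?h)"
    proof (rule has_sum_cong_neutral)
      fix m assume "m \<in> UNIV - range ?h"
      then have "m < M" by (metis DiffD2 le_iff_add nonneg_int_cases not_less range_eqI zle_iff_zadd)
      then show "b m * x powi m = 0" by (simp add: b)
    qed auto
    also have "\<dots> \<longleftrightarrow> ((\<lambda>n. b (M + int n) * x powi (M + int n)) has_sum 0) UNIV"
      by (subst has_sum_reindex) (auto simp: inj_on_def o_def)
    finally have "((\<lambda>n. b (M + int n) * x powi (M + int n)) has_sum 0) UNIV" using sum[OF x] by simp
    from has_sum_cmult_right[OF this, of "x powi (- M)"]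
    have "((\<lambda>n. x powi (- M) * (b (M + int n) * x powi (M + int n))) has_sum 0) UNIV" by simp
    moreover have "x powi (- M) * (b (M + int n) * x powi (M + int n)) = b (M + int n) * x ^ n" for n
      using x0 by (simp add: power_int_add power_int_minus)
    ultimately show "((\<lambda>n. b (M + int n) * x ^ n) has_sum 0) UNIV" by simp
  qed
  then show ?thesis using b[of m] by (metis add_diff_cancel_left' le_iff_diff_le_0 nonneg_int_cases not_less diff_add_cancel add.commute diff_ge_0_iff_ge)
qed

lemma has_sum_minus:
  fixes f g :: "'i \<Rightarrow> complex"
  assumes "(f has_sum S) A" "(g has_sum T) A"
  shows "((\<lambda>x. f x - g x) has_sum (S - T)) A"
  using has_sum_add[OF assms(1) has_sum_cmult_right[OF assms(2), of "-1"]] by simp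

text \<open>The substitution \<open>z = 1/x\<close> leads to the punctured disc at 0.\<close>

lemma laurent_unique_inf:
  fixes f g :: "int \<Rightarrow> complex"
  assumes "\<And>m. m < M \<Longrightarrow> f m = 0" "\<And>m. m < M \<Longrightarrow> g m = 0"
    and "\<And>z. norm z > 1 \<Longrightarrow> ((\<lambda>m. f m * z powi (- m - 1)) has_sum S z) UNIV"
    and "\<And>z. norm z > 1 \<Longrightarrow> ((\<lambda>m. g m * z powi (- m - 1)) has_sum S z) UNIV"
  shows "f m = g m"
proof -
  define b where "b m = f (m - 1) - g (m - 1)" for m
  have "b (m + 1) = 0"
  proof (rule laurent_zero[of "M + 1"])
    fix x :: complex assume x: "0 < norm x" "norm x < 1"
    then have z: "norm (inverse x) > 1" by (simp add: norm_inverse one_less_inverse_iff)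
    from has_sum_minus[OF assms(3)[OF z] assms(4)[OF z]]
    have s: "((\<lambda>m. (f m - g m) * inverse x powi (- m - 1)) has_sum 0) UNIV"
      by (simp add: algebra_simps)
    have "bij (\<lambda>m::int. m - 1)" by (rule bij_betwI[of _ _ _ "\<lambda>m. m + 1"]) auto
    from has_sum_reindex_bij_betw[OF this, of "\<lambda>m. (f m - g m) * inverse x powi (- m - 1)" 0] s
    have "((\<lambda>m. b m * inverse x powi (- (m - 1) - 1)) has_sum 0) UNIV" by (simp add: b_def)
    then show "((\<lambda>m. b m * x powi m) has_sum 0) UNIV"
      by (simp add: power_int_inverse power_int_minus)
  qed (simp add: b_def assms)
  then show ?thesis by (simp add: b_def)
qed

lemma laurent_unique_point:
  fixes f g :: "int \<Rightarrow> complex"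
  assumes "\<And>m. m \<ge> N \<Longrightarrow> f m = 0" "\<And>m. m \<ge> N \<Longrightarrow> g m = 0"
    and "\<And>w. 0 < norm w \<Longrightarrow> norm w < 1 \<Longrightarrow> ((\<lambda>m. f m * w powi (- m - 1)) has_sum S w) UNIV"
    and "\<And>w. 0 < norm w \<Longrightarrow> norm w < 1 \<Longrightarrow> ((\<lambda>m. g m * w powi (- m - 1)) has_sum S w) UNIV"
  shows "f m = g m"
proof -
  define b where "b m = f (- m - 1) - g (- m - 1)" for m
  have "b (- m - 1) = 0"
  proof (rule laurent_zero[of "- N"])
    fix x :: complex assume x: "0 < norm x" "norm x < 1"
    from has_sum_minus[OF assms(3)[OF x] assms(4)[OF x]]
    have s: "((\<lambda>m. (f m - g m) * x powi (- m - 1)) has_sum 0) UNIV"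
      by (simp add: algebra_simps)
    have "bij (\<lambda>m::int. - m - 1)" by (rule bij_betwI[of _ _ _ "\<lambda>m. - m - 1"]) auto
    from has_sum_reindex_bij_betw[OF this, of "\<lambda>m. (f m - g m) * x powi (- m - 1)" 0] s
    show "((\<lambda>m. b m * x powi m) has_sum 0) UNIV" by (simp add: b_def)
  qed (simp add: b_def assms)
  then show ?thesis by (simp add: b_def)
qed

section \<open>Binomial forms of the residue theorem\<close>

lemma ibin_negate: "ibin q l = (- 1) powi l * ibin (l - 1 - q) l"
proof (cases "l < 0")
  case False
  then obtain n where l: "l = int n" using nonneg_int_cases[of l] by auto
  have "(of_int q gchoose n :: complex) = (- 1) ^ n * (of_nat n - of_int q - 1 gchoose n)"
    by (rule gbinomial_negated_upper)
  moreover have "of_nat n - of_int q - 1 = (of_int (int n - 1 - q) :: complex)" by simp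
  ultimately show ?thesis
    unfolding l by (simp only: ibin_def sgn_powi(3)) simp
qed (simp add: ibin_def)

text \<open>The residue theorem for \<open>z^(q+m) (z - 1)^r\<close>: the right-hand side is its
  residue at 1, the coefficient of \<open>w^(-r-1)\<close> in \<open>(1 + w)^(q+m)\<close>.\<close>

lemma ibin_residue: "exp_inf q r m - exp_zero q r m = ibin (q + m) (- r - 1)"
proof -
  define Q where "Q = q + m"
  have sym: "ibin (int a) (int b) = ibin (int a) (int a - int b)" for a b
  proof (cases "b \<le> a")
    case True
    then have "nat (int a - int b) = a - b" by simp
    then show ?thesis using True
      by (simp add: ibin_def binomial_gbinomial[symmetric] binomial_symmetric[of b a])
  next
    case False
    then show ?thesis by (simp add: ibin_def binomial_gbinomial[symmetric])
  qed
  have "(- 1) powi (Q + r + 1) * ibin r (Q + r + 1) - (- 1) powi (r - Q - 1) * ibin r (- Q - 1) = ibin Q (- r - 1)"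
  \<comment> \<open>Without a pole at 1 the function is a Laurent polynomial: its two expansions
    coincide and the residue is zero.\<close>
  proof (cases "r \<ge> 0")
    case True
    then obtain a where a: "r = int a" using nonneg_int_cases by blast
    have "ibin r (Q + r + 1) = ibin r (- Q - 1)"
    proof (cases "Q + r + 1 \<ge> 0")
      case True
      then obtain b where b: "Q + r + 1 = int b" using nonneg_int_cases by blast
      have "- Q - 1 = int a - int b" using a b by simp
      then show ?thesis unfolding a[symmetric] b using sym[of a b] a by simp
    next
      case False
      then obtain b where b: "- Q - 1 = int b" using a nonneg_int_cases[of "- Q - 1"] by auto
      have "b > a" using False a b by simp
      then show ?thesis using False by (simp add: ibin_def a b binomial_gbinomial[symmetric])
    qed
    moreover have "(- 1 :: complex) powi (r - Q - 1) = (- 1) powi (Q + r + 1)"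
    proof -
      have "r - Q - 1 = Q + r + 1 + - (Q + 1) + - (Q + 1)" by simp
      then show ?thesis by (simp only: sgn_powi(1)) (simp add: sgn_powi mult.assoc)
    qed
    ultimately show ?thesis using True by (simp add: ibin_def[of Q])
  next
    \<comment> \<open>For a pole of order \<open>t + 1\<close> the upper indices are negated;
      according to the sign of \<open>Q\<close> only one of the two expansions contributes.\<close>
    case False
    then obtain t where t: "- r - 1 = int t" using nonneg_int_cases[of "- r - 1"] by auto
    then have r: "r = - 1 - int t" by simp
    have 1: "(- 1) powi l * ibin r l = ibin (l + int t) l" for l
      unfolding r by (subst ibin_negate) (simp add: sgn_powi(5) algebra_simps)
    have e1: "(- 1) powi (Q + r + 1) * ibin r (Q + r + 1) = ibin Q (Q - int t)"
      unfolding 1 by (simp add: r)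
    have e2: "(- 1) powi (r - Q - 1) * ibin r (- Q - 1) = (- 1) powi r * ibin (- Q - 1 + int t) (- Q - 1)"
    proof -
      have "r - Q - 1 = r + (- Q - 1)" by simp
      then show ?thesis by (simp only: sgn_powi(1) mult.assoc 1)
    qed
    show ?thesis
    proof (cases "Q \<ge> 0")
      case True
      then obtain a where "Q = int a" using nonneg_int_cases by blast
      then show ?thesis unfolding e1 e2 t using sym[of a t] by (simp add: ibin_def)
    next
      case False
      then obtain b where b: "- Q - 1 = int b" using nonneg_int_cases[of "- Q - 1"] by auto
      have "ibin Q (Q - int t) = 0" using False by (simp add: ibin_def)
      moreover have "ibin Q (int t) = (- 1) powi (int t) * ibin (int b + int t) (int t)"
        by (subst ibin_negate) (simp add: b[symmetric] algebra_simps)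
      moreover have "ibin (int b + int t) (int t) = ibin (int b + int t) (int b)"
        using sym[of "b + t" t] by simp
      moreover have "(- 1 :: complex) powi r = - ((- 1) powi int t)"
      proof -
        have "r = - (1 + int t)" using r by simp
        then show ?thesis by (simp only: sgn_powi(2)) (simp only: sgn_powi(1), simp)
      qed
      ultimately show ?thesis by (simp only: e1 e2 t) (simp add: b)
    qed
  qed
  moreover have "q + r + m + 1 = Q + r + 1" "r - q - m - 1 = r - Q - 1" "- q - m - 1 = - Q - 1" "q + m = Q"
    by (simp_all add: Q_def)
  ultimately show ?thesis
    unfolding exp_inf_def exp_zero_def by (simp only:)
qed

interpretation cx: complex_space "(*)"
  by unfold_locales (auto simp: algebra_simps)

lemma ibin_vandermonde: "cx.binsum (of_int a) (\<lambda>i. ibin b (L - int i)) = ibin (a + b) L"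
proof (cases "L < 0")
  case False
  then obtain N where N: "L = int N" using nonneg_int_cases[of L] by auto
  have "cx.binsum (of_int a) (\<lambda>i. ibin b (L - int i)) = (\<Sum>i<Suc N. (of_int a gchoose i) * ibin b (L - int i))"
    by (rule cx.binsum_eq) (simp add: ibin_def N)
  also have "\<dots> = (\<Sum>i\<le>N. (of_int a gchoose i) * (of_int b gchoose (N - i)))"
    by (intro sum.cong) (auto simp: ibin_def N nat_diff_distrib)
  also have "\<dots> = ibin (a + b) L"
    by (simp add: gbinomial_Vandermonde atMost_atLeast0 ibin_def N)
  finally show ?thesis .
qed (simp add: ibin_def)

lemma truncated_ibin: "truncated (\<lambda>i. c * ibin b (L - int i))"
  by (rule truncatedI[of "nat (L + 1)"]) (auto simp: ibin_def)


text \<open>This is the source of the Kronecker delta in the duality of expansion coefficients used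
  next.\<close>

lemma ibin_self_pred: "ibin (l - 1) l = (if l = 0 then 1 else 0)"
proof -
  consider "l < 0" | "l = 0" | "l > 0" by linarith
  then show ?thesis
  proof cases
    case 3
    then obtain b where b: "l = int (Suc b)" using zero_less_imp_eq_int gr0_implies_Suc by blast
    have "(of_nat b gchoose Suc b :: complex) = 0"
      by (simp add: binomial_gbinomial[symmetric])
    then show ?thesis using 3 by (simp add: b ibin_def nat_add_distrib)
  qed (auto simp: ibin_def)
qed

text \<open>The iterate and product coefficients that satisfy weak associativity are the expansions at \<open>1\<close>
  and \<open>\<infinity>\<close> of one rational function, with poles only at \<open>0\<close> and \<open>1\<close>.\<close>

lemma weak_associativity_expansion:
  fixes A C :: "int \<Rightarrow> complex"
  assumes A: "\<And>m. m < M \<Longrightarrow> A m = 0" and C: "\<And>m. m \<ge> N \<Longrightarrow> C m = 0"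
    and WA: "\<And>n. cx.binsum (of_nat a) (\<lambda>i. C (n + int i))
               = cx.binsum (of_int n) (\<lambda>i. (- 1) ^ i * A (int a + n - int i))"
  defines "ct \<equiv> \<lambda>n. cx.binsum (of_nat a) (\<lambda>i. C (n + int i))"
    and "J \<equiv> {M - int a..<N}"
  shows "A m = (\<Sum>n\<in>J. ct n * exp_inf (- int a) (- n - 1) m)"
    and "C m = (\<Sum>n\<in>J. ct n * exp_one (- int a) (- n - 1) m)"
proof -
  \<comment> \<open>\<open>ct n\<close> is to be the coefficient of \<open>(z - 1)^(-n-1)\<close> in
    \<open>z^a f\<close> for the function \<open>f\<close> sought. Finitely many are nonzero, so
    \<open>f\<close> is the sum of the \<open>ct n z^(-a) (z - 1)^(-n-1)\<close>.\<close>
  have ct_high: "ct n = 0" if "n \<ge> N" for n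
    using that by (simp add: ct_def C)
  have ct_low: "ct n = 0" if "n < M - int a" for n
  proof -
    have "A (int a + n - int i) = 0" for i using that by (intro A) simp
    then show ?thesis unfolding ct_def WA by simp
  qed
  have trC: "truncated (\<lambda>i. C (k + int i))" for k by (rule truncatedI[of "nat (N - k)"]) (simp add: C)
  show "C m = (\<Sum>n\<in>J. ct n * exp_one (- int a) (- n - 1) m)"
  proof -
    \<comment> \<open>Division by \<open>(1 + w)^a\<close>, in the form
      \<open>(1 + S)^(-a) (1 + S)^a = 1\<close>.\<close>
    have "C m = cx.binsum (- of_nat a) (\<lambda>l. cx.binsum (of_nat a) (\<lambda>i. C (m + int (l + i))))"
      by (subst cx.binsum_vandermonde[OF trC]) (simp add: cx.binsum_at_0)
    also have "\<dots> = cx.binsum (of_int (- int a)) (\<lambda>l. ct (m + int l))"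
      by (simp add: ct_def add.assoc)
    also have "\<dots> = (\<Sum>l<nat (N - m). (of_int (- int a) gchoose l) * ct (m + int l))"
      by (rule cx.binsum_eq) (simp add: ct_high)
    also have "\<dots> = (\<Sum>n\<in>{m..<N}. ct n * ibin (- int a) (n - m))"
      by (rule sum.reindex_bij_witness[of _ "\<lambda>n. nat (n - m)" "\<lambda>l. m + int l"]) (auto simp: ibin_def)
    also have "\<dots> = (\<Sum>n\<in>J. ct n * ibin (- int a) (n - m))"
      unfolding J_def by (rule sum.mono_neutral_cong) (auto simp: ct_low ibin_def)
    finally show ?thesis by (simp add: exp_one_def)
  qed
  \<comment> \<open>The expected expansion at infinity. It satisfies the same linear equations as
    \<open>A\<close>, and these determine a sequence that vanishes at small indices.\<close>
  define A' where "A' m = (\<Sum>n\<in>J. ct n * exp_inf (- int a) (- n - 1) m)" for m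
  have e0: "exp_inf (- int a) (- n - 1) m = 0" if "m < int a + n" for n m
    using that by (simp add: exp_inf_def ibin_def)
  have A'0: "A' m = 0" if "m < M" for m
    unfolding A'_def J_def using that by (intro sum.neutral ballI) (simp add: e0)
  \<comment> \<open>The functional with index \<open>n\<close> takes the coefficient of
    \<open>1/z\<close> in \<open>z^a (z - 1)^n f\<close> at infinity; on
    \<open>z^(-a) (z - 1)^(-n'-1)\<close> this is a Kronecker delta.\<close>
  have delta: "cx.binsum (of_int n) (\<lambda>i. (- 1) ^ i * exp_inf (- int a) (- n' - 1) (int a + n - int i))
      = (if n = n' then 1 else 0)" for n n'
  proof -
    have "(- 1) ^ i * exp_inf (- int a) (- n' - 1) (int a + n - int i)
        = (- 1) powi (n - n') * ibin (- n' - 1) (n - n' - int i)" for i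
    proof -
      have "- int a + (- n' - 1) + (int a + n - int i) + 1 = n - n' + - int i" by simp
      then have "exp_inf (- int a) (- n' - 1) (int a + n - int i)
          = (- 1) powi (n - n' + - int i) * ibin (- n' - 1) (n - n' - int i)"
        by (simp only: exp_inf_def) simp
      moreover have "(- 1) ^ i * (- 1) powi (n - n' + - int i) = ((- 1) powi (n - n') :: complex)"
        by (simp only: sgn_powi(3)[symmetric] sgn_powi(1)[symmetric]) simp
      ultimately show ?thesis by (simp only: mult.assoc[symmetric])
    qed
    then have "cx.binsum (of_int n) (\<lambda>i. (- 1) ^ i * exp_inf (- int a) (- n' - 1) (int a + n - int i))
        = (- 1) powi (n - n') * ibin (n + (- n' - 1)) (n - n')"
      using cx.binsum_scale[OF truncated_ibin[of 1 "- n' - 1" "n - n'"], of "of_int n" "(- 1) powi (n - n')"]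
      by (simp add: ibin_vandermonde)
    also have "n + (- n' - 1) = (n - n') - 1" by simp
    finally show ?thesis unfolding ibin_self_pred by simp
  qed
  have A'_ct: "cx.binsum (of_int n) (\<lambda>i. (- 1) ^ i * A' (int a + n - int i)) = ct n" for n
  proof -
    define K where "K = nat (n - (M - int a) + 1)"
    have z: "exp_inf (- int a) (- n' - 1) (int a + n - int i) = 0" if "i \<ge> K" "n' \<in> J" for i n'
      using that by (intro e0) (auto simp: K_def J_def)
    have "cx.binsum (of_int n) (\<lambda>i. (- 1) ^ i * A' (int a + n - int i))
        = (\<Sum>i<K. (of_int n gchoose i) * ((- 1) ^ i * A' (int a + n - int i)))"
      by (rule cx.binsum_eq) (simp add: A'_def z)
    also have "\<dots> = (\<Sum>n'\<in>J. ct n' * (\<Sum>i<K. (of_int n gchoose i) * ((- 1) ^ i * exp_inf (- int a) (- n' - 1) (int a + n - int i))))"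
      unfolding A'_def sum_distrib_left by (subst sum.swap) (simp add: mult_ac)
    also have "\<dots> = (\<Sum>n'\<in>J. ct n' * (if n = n' then 1 else 0))"
    proof (intro sum.cong refl arg_cong2[of _ _ _ _ "(*)"])
      fix n' assume "n' \<in> J"
      then show "(\<Sum>i<K. (of_int n gchoose i) * ((- 1) ^ i * exp_inf (- int a) (- n' - 1) (int a + n - int i)))
          = (if n = n' then 1 else 0)"
        unfolding delta[symmetric] by (intro cx.binsum_eq[symmetric]) (simp add: z)
    qed
    also have "\<dots> = ct n"
      using ct_low[of n] ct_high[of n] by (cases "n \<in> J") (auto simp: J_def not_less if_distrib[of "\<lambda>x. _ * x"] cong: if_cong)
    finally show ?thesis .
  qed
  \<comment> \<open>The system is triangular: the equation with leading index \<open>M + k\<close>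
    otherwise involves smaller indices only.\<close>
  have "A (M + int k) - A' (M + int k) = 0" for k
  proof (induction k rule: less_induct)
    case (less k)
    define n where "n = M + int k - int a"
    have z: "A (int a + n - int i) - A' (int a + n - int i) = 0" if "i \<ge> 1" for i
    proof (cases "i \<le> k")
      case True
      then have idx: "int a + n - int i = M + int (k - i)" by (simp add: n_def)
      show ?thesis unfolding idx using less[of "k - i"] that True by simp
    qed (simp add: n_def A A'0)
    have t: "truncated (\<lambda>i. (- 1) ^ i * A (int a + n - int i))" "truncated (\<lambda>i. (- 1) ^ i * A' (int a + n - int i))"
      by (rule truncatedI[of "k + 1"], simp add: n_def A, rule truncatedI[of "k + 1"], simp add: n_def A'0)
    have "0 = cx.binsum (of_int n) (\<lambda>i. (- 1) ^ i * A (int a + n - int i))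
        - cx.binsum (of_int n) (\<lambda>i. (- 1) ^ i * A' (int a + n - int i))"
      unfolding A'_ct by (simp add: ct_def WA)
    also have "\<dots> = cx.binsum (of_int n) (\<lambda>i. (- 1) ^ i * (A (int a + n - int i) - A' (int a + n - int i)))"
      by (simp only: cx.binsum_diff[OF t, symmetric] right_diff_distrib)
    also have "\<dots> = (\<Sum>i<1. (of_int n gchoose i) * ((- 1) ^ i * (A (int a + n - int i) - A' (int a + n - int i))))"
      by (rule cx.binsum_eq) (simp only: z mult_zero_right)
    also have "\<dots> = A (M + int k) - A' (M + int k)" by (simp add: n_def)
    finally show ?case ..
  qed
  from this[of "nat (m - M)"] show "A m = (\<Sum>n\<in>J. ct n * exp_inf (- int a) (- n - 1) m)"
    unfolding A'_def[symmetric] using A[of m] A'0[of m] by (cases "m < M") auto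
qed

section \<open>From weak associativity to rational functions of two variables\<close>

lemma abs_has_sum_diagonal:
  fixes g :: "int \<times> int \<Rightarrow> complex"
  shows "abs_has_sum (\<lambda>(m, n). if m + n = s then g (m, n) else 0) S \<longleftrightarrow> abs_has_sum (\<lambda>m. g (m, s - m)) S"
proof -
  have "p \<in> range (\<lambda>m. (m, s - m))" if "fst p + snd p = s" for p :: "int \<times> int"
    using that by (intro image_eqI[of _ _ "fst p"]) (auto simp: prod_eq_iff)
  then have "(case p of (m, n) \<Rightarrow> if m + n = s then g (m, n) else 0) = 0" if "p \<notin> range (\<lambda>m. (m, s - m))" for p
    using that by (cases p) fastforce
  then show ?thesis
    by (subst abs_has_sum_reindex[of "\<lambda>m. (m, s - m)"]) (auto simp: inj_on_def)
qed

lemma abs_has_sum_diagonals: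
  fixes g :: "int \<times> int \<Rightarrow> complex"
  assumes S: "finite S" and 0: "\<And>m n. m + n \<notin> S \<Longrightarrow> g (m, n) = 0"
    and sum: "\<And>s. s \<in> S \<Longrightarrow> abs_has_sum (\<lambda>m. g (m, s - m)) (T s)"
  shows "abs_has_sum g (\<Sum>s\<in>S. T s)"
proof -
  have "abs_has_sum (\<lambda>p. \<Sum>s\<in>S. (case p of (m, n) \<Rightarrow> if m + n = s then g (m, n) else 0)) (\<Sum>s\<in>S. T s)"
    by (rule abs_has_sum_sum[OF S]) (simp add: abs_has_sum_diagonal sum)
  moreover have "(\<Sum>s\<in>S. (case p of (m, n) \<Rightarrow> if m + n = s then g (m, n) else 0)) = g p" for p
    using 0 S by (cases p) (auto simp: sum.delta)
  ultimately show ?thesis by simp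
qed

text \<open>Only finitely many diagonals \<open>m + n = s\<close> contribute. On each the series is
  homogeneous of degree \<open>- s - 2\<close>, thus \<open>z2^(-s-2)\<close> times a series in
  \<open>z1/z2\<close>, which \<open>weak_associativity_expansion\<close> sums.\<close>

lemma duality_of_weak_associativity:
  fixes a c :: "int \<Rightarrow> int \<Rightarrow> complex"
  assumes S: "finite S" and a_S: "\<And>m n. m + n \<notin> S \<Longrightarrow> a m n = 0" and c_S: "\<And>m n. m + n \<notin> S \<Longrightarrow> c m n = 0"
    and a_N: "\<And>m n. n \<ge> N \<Longrightarrow> a m n = 0" and c_N: "\<And>m n. m \<ge> N' \<Longrightarrow> c m n = 0"
    and WA: "\<And>n k. cx.binsum (of_nat a0) (\<lambda>i. c (n + int i) (int a0 + k - int i))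
               = cx.binsum (of_int n) (\<lambda>i. (- 1) ^ i * a (int a0 + n - int i) (k + int i))"
  shows "\<exists>(P :: complex poly poly) p b k. \<forall>z1 z2.
     (let R = poly (poly P [:z2:]) z1 / (z1 ^ p * z2 ^ b * (z1 - z2) ^ k) in
      (cmod z1 > cmod z2 \<and> cmod z2 > 0 \<longrightarrow>
        abs_has_sum (\<lambda>(m, n). a m n * z1 powi (- m - 1) * z2 powi (- n - 1)) R) \<and>
      (cmod z2 > cmod (z1 - z2) \<and> cmod (z1 - z2) > 0 \<longrightarrow>
        abs_has_sum (\<lambda>(m, n). c m n * (z1 - z2) powi (- m - 1) * z2 powi (- n - 1)) R))"
proof -
  define ct where "ct s n = cx.binsum (of_nat a0) (\<lambda>i. c (n + int i) (s - (n + int i)))" for s n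
  \<comment> \<open>On the diagonal \<open>s\<close> the product coefficients vanish when
    \<open>s - m \<ge> N\<close>, that is for \<open>m < s - N + 1\<close>.\<close>
  define J where "J s = {s - N + 1 - int a0..<N'}" for s
  have exps: "a m (s - m) = (\<Sum>n\<in>J s. ct s n * exp_inf (- int a0) (- n - 1) m)"
    "c m (s - m) = (\<Sum>n\<in>J s. ct s n * exp_one (- int a0) (- n - 1) m)" for s m
  proof -
    have WA': "cx.binsum (of_nat a0) (\<lambda>i. c (n + int i) (s - (n + int i)))
               = cx.binsum (of_int n) (\<lambda>i. (- 1) ^ i * a (int a0 + n - int i) (s - (int a0 + n - int i)))" for n
      using WA[of n "s - int a0 - n"] by (simp add: algebra_simps)
    show "a m (s - m) = (\<Sum>n\<in>J s. ct s n * exp_inf (- int a0) (- n - 1) m)"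
      unfolding J_def ct_def
      by (rule weak_associativity_expansion(1)[where A = "\<lambda>m. a m (s - m)" and C = "\<lambda>m. c m (s - m)" and N = N'])
        (use a_N c_N WA' in auto)
    show "c m (s - m) = (\<Sum>n\<in>J s. ct s n * exp_one (- int a0) (- n - 1) m)"
      unfolding J_def ct_def
      by (rule weak_associativity_expansion(2)[where A = "\<lambda>m. a m (s - m)" and C = "\<lambda>m. c m (s - m)" and N = N'])
        (use a_N c_N WA' in auto)
  qed
  define b where "b = nat N"
  define k where "k = nat N'"
  \<comment> \<open>The outer variable is \<open>z2\<close>, the inner one \<open>z1\<close>; with
    these \<open>b\<close> and \<open>k\<close> all exponents are nonnegative for \<open>n\<close>
    in \<open>J s\<close>.\<close>
  define P :: "complex poly poly" where "P = (\<Sum>s\<in>S. \<Sum>n\<in>J s. [:[:ct s n:]:]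
      * [:0, 1:] ^ nat (int b + int a0 - s - 1 + n) * ([:[:0, 1:]:] - [:0, 1:]) ^ nat (int k - n - 1))"
  define R where "R z1 z2 = poly (poly P [:z2:]) z1 / (z1 ^ a0 * z2 ^ b * (z1 - z2) ^ k)" for z1 z2
  define T where "T s z1 z2 = (\<Sum>n\<in>J s. ct s n * (z1 powi (- int a0) * z2 powi (int a0 - s - 1 + n) * (z1 - z2) powi (- n - 1)))" for s z1 z2
  have R: "R z1 z2 = (\<Sum>s\<in>S. T s z1 z2)" if z: "z1 \<noteq> 0" "z2 \<noteq> 0" "z1 \<noteq> z2" for z1 z2
  proof -
    have "poly (poly P [:z2:]) z1 = (\<Sum>s\<in>S. \<Sum>n\<in>J s. ct s n
        * z2 ^ nat (int b + int a0 - s - 1 + n) * (z1 - z2) ^ nat (int k - n - 1))"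
      by (simp add: P_def poly_sum mult.assoc)
    moreover have "ct s n * z2 ^ nat (int b + int a0 - s - 1 + n) * (z1 - z2) ^ nat (int k - n - 1)
          / (z1 ^ a0 * z2 ^ b * (z1 - z2) ^ k)
        = ct s n * (z1 powi (- int a0) * z2 powi (int a0 - s - 1 + n) * (z1 - z2) powi (- n - 1))"
      if "n \<in> J s" for s n
    proof -
      have n: "int b + int a0 - s - 1 + n \<ge> 0" "int k - n - 1 \<ge> 0"
        using that by (auto simp: J_def b_def k_def)
      have "z2 ^ nat (int b + int a0 - s - 1 + n) = z2 powi (int b + (int a0 - s - 1 + n))"
        using n(1) by (simp add: power_int_def algebra_simps)
      moreover have "(z1 - z2) ^ nat (int k - n - 1) = (z1 - z2) powi (int k + (- n - 1))"
        using n(2) by (simp add: power_int_def algebra_simps)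
      moreover have "z2 powi (int b + (int a0 - s - 1 + n)) = z2 ^ b * z2 powi (int a0 - s - 1 + n)"
        by (subst power_int_add, use z in simp)+ (use z in simp)
      moreover have "(z1 - z2) powi (int k + (- n - 1)) = (z1 - z2) ^ k * (z1 - z2) powi (- n - 1)"
        by (subst power_int_add, use z in simp)+ (use z in simp)
      moreover have "z1 powi (- int a0) = 1 / z1 ^ a0" by (simp add: power_int_minus divide_inverse)
      ultimately show ?thesis using z by simp
    qed
    ultimately show ?thesis unfolding R_def T_def by (simp add: sum_divide_distrib)
  qed
  have scaled: "z2 powi (- s - 2) * ((z1 / z2) powi (- int a0) * (z1 / z2 - 1) powi (- n - 1))
      = z1 powi (- int a0) * z2 powi (int a0 - s - 1 + n) * (z1 - z2) powi (- n - 1)"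
    if z: "z1 \<noteq> 0" "z2 \<noteq> 0" "z1 \<noteq> z2" for z1 z2 :: complex and s n
  proof -
    have "z1 / z2 - 1 = (z1 - z2) / z2" using z by (simp add: field_simps)
    then have "z2 powi (- s - 2) * ((z1 / z2) powi (- int a0) * (z1 / z2 - 1) powi (- n - 1))
        = z1 powi (- int a0) * (z1 - z2) powi (- n - 1) * (z2 powi (- s - 2) * (z2 powi int a0 * z2 powi (n + 1)))"
      by (simp only: power_int_divide_distrib) (simp add: power_int_minus field_simps power_int_diff power_int_add z)
    also have "z2 powi (- s - 2) * (z2 powi int a0 * z2 powi (n + 1)) = z2 powi (- s - 2 + (int a0 + (n + 1)))"
      by (subst power_int_add, use z in simp)+ (use z in simp)
    also have "- s - 2 + (int a0 + (n + 1)) = int a0 - s - 1 + n" by simp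
    finally show ?thesis by (simp add: mult_ac)
  qed
  have prod: "abs_has_sum (\<lambda>(m, n). a m n * z1 powi (- m - 1) * z2 powi (- n - 1)) (R z1 z2)"
    if "cmod z1 > cmod z2" "cmod z2 > 0" for z1 z2
  proof -
    have z: "z1 \<noteq> 0" "z2 \<noteq> 0" "z1 \<noteq> z2" "norm (z1 / z2) > 1" using that by (auto simp: norm_divide)
    show ?thesis unfolding R[OF z(1-3)]
    proof (rule abs_has_sum_diagonals[OF S])
      fix s
      have "abs_has_sum (\<lambda>m. z2 powi (- s - 2) * (\<Sum>n\<in>J s. ct s n * (exp_inf (- int a0) (- n - 1) m * (z1 / z2) powi (- m - 1))))
         (z2 powi (- s - 2) * (\<Sum>n\<in>J s. ct s n * ((z1 / z2) powi (- int a0) * (z1 / z2 - 1) powi (- n - 1))))"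
        by (intro abs_has_sum_cmult abs_has_sum_sum exp_inf_sum z) (simp add: J_def)
      also have "z2 powi (- s - 2) * (\<Sum>n\<in>J s. ct s n * ((z1 / z2) powi (- int a0) * (z1 / z2 - 1) powi (- n - 1))) = T s z1 z2"
        unfolding T_def sum_distrib_left by (intro sum.cong refl) (simp only: mult.left_commute[of _ "ct s _"] scaled[OF z(1-3)])
      also have "(\<lambda>m. z2 powi (- s - 2) * (\<Sum>n\<in>J s. ct s n * (exp_inf (- int a0) (- n - 1) m * (z1 / z2) powi (- m - 1))))
        = (\<lambda>m. a m (s - m) * z1 powi (- m - 1) * z2 powi (- (s - m) - 1))"
      proof (rule ext)
        fix m
        have "z2 powi (- (s - m) - 1) = z2 powi (- s - 2 + (m + 1))" by (simp add: algebra_simps)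
        also have "\<dots> = z2 powi (- s - 2) * z2 powi (m + 1)"
          by (rule power_int_add) (use z in simp)
        finally have "z2 powi (- (s - m) - 1) = z2 powi (- s - 2) * z2 powi (m + 1)" .
        moreover have "(z1 / z2) powi (- m - 1) = z1 powi (- m - 1) * z2 powi (m + 1)"
        proof -
          have "- m - 1 = - (m + 1)" by simp
          then show ?thesis using z by (simp only: power_int_divide_distrib power_int_minus) (simp add: field_simps)
        qed
        moreover have "(\<Sum>n\<in>J s. ct s n * (exp_inf (- int a0) (- n - 1) m * x)) = a m (s - m) * x" for x
          unfolding exps by (simp add: sum_distrib_right mult.assoc)
        ultimately show "z2 powi (- s - 2) * (\<Sum>n\<in>J s. ct s n * (exp_inf (- int a0) (- n - 1) m * (z1 / z2) powi (- m - 1)))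
          = a m (s - m) * z1 powi (- m - 1) * z2 powi (- (s - m) - 1)" by (simp only:) (simp add: mult_ac)
      qed
      finally show "abs_has_sum (\<lambda>m. case (m, s - m) of (m, n) \<Rightarrow> a m n * z1 powi (- m - 1) * z2 powi (- n - 1)) (T s z1 z2)"
        by simp
    qed (simp add: a_S)
  qed
  have iter: "abs_has_sum (\<lambda>(m, n). c m n * (z1 - z2) powi (- m - 1) * z2 powi (- n - 1)) (R z1 z2)"
    if "cmod z2 > cmod (z1 - z2)" "cmod (z1 - z2) > 0" for z1 z2
  proof -
    have z: "z1 \<noteq> 0" "z2 \<noteq> 0" "z1 \<noteq> z2" using that by auto
    have wz: "z1 / z2 - 1 = (z1 - z2) / z2" "1 + (z1 / z2 - 1) = z1 / z2" using z by (simp_all add: field_simps)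
    then have w: "0 < norm (z1 / z2 - 1)" "norm (z1 / z2 - 1) < 1" using that z by (auto simp: norm_divide)
    show ?thesis unfolding R[OF z]
    proof (rule abs_has_sum_diagonals[OF S])
      fix s
      have "abs_has_sum (\<lambda>m. z2 powi (- s - 2) * (\<Sum>n\<in>J s. ct s n * (exp_one (- int a0) (- n - 1) m * (z1 / z2 - 1) powi (- m - 1))))
         (z2 powi (- s - 2) * (\<Sum>n\<in>J s. ct s n * ((1 + (z1 / z2 - 1)) powi (- int a0) * (z1 / z2 - 1) powi (- n - 1))))"
        by (intro abs_has_sum_cmult abs_has_sum_sum exp_one_sum w) (simp add: J_def)
      also have "z2 powi (- s - 2) * (\<Sum>n\<in>J s. ct s n * ((1 + (z1 / z2 - 1)) powi (- int a0) * (z1 / z2 - 1) powi (- n - 1))) = T s z1 z2"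
        unfolding T_def sum_distrib_left wz(2)
        by (intro sum.cong refl) (simp only: mult.left_commute[of _ "ct s _"] scaled[OF z])
      also have "(\<lambda>m. z2 powi (- s - 2) * (\<Sum>n\<in>J s. ct s n * (exp_one (- int a0) (- n - 1) m * (z1 / z2 - 1) powi (- m - 1))))
        = (\<lambda>m. c m (s - m) * (z1 - z2) powi (- m - 1) * z2 powi (- (s - m) - 1))"
      proof (rule ext)
        fix m
        have "z2 powi (- (s - m) - 1) = z2 powi (- s - 2 + (m + 1))" by (simp add: algebra_simps)
        also have "\<dots> = z2 powi (- s - 2) * z2 powi (m + 1)"
          by (rule power_int_add) (use z in simp)
        finally have "z2 powi (- (s - m) - 1) = z2 powi (- s - 2) * z2 powi (m + 1)" .
        moreover have "(z1 / z2 - 1) powi (- m - 1) = (z1 - z2) powi (- m - 1) * z2 powi (m + 1)"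
        proof -
          have "- m - 1 = - (m + 1)" by simp
          then show ?thesis using z by (simp only: wz power_int_divide_distrib power_int_minus) (simp add: field_simps)
        qed
        moreover have "(\<Sum>n\<in>J s. ct s n * (exp_one (- int a0) (- n - 1) m * x)) = c m (s - m) * x" for x
          unfolding exps by (simp add: sum_distrib_right mult.assoc)
        ultimately show "z2 powi (- s - 2) * (\<Sum>n\<in>J s. ct s n * (exp_one (- int a0) (- n - 1) m * (z1 / z2 - 1) powi (- m - 1)))
          = c m (s - m) * (z1 - z2) powi (- m - 1) * z2 powi (- (s - m) - 1)" by (simp only:) (simp add: mult_ac)
      qed
      finally show "abs_has_sum (\<lambda>m. case (m, s - m) of (m, n) \<Rightarrow> c m n * (z1 - z2) powi (- m - 1) * z2 powi (- n - 1)) (T s z1 z2)"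
        by simp
    qed (simp add: c_S)
  qed
  show ?thesis
    by (intro exI[of _ P] exI[of _ a0] exI[of _ b] exI[of _ k] allI)
      (unfold Let_def R_def[symmetric], use prod iter in blast)
qed


section \<open>Comparing the two orders of a product\<close>

lemma exp_family_bound:
  assumes "finite J"
  shows "\<exists>B. \<forall>j\<in>J. \<forall>m. (m < - B \<longrightarrow> exp_inf (q j) (r j) m = 0) \<and> (m \<ge> B \<longrightarrow> exp_one (q j) (r j) m = 0)
    \<and> (m \<ge> B \<longrightarrow> exp_zero (q j) (r j) m = 0)"
proof -
  define B where "B = (\<Sum>j\<in>J. \<bar>q j\<bar> + \<bar>r j\<bar> + 1)"
  have le: "\<bar>q j\<bar> + \<bar>r j\<bar> + 1 \<le> B" if "j \<in> J" for j
    unfolding B_def by (rule member_le_sum) (use that assms in auto)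
  show ?thesis
  proof (intro exI[of _ B] ballI allI)
    fix j m assume j: "j \<in> J"
    show "(m < - B \<longrightarrow> exp_inf (q j) (r j) m = 0) \<and> (m \<ge> B \<longrightarrow> exp_one (q j) (r j) m = 0)
      \<and> (m \<ge> B \<longrightarrow> exp_zero (q j) (r j) m = 0)"
      using le[OF j] by (auto simp: exp_inf_def exp_one_def exp_zero_def ibin_def)
  qed
qed

lemma exp_family_has_sum:
  assumes "finite J"
  shows "norm z > 1 \<Longrightarrow> ((\<lambda>m. (\<Sum>j\<in>J. p j * exp_inf (q j) (r j) m) * z powi (- m - 1)) has_sum
           (\<Sum>j\<in>J. p j * (z powi q j * (z - 1) powi r j))) UNIV"
    and "0 < norm w \<Longrightarrow> norm w < 1 \<Longrightarrow> ((\<lambda>m. (\<Sum>j\<in>J. p j * exp_one (q j) (r j) m) * w powi (- m - 1)) has_sum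
           (\<Sum>j\<in>J. p j * ((1 + w) powi q j * w powi r j))) UNIV"
    and "0 < norm z \<Longrightarrow> norm z < 1 \<Longrightarrow> ((\<lambda>m. (\<Sum>j\<in>J. p j * exp_zero (q j) (r j) m) * z powi (- m - 1)) has_sum
           (\<Sum>j\<in>J. p j * (z powi q j * (z - 1) powi r j))) UNIV"
proof -
  have *: "((\<lambda>m. (\<Sum>j\<in>J. p j * e j m) * x powi (- m - 1)) has_sum (\<Sum>j\<in>J. p j * S j)) UNIV"
    if "\<And>j. abs_has_sum (\<lambda>m. e j m * x powi (- m - 1)) (S j)" for e :: "'a \<Rightarrow> int \<Rightarrow> complex" and x S
  proof -
    have "abs_has_sum (\<lambda>m. \<Sum>j\<in>J. p j * (e j m * x powi (- m - 1))) (\<Sum>j\<in>J. p j * S j)"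
      by (intro abs_has_sum_sum abs_has_sum_cmult that assms)
    then show ?thesis by (simp add: abs_has_sum_def sum_distrib_right mult.assoc)
  qed
  show "norm z > 1 \<Longrightarrow> ((\<lambda>m. (\<Sum>j\<in>J. p j * exp_inf (q j) (r j) m) * z powi (- m - 1)) has_sum
           (\<Sum>j\<in>J. p j * (z powi q j * (z - 1) powi r j))) UNIV"
    by (rule *) (rule exp_inf_sum)
  show "0 < norm w \<Longrightarrow> norm w < 1 \<Longrightarrow> ((\<lambda>m. (\<Sum>j\<in>J. p j * exp_one (q j) (r j) m) * w powi (- m - 1)) has_sum
           (\<Sum>j\<in>J. p j * ((1 + w) powi q j * w powi r j))) UNIV"
    by (rule *) (rule exp_one_sum)
  show "0 < norm z \<Longrightarrow> norm z < 1 \<Longrightarrow> ((\<lambda>m. (\<Sum>j\<in>J. p j * exp_zero (q j) (r j) m) * z powi (- m - 1)) has_sum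
           (\<Sum>j\<in>J. p j * (z powi q j * (z - 1) powi r j))) UNIV"
    by (rule *) (rule exp_zero_sum)
qed

text \<open>Clearing denominators leaves a polynomial, which has the infinitely many zeros
  \<open>1 + 1/(n + 2)\<close> in the disc around 1.\<close>

lemma laurent_identity:
  fixes z :: complex
  assumes J: "finite J"
    and 0: "\<And>w. 0 < norm w \<Longrightarrow> norm w < 1 \<Longrightarrow> (\<Sum>j\<in>J. p j * ((1 + w) powi q j * w powi r j)) = 0"
    and z: "z \<noteq> 0" "z \<noteq> 1"
  shows "(\<Sum>j\<in>J. p j * (z powi q j * (z - 1) powi r j)) = 0"
proof -
  define B where "B = (\<Sum>j\<in>J. nat \<bar>q j\<bar> + nat \<bar>r j\<bar>)"
  have le: "nat \<bar>q j\<bar> + nat \<bar>r j\<bar> \<le> B" if "j \<in> J" for j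
    unfolding B_def by (rule member_le_sum) (use that J in auto)
  define Q where "Q = (\<Sum>j\<in>J. [:p j:] * [:0, 1:] ^ nat (q j + int B) * [:-1, 1:] ^ nat (r j + int B))"
  have Q: "poly Q x = x ^ B * (x - 1) ^ B * (\<Sum>j\<in>J. p j * (x powi q j * (x - 1) powi r j))"
    if x: "x \<noteq> 0" "x \<noteq> 1" for x
  proof -
    have eq: "p j * x ^ nat (q j + int B) * (x - 1) ^ nat (r j + int B)
        = x ^ B * (x - 1) ^ B * (p j * (x powi q j * (x - 1) powi r j))" if "j \<in> J" for j
    proof -
      have n: "q j + int B \<ge> 0" "r j + int B \<ge> 0" using le[OF that] by linarith+
      have "x ^ nat (q j + int B) = x powi (q j + int B)" using n by (simp add: power_int_def)
      also have "\<dots> = x powi q j * x ^ B" using x by (subst power_int_add) simp_all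
      finally have 1: "x ^ nat (q j + int B) = x powi q j * x ^ B" .
      have "(x - 1) ^ nat (r j + int B) = (x - 1) powi (r j + int B)" using n by (simp add: power_int_def)
      also have "\<dots> = (x - 1) powi r j * (x - 1) ^ B" using x by (subst power_int_add) simp_all
      finally show ?thesis unfolding 1 by simp
    qed
    have "poly Q x = (\<Sum>j\<in>J. p j * x ^ nat (q j + int B) * (x - 1) ^ nat (r j + int B))"
      by (simp add: Q_def poly_sum mult.assoc)
    also have "\<dots> = (\<Sum>j\<in>J. x ^ B * (x - 1) ^ B * (p j * (x powi q j * (x - 1) powi r j)))"
      by (rule sum.cong[OF refl eq])
    finally show ?thesis by (simp only: sum_distrib_left)
  qed
  let ?x = "\<lambda>n::nat. 1 + 1 / of_nat (n + 2) :: complex"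
  have "inj ?x" by (auto simp: inj_on_def)
  then have "infinite (range ?x)" using finite_imageD infinite_UNIV_nat by blast
  moreover have "range ?x \<subseteq> {x. poly Q x = 0}"
  proof
    fix x assume "x \<in> range ?x"
    then obtain n where x: "x = 1 + 1 / of_nat (n + 2)" by blast
    have w: "0 < norm (1 / of_nat (n + 2) :: complex)" "norm (1 / of_nat (n + 2) :: complex) < 1"
      by (simp_all only: norm_divide norm_one norm_of_nat) (simp_all add: divide_less_eq)
    then have "x \<noteq> 0" "x \<noteq> 1" unfolding x by (auto simp: add_eq_0_iff)
    then show "x \<in> {x. poly Q x = 0}" using 0[OF w] by (simp add: Q x)
  qed
  ultimately have "Q = 0" using poly_roots_finite finite_subset by blast
  then show ?thesis using Q[OF z] z by simp
qed

text \<open>Skew symmetry of the iterate coefficients identifies the rational functions that belong to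
  the two orders of a product, and the residue theorem gives the commutator formula.\<close>

lemma commutator_of_duality:
  fixes A C A' C' :: "int \<Rightarrow> complex" and P P' :: "complex poly"
  assumes A: "\<And>m. m < M \<Longrightarrow> A m = 0" and C: "\<And>m. m \<ge> N \<Longrightarrow> C m = 0"
    and A': "\<And>m. m < M' \<Longrightarrow> A' m = 0" and C': "\<And>m. m \<ge> N' \<Longrightarrow> C' m = 0"
    and sumA: "\<And>z. norm z > 1 \<Longrightarrow> ((\<lambda>m. A m * z powi (- m - 1)) has_sum poly P z / (z ^ a * (z - 1) ^ k)) UNIV"
    and sumC: "\<And>w. 0 < norm w \<Longrightarrow> norm w < 1 \<Longrightarrow>
        ((\<lambda>m. C m * w powi (- m - 1)) has_sum poly P (1 + w) / ((1 + w) ^ a * w ^ k)) UNIV"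
    and sumA': "\<And>z. norm z > 1 \<Longrightarrow> ((\<lambda>m. A' m * z powi (- m - 1)) has_sum poly P' z / (z ^ a' * (z - 1) ^ k')) UNIV"
    and sumC': "\<And>w. 0 < norm w \<Longrightarrow> norm w < 1 \<Longrightarrow>
        ((\<lambda>m. C' m * w powi (- m - 1)) has_sum poly P' (1 + w) / ((1 + w) ^ a' * w ^ k')) UNIV"
    and skew: "\<And>m. C m = (- 1) powi (m + 1) * cx.binsum (of_int (s - m)) (\<lambda>i. C' (m + int i))"
  shows "A m - A' (s - m) = cx.binsum (of_int m) (\<lambda>i. C (int i))"
proof -
  \<comment> \<open>Rewriting the numerator in powers of \<open>z - 1\<close> gives a combination of
    functions \<open>z^(-a) (z - 1)^(j-k)\<close>; by uniqueness of Laurent coefficients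
    \<open>A\<close> and \<open>C\<close> are its expansions at infinity and at 1.\<close>
  have expand: "(\<forall>m. A m = (\<Sum>j\<le>degree (pcompose P [:1, 1:]). coeff (pcompose P [:1, 1:]) j * exp_inf (- int a) (int j - int k) m))
      \<and> (\<forall>m. C m = (\<Sum>j\<le>degree (pcompose P [:1, 1:]). coeff (pcompose P [:1, 1:]) j * exp_one (- int a) (int j - int k) m))"
    if A: "\<And>m. m < M \<Longrightarrow> A m = 0" and C: "\<And>m. m \<ge> N \<Longrightarrow> C m = 0"
    and sumA: "\<And>z. norm z > 1 \<Longrightarrow> ((\<lambda>m. A m * z powi (- m - 1)) has_sum poly P z / (z ^ a * (z - 1) ^ k)) UNIV"
    and sumC: "\<And>w. 0 < norm w \<Longrightarrow> norm w < 1 \<Longrightarrow>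
        ((\<lambda>m. C m * w powi (- m - 1)) has_sum poly P (1 + w) / ((1 + w) ^ a * w ^ k)) UNIV"
    for A C :: "int \<Rightarrow> complex" and P :: "complex poly" and a k M N
  proof -
    define p where "p = pcompose P [:1, 1:]"
    have F: "poly P z / (z ^ a * (z - 1) ^ k)
        = (\<Sum>j\<le>degree p. coeff p j * (z powi (- int a) * (z - 1) powi (int j - int k)))" if "z \<noteq> 0" "z \<noteq> 1" for z
    proof -
      have "poly P z = poly p (z - 1)" by (simp add: p_def poly_pcompose)
      also have "\<dots> = (\<Sum>j\<le>degree p. coeff p j * (z - 1) ^ j)" by (rule poly_altdef)
      finally show ?thesis using that
        by (simp add: sum_divide_distrib power_int_diff power_int_minus field_simps)
    qed
    obtain B where B: "\<forall>j\<in>{..degree p}. \<forall>m. (m < - B \<longrightarrow> exp_inf (- int a) (int j - int k) m = 0)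
        \<and> (m \<ge> B \<longrightarrow> exp_one (- int a) (int j - int k) m = 0) \<and> (m \<ge> B \<longrightarrow> exp_zero (- int a) (int j - int k) m = 0)"
      using exp_family_bound[of "{..degree p}" "\<lambda>_. - int a" "\<lambda>j. int j - int k", OF finite_atMost] ..
    have "A m = (\<Sum>j\<le>degree p. coeff p j * exp_inf (- int a) (int j - int k) m)" for m
    proof (rule laurent_unique_inf[where M = "min M (- B)" and S = "\<lambda>z. poly P z / (z ^ a * (z - 1) ^ k)"])
      fix z :: complex assume z: "norm z > 1"
      then have "z \<noteq> 0" "z \<noteq> 1" by auto
      then show "((\<lambda>m. (\<Sum>j\<le>degree p. coeff p j * exp_inf (- int a) (int j - int k) m) * z powi (- m - 1))
          has_sum poly P z / (z ^ a * (z - 1) ^ k)) UNIV"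
        unfolding F[OF \<open>z \<noteq> 0\<close> \<open>z \<noteq> 1\<close>] by (intro exp_family_has_sum(1) z) simp
    qed (use A B sumA in auto)
    moreover have "C m = (\<Sum>j\<le>degree p. coeff p j * exp_one (- int a) (int j - int k) m)" for m
    proof (rule laurent_unique_point[where N = "max N B" and S = "\<lambda>w. poly P (1 + w) / ((1 + w) ^ a * w ^ k)"])
      fix w :: complex assume w: "0 < norm w" "norm w < 1"
      then have "1 + w \<noteq> 0" "1 + w \<noteq> 1"
        by (auto simp: add_eq_0_iff)
      from F[OF this] show "((\<lambda>m. (\<Sum>j\<le>degree p. coeff p j * exp_one (- int a) (int j - int k) m) * w powi (- m - 1))
          has_sum poly P (1 + w) / ((1 + w) ^ a * w ^ k)) UNIV"
        using exp_family_has_sum(2)[of "{..degree p}" w "coeff p" "\<lambda>_. - int a" "\<lambda>j. int j - int k"] w by simp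
    qed (use C B sumC in auto)
    ultimately show ?thesis unfolding p_def by blast
  qed
  define p where "p = pcompose P [:1, 1:]"
  define p' where "p' = pcompose P' [:1, 1:]"
  \<comment> \<open>Exchanging the two points replaces \<open>f'(z)\<close> by
    \<open>z^(-s-2) f'(1/z)\<close>, which turns \<open>z^(-a') (z - 1)^(r')\<close> into
    \<open>(-1)^(r') z^(q') (z - 1)^(r')\<close>. This explains \<open>q'\<close> and the sign in
    \<open>d\<close>.\<close>
  define q' where "q' j = int k' - int j + int a' - s - 2" for j
  define r where "r j = int j - int k" for j
  define r' where "r' j = int j - int k'" for j
  have Ae: "A m = (\<Sum>j\<le>degree p. coeff p j * exp_inf (- int a) (r j) m)"
    and Ce: "C m = (\<Sum>j\<le>degree p. coeff p j * exp_one (- int a) (r j) m)" for m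
    using expand[OF A C sumA sumC] unfolding p_def r_def by auto
  have A'e: "A' m = (\<Sum>j\<le>degree p'. coeff p' j * exp_inf (- int a') (r' j) m)"
    and C'e: "C' m = (\<Sum>j\<le>degree p'. coeff p' j * exp_one (- int a') (r' j) m)" for m
    using expand[OF A' C' sumA' sumC'] unfolding p'_def r'_def by auto
  define d where "d j = (- 1) powi (r' j) * coeff p' j" for j
  have binsum_sum: "cx.binsum b (\<lambda>i. \<Sum>j\<le>(n::nat). c j * ibin (h j) (L j - int i)) = (\<Sum>j\<le>n. c j * cx.binsum b (\<lambda>i. ibin (h j) (L j - int i)))"
    for b n c h L
  proof (induction n)
    case 0
    then show ?case using cx.binsum_scale[OF truncated_ibin[of 1]] by simp
  next
    case (Suc n)
    have "truncated (\<lambda>i. \<Sum>j\<le>n. c j * ibin (h j) (L j - int i))"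
      by (induction n) (auto intro: truncated_ibin truncated_add)
    from cx.binsum_add[OF this truncated_ibin, of b "c (Suc n)" "h (Suc n)" "L (Suc n)"]
    show ?case using Suc cx.binsum_scale[OF truncated_ibin[of 1]] by simp
  qed
  \<comment> \<open>By skew symmetry the function of the first order and the exchanged function of
    the second have the same expansion at 1.\<close>
  have C2: "C m = (\<Sum>j\<le>degree p'. d j * exp_one (q' j) (r' j) m)" for m
  proof -
    have "cx.binsum (of_int (s - m)) (\<lambda>i. C' (m + int i))
        = (\<Sum>j\<le>degree p'. coeff p' j * cx.binsum (of_int (s - m)) (\<lambda>i. ibin (- int a') ((- r' j - m - 1) - int i)))"
      unfolding C'e exp_one_def binsum_sum[symmetric] by (simp add: algebra_simps)
    also have "\<dots> = (\<Sum>j\<le>degree p'. coeff p' j * ibin (s - m - int a') (- r' j - m - 1))"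
      unfolding ibin_vandermonde by simp
    finally have C_sum: "C m = (\<Sum>j\<le>degree p'. (- 1) powi (m + 1) * (coeff p' j * ibin (s - m - int a') (- r' j - m - 1)))"
      unfolding skew[of m] by (simp add: sum_distrib_left)
    have "(- 1) powi (m + 1) * (coeff p' j * ibin (s - m - int a') (- r' j - m - 1))
        = d j * exp_one (q' j) (r' j) m" for j
    proof -
      have "- r' j - m - 1 - 1 - (s - m - int a') = q' j" by (simp add: r'_def q'_def)
      then have e1: "ibin (s - m - int a') (- r' j - m - 1) = (- 1) powi (- r' j - m - 1) * ibin (q' j) (- r' j - m - 1)"
        by (subst ibin_negate) simp
      have e2: "(- 1 :: complex) powi (m + 1) * (- 1) powi (- r' j - m - 1) = (- 1) powi (r' j)"
      proof -
        have "m + 1 + (- r' j - m - 1) = - r' j" by simp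
        then show ?thesis by (simp only: sgn_powi(1)[symmetric] sgn_powi(2))
      qed
      show ?thesis
        unfolding exp_one_def d_def e1 e2[symmetric] by (simp only: mult_ac)
    qed
    then show ?thesis unfolding C_sum by (simp only:)
  qed
  \<comment> \<open>The disjoint union indexes the difference of these two functions, which will
    vanish identically.\<close>
  define J where "J = {..degree p} <+> {..degree p'}"
  have J: "finite J" by (simp add: J_def)
  define pp where "pp = case_sum (coeff p) (\<lambda>j. - d j)"
  define qq :: "nat + nat \<Rightarrow> int" where "qq = case_sum (\<lambda>_. - int a) q'"
  define rr where "rr = case_sum r r'"
  have J_sum: "(\<Sum>x\<in>J. pp x * f (qq x) (rr x)) = (\<Sum>j\<le>degree p. coeff p j * f (- int a) (r j)) - (\<Sum>j\<le>degree p'. d j * f (q' j) (r' j))"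
    for f :: "int \<Rightarrow> int \<Rightarrow> complex"
    unfolding J_def by (subst sum.Plus) (simp_all add: pp_def qq_def rr_def sum_negf)
  have one: "(\<Sum>j\<in>J. pp j * exp_one (qq j) (rr j) m) = 0" for m
    unfolding J_sum[of "\<lambda>q r. exp_one q r m"] Ce[symmetric] C2[symmetric] by simp
  have "(\<Sum>j\<in>J. pp j * ((1 + w) powi qq j * w powi rr j)) = 0" if "0 < norm w" "norm w < 1" for w
    using has_sum_unique[OF exp_family_has_sum(2)[OF J that, of pp qq rr], of 0] one by simp
  then have zero: "(\<Sum>j\<in>J. pp j * (z powi qq j * (z - 1) powi rr j)) = 0" if "z \<noteq> 0" "z \<noteq> 1" for z
    using laurent_identity[OF J _ that, of pp qq rr] by blast
  obtain B where B: "\<forall>j\<in>J. \<forall>m. (m < - B \<longrightarrow> exp_inf (qq j) (rr j) m = 0)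
      \<and> (m \<ge> B \<longrightarrow> exp_one (qq j) (rr j) m = 0) \<and> (m \<ge> B \<longrightarrow> exp_zero (qq j) (rr j) m = 0)"
    using exp_family_bound[OF J, of qq rr] ..
  \<comment> \<open>Equal functions have equal expansions at 0; for the exchanged function the
    coefficients there are the products in the opposite order.\<close>
  have "(\<Sum>j\<in>J. pp j * exp_zero (qq j) (rr j) m) = 0" for m
  proof (rule laurent_unique_point[where N = B and g = "\<lambda>_. 0" and S = "\<lambda>_. 0"])
    fix z :: complex assume z: "0 < norm z" "norm z < 1"
    then have "z \<noteq> 0" "z \<noteq> 1" by auto
    then show "((\<lambda>m. (\<Sum>j\<in>J. pp j * exp_zero (qq j) (rr j) m) * z powi (- m - 1)) has_sum 0) UNIV"
      using exp_family_has_sum(3)[OF J z, of pp qq rr] zero by simp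
  qed (use B in auto)
  then have zero_eq: "(\<Sum>j\<le>degree p. coeff p j * exp_zero (- int a) (r j) m) = (\<Sum>j\<le>degree p'. d j * exp_zero (q' j) (r' j) m)"
    using J_sum[of "\<lambda>q r. exp_zero q r m"] by simp
  have "d j * exp_zero (q' j) (r' j) m = coeff p' j * exp_inf (- int a') (r' j) (s - m)" for j
  proof -
    have e: "- q' j - m - 1 = - int a' + r' j + (s - m) + 1" "r' j - q' j - m - 1 = r' j + (- int a' + r' j + (s - m) + 1)"
      by (simp_all add: q'_def r'_def)
    show ?thesis
      unfolding d_def exp_zero_def exp_inf_def e sgn_powi(1)[of "r' j"]
      by (simp only: sgn_powi(5) mult_ac)
  qed
  then have "A' (s - m) = (\<Sum>j\<le>degree p. coeff p j * exp_zero (- int a) (r j) m)"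
    unfolding zero_eq A'e by simp
  \<comment> \<open>Infinity minus zero is the residue at 1.\<close>
  then have "A m - A' (s - m) = (\<Sum>j\<le>degree p. coeff p j * ibin (- int a + m) (- r j - 1))"
    unfolding Ae by (simp add: sum_subtractf[symmetric] right_diff_distrib[symmetric] ibin_residue)
  also have "\<dots> = (\<Sum>j\<le>degree p. coeff p j * cx.binsum (of_int m) (\<lambda>i. ibin (- int a) ((- r j - 1) - int i)))"
    unfolding ibin_vandermonde by (simp add: add.commute)
  also have "\<dots> = cx.binsum (of_int m) (\<lambda>i. C (int i))"
    unfolding binsum_sum[symmetric] Ce exp_one_def by (simp add: algebra_simps)
  finally show ?thesis .
qed



context universal_virasoro
begin

subsection \<open>Homogeneous elements and functionals\<close>

lemma homogeneous_induct [case_names 0 add homogeneous]: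
  assumes "P 0" "\<And>a x y. P x \<Longrightarrow> P y \<Longrightarrow> P (a *s x + y)" "\<And>q x. x \<in> gr q \<Longrightarrow> P x"
  shows "P v"
proof -
  obtain p where p: "\<forall>n. p n \<in> graded_span n" "v = Sum_any p"
    using graded_decomposition[of v] by blast
  have "P (sum p A)" if "finite A" for A
    using that
  proof (induction A rule: finite_induct)
    case (insert q A)
    have "P (p q)" using assms(3)[of "p q" q] p(1) by (simp add: graded_span_eq)
    then show ?case using insert assms(2)[of "p q" "sum p A" 1] by simp
  qed (simp add: assms)
  then show ?thesis unfolding p(2) Sum_any.expand_set using assms(1) by (cases "finite {n. p n \<noteq> 0}") auto
qed

definition component :: "int \<Rightarrow> 'v \<Rightarrow> 'v" where
  "component d v = (SOME p. (\<forall>n. p n \<in> gr n) \<and> finite {n. p n \<noteq> 0} \<and> v = Sum_any p) d"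

lemma component_eq:
  assumes "\<And>n. p n \<in> gr n" "finite {n. p n \<noteq> 0}" "v = Sum_any p"
  shows "component d v = p d"
proof -
  from direct_sum[of v] obtain p0 where
    p0: "\<And>p. (\<forall>n. p n \<in> gr n) \<and> finite {n. p n \<noteq> 0} \<and> v = Sum_any p \<Longrightarrow> p = p0"
    by (elim ex1E) blast
  have "\<exists>p. (\<forall>n. p n \<in> gr n) \<and> finite {n. p n \<noteq> 0} \<and> v = Sum_any p" using assms by blast
  from p0[OF someI_ex[OF this]] p0[of p] assms show ?thesis unfolding component_def by simp
qed

lemma component_exists:
  obtains p where "\<And>n. p n \<in> gr n" "finite {n. p n \<noteq> 0}" "v = Sum_any p" "\<And>d. component d v = p d"
proof -
  from direct_sum[of v] obtain p where p: "\<forall>n. p n \<in> gr n" "finite {n. p n \<noteq> 0}" "v = Sum_any p"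
    by (elim ex1E) blast
  show ?thesis by (rule that[of p]) (use p component_eq[of p v] in auto)
qed

lemma linear_component: "Vector_Spaces.linear (*s) (*s) (component d)"
  unfolding Vector_Spaces.linear_iff
proof (intro conjI allI vector_space_axioms)
  fix x y a
  obtain p where p: "\<And>n. p n \<in> gr n" "finite {n. p n \<noteq> 0}" "x = Sum_any p" "\<And>d. component d x = p d"
    using component_exists[of x] by blast
  obtain r where r: "\<And>n. r n \<in> gr n" "finite {n. r n \<noteq> 0}" "y = Sum_any r" "\<And>d. component d y = r d"
    using component_exists[of y] by blast
  have "component d (x + y) = (\<lambda>n. p n + r n) d"
  proof (rule component_eq)
    show "finite {n. p n + r n \<noteq> 0}"
      by (rule finite_subset[OF _ finite_UnI[OF p(2) r(2)]]) auto
    show "x + y = (\<Sum>n. p n + r n)" unfolding p(3) r(3) by (rule Sum_any.distrib[symmetric]) (rule p r)+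
  qed (auto intro: gr_add p r)
  then show "component d (x + y) = component d x + component d y" using p r by simp
  have "component d (a *s x) = (\<lambda>n. a *s p n) d"
  proof (rule component_eq)
    show "finite {n. a *s p n \<noteq> 0}" by (rule finite_subset[OF _ p(2)]) auto
    show "a *s x = (\<Sum>n. a *s p n)"
      unfolding p(3) by (subst (1 2) Sum_any.expand_superset[OF p(2)]) (auto simp: scale_sum_right)
  qed (auto intro: gr_scale p)
  then show "component d (a *s x) = a *s component d x" using p by simp
qed

lemma component_gr: "x \<in> gr n \<Longrightarrow> component d x = (if d = n then x else 0)"
  using component_eq[of "\<lambda>m. if m = n then x else 0" x d] by (auto simp: gr_0 intro: finite_subset[of _ "{n}"])

text \<open>A functional with value 1 at \<open>x\<close>, composed with the projection to weight
  \<open>d\<close>, sees a single weight. It therefore lies in \<open>graded_dual\<close>, to which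
  duality is restricted.\<close>

lemma homogeneous_separation:
  assumes x: "x \<in> gr d"
    and 0: "\<And>f. Vector_Spaces.linear (*s) (*) f \<Longrightarrow> (\<And>n v. n \<noteq> d \<Longrightarrow> v \<in> gr n \<Longrightarrow> f v = 0) \<Longrightarrow> f x = 0"
  shows "x = 0"
proof (rule ccontr)
  assume "x \<noteq> 0"
  interpret pp: vector_space_pair "(*s)" "(*) :: complex \<Rightarrow> complex \<Rightarrow> complex"
    by (intro vector_space_pair.intro vector_space_axioms vector_space_complex)
  have "independent {x}" using \<open>x \<noteq> 0\<close> by simp
  from pp.linear_independent_extend[OF this, of "\<lambda>_. 1"] obtain g where
    g: "Vector_Spaces.linear (*s) (*) g" "g x = 1" by blast
  interpret g: Vector_Spaces.linear "(*s)" "(*)" g by (rule g)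
  have "(g \<circ> component d) x = 0"
  proof (rule 0)
    show "Vector_Spaces.linear (*s) (*) (g \<circ> component d)"
      by (rule Vector_Spaces.linear_compose[OF linear_component g(1)])
  qed (simp add: component_gr g.zero)
  then show False using g x by (simp add: component_gr)
qed

text \<open>On homogeneous arguments the weight of \<open>G\<close> depends on \<open>m + n\<close>
  alone, and \<open>f\<close> sees finitely many weights; linearity in each argument does the
  rest.\<close>

lemma finite_diagonals:
  assumes f: "f \<in> graded_dual"
    and G1: "\<And>a x y v w m n. G (a *s x + y) v w m n = a *s G x v w m n + G y v w m n"
    and G2: "\<And>a x y u w m n. G u (a *s x + y) w m n = a *s G u x w m n + G u y w m n"
    and G3: "\<And>a x y u v m n. G u v (a *s x + y) m n = a *s G u v x m n + G u v y m n"
    and hom: "\<And>p q r u v w m n. u \<in> gr p \<Longrightarrow> v \<in> gr q \<Longrightarrow> w \<in> gr r \<Longrightarrow> G u v w m n \<in> gr (p + q + r - m - n - 2)"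
  shows "\<exists>S. finite S \<and> (\<forall>m n. m + n \<notin> S \<longrightarrow> f (G u v w m n) = 0)"
proof -
  have lf: "Vector_Spaces.linear (*s) (*) f" and Df: "finite {n. \<exists>v \<in> gr n. f v \<noteq> 0}"
    using f unfolding graded_dual_def by auto
  interpret f: Vector_Spaces.linear "(*s)" "(*)" f by (rule lf)
  define Fin where "Fin u v w \<longleftrightarrow> (\<exists>S. finite S \<and> (\<forall>m n. m + n \<notin> S \<longrightarrow> f (G u v w m n) = (0::complex)))" for u v w
  have zero: "G 0 v w m n = 0" "G u 0 w m n = 0" "G u v 0 m n = 0" for u v w m n
    using G1[of "-1" 0 0 v w m n] G2[of u "-1" 0 0 w m n] G3[of u v "-1" 0 0 m n] by auto
  have comb: "\<exists>S. finite S \<and> (\<forall>m n. m + n \<notin> S \<longrightarrow> f (a *s g m n + h m n) = 0)"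
    if "\<exists>S. finite S \<and> (\<forall>m n. m + n \<notin> S \<longrightarrow> f (g m n) = 0)" "\<exists>S. finite S \<and> (\<forall>m n. m + n \<notin> S \<longrightarrow> f (h m n) = 0)"
    for a and g h :: "int \<Rightarrow> int \<Rightarrow> 'v"
  proof -
    from that obtain S T where "finite S" "\<forall>m n. m + n \<notin> S \<longrightarrow> f (g m n) = 0"
      "finite T" "\<forall>m n. m + n \<notin> T \<longrightarrow> f (h m n) = 0" by blast
    then show ?thesis by (intro exI[of _ "S \<union> T"]) (auto simp: f.add f.scale)
  qed
  have triv: "\<exists>S::int set. finite S" by blast
  have "Fin u v w"
  proof (induction u rule: homogeneous_induct)
    case 0 show ?case by (auto simp: Fin_def zero f.zero triv)
  next
    case (add a x y) then show ?case unfolding Fin_def G1 by (rule comb)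
  next
    case (homogeneous p u)
    show ?case
    proof (induction v rule: homogeneous_induct)
      case 0 show ?case by (auto simp: Fin_def zero f.zero triv)
    next
      case (add a x y) then show ?case unfolding Fin_def G2 by (rule comb)
    next
      case (homogeneous q v)
      show ?case
      proof (induction w rule: homogeneous_induct)
        case 0 show ?case by (auto simp: Fin_def zero f.zero triv)
      next
        case (add a x y) then show ?case unfolding Fin_def G3 by (rule comb)
      next
        case (homogeneous r w)
        let ?S = "(\<lambda>d. p + q + r - 2 - d) ` {n. \<exists>v \<in> gr n. f v \<noteq> 0}"
        have "f (G u v w m n) = 0" if "m + n \<notin> ?S" for m n
        proof (rule ccontr)
          assume "f (G u v w m n) \<noteq> 0"
          then have "p + q + r - m - n - 2 \<in> {n. \<exists>v \<in> gr n. f v \<noteq> 0}"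
            using hom[OF \<open>u \<in> gr p\<close> \<open>v \<in> gr q\<close> \<open>w \<in> gr r\<close>, of m n] by blast
          then have "p + q + r - 2 - (p + q + r - m - n - 2) \<in> ?S" by (rule imageI)
          then show False using that by simp
        qed
        then show ?case unfolding Fin_def using Df by blast
      qed
    qed
  qed
  then show ?thesis unfolding Fin_def .
qed


subsection \<open>The central charge cocycle satisfies duality\<close>

text \<open>The \<open>t\<close>-parts of iterated deformed products are exactly the sums in
  \<open>cocycle_duality\<close>.\<close>

lemma Y2_Y2:
  "snd (Y2 (Y2 (u1, 0) m (u2, 0)) n (v, 0)) = charge_cocycle (Y u1 m u2) n v + Y (charge_cocycle u1 m u2) n v"
  "snd (Y2 (u1, 0) m (Y2 (u2, 0) n (v, 0))) = charge_cocycle u1 m (Y u2 n v) + Y u1 m (charge_cocycle u2 n v)"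
  by (simp_all add: Y2_eq Yl.zero Yr.zero)

text \<open>Composing \<open>f\<close> with the \<open>t\<close>-part is linear, so weak
  associativity of \<open>Y2\<close> passes to the scalar coefficients, and weights provide the
  finitely many diagonals.\<close>

lemma charge_cocycle_duality: "cocycle_duality charge_cocycle"
  unfolding cocycle_duality_def
proof (intro ballI allI)
  fix f u1 u2 v
  assume f: "f \<in> graded_dual"
  then have lf: "Vector_Spaces.linear (*s) (*) f" unfolding graded_dual_def by auto
  interpret f: Vector_Spaces.linear "(*s)" "(*)" f by (rule lf)
  define a where "a m n = f (charge_cocycle u1 m (Y u2 n v)) + f (Y u1 m (charge_cocycle u2 n v))" for m n
  define c where "c m n = f (charge_cocycle (Y u1 m u2) n v) + f (Y (charge_cocycle u1 m u2) n v)" for m n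
  have a_eq: "a m n = (f \<circ> snd) (Y2 (u1, 0) m (Y2 (u2, 0) n (v, 0)))"
    and c_eq: "c m n = (f \<circ> snd) (Y2 (Y2 (u1, 0) m (u2, 0)) n (v, 0))" for m n
    by (simp_all add: a_def c_def Y2_Y2 f.add)
  have lfs: "Vector_Spaces.linear scale2 (*) (f \<circ> snd)"
    by (rule Vector_Spaces.linear_compose[OF linear_snd lf])
  interpret fs: Vector_Spaces.linear scale2 "(*)" "f \<circ> snd" by (rule lfs)
  obtain a0 where a0: "\<And>m n k. m \<ge> int a0 \<Longrightarrow> E.iterate_term m n k (u1, 0) (u2, 0) (v, 0) = E.product_term m n k (u1, 0) (u2, 0) (v, 0)"
    using E.weak_associativity[of "(u1, 0)" "(u2, 0)" "(v, 0)"] by blast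
  have WA: "cx.binsum (of_nat a0) (\<lambda>i. c (n + int i) (int a0 + k - int i))
               = cx.binsum (of_int n) (\<lambda>i. (- 1) ^ i * a (int a0 + n - int i) (k + int i))" for n k
  proof -
    have "(f \<circ> snd) (E.iterate_term (int a0) n k (u1, 0) (u2, 0) (v, 0))
        = cx.binsum (of_nat a0) (\<lambda>i. c (n + int i) (int a0 + k - int i))"
      unfolding E.iterate_term_def c_eq by (subst S2.linear_binsum[OF lfs E.tr_iterate]) simp
    moreover have "(f \<circ> snd) (E.product_term (int a0) n k (u1, 0) (u2, 0) (v, 0))
        = cx.binsum (of_int n) (\<lambda>i. (- 1) ^ i * a (int a0 + n - int i) (k + int i))"
      unfolding E.product_term_def S2.altsum_def a_eq
      by (subst S2.linear_binsum[OF lfs S2.truncated_alt[OF E.tr_product]]) (simp add: fs.scale del: o_apply)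
    ultimately show ?thesis using a0[of "int a0" n k] by simp
  qed
  obtain S1 where S1: "finite S1" "\<And>m n. m + n \<notin> S1 \<Longrightarrow> f (charge_cocycle u1 m (Y u2 n v)) = 0"
    using finite_diagonals[OF f, of "\<lambda>u1 u2 v m n. charge_cocycle u1 m (Y u2 n v)" u1 u2 v]
      charge_cocycle_gr[OF _ Y_gr]
    by (fastforce simp: Yr.add Yr.scale Yl.add Yl.scale Xr.add Xr.scale Xl.add Xl.scale algebra_simps)
  obtain S2 where S2: "finite S2" "\<And>m n. m + n \<notin> S2 \<Longrightarrow> f (Y u1 m (charge_cocycle u2 n v)) = 0"
    using finite_diagonals[OF f, of "\<lambda>u1 u2 v m n. Y u1 m (charge_cocycle u2 n v)" u1 u2 v]
      Y_gr[OF _ charge_cocycle_gr]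
    by (fastforce simp: Yr.add Yr.scale Yl.add Yl.scale Xr.add Xr.scale Xl.add Xl.scale algebra_simps)
  obtain S3 where S3: "finite S3" "\<And>m n. m + n \<notin> S3 \<Longrightarrow> f (charge_cocycle (Y u1 m u2) n v) = 0"
    using finite_diagonals[OF f, of "\<lambda>u1 u2 v m n. charge_cocycle (Y u1 m u2) n v" u1 u2 v]
      charge_cocycle_gr[OF Y_gr]
    by (fastforce simp: Yr.add Yr.scale Yl.add Yl.scale Xr.add Xr.scale Xl.add Xl.scale algebra_simps)
  obtain S4 where S4: "finite S4" "\<And>m n. m + n \<notin> S4 \<Longrightarrow> f (Y (charge_cocycle u1 m u2) n v) = 0"
    using finite_diagonals[OF f, of "\<lambda>u1 u2 v m n. Y (charge_cocycle u1 m u2) n v" u1 u2 v]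
      Y_gr[OF charge_cocycle_gr]
    by (fastforce simp: Yr.add Yr.scale Yl.add Yl.scale Xr.add Xr.scale Xl.add Xl.scale algebra_simps)
  obtain N1 N2 where N1: "\<And>n. n \<ge> N1 \<Longrightarrow> Y u2 n v = 0" and N2: "\<And>n. n \<ge> N2 \<Longrightarrow> charge_cocycle u2 n v = 0"
    using Y_bounded charge_cocycle_bounded by metis
  obtain N3 N4 where N3: "\<And>n. n \<ge> N3 \<Longrightarrow> Y u1 n u2 = 0" and N4: "\<And>n. n \<ge> N4 \<Longrightarrow> charge_cocycle u1 n u2 = 0"
    using Y_bounded charge_cocycle_bounded by metis
  have fin: "finite (S1 \<union> S2 \<union> S3 \<union> S4)" using S1 S2 S3 S4 by simp
  have aS: "a m n = 0" if "m + n \<notin> S1 \<union> S2 \<union> S3 \<union> S4" for m n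
    using that S1(2) S2(2) by (simp add: a_def)
  have cS: "c m n = 0" if "m + n \<notin> S1 \<union> S2 \<union> S3 \<union> S4" for m n
    using that S3(2) S4(2) by (simp add: c_def)
  have aN: "a m n = 0" if "n \<ge> max N1 N2" for m n
    using that N1 N2 by (simp add: a_def Xr.zero Yr.zero f.zero)
  have cN: "c m n = 0" if "m \<ge> max N3 N4" for m n
    using that N3 N4 by (simp add: c_def Xl.zero Yl.zero f.zero)
  show "\<exists>(P :: complex poly poly) (a :: nat) (b :: nat) (k :: nat). \<forall>z1 z2 :: complex.
          let R = poly (poly P [:z2:]) z1 / (z1 ^ a * z2 ^ b * (z1 - z2) ^ k);
              prod = (\<lambda>(m, n). (f (charge_cocycle u1 m (Y u2 n v)) + f (Y u1 m (charge_cocycle u2 n v)))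
                        * z1 powi (- m - 1) * z2 powi (- n - 1));
              iter = (\<lambda>(m, n). (f (charge_cocycle (Y u1 m u2) n v) + f (Y (charge_cocycle u1 m u2) n v))
                        * (z1 - z2) powi (- m - 1) * z2 powi (- n - 1))
          in (cmod z1 > cmod z2 \<and> cmod z2 > 0
                \<longrightarrow> prod abs_summable_on UNIV \<and> (prod has_sum R) UNIV) \<and>
             (cmod z2 > cmod (z1 - z2) \<and> cmod (z1 - z2) > 0
                \<longrightarrow> iter abs_summable_on UNIV \<and> (iter has_sum R) UNIV)"
    using duality_of_weak_associativity[OF fin aS cS aN cN WA]
    unfolding Let_def abs_has_sum_def a_def c_def .
qed

theorem charge_cocycle_in_cocycles: "charge_cocycle \<in> cocycles"
proof -
  \<comment> \<open>The commutator formula at mode 0, where \<open>K\<close> vanishes.\<close>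
  have "D (charge_cocycle u n v) - charge_cocycle u n (D v) = charge_cocycle (D u) n v" for u n v
    using charge_cocycle_commutator[of 0 u n v] by (simp add: binsum_at_0 K_0 omega_derivation Yr.zero Yl.zero)
  moreover have "laurent_bilinear charge_cocycle"
    unfolding laurent_bilinear_def using linear_charge_cocycle charge_cocycle_bounded by blast
  moreover have "weight_compatible charge_cocycle"
    unfolding weight_compatible_def using charge_cocycle_gr by blast
  ultimately show ?thesis
    unfolding cocycles_def mem_Collect_eq
    using charge_cocycle_vac charge_cocycle_vac_right charge_cocycle_D charge_cocycle_duality charge_cocycle_skew
    by blast
qed

end


context universal_virasoro
begin

section \<open>The commutator formula for cocycles\<close>

text \<open>The \<open>t\<close>-part of the commutator formula for \<open>Y + t Z\<close>.\<close>

definition first_order_commutator :: "('v \<Rightarrow> int \<Rightarrow> 'v \<Rightarrow> 'v) \<Rightarrow> 'v \<Rightarrow> 'v \<Rightarrow> 'v \<Rightarrow> bool" where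
  "first_order_commutator Z u1 u2 v \<longleftrightarrow> (\<forall>m n.
     Z u1 m (Y u2 n v) + Y u1 m (Z u2 n v) - (Z u2 n (Y u1 m v) + Y u2 n (Z u1 m v))
     = binsum (of_int m) (\<lambda>i. Z (Y u1 (int i) u2) (m + n - int i) v + Y (Z u1 (int i) u2) (m + n - int i) v))"

lemma laurent_bilinear_linear:
  assumes "laurent_bilinear Z"
  shows "Vector_Spaces.linear (*s) (*s) (\<lambda>v. Z u n v)" "Vector_Spaces.linear (*s) (*s) (\<lambda>u. Z u n v)"
    "\<exists>N. \<forall>n\<ge>N. Z u n v = 0"
  using assms unfolding laurent_bilinear_def by blast+

lemma linear_zero: "Vector_Spaces.linear (*s) (*s) f \<Longrightarrow> f 0 = 0"
  by (metis linear_scale' scale_zero_left)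

lemma first_order_truncated:
  assumes "laurent_bilinear Z"
  shows "\<exists>N. \<forall>i\<ge>N. \<forall>f v. Z (Y u1 (int i) u2) (f i) v = 0 \<and> Y (Z u1 (int i) u2) (f i) v = 0"
proof -
  obtain N1 where N1: "\<And>n. n \<ge> N1 \<Longrightarrow> Y u1 n u2 = 0" using Y_bounded by blast
  obtain N2 where N2: "\<And>n. n \<ge> N2 \<Longrightarrow> Z u1 n u2 = 0" using laurent_bilinear_linear(3)[OF assms] by blast
  show ?thesis
    by (rule exI[of _ "nat (max N1 N2)"])
      (auto simp: N1 N2 Yl.zero linear_zero[OF laurent_bilinear_linear(2)[OF assms]])
qed

lemma truncated_first_order:
  assumes "laurent_bilinear Z"
  shows "truncated (\<lambda>i. Z (Y u1 (int i) u2) (f i) v)" "truncated (\<lambda>i. Y (Z u1 (int i) u2) (f i) v)"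
  using first_order_truncated[OF assms, of u1 u2] unfolding truncated_def by blast+

text \<open>The derivative property means \<open>Z(e^(yD) g, x) = Z(g, x + y)\<close>; expanding in
  \<open>y\<close> gives the binomial sum. It carries skew symmetry into the inner product of an
  iterate.\<close>

lemma esum_derivation:
  assumes lin: "\<And>n. Vector_Spaces.linear (*s) (*s) (\<lambda>u. Z u n)"
    and ZD: "\<And>x n. Z (D x) n = (- of_int n) *s Z x (n - 1)"
    and g: "\<exists>N. \<forall>q\<ge>N. g q = 0"
  shows "Z (V.esum m g) n = (- 1) powi (m + 1) *s binsum (of_int n) (\<lambda>j. Z (g (m + int j)) (n - int j))"
proof -
  interpret Z: Vector_Spaces.linear "(*s)" "(*s)" "\<lambda>u. Z u k" for k by (rule lin)
  have iter: "Z ((W 0 ^^ j) x) n = ((- 1) ^ j * (fact j * (of_int n gchoose j))) *s Z x (n - int j)" for j x n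
  proof (induction j arbitrary: n)
    case (Suc j)
    have "Z ((W 0 ^^ Suc j) x) n = ((- of_int n) * ((- 1) ^ j * (fact j * (of_int (n - 1) gchoose j)))) *s Z x (n - 1 - int j)"
      by (simp add: omega_derivation ZD Suc)
    also have "(- of_int n) * ((- 1) ^ j * (fact j * (of_int (n - 1) gchoose j)))
        = (- 1) ^ Suc j * (fact (Suc j) * (of_int n gchoose Suc j) :: complex)"
      using arg_cong[OF gbinomial_absorption[of j "of_int n :: complex"], of "\<lambda>x. fact j * ((- 1) ^ j * x)"]
      by (simp add: algebra_simps)
    also have "n - 1 - int j = n - int (Suc j)" by simp
    finally show ?case .
  qed simp
  have dpow: "Z (V.dpow (int j) x) n = ((- 1) ^ j * (of_int n gchoose j)) *s Z x (n - int j)" for j x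
    by (simp add: V.dpow_def Z.scale iter)
  from g obtain N where N: "\<And>q. q \<ge> N \<Longrightarrow> g q = 0" by blast
  define M where "M = nat (N - m)"
  have "N \<le> m + int M" by (simp add: M_def)
  then have "Z (V.esum m g) n = (\<Sum>j<M. (- 1) powi (- (m + int j) - 1) *s Z (V.dpow (int j) (g (m + int j))) n)"
    by (subst V.esum_eq[of m M]) (auto simp: N Z.sum Z.scale)
  also have "\<dots> = (\<Sum>j<M. (- 1) powi (m + 1) *s (of_int n gchoose j) *s Z (g (m + int j)) (n - int j))"
  proof (rule sum.cong[OF refl])
    fix j
    have "(- 1 :: complex) powi (- (m + int j) - 1) * (- 1) ^ j = (- 1) powi (m + 1)"
      unfolding sgn_powi(3)[symmetric] sgn_powi(1)[symmetric] sgn_powi(2)[of "m + 1", symmetric]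
      by (rule arg_cong[of _ _ "\<lambda>e. (- 1) powi e"]) simp
    then show "(- 1) powi (- (m + int j) - 1) *s Z (V.dpow (int j) (g (m + int j))) n
      = (- 1) powi (m + 1) *s (of_int n gchoose j) *s Z (g (m + int j)) (n - int j)"
      unfolding dpow scale_scale mult.assoc[symmetric] by simp
  qed
  also have "\<dots> = (- 1) powi (m + 1) *s binsum (of_int n) (\<lambda>j. Z (g (m + int j)) (n - int j))"
    using \<open>N \<le> m + int M\<close> by (subst binsum_eq[of M]) (auto simp: N Z.zero scale_sum_right)
  finally show ?thesis .
qed

lemma cocycle_properties:
  assumes "Y1 \<in> cocycles"
  shows "laurent_bilinear Y1" "weight_compatible Y1" "Y1 vac n v = 0" "Y1 u n vac = 0"
    "D (Y1 u n v) - Y1 u n (D v) = Y1 (D u) n v" "Y1 (D u) n v = (- of_int n) *s Y1 u (n - 1) v"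
    "cocycle_duality Y1" "Y1 u n v = V.esum n (\<lambda>q. Y1 v q u)"
  using assms unfolding cocycles_def esum_D_form by blast+

lemma cocycle_gr:
  assumes "Y1 \<in> cocycles" "u \<in> gr p" "v \<in> gr q"
  shows "Y1 u n v \<in> gr (p + q - n - 1)"
  using cocycle_properties(2)[OF assms(1)] assms(2,3) unfolding weight_compatible_def by blast

text \<open>When \<open>f\<close> sees only the diagonal \<open>m + n = s\<close>, nothing is lost
  by setting \<open>z2 = 1\<close>, and functions of one variable remain.\<close>

lemma diagonal_duality:
  assumes dual: "cocycle_duality Y1" and f: "f \<in> graded_dual"
    and a0: "\<And>m n. m + n \<noteq> s \<Longrightarrow> f (Y1 u1 m (Y u2 n v)) + f (Y u1 m (Y1 u2 n v)) = 0"
    and c0: "\<And>m n. m + n \<noteq> s \<Longrightarrow> f (Y1 (Y u1 m u2) n v) + f (Y (Y1 u1 m u2) n v) = 0"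
  shows "\<exists>(P :: complex poly) a k.
    (\<forall>z. norm z > 1 \<longrightarrow> ((\<lambda>m. (f (Y1 u1 m (Y u2 (s - m) v)) + f (Y u1 m (Y1 u2 (s - m) v))) * z powi (- m - 1))
        has_sum poly P z / (z ^ a * (z - 1) ^ k)) UNIV) \<and>
    (\<forall>w. 0 < norm w \<longrightarrow> norm w < 1 \<longrightarrow>
        ((\<lambda>m. (f (Y1 (Y u1 m u2) (s - m) v) + f (Y (Y1 u1 m u2) (s - m) v)) * w powi (- m - 1))
        has_sum poly P (1 + w) / ((1 + w) ^ a * w ^ k)) UNIV)"
proof -
  define A where "A m n = f (Y1 u1 m (Y u2 n v)) + f (Y u1 m (Y1 u2 n v))" for m n
  define C where "C m n = f (Y1 (Y u1 m u2) n v) + f (Y (Y1 u1 m u2) n v)" for m n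
  from dual f obtain P :: "complex poly poly" and a b k where
    P: "\<And>z1 z2 :: complex.
          let R = poly (poly P [:z2:]) z1 / (z1 ^ a * z2 ^ b * (z1 - z2) ^ k);
              prod = (\<lambda>(m, n). A m n * z1 powi (- m - 1) * z2 powi (- n - 1));
              iter = (\<lambda>(m, n). C m n * (z1 - z2) powi (- m - 1) * z2 powi (- n - 1))
          in (cmod z1 > cmod z2 \<and> cmod z2 > 0
                \<longrightarrow> prod abs_summable_on UNIV \<and> (prod has_sum R) UNIV) \<and>
             (cmod z2 > cmod (z1 - z2) \<and> cmod (z1 - z2) > 0
                \<longrightarrow> iter abs_summable_on UNIV \<and> (iter has_sum R) UNIV)"
    unfolding cocycle_duality_def A_def C_def by blast
  have diag: "((\<lambda>m. G m (s - m) * z powi (- m - 1)) has_sum R) UNIV"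
    if "(\<lambda>(m, n). G m n * z powi (- m - 1) * 1 powi (- n - 1)) abs_summable_on UNIV"
      "((\<lambda>(m, n). G m n * z powi (- m - 1) * 1 powi (- n - 1)) has_sum R) UNIV"
      "\<And>m n. m + n \<noteq> s \<Longrightarrow> G m n = 0" for G :: "int \<Rightarrow> int \<Rightarrow> complex" and z R
  proof -
    have "abs_has_sum (\<lambda>(m, n). if m + n = s then (\<lambda>(m, n). G m n * z powi (- m - 1)) (m, n) else 0) R"
      unfolding abs_has_sum_def
      using that(1,2) by (rule conjI[THEN subst[where P = "\<lambda>g. g abs_summable_on UNIV \<and> (g has_sum R) UNIV", rotated]])
        (auto simp: fun_eq_iff that(3))
    then show ?thesis unfolding abs_has_sum_diagonal by (simp add: abs_has_sum_def)
  qed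
  show ?thesis
  proof (intro exI conjI allI impI)
    fix z :: complex assume "norm z > 1"
    then show "((\<lambda>m. (f (Y1 u1 m (Y u2 (s - m) v)) + f (Y u1 m (Y1 u2 (s - m) v))) * z powi (- m - 1))
        has_sum poly (poly P [:1:]) z / (z ^ a * (z - 1) ^ k)) UNIV"
      using P[where ?z1.0 = z and ?z2.0 = 1] diag[of A z] a0 unfolding Let_def A_def[symmetric] by simp
  next
    fix w :: complex assume "0 < norm w" "norm w < 1"
    then show "((\<lambda>m. (f (Y1 (Y u1 m u2) (s - m) v) + f (Y (Y1 u1 m u2) (s - m) v)) * w powi (- m - 1))
        has_sum poly (poly P [:1:]) (1 + w) / ((1 + w) ^ a * w ^ k)) UNIV"
      using P[where ?z1.0 = "1 + w" and ?z2.0 = 1] diag[of C w] c0 unfolding Let_def C_def[symmetric] by simp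
  qed
qed

text \<open>It suffices to test on functionals of the single weight \<open>d\<close>. Duality for
  \<open>(u1, u2)\<close> and for \<open>(u2, u1)\<close>, linked by skew symmetry, then meets the
  hypotheses of \<open>commutator_of_duality\<close>.\<close>

lemma cocycle_commutator_homogeneous:
  assumes Y1: "Y1 \<in> cocycles" and u1: "u1 \<in> gr p1" and u2: "u2 \<in> gr p2" and v: "v \<in> gr q"
  shows "first_order_commutator Y1 u1 u2 v"
  unfolding first_order_commutator_def
proof (intro allI)
  fix m n
  note Y1_gr = cocycle_gr[OF Y1] and bil = cocycle_properties(1)[OF Y1]
  let ?R = "binsum (of_int m) (\<lambda>i. Y1 (Y u1 (int i) u2) (m + n - int i) v + Y (Y1 u1 (int i) u2) (m + n - int i) v)"
  define s where "s = m + n"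
  define d where "d = p1 + p2 + q - s - 2"
  have gr1: "Y1 a k (Y b l w) \<in> gr (r1 + r2 + r3 - k - l - 2)" "Y a k (Y1 b l w) \<in> gr (r1 + r2 + r3 - k - l - 2)"
      "Y1 (Y a k b) l w \<in> gr (r1 + r2 + r3 - k - l - 2)" "Y (Y1 a k b) l w \<in> gr (r1 + r2 + r3 - k - l - 2)"
    if "a \<in> gr r1" "b \<in> gr r2" "w \<in> gr r3" for a b w k l r1 r2 r3
    using Y1_gr[OF that(1) Y_gr[OF that(2,3), of l], of k] Y_gr[OF that(1) Y1_gr[OF that(2,3), of l], of k]
      Y1_gr[OF Y_gr[OF that(1,2), of k] that(3), of l] Y_gr[OF Y1_gr[OF that(1,2), of k] that(3), of l]
    by (simp_all add: algebra_simps)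
  note g12 = gr1[OF u1 u2 v] and g21 = gr1[OF u2 u1 v, unfolded add.commute[of p2 p1]]
  have "Y1 u1 m (Y u2 n v) + Y u1 m (Y1 u2 n v) - (Y1 u2 n (Y u1 m v) + Y u2 n (Y1 u1 m v)) - ?R = 0"
  proof (rule homogeneous_separation)
    have e: "p1 + p2 + q - m - n - 2 = d" "p1 + p2 + q - n - m - 2 = d" "\<And>i. p1 + p2 + q - i - (m + n - i) - 2 = d"
      by (simp_all add: d_def s_def)
    show "Y1 u1 m (Y u2 n v) + Y u1 m (Y1 u2 n v) - (Y1 u2 n (Y u1 m v) + Y u2 n (Y1 u1 m v)) - ?R \<in> gr d"
      using g12(1,2)[of m n] g21(1,2)[of n m] g12(3,4)[of "int i" "m + n - int i" for i]
      unfolding e by (intro gr_diff gr_add gr_binsum) auto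
  next
    fix f assume lf: "Vector_Spaces.linear (*s) (*) f" and off: "\<And>n v. n \<noteq> d \<Longrightarrow> v \<in> gr n \<Longrightarrow> f v = 0"
    interpret f: Vector_Spaces.linear "(*s)" "(*)" f by (rule lf)
    have f: "f \<in> graded_dual"
      using lf off finite_subset[of "{n. \<exists>v\<in>gr n. f v \<noteq> 0}" "{d}"] unfolding graded_dual_def by auto
    have f0: "f x = 0" if "x \<in> gr (p1 + p2 + q - k - l - 2)" "k + l \<noteq> s" for x k l
      using off[OF _ that(1)] that(2) by (simp add: d_def)
    define A where "A k = f (Y1 u1 k (Y u2 (s - k) v)) + f (Y u1 k (Y1 u2 (s - k) v))" for k
    define C where "C k = f (Y1 (Y u1 k u2) (s - k) v) + f (Y (Y1 u1 k u2) (s - k) v)" for k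
    define A' where "A' k = f (Y1 u2 k (Y u1 (s - k) v)) + f (Y u2 k (Y1 u1 (s - k) v))" for k
    define C' where "C' k = f (Y1 (Y u2 k u1) (s - k) v) + f (Y (Y1 u2 k u1) (s - k) v)" for k
    have zerog12: "\<And>k l. k + l \<noteq> s \<Longrightarrow> f (Y1 u1 k (Y u2 l v)) + f (Y u1 k (Y1 u2 l v)) = 0"
        "\<And>k l. k + l \<noteq> s \<Longrightarrow> f (Y1 (Y u1 k u2) l v) + f (Y (Y1 u1 k u2) l v) = 0"
      using f0[OF g12(1)] f0[OF g12(2)] f0[OF g12(3)] f0[OF g12(4)] by simp_all
    have zerog21: "\<And>k l. k + l \<noteq> s \<Longrightarrow> f (Y1 u2 k (Y u1 l v)) + f (Y u2 k (Y1 u1 l v)) = 0"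
        "\<And>k l. k + l \<noteq> s \<Longrightarrow> f (Y1 (Y u2 k u1) l v) + f (Y (Y1 u2 k u1) l v) = 0"
      using f0[OF g21(1)] f0[OF g21(2)] f0[OF g21(3)] f0[OF g21(4)] by simp_all
    obtain P a k where dual:
      "\<And>z. norm z > 1 \<Longrightarrow> ((\<lambda>m. A m * z powi (- m - 1)) has_sum poly P z / (z ^ a * (z - 1) ^ k)) UNIV"
      "\<And>w. 0 < norm w \<Longrightarrow> norm w < 1 \<Longrightarrow>
         ((\<lambda>m. C m * w powi (- m - 1)) has_sum poly P (1 + w) / ((1 + w) ^ a * w ^ k)) UNIV"
      using diagonal_duality[OF cocycle_properties(7)[OF Y1] f zerog12] unfolding A_def C_def by blast
    obtain P' a' k' where dual':
      "\<And>z. norm z > 1 \<Longrightarrow> ((\<lambda>m. A' m * z powi (- m - 1)) has_sum poly P' z / (z ^ a' * (z - 1) ^ k')) UNIV"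
      "\<And>w. 0 < norm w \<Longrightarrow> norm w < 1 \<Longrightarrow>
         ((\<lambda>m. C' m * w powi (- m - 1)) has_sum poly P' (1 + w) / ((1 + w) ^ a' * w ^ k')) UNIV"
      using diagonal_duality[OF cocycle_properties(7)[OF Y1] f zerog21] unfolding A'_def C'_def by blast
    note z = linear_zero[OF laurent_bilinear_linear(1)[OF bil]] linear_zero[OF laurent_bilinear_linear(2)[OF bil]]
      Yl.zero Yr.zero f.zero
    have bA: "\<exists>M. \<forall>k<M. f (Y1 a k (Y b (s - k) v)) + f (Y a k (Y1 b (s - k) v)) = 0" for a b
    proof -
      obtain N1 N2 where "\<And>n. n \<ge> N1 \<Longrightarrow> Y b n v = 0" "\<And>n. n \<ge> N2 \<Longrightarrow> Y1 b n v = 0"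
        using Y_bounded laurent_bilinear_linear(3)[OF bil] by metis
      then show ?thesis by (intro exI[of _ "s - max N1 N2"]) (simp add: z)
    qed
    have bC: "\<exists>N. \<forall>k\<ge>N. f (Y1 (Y a k b) (s - k) v) + f (Y (Y1 a k b) (s - k) v) = 0" for a b
    proof -
      obtain N1 N2 where "\<And>n. n \<ge> N1 \<Longrightarrow> Y a n b = 0" "\<And>n. n \<ge> N2 \<Longrightarrow> Y1 a n b = 0"
        using Y_bounded laurent_bilinear_linear(3)[OF bil] by metis
      then show ?thesis by (intro exI[of _ "max N1 N2"]) (simp add: z)
    qed
    obtain M where M: "\<And>k. k < M \<Longrightarrow> A k = 0" using bA unfolding A_def by blast
    obtain M' where M': "\<And>k. k < M' \<Longrightarrow> A' k = 0" using bA unfolding A'_def by blast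
    obtain N where N: "\<And>k. k \<ge> N \<Longrightarrow> C k = 0" using bC unfolding C_def by blast
    obtain N' where N': "\<And>k. k \<ge> N' \<Longrightarrow> C' k = 0" using bC unfolding C'_def by blast
    have f_binsum: "f (binsum b g) = cx.binsum b (\<lambda>i. f (g i))" if "truncated g" for b g
      by (rule linear_binsum[OF lf that])
    \<comment> \<open>Skew symmetry of \<open>Y\<close> is used inside \<open>Y1\<close>, and that
      of \<open>Y1\<close> inside \<open>Y\<close>.\<close>
    have skew: "C k = (- 1) powi (k + 1) * cx.binsum (of_int (s - k)) (\<lambda>i. C' (k + int i))" for k
    proof -
      have t1: "truncated (\<lambda>j. Y1 (Y u2 (k + int j) u1) (s - k - int j) v)"
        by (rule truncated_map[OF truncated_Y[of u2 k u1]]) (simp add: z)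
      have t2: "truncated (\<lambda>j. Y (Y1 u2 (k + int j) u1) (s - k - int j) v)"
        by (rule truncated_map[OF truncated_int[OF laurent_bilinear_linear(3)[OF bil, of u2 u1], of k]]) (simp add: z)
      have "Y1 (Y u1 k u2) (s - k) v
          = (- 1) powi (k + 1) *s binsum (of_int (s - k)) (\<lambda>j. Y1 (Y u2 (k + int j) u1) (s - k - int j) v)"
        by (subst V.skew_symmetry, rule esum_derivation[of "\<lambda>u n. Y1 u n v"])
          (use laurent_bilinear_linear(2)[OF bil] cocycle_properties(6)[OF Y1] Y_bounded in blast)+
      moreover have "Y (Y1 u1 k u2) (s - k) v
          = (- 1) powi (k + 1) *s binsum (of_int (s - k)) (\<lambda>j. Y (Y1 u2 (k + int j) u1) (s - k - int j) v)"
        by (subst cocycle_properties(8)[OF Y1], rule esum_derivation[of "\<lambda>u n. Y u n v"])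
          (use linear_Y_left Y_D laurent_bilinear_linear(3)[OF bil] in blast)+
      ultimately have "C k = f ((- 1) powi (k + 1) *s binsum (of_int (s - k))
          (\<lambda>j. Y1 (Y u2 (k + int j) u1) (s - k - int j) v + Y (Y1 u2 (k + int j) u1) (s - k - int j) v))"
        unfolding C_def by (simp add: f.add binsum_add[OF t1 t2] scale_right_distrib)
      also have "\<dots> = (- 1) powi (k + 1) * cx.binsum (of_int (s - k)) (\<lambda>i. C' (k + int i))"
        unfolding C'_def f.scale f_binsum[OF truncated_add[OF t1 t2]] by (simp only: f.add diff_diff_eq)
      finally show ?thesis .
    qed
    have "A m - A' (s - m) = cx.binsum (of_int m) (\<lambda>i. C (int i))"
      by (rule commutator_of_duality[OF M N M' N' dual dual' skew])
    moreover have "f ?R = cx.binsum (of_int m) (\<lambda>i. C (int i))"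
      unfolding C_def s_def
      by (subst f_binsum[OF truncated_add[OF truncated_first_order[OF bil]]]) (simp add: f.add)
    ultimately show "f (Y1 u1 m (Y u2 n v) + Y u1 m (Y1 u2 n v) - (Y1 u2 n (Y u1 m v) + Y u2 n (Y1 u1 m v)) - ?R) = 0"
      by (simp add: f.add f.diff A_def A'_def s_def)
  qed
  then show "Y1 u1 m (Y u2 n v) + Y u1 m (Y1 u2 n v) - (Y1 u2 n (Y u1 m v) + Y u2 n (Y1 u1 m v)) = ?R" by simp
qed

lemma first_order_commutator_add:
  assumes Z: "laurent_bilinear Z" and Z': "laurent_bilinear Z'"
    and "first_order_commutator Z u1 u2 v" "first_order_commutator Z' u1 u2 v"
  shows "first_order_commutator (\<lambda>u n v. Z u n v + a *s Z' u n v) u1 u2 v"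
  unfolding first_order_commutator_def
proof (intro allI)
  fix m n
  let ?f = "\<lambda>Z i. Z (Y u1 (int i) u2) (m + n - int i) v + Y (Z u1 (int i) u2) (m + n - int i) v"
  have t: "truncated (?f Z)" "truncated (?f Z')"
    by (rule truncated_add[OF truncated_first_order[OF Z]], rule truncated_add[OF truncated_first_order[OF Z']])
  have t3: "truncated (\<lambda>i. a *s ?f Z' i)" by (rule truncated_map[OF t(2)]) simp
  have "binsum (of_int m) (?f (\<lambda>u n v. Z u n v + a *s Z' u n v)) = binsum (of_int m) (\<lambda>i. ?f Z i + a *s ?f Z' i)"
    by (simp add: Yl.add Yl.scale scale_right_distrib algebra_simps)
  also have "\<dots> = binsum (of_int m) (?f Z) + a *s binsum (of_int m) (?f Z')"
    by (simp only: binsum_add[OF t(1) t3] binsum_scale[OF t(2)])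
  also have "\<dots> = Z u1 m (Y u2 n v) + Y u1 m (Z u2 n v) - (Z u2 n (Y u1 m v) + Y u2 n (Z u1 m v))
     + a *s (Z' u1 m (Y u2 n v) + Y u1 m (Z' u2 n v) - (Z' u2 n (Y u1 m v) + Y u2 n (Z' u1 m v)))"
    using assms(3,4) unfolding first_order_commutator_def by simp
  finally show "Z u1 m (Y u2 n v) + a *s Z' u1 m (Y u2 n v) + Y u1 m (Z u2 n v + a *s Z' u2 n v)
     - (Z u2 n (Y u1 m v) + a *s Z' u2 n (Y u1 m v) + Y u2 n (Z u1 m v + a *s Z' u1 m v))
     = binsum (of_int m) (?f (\<lambda>u n v. Z u n v + a *s Z' u n v))"
    by (simp add: Yr.add Yr.scale scale_right_distrib scale_right_diff_distrib)
qed

end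


section \<open>Cocycles modulo coboundaries\<close>

context universal_virasoro
begin

text \<open>By \<open>rel\<close> the modes \<open>W + t U\<close> satisfy the relations of
  \<open>W\<close> with the same charge. Freeness yields \<open>v \<mapsto> v + t \<phi>(v)\<close>
  intertwining the two on creation modes, and \<open>rel\<close> extends this to all modes along
  words.\<close>

lemma derivation_of_modes:
  assumes lin: "\<And>k. Vector_Spaces.linear (*s) (*s) (U k)"
    and rel: "\<And>m n v. U m (W n v) + W m (U n v) - (U n (W m v) + W n (U m v)) = of_int (m - n) *s U (m + n - 1) v"
    and U_vac: "\<And>m. m \<ge> 0 \<Longrightarrow> U m vac = 0" and U0: "\<And>v. U 0 v = 0"
    and gr: "\<And>q v k. v \<in> gr q \<Longrightarrow> U k v \<in> gr (q + 1 - k)"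
  obtains \<phi> where "Vector_Spaces.linear (*s) (*s) \<phi>" "\<And>n. \<phi> ` gr n \<subseteq> gr n" "\<And>v. \<phi> (D v) = D (\<phi> v)"
    "\<phi> vac = 0" "\<And>k v. \<phi> (W k v) = W k (\<phi> v) + U k v"
proof -
  interpret U: Vector_Spaces.linear "(*s)" "(*s)" "U k" for k by (rule lin)
  define lam where "lam j p = (W (- 1 - int j) (fst p), W (- 1 - int j) (snd p) + U (- 1 - int j) (fst p))" for j p
  have "creation_module scale2 UNIV lam"
    unfolding creation_module_def
  proof (intro conjI ballI allI vector_space_scale2)
    show "module.subspace scale2 (UNIV :: ('v \<times> 'v) set)" by (rule S2.subspace_UNIV)
    show "lam i (lam j x) - lam j (lam i x) = scale2 (of_int (int j - int i)) (lam (i + j + 2) x)" for i j x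
    proof -
      have e: "- 1 - int i - (- 1 - int j) = int j - int i" "- 1 - int i + (- 1 - int j) - 1 = - 1 - int (i + j + 2)"
        by simp_all
      have n2: "- 1 - int i + (- 1 - int j) \<noteq> 2" by simp
      have r1: "W (- 1 - int i) (W (- 1 - int j) y) - W (- 1 - int j) (W (- 1 - int i) y)
          = of_int (int j - int i) *s W (- 1 - int (i + j + 2)) y" for y
        using W_virasoro[of "- 1 - int i" "- 1 - int j" y] n2 unfolding e by simp
      have r2: "U (- 1 - int i) (W (- 1 - int j) y) + W (- 1 - int i) (U (- 1 - int j) y)
          - (U (- 1 - int j) (W (- 1 - int i) y) + W (- 1 - int j) (U (- 1 - int i) y))
          = of_int (int j - int i) *s U (- 1 - int (i + j + 2)) y" for y
        using rel[of "- 1 - int i" "- 1 - int j" y] unfolding e .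
      show ?thesis
        unfolding lam_def scale2_def prod_eq_iff fst_diff snd_diff fst_conv snd_conv scale_right_distrib r1[symmetric] r2[symmetric]
        by (simp add: Yr.add)
    qed
  qed (auto simp: lam_def scale2_def Yr.add Yr.scale U.add U.scale scale_right_distrib prod_eq_iff)
  from universal_property[OF this, of "(vac, 0)"] obtain T where
    T: "Vector_Spaces.linear (*s) scale2 T" "T vac = (vac, 0)" "\<And>j v. T (W (- 1 - int j) v) = lam j (T v)" by blast
  interpret T: Vector_Spaces.linear "(*s)" scale2 T by (rule T(1))
  define \<phi> where "\<phi> = snd \<circ> T"
  have lin_\<phi>: "Vector_Spaces.linear (*s) (*s) \<phi>"
    unfolding \<phi>_def by (rule Vector_Spaces.linear_compose[OF T(1) linear_snd])
  interpret \<phi>: Vector_Spaces.linear "(*s)" "(*s)" \<phi> by (rule lin_\<phi>)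
  have fst_T: "fst (T v) = v" for v
    by (induction v rule: word_induct) (auto simp: T lam_def T.zero T.add T.scale scale2_def)
  have \<phi>_vac: "\<phi> vac = 0" by (simp add: \<phi>_def T)
  have neg: "\<phi> (W (- 1 - int j) v) = W (- 1 - int j) (\<phi> v) + U (- 1 - int j) v" for j v
    by (simp add: \<phi>_def T lam_def fst_T)
  have \<phi>_W: "\<phi> (W k v) = W k (\<phi> v) + U k v" for k v
  proof (induction v arbitrary: k rule: word_induct)
    case vac
    show ?case
    proof (cases "k \<ge> 0")
      case False
      then have "k = - 1 - int (nat (- 1 - k))" by simp
      then show ?thesis using neg by metis
    qed (simp add: U_vac W_vac \<phi>_vac Yr.zero \<phi>.zero)
  next
    case 0 then show ?case by (simp add: Yr.zero U.zero \<phi>.zero)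
  next
    case (add a x y)
    then show ?case by (simp add: Yr.add Yr.scale U.add U.scale \<phi>.add \<phi>.scale scale_right_distrib)
  next
    case (step j x)
    define l where "l = - 1 - int j"
    note neg' = neg[of j, folded l_def]
    have sw: "W k (W l y) = W l (W k y) + of_int (k - l) *s W (k + l - 1) y + (if k + l = 2 then vir_cocycle k else 0) *s (c *s y)" for y
      using W_virasoro[of k l y] by (simp add: algebra_simps)
    have "\<phi> (W k (W l x)) = W l (W k (\<phi> x)) + W l (U k x) + U l (W k x)
        + of_int (k - l) *s W (k + l - 1) (\<phi> x) + of_int (k - l) *s U (k + l - 1) x
        + (if k + l = 2 then vir_cocycle k else 0) *s (c *s \<phi> x)"
      unfolding sw[of x] \<phi>.add \<phi>.scale neg' step by (simp add: Yr.add scale_right_distrib)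
    also have "\<dots> = W k (W l (\<phi> x)) + W k (U l x) + U k (W l x)"
      unfolding sw[of "\<phi> x"] rel[symmetric] by (simp add: algebra_simps)
    also have "\<dots> = W k (\<phi> (W l x)) + U k (W l x)" unfolding neg' by (simp add: Yr.add)
    finally show ?case unfolding l_def .
  qed
  have "\<phi> v \<in> gr q" if "v \<in> gr q" for v q
    using that
  proof (induction rule: graded_induct)
    case (step q j x)
    have "q + 1 - (- 1 - int j) = q + 2 + int j" by simp
    then show ?case
      unfolding neg using W_gr[OF step(2), of "- 1 - int j"] gr[OF step(1), of "- 1 - int j"]
      by (intro gr_add) (simp_all add: add_ac)
  qed (auto simp: \<phi>_vac \<phi>.zero \<phi>.add \<phi>.scale gr_0 gr_add gr_scale)
  then show ?thesis
    using \<phi>_W[of 0] U0 by (intro that[OF lin_\<phi> _ _ \<phi>_vac \<phi>_W]) (auto simp: omega_derivation)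
qed

text \<open>The \<open>t\<close>-part of the Virasoro relations for \<open>W2\<close>; the last term
  comes from the charge \<open>c + t\<close>.\<close>

lemma K_first_order:
  "K m (W n v) + W m (K n v) - (K n (W m v) + W n (K m v))
     = of_int (m - n) *s K (m + n - 1) v + (if m + n = 2 then vir_cocycle m else 0) *s v"
  using arg_cong[OF E.W_rel[of m n "(v, 0)"], of snd]
  by (simp add: W2_def C2_def scale2_def Yr.zero algebra_simps)

text \<open>\<open>Y1 \<omega> n \<omega>\<close> has weight \<open>3 - n\<close>, so
  \<open>low_weights\<close> leaves two constants for \<open>n \<ge> 1\<close>. For
  \<open>n = 0\<close>, of weight 3, skew symmetry determines the value through the one for
  \<open>n = 1\<close>.\<close>

lemma cocycle_conformal:
  assumes Y1: "Y1 \<in> cocycles"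
  obtains a b where "Y1 \<omega> 0 \<omega> = (b / 2) *s D \<omega>" "Y1 \<omega> 1 \<omega> = b *s \<omega>" "Y1 \<omega> 2 \<omega> = 0" "Y1 \<omega> 3 \<omega> = a *s vac"
    "\<And>n. n \<ge> 4 \<Longrightarrow> Y1 \<omega> n \<omega> = 0"
proof -
  have gr3: "Y1 \<omega> n \<omega> \<in> gr (3 - n)" for n
    using cocycle_gr[OF Y1 omega_weight omega_weight, of n] by simp
  obtain b where b: "Y1 \<omega> 1 \<omega> = b *s \<omega>" using low_weights(4)[OF gr3[of 1]] by auto
  obtain a where a: "Y1 \<omega> 3 \<omega> = a *s vac" using low_weights(2)[OF gr3[of 3]] by auto
  have y2: "Y1 \<omega> 2 \<omega> = 0" using low_weights(3)[OF gr3[of 2]] by simp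
  have y4: "Y1 \<omega> n \<omega> = 0" if "n \<ge> 4" for n using low_weights(1)[OF gr3[of n]] that by simp
  have d3: "V.dpow 3 (a *s vac) = 0"
    by (simp add: V.dpow_def numeral_3_eq_3 Yr.scale Yr.zero W_vac)
  have d1: "V.dpow 1 (b *s \<omega>) = b *s D \<omega>"
    by (simp add: V.dpow_def Yr.scale omega_derivation)
  have S: "{..<4::nat} = {0, 1, 2, 3}" by auto
  have "Y1 \<omega> 0 \<omega> = (\<Sum>j\<in>{0, 1, 2, 3}. (- 1) powi (- (0 + int j) - 1) *s V.dpow (int j) (Y1 \<omega> (0 + int j) \<omega>))"
    unfolding S[symmetric] by (subst cocycle_properties(8)[OF Y1], rule V.esum_eq) (simp add: y4)
  also have "\<dots> = - Y1 \<omega> 0 \<omega> + b *s D \<omega>"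
    using d1 d3 by (simp add: a b y2 power_int_minus V.dpow_def Yr.zero numeral_2_eq_2)
  finally have "2 *s Y1 \<omega> 0 \<omega> = b *s D \<omega>" by (simp add: scale_left_distrib[of 1 1, simplified] algebra_simps)
  then have "(1 / 2) *s 2 *s Y1 \<omega> 0 \<omega> = (1 / 2) *s b *s D \<omega>" by simp
  then have "Y1 \<omega> 0 \<omega> = (b / 2) *s D \<omega>" by simp
  from that[OF this b y2 a y4] show ?thesis .
qed

lemma linear_diff_scale:
  assumes "Vector_Spaces.linear (*s) (*s) f" "Vector_Spaces.linear (*s) (*s) g"
  shows "Vector_Spaces.linear (*s) (*s) (\<lambda>v. f v + a *s g v)"
  using vector_space_axioms
  by (simp add: Vector_Spaces.linear_iff linear_add'[OF assms(1)] linear_add'[OF assms(2)]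
      linear_scale'[OF assms(1)] linear_scale'[OF assms(2)] scale_right_distrib add_ac)

lemma coboundary_laurent_bilinear:
  assumes \<phi>: "Vector_Spaces.linear (*s) (*s) \<phi>"
  shows "laurent_bilinear (coboundary \<phi>)"
proof -
  interpret \<phi>: Vector_Spaces.linear "(*s)" "(*s)" \<phi> by (rule \<phi>)
  have "\<exists>N. \<forall>n\<ge>N. coboundary \<phi> u n v = 0" for u v
  proof -
    obtain N1 N2 N3 where "\<And>n. n \<ge> N1 \<Longrightarrow> Y (\<phi> u) n v = 0" "\<And>n. n \<ge> N2 \<Longrightarrow> Y u n v = 0" "\<And>n. n \<ge> N3 \<Longrightarrow> Y u n (\<phi> v) = 0"
      using Y_bounded by metis
    then show ?thesis by (intro exI[of _ "max N1 (max N2 N3)"]) (simp add: coboundary_def \<phi>.zero)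
  qed
  then show ?thesis
    unfolding laurent_bilinear_def Vector_Spaces.linear_iff
    using vector_space_axioms
    by (simp add: coboundary_def Yr.add Yl.add Yr.scale Yl.scale \<phi>.add \<phi>.scale scale_right_distrib scale_right_diff_distrib)
qed

text \<open>A coboundary is the \<open>t\<close>-part of
  \<open>(1 - t \<phi>) Y((1 + t \<phi>) u, x) (1 + t \<phi>) v\<close>, a transport of structure,
  so the formula follows from that for \<open>Y\<close>.\<close>

lemma coboundary_commutator:
  assumes \<phi>: "Vector_Spaces.linear (*s) (*s) \<phi>"
  shows "first_order_commutator (coboundary \<phi>) u1 u2 v"
  unfolding first_order_commutator_def
proof (intro allI)
  fix m n
  interpret \<phi>: Vector_Spaces.linear "(*s)" "(*s)" \<phi> by (rule \<phi>)
  let ?t1 = "\<lambda>i. Y (Y (\<phi> u1) (int i) u2) (m + n - int i) v"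
  let ?t2 = "\<lambda>i. Y (Y u1 (int i) (\<phi> u2)) (m + n - int i) v"
  let ?t3 = "\<lambda>i. Y (Y u1 (int i) u2) (m + n - int i) (\<phi> v)"
  let ?t4 = "\<lambda>i. Y (Y u1 (int i) u2) (m + n - int i) v"
  have t: "truncated ?t1" "truncated ?t2" "truncated ?t3" "truncated ?t4"
    by ((rule truncated_map[OF truncated_Y[of "\<phi> u1" 0 u2]] truncated_map[OF truncated_Y[of u1 0 "\<phi> u2"]]
          truncated_map[OF truncated_Y[of u1 0 u2]], simp add: Yl.zero; fail)+)
  have t4: "truncated (\<lambda>i. \<phi> (?t4 i))" by (rule truncated_map[OF t(4)]) (simp add: \<phi>.zero)
  have "binsum (of_int m) (\<lambda>i. coboundary \<phi> (Y u1 (int i) u2) (m + n - int i) v + Y (coboundary \<phi> u1 (int i) u2) (m + n - int i) v)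
      = binsum (of_int m) (\<lambda>i. ?t1 i + ?t2 i + ?t3 i - \<phi> (?t4 i))"
    by (rule binsum_cong) (simp add: coboundary_def Yl.add Yl.diff)
  also have "\<dots> = binsum (of_int m) ?t1 + binsum (of_int m) ?t2 + binsum (of_int m) ?t3 - \<phi> (binsum (of_int m) ?t4)"
    by (simp only: binsum_diff binsum_add truncated_add t t4 linear_binsum[OF \<phi> t(4)])
  also have "\<dots> = (Y (\<phi> u1) m (Y u2 n v) - Y u2 n (Y (\<phi> u1) m v)) + (Y u1 m (Y (\<phi> u2) n v) - Y (\<phi> u2) n (Y u1 m v))
       + (Y u1 m (Y u2 n (\<phi> v)) - Y u2 n (Y u1 m (\<phi> v))) - \<phi> (Y u1 m (Y u2 n v) - Y u2 n (Y u1 m v))"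
    unfolding commutator ..
  finally show "coboundary \<phi> u1 m (Y u2 n v) + Y u1 m (coboundary \<phi> u2 n v)
      - (coboundary \<phi> u2 n (Y u1 m v) + Y u2 n (coboundary \<phi> u1 m v))
      = binsum (of_int m) (\<lambda>i. coboundary \<phi> (Y u1 (int i) u2) (m + n - int i) v + Y (coboundary \<phi> u1 (int i) u2) (m + n - int i) v)"
    by (simp add: coboundary_def Yr.add Yr.diff \<phi>.diff)
qed

text \<open>With \<open>Z \<omega> = 0\<close> the formula expresses \<open>Z\<close> on
  \<open>W l x\<close> by values on \<open>x\<close>, so vanishing spreads from the vacuum along
  words.\<close>

lemma zero_of_first_order_commutator:
  assumes Z: "laurent_bilinear Z" and \<omega>: "\<And>k v. Z \<omega> k v = 0" and vac: "\<And>u n. Z u n vac = 0"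
    and comm: "\<And>p q u v. u \<in> gr p \<Longrightarrow> v \<in> gr q \<Longrightarrow> first_order_commutator Z \<omega> u v"
  shows "Z u n v = 0"
proof -
  note lin = laurent_bilinear_linear(1,2)[OF Z]
  note z = linear_zero[OF lin(1)] linear_zero[OF lin(2)]
  note a = linear_add'[OF lin(1)] linear_add'[OF lin(2)] linear_scale'[OF lin(1)] linear_scale'[OF lin(2)]
  have hom: "\<forall>p u n. u \<in> gr p \<longrightarrow> Z u n v = 0" if "v \<in> gr q" for q v
    using that
  proof (induction rule: graded_induct)
    case (step q j x)
    show ?case
    proof (intro allI impI)
      fix p u n assume u: "u \<in> gr p"
      have "Z (W (int i) u) k x = 0" for i k using step(2) W_gr[OF u] by blast
      then show "Z u n (W (- 1 - int j) x) = 0"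
        using comm[OF u step(1), unfolded first_order_commutator_def, rule_format, of "- 1 - int j" n] step(2) u
        by (simp add: \<omega> Yr.zero Yl.zero)
    qed
  qed (auto simp: vac z a)
  show ?thesis
  proof (induction u arbitrary: v rule: homogeneous_induct)
    case (homogeneous p u)
    show ?case by (induction v rule: homogeneous_induct) (use hom homogeneous in \<open>auto simp: z a\<close>)
  qed (auto simp: z a)
qed

text \<open>The products \<open>Y1 \<omega> 0 \<omega>\<close> and
  \<open>Y1 \<omega> 1 \<omega>\<close> are \<open>b / 2\<close> times those of \<open>Y\<close>,
  which explains the \<open>W\<close>-term; \<open>2 a\<close> is due to
  \<open>binom(m,3) = 2 vir_cocycle m\<close>.\<close>

lemma cocycle_conformal_commutator:
  assumes Y1: "Y1 \<in> cocycles"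
  obtains a b where "\<And>m n v. Y1 \<omega> m (W n v) + W m (Y1 \<omega> n v) - (Y1 \<omega> n (W m v) + W n (Y1 \<omega> m v))
      = of_int (m - n) *s (Y1 \<omega> (m + n - 1) v + (b / 2) *s W (m + n - 1) v)
        + (if m + n = 2 then (2 * a) * vir_cocycle m else 0) *s v"
proof -
  note bil = cocycle_properties(1)[OF Y1]
  note lin = laurent_bilinear_linear(1,2)[OF bil]
  note z = linear_zero[OF lin(1)] linear_zero[OF lin(2)]
  note add = linear_add'[OF lin(1)] linear_add'[OF lin(2)] linear_scale'[OF lin(1)] linear_scale'[OF lin(2)]
  obtain a b where y: "Y1 \<omega> 0 \<omega> = (b / 2) *s D \<omega>" "Y1 \<omega> 1 \<omega> = b *s \<omega>" "Y1 \<omega> 2 \<omega> = 0" "Y1 \<omega> 3 \<omega> = a *s vac"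
    "\<And>n. n \<ge> 4 \<Longrightarrow> Y1 \<omega> n \<omega> = 0"
    using cocycle_conformal[OF Y1] by blast
  have "Y1 \<omega> m (W n v) + W m (Y1 \<omega> n v) - (Y1 \<omega> n (W m v) + W n (Y1 \<omega> m v))
      = of_int (m - n) *s (Y1 \<omega> (m + n - 1) v + (b / 2) *s W (m + n - 1) v)
        + (if m + n = 2 then (2 * a) * vir_cocycle m else 0) *s v" for m n v
  proof (induction v rule: homogeneous_induct)
    case 0 then show ?case by (simp add: z Yr.zero)
  next
    case (add d x w)
    let ?L = "\<lambda>v. Y1 \<omega> m (W n v) + W m (Y1 \<omega> n v) - (Y1 \<omega> n (W m v) + W n (Y1 \<omega> m v))"
    have "?L (d *s x + w) = d *s ?L x + ?L w"
      by (simp add: Yr.add Yr.scale linear_add'[OF lin(1)] linear_scale'[OF lin(1)] scale_right_distrib scale_right_diff_distrib)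
    also have "\<dots> = d *s (of_int (m - n) *s (Y1 \<omega> (m + n - 1) x + (b / 2) *s W (m + n - 1) x)
        + (if m + n = 2 then (2 * a) * vir_cocycle m else 0) *s x)
        + (of_int (m - n) *s (Y1 \<omega> (m + n - 1) w + (b / 2) *s W (m + n - 1) w)
        + (if m + n = 2 then (2 * a) * vir_cocycle m else 0) *s w)"
      by (simp only: add)
    also have "\<dots> = of_int (m - n) *s (Y1 \<omega> (m + n - 1) (d *s x + w) + (b / 2) *s W (m + n - 1) (d *s x + w))
        + (if m + n = 2 then (2 * a) * vir_cocycle m else 0) *s (d *s x + w)"
      by (simp add: Yr.add Yr.scale linear_add'[OF lin(1)] linear_scale'[OF lin(1)] scale_right_distrib mult_ac)
    finally show ?case .
  next
    case (homogeneous q v)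
    let ?f = "\<lambda>i. Y1 (W (int i) \<omega>) (m + n - int i) v + Y (Y1 \<omega> (int i) \<omega>) (m + n - int i) v"
    have "?f i = 0" if "i \<ge> 4" for i
      using that by (simp add: y omega_modes z Yl.zero)
    then have "binsum (of_int m) ?f = (\<Sum>i<4. (of_int m gchoose i) *s ?f i)" by (rule binsum_eq)
    also have "{..<4::nat} = {0, 1, 2, 3}" by auto
    also have "(\<Sum>i\<in>{0, 1, 2, 3}. (of_int m gchoose i) *s ?f i)
        = ?f 0 + of_int m *s ?f 1 + (of_int m gchoose 3) *s ?f 3"
      by (simp add: omega_modes y z Yl.zero)
    also have "?f 0 = - (of_int (m + n) *s (Y1 \<omega> (m + n - 1) v + (b / 2) *s W (m + n - 1) v))"
      by (simp add: omega_derivation y Yl.scale Y_D cocycle_properties(6)[OF Y1] scale_right_distrib mult_ac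
          del: of_int_add)
    also have "?f 1 = 2 *s (Y1 \<omega> (m + n - 1) v + (b / 2) *s W (m + n - 1) v)"
      by (simp add: omega_modes y Yl.scale add scale_right_distrib)
    also have "?f 3 = (if m + n = 2 then a *s v else 0)"
      by (simp add: omega_modes y Yl.scale add cocycle_properties(3)[OF Y1] vacuum)
    also have "(of_int m gchoose 3) = 2 * vir_cocycle m"
      by (simp add: gbinomial_prod_rev numeral_3_eq_3 vir_cocycle_def)
    finally have R: "binsum (of_int m) ?f = - (of_int (m + n) *s (Y1 \<omega> (m + n - 1) v + (b / 2) *s W (m + n - 1) v))
        + of_int m *s 2 *s (Y1 \<omega> (m + n - 1) v + (b / 2) *s W (m + n - 1) v)
        + (2 * vir_cocycle m) *s (if m + n = 2 then a *s v else 0)" .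
    have coeff: "- (of_int (m + n) *s x) + of_int m *s 2 *s x = of_int (m - n) *s x" for x
      unfolding scale_minus_left[symmetric] scale_scale scale_left_distrib[symmetric] by (simp add: algebra_simps)
    show ?case
      using cocycle_commutator_homogeneous[OF Y1 omega_weight omega_weight homogeneous,
          unfolded first_order_commutator_def, rule_format, of m n]
      unfolding R coeff by (simp add: mult_ac)
  qed
  from that[OF this] show ?thesis .
qed

lemma cocycle_normal_form:
  assumes Y1: "Y1 \<in> cocycles"
  obtains \<alpha> \<phi> where "Vector_Spaces.linear (*s) (*s) \<phi>" "\<And>n. \<phi> ` gr n \<subseteq> gr n" "\<And>v. \<phi> (D v) = D (\<phi> v)"
    "\<phi> vac = 0" "\<And>u n v. Y1 u n v = \<alpha> *s charge_cocycle u n v - coboundary \<phi> u n v"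
proof -
  note bil = cocycle_properties(1)[OF Y1]
  note lin = laurent_bilinear_linear(1,2)[OF bil]
  note X = charge_cocycle_in_cocycles
  obtain b a where rel: "\<And>m n v. Y1 \<omega> m (W n v) + W m (Y1 \<omega> n v) - (Y1 \<omega> n (W m v) + W n (Y1 \<omega> m v))
      = of_int (m - n) *s (Y1 \<omega> (m + n - 1) v + (b / 2) *s W (m + n - 1) v)
        + (if m + n = 2 then (2 * a) * vir_cocycle m else 0) *s v"
    by (rule cocycle_conformal_commutator[OF Y1]) (rule that)
  \<comment> \<open>Removing \<open>(b / 2) W\<close> takes away \<open>b c\<close> from the central
    term, since \<open>W\<close> enters the bracket twice; the rest is matched by \<open>K\<close>,
    whose central coefficient is 1.\<close>
  define \<alpha> where "\<alpha> = 2 * a - b * c"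
  define U where "U k v = Y1 \<omega> k v + (- (b / 2)) *s W k v + (- \<alpha>) *s K k v" for k v
  have lin_U: "Vector_Spaces.linear (*s) (*s) (U k)" for k
    unfolding U_def by (intro linear_diff_scale lin linear_Y_right linear_K)
  interpret U: Vector_Spaces.linear "(*s)" "(*s)" "U k" for k by (rule lin_U)
  have rel_U: "U m (W n v) + W m (U n v) - (U n (W m v) + W n (U m v)) = of_int (m - n) *s U (m + n - 1) v" for m n v
  proof -
    let ?b = "\<lambda>F G. F m (W n v) + W m (G n v) - (F n (W m v) + W n (G m v))"
    let ?z = "(if m + n = 2 then vir_cocycle m else 0)"
    have half: "d *s (- (b / 2)) *s x = d *s (b / 2) *s x + (- (b / 2)) *s 2 *s d *s x" for d x
      unfolding scale_scale scale_left_distrib[symmetric] by simp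
    have WW: "W m (W n v) + W m (W n v) - (W n (W m v) + W n (W m v)) = 2 *s (of_int (m - n) *s W (m + n - 1) v + ?z *s c *s v)"
      unfolding W_virasoro[symmetric] scale_left_distrib[of 1 1, simplified] by (simp add: algebra_simps)
    have "U m (W n v) + W m (U n v) - (U n (W m v) + W n (U m v))
        = (Y1 \<omega> m (W n v) + W m (Y1 \<omega> n v) - (Y1 \<omega> n (W m v) + W n (Y1 \<omega> m v)))
          + (- (b / 2)) *s (W m (W n v) + W m (W n v) - (W n (W m v) + W n (W m v)))
          + (- \<alpha>) *s (K m (W n v) + W m (K n v) - (K n (W m v) + W n (K m v)))"
      unfolding U_def Yr.add Yr.scale scale_right_distrib scale_right_diff_distrib by (simp add: algebra_simps)
    also have "\<dots> = of_int (m - n) *s U (m + n - 1) v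
        + ((if m + n = 2 then (2 * a) * vir_cocycle m else 0) *s v - b *s ?z *s c *s v - \<alpha> *s ?z *s v)"
      unfolding rel WW K_first_order U_def scale_right_distrib half
      by (simp add: mult_ac del: of_int_diff)
    also have "(if m + n = 2 then (2 * a) * vir_cocycle m else 0) *s v - b *s ?z *s c *s v - \<alpha> *s ?z *s v = 0"
      unfolding scale_scale scale_left_diff_distrib[symmetric] \<alpha>_def by (simp add: left_diff_distrib)
    finally show ?thesis by simp
  qed
  have U_vac: "U k vac = 0" if "k \<ge> 0" for k
    using that by (simp add: U_def cocycle_properties(4)[OF Y1] W_vac K_vac)
  \<comment> \<open>The translation properties of \<open>Y1\<close>, \<open>K\<close> and
    \<open>W\<close> give \<open>[D, U l] = - l U (l - 1)\<close>. Compared with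
    \<open>rel_U\<close> this makes \<open>U 0\<close> commute with creation modes, and it kills the
    vacuum. Its vanishing is what lets \<open>\<phi>\<close> commute with \<open>D\<close>.\<close>
  have U_D: "U 0 v = 0" for v
  proof (induction v rule: word_induct)
    case (step j x)
    define l where "l = - 1 - int j"
    have "D (Z \<omega> l x) - Z \<omega> l (D x) = - (of_int l *s Z \<omega> (l - 1) x)" if "Z \<in> cocycles" for Z
      using cocycle_properties(5,6)[OF that, of \<omega> l x] by simp
    from this[OF Y1] this[OF X] have
      "D (Y1 \<omega> l x) - Y1 \<omega> l (D x) = - (of_int l *s Y1 \<omega> (l - 1) x)" "D (K l x) - K l (D x) = - (of_int l *s K (l - 1) x)"
      by (simp_all add: charge_cocycle_conformal)
    moreover have "D (W l x) - W l (D x) = - (of_int l *s W (l - 1) x)"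
      using W_virasoro[of 0 l x] by (simp add: omega_derivation split: if_splits)
    ultimately have "(D (Y1 \<omega> l x) - Y1 \<omega> l (D x)) + (- (b / 2)) *s (D (W l x) - W l (D x)) + (- \<alpha>) *s (D (K l x) - K l (D x))
        = - (of_int l *s U (l - 1) x)"
      by (simp add: U_def scale_right_distrib scale_right_diff_distrib mult_ac)
    also have "(D (Y1 \<omega> l x) - Y1 \<omega> l (D x)) + (- (b / 2)) *s (D (W l x) - W l (D x)) + (- \<alpha>) *s (D (K l x) - K l (D x))
        = W 0 (U l x) - U l (W 0 x)"
      unfolding U_def omega_derivation[symmetric] Yr.add Yr.scale scale_right_diff_distrib by simp
    finally have "W 0 (U l x) - U l (W 0 x) = - (of_int l *s U (l - 1) x)" .
    then show ?case using rel_U[of l 0 x] step unfolding l_def[symmetric] by (simp add: Yr.zero algebra_simps)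
  qed (auto simp: U_vac U.zero U.add U.scale)
  have U_gr: "U k v \<in> gr (q + 1 - k)" if "v \<in> gr q" for k v q
    using cocycle_gr[OF Y1 omega_weight that, of k] W_gr[OF that, of k] K_gr[OF that, of k]
    unfolding U_def by (intro gr_add gr_scale) (simp_all add: algebra_simps)
  obtain \<phi> where \<phi>: "Vector_Spaces.linear (*s) (*s) \<phi>" "\<And>n. \<phi> ` gr n \<subseteq> gr n" "\<And>v. \<phi> (D v) = D (\<phi> v)"
    "\<phi> vac = 0" "\<And>k v. \<phi> (W k v) = W k (\<phi> v) + U k v"
    by (rule derivation_of_modes[of U, OF lin_U rel_U U_vac U_D U_gr]) (assumption | rule that)+
  interpret \<phi>: Vector_Spaces.linear "(*s)" "(*s)" \<phi> by (rule \<phi>(1))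
  \<comment> \<open>\<open>\<omega>\<close> is \<open>W (- 1) vac\<close>, and on the vacuum only
    the \<open>W\<close>-part of \<open>U\<close> survives.\<close>
  have \<phi>_\<omega>: "\<phi> \<omega> = (- (b / 2)) *s \<omega>"
    using \<phi>(5)[of "- 1" vac] by (simp add: creation \<phi>(4) Yr.zero U_def cocycle_properties(4)[OF Y1] K_vac)
  have \<phi>_iter: "\<phi> ((W 0 ^^ j) v) = (W 0 ^^ j) (\<phi> v)" for j v
    by (induction j) (auto simp: omega_derivation \<phi>(3))
  have \<phi>_dpow: "\<phi> (V.dpow j v) = V.dpow j (\<phi> v)" for j v
    by (simp add: V.dpow_def \<phi>.zero \<phi>.scale \<phi>_iter)
  define Z where "Z u n v = Y1 u n v + 1 *s coboundary \<phi> u n v + (- \<alpha>) *s charge_cocycle u n v" for u n v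
  note bil3 = bil coboundary_laurent_bilinear[OF \<phi>(1)] cocycle_properties(1)[OF X]
  have bilinear_add: "laurent_bilinear (\<lambda>u n v. F u n v + d *s G u n v)" if F: "laurent_bilinear F" and G: "laurent_bilinear G" for F G d
  proof -
    have "\<exists>N. \<forall>n\<ge>N. F u n v + d *s G u n v = 0" for u v
    proof -
      obtain N1 N2 where "\<And>n. n \<ge> N1 \<Longrightarrow> F u n v = 0" "\<And>n. n \<ge> N2 \<Longrightarrow> G u n v = 0"
        using laurent_bilinear_linear(3)[OF F] laurent_bilinear_linear(3)[OF G] by metis
      then show ?thesis by (intro exI[of _ "max N1 N2"]) simp
    qed
    then show ?thesis
      unfolding laurent_bilinear_def
      using linear_diff_scale[OF laurent_bilinear_linear(1)[OF F] laurent_bilinear_linear(1)[OF G]]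
        linear_diff_scale[OF laurent_bilinear_linear(2)[OF F] laurent_bilinear_linear(2)[OF G]] by blast
  qed
  have "Z u n v = 0" for u n v
  proof (rule zero_of_first_order_commutator[of Z])
    show "laurent_bilinear Z" unfolding Z_def by (intro bilinear_add bil3)
    \<comment> \<open>The commutator of \<open>\<phi>\<close> with \<open>W k\<close> contributes
      \<open>- U k v\<close>, and \<open>Y (\<phi> \<omega>)\<close> cancels the
      \<open>W\<close>-part of it.\<close>
    show "Z \<omega> k v = 0" for k v
    proof -
      have "Y (\<phi> \<omega>) k v = (- (b / 2)) *s W k v" by (simp only: \<phi>_\<omega> Yl.scale)
      then show ?thesis by (simp add: Z_def coboundary_def \<phi>(5) U_def charge_cocycle_conformal)
    qed
    show "Z u n vac = 0" for u n
      by (simp add: Z_def coboundary_def cocycle_properties(4)[OF Y1] charge_cocycle_vac_right \<phi>(4) Yr.zero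
          Y_vac_right \<phi>_dpow)
    show "first_order_commutator Z \<omega> u v" if "u \<in> gr p" "v \<in> gr q" for p q u v
      unfolding Z_def
      by (intro first_order_commutator_add bilinear_add bil3 coboundary_commutator[OF \<phi>(1)]
          cocycle_commutator_homogeneous[OF Y1 omega_weight that] cocycle_commutator_homogeneous[OF X omega_weight that])
  qed
  then have "Y1 u n v = \<alpha> *s charge_cocycle u n v - coboundary \<phi> u n v" for u n v
    by (simp add: Z_def algebra_simps add_eq_0_iff2)
  from that[OF \<phi>(1-4) this] show ?thesis .
qed

lemma coboundaries_closed:
  assumes "F \<in> coboundaries" "G \<in> coboundaries"
  shows "F - G \<in> coboundaries"
proof -
  from assms obtain \<phi> \<psi> where
    F: "F = coboundary \<phi>" "Vector_Spaces.linear (*s) (*s) \<phi>" "\<And>n. \<phi> ` gr n \<subseteq> gr n" "\<And>v. \<phi> (D v) = D (\<phi> v)" "\<phi> vac = 0" and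
    G: "G = coboundary \<psi>" "Vector_Spaces.linear (*s) (*s) \<psi>" "\<And>n. \<psi> ` gr n \<subseteq> gr n" "\<And>v. \<psi> (D v) = D (\<psi> v)" "\<psi> vac = 0"
    unfolding coboundaries_def by blast
  let ?\<chi> = "\<lambda>v. \<phi> v - \<psi> v"
  have "Vector_Spaces.linear (*s) (*s) ?\<chi>"
    using linear_diff_scale[OF F(2) G(2), of "- 1"] by simp
  moreover have "?\<chi> ` gr n \<subseteq> gr n" for n
    using F(3)[of n] G(3)[of n] by (auto intro!: gr_diff)
  moreover have "?\<chi> (D v) = D (?\<chi> v)" for v
    using Yr.diff[of \<omega> 0 "\<phi> v" "\<psi> v"] by (simp only: F(4) G(4) omega_derivation)
  moreover have "F - G = coboundary ?\<chi>"
    by (simp add: F(1) G(1) fun_eq_iff coboundary_def Yl.diff Yr.diff)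
  ultimately show ?thesis using F(5) G(5) unfolding coboundaries_def by (auto intro!: exI[of _ ?\<chi>])
qed

lemma zero_in_coboundaries: "0 \<in> coboundaries"
proof -
  have "coboundary (\<lambda>_. 0) = 0" by (simp add: fun_eq_iff coboundary_def Yl.zero Yr.zero)
  moreover have "D 0 = 0" by (metis omega_derivation Yr.zero)
  moreover have "Vector_Spaces.linear (*s) (*s) (\<lambda>_. 0)"
    using vector_space_axioms by (simp add: Vector_Spaces.linear_iff)
  ultimately show ?thesis
    unfolding coboundaries_def by (auto intro!: exI[of _ "\<lambda>_. 0"] simp: gr_0)
qed

lemma charge_cocycle_not_coboundary:
  assumes "(\<lambda>u n v. \<alpha> *s charge_cocycle u n v) \<in> coboundaries"
  shows "\<alpha> = 0"
proof -
  from assms obtain \<phi> where \<phi>: "Vector_Spaces.linear (*s) (*s) \<phi>" "\<phi> ` gr 2 \<subseteq> gr 2" "\<phi> vac = 0"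
    and eq: "(\<lambda>u n v. \<alpha> *s charge_cocycle u n v) = coboundary \<phi>"
    unfolding coboundaries_def by blast
  interpret \<phi>: Vector_Spaces.linear "(*s)" "(*s)" \<phi> by (rule \<phi>(1))
  have eq': "\<alpha> *s charge_cocycle u n v = Y (\<phi> u) n v - \<phi> (Y u n v) + Y u n (\<phi> v)" for u n v
    using fun_cong[OF fun_cong[OF fun_cong[OF eq]], of u n v] by (simp add: coboundary_def)
  obtain \<mu> where \<mu>: "\<phi> \<omega> = \<mu> *s \<omega>" using low_weights(4)[of "\<phi> \<omega>" 2] \<phi>(2) omega_weight by blast
  \<comment> \<open>At mode 1 the left side is zero because \<open>K 1 \<omega> = 0\<close>, and the
    coboundary has the value \<open>2 \<mu> \<omega>\<close>.\<close>
  have "\<mu> *s \<omega> = 0"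
    using eq'[of \<omega> 1 \<omega>]
    by (simp add: charge_cocycle_conformal K_1_conformal omega_modes \<mu> \<phi>.scale Yl.scale Yr.scale mult.commute)
  then have "\<phi> \<omega> = 0" by (simp add: \<mu>)
  \<comment> \<open>At mode 3 the coboundary vanishes, since \<open>\<phi>\<close> kills both
    \<open>\<omega>\<close> and the vacuum.\<close>
  then have "\<alpha> *s (1 / 2) *s vac = 0"
    using eq'[of \<omega> 3 \<omega>]
    by (simp add: charge_cocycle_conformal K_3_conformal omega_modes \<phi>.scale \<phi>(3) Yl.zero Yr.zero)
  then show ?thesis using vac_nonzero by simp
qed

lemma cocycle_class:
  assumes "Y1 \<in> cocycles"
  shows "\<exists>\<alpha>. Y1 - (\<lambda>u n v. \<alpha> *s charge_cocycle u n v) \<in> coboundaries"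
proof -
  obtain \<alpha> \<phi> where \<phi>: "Vector_Spaces.linear (*s) (*s) \<phi>" "\<And>n. \<phi> ` gr n \<subseteq> gr n" "\<And>v. \<phi> (D v) = D (\<phi> v)"
    "\<phi> vac = 0" "\<And>u n v. Y1 u n v = \<alpha> *s charge_cocycle u n v - coboundary \<phi> u n v"
    by (rule cocycle_normal_form[OF assms]) (rule that)
  have "Y1 - (\<lambda>u n v. \<alpha> *s charge_cocycle u n v) = 0 - coboundary \<phi>"
    by (simp add: fun_eq_iff \<phi>(5))
  moreover have "coboundary \<phi> \<in> coboundaries" unfolding coboundaries_def using \<phi> by blast
  ultimately show ?thesis using coboundaries_closed[OF zero_in_coboundaries] by metis
qed

end

text \<open>Since \<open>B\<close> contains 0 and is closed under differences, two cosets agree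
  exactly when the difference of representatives lies in \<open>B\<close>; \<open>nz\<close> then
  gives uniqueness of the coefficient.\<close>

lemma quotient_has_dim_1I:
  fixes sc :: "complex \<Rightarrow> 'a::ab_group_add \<Rightarrow> 'a"
  assumes x: "x \<in> Z" and B0: "0 \<in> B" and B: "\<And>y z. y \<in> B \<Longrightarrow> z \<in> B \<Longrightarrow> y - z \<in> B"
    and cls: "\<And>z. z \<in> Z \<Longrightarrow> \<exists>\<alpha>. z - sc \<alpha> x \<in> B"
    and sc: "\<And>\<alpha> \<beta>. sc (\<alpha> - \<beta>) x = sc \<alpha> x - sc \<beta> x" and nz: "\<And>\<alpha>. sc \<alpha> x \<in> B \<Longrightarrow> \<alpha> = 0"
  shows "quotient_has_dim sc Z B 1"
proof -
  have coset: "y +o B = z +o B \<longleftrightarrow> y - z \<in> B" for y z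
  proof
    assume "y +o B = z +o B"
    moreover have "y \<in> y +o B" using B0 unfolding elt_set_plus_def by force
    ultimately show "y - z \<in> B" unfolding elt_set_plus_def by auto
  next
    have sub: "y +o B \<subseteq> z +o B" if "y - z \<in> B" for y z
    proof
      fix w assume "w \<in> y +o B"
      then obtain b where b: "b \<in> B" "w = y + b" unfolding elt_set_plus_def by blast
      have "(y - z) - (0 - b) \<in> B" by (intro B that B0 b)
      then show "w \<in> z +o B" unfolding elt_set_plus_def b(2)
        by (intro CollectI bexI[of _ "(y - z) - (0 - b)"]) (auto simp: algebra_simps)
    qed
    assume "y - z \<in> B"
    moreover from this have "z - y \<in> B" using B[OF B0] by fastforce
    ultimately show "y +o B = z +o B" using sub by blast
  qed
  show ?thesis
    unfolding quotient_has_dim_def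
  proof (intro exI[of _ "{x}"] conjI ballI)
    fix \<xi> assume "\<xi> \<in> quotient_space Z B"
    then obtain z where z: "z \<in> Z" "\<xi> = z +o B" unfolding quotient_space_def by blast
    from cls[OF z(1)] obtain \<alpha> where \<alpha>: "z - sc \<alpha> x \<in> B" by blast
    show "\<exists>!a. a \<in> extensional {x} \<and> \<xi> = (\<Sum>s\<in>{x}. sc (a s) s) +o B"
    proof (rule ex1I)
      show "(\<lambda>s. if s = x then \<alpha> else undefined) \<in> extensional {x}
          \<and> \<xi> = (\<Sum>s\<in>{x}. sc (if s = x then \<alpha> else undefined) s) +o B"
        using \<alpha> coset by (simp add: z extensional_def)
    next
      fix a assume a: "a \<in> extensional {x} \<and> \<xi> = (\<Sum>s\<in>{x}. sc (a s) s) +o B"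
      then have "z - sc (a x) x \<in> B" using coset by (simp add: z)
      from B[OF this \<alpha>] have "sc (\<alpha> - a x) x \<in> B" by (simp add: sc)
      then have "a x = \<alpha>" using nz by fastforce
      then show "a = (\<lambda>s. if s = x then \<alpha> else undefined)"
        using a by (auto simp: extensional_def)
    qed
  qed (use x in auto)
qed

theorem mainTheorem7:
  fixes scale :: "complex \<Rightarrow> 'v::ab_group_add \<Rightarrow> 'v"
    and gr :: "int \<Rightarrow> 'v set"
    and Y :: "'v \<Rightarrow> int \<Rightarrow> 'v \<Rightarrow> 'v"
    and vac \<omega> :: 'v
    and c :: complex
  assumes "universal_virasoro scale gr Y vac \<omega> c"
  shows "grading_restricted_vertex_algebra.dim_H2_half_eq scale gr Y vac 1"
proof -
  interpret universal_virasoro scale gr Y vac \<omega> c by (rule assms)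
  show ?thesis
    unfolding dim_H2_half_eq_def
  proof (rule quotient_has_dim_1I[where x = charge_cocycle])
    show "(\<lambda>u n v. scale (\<alpha> - \<beta>) (charge_cocycle u n v))
        = (\<lambda>u n v. scale \<alpha> (charge_cocycle u n v)) - (\<lambda>u n v. scale \<beta> (charge_cocycle u n v))" for \<alpha> \<beta>
      by (simp add: fun_eq_iff scale_left_diff_distrib)
  qed (use charge_cocycle_in_cocycles zero_in_coboundaries coboundaries_closed cocycle_class
      charge_cocycle_not_coboundary in blast)+
qed

end
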